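(* Let $q>-1$, and let $a$ be a random variable with values in $(-1,1)$ having a probability density $\phi(x)$, $x\in(-1,1)$ (the mixing density), such that $$\mathrm{E}\Big[\frac1{1-|a|}\Big]<\infty\qquad\text{and}\qquad\int_{-1}^1\frac{\phi(x)^2}{(1-x^2)^q}\,\mathrm{d}x<\infty .$$ Let $W\sim ID(\mu,\sigma,\pi)$ with $\sigma_W^2:=\mathrm{Var}(W)>0$, let $\{M_s,\,s\in\mathbb{Z}\}$ be i.i.d. copies of an infinitely divisible random measure $M\sim W$ on $(-1,1)$ with control measure $\Phi(\mathrm{d}x)=\phi(x)\mathrm{d}x$, and let $$\mathfrak{X}(t)=\sum_{s\le t}\int_{(-1,1)}x^{t-s}M_s(\mathrm{d}x),\qquad t\in\mathbb{Z},$$ with $\mathrm{E}\mathfrak{X}(0)^4<\infty$. Let $$K_n=[\gamma\log n]\quad\text{with}\quad 0<\gamma<(2\log(1+\sqrt2))^{-1},$$ and let $\widehat\phi_n$ and $\widetilde\phi_n$ be the estimators of $\phi$, based on the observations $\mathfrak{X}(1),\dots,\mathfrak{X}(n)$, defined in the context. Then, as $n\to\infty$, $$\int_{-1}^1\frac{(\widehat\phi_n(x)-\phi(x))^2}{(1-x^2)^q}\,\mathrm{d}x\ \to\ 0\ \text{ in probability},\qquad\text{and}\qquad\int_{-1}^1\frac{\mathrm{E}(\widetilde\phi_n(x)-\phi(x))^2}{(1-x^2)^q}\,\mathrm{d}x\ \to\ 0 .$$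
   Context: **Infinitely divisible laws and random measures.** $W\sim ID(\mu,\sigma,\pi)$ means that $W$ is infinitely divisible with $$V(\theta):=\log\mathrm{E}e^{\mathrm{i}\theta W}=\int_{\mathbb{R}}\big(e^{\mathrm{i}\theta y}-1-\mathrm{i}\theta y\mathbf{1}(|y|\le1)\big)\pi(\mathrm{d}y)-\tfrac12\theta^2\sigma^2+\mathrm{i}\theta\mu,$$ $\mu\in\mathbb{R}$, $\sigma\ge0$, $\pi$ a L\'evy measure on $\mathbb{R}$. $M\sim W$ with control measure $\Phi$ means: $M$ is an independently scattered, a.s. $\sigma$-additive random measure on the Borel subsets of $(-1,1)$ with $\mathrm{E}e^{\mathrm{i}\theta M(A)}=e^{\Phi(A)V(\theta)}$ for all Borel $A\subset(-1,1)$, $\theta\in\mathbb{R}$. Integrals with respect to $M_s$ are the usual stochastic integrals. **Polynomials.** $G_n^{(q)}(x)=\sum_{j=0}^n g_{n,j}^{(q)}x^j$, $n=0,1,\dots$, are the normalized Gegenbauer polynomials: the orthonormal basis of polynomials ($G^{(q)}_n$ of degree $n$) of $L_2((-1,1),w^{(q)}(x)\mathrm{d}x)$ with weight $w^{(q)}(x)=(1-x^2)^q$, i.e. $\int_{-1}^1G_j^{(q)}G_k^{(q)}w^{(q)}\mathrm{d}x=\mathbf{1}(j=k)$. **Estimators.** Put $\overline{\mathfrak{X}}:=\frac1n\sum_{k=1}^n\mathfrak{X}(k)$, $$\widehat r_n(j):=\frac1n\sum_{i=1}^{n-j}(\mathfrak{X}(i)-\overline{\mathfrak{X}})(\mathfrak{X}(i+j)-\overline{\mathfrak{X}}),\quad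 j=0,1,\dots,n,\qquad\widehat\sigma_W^2:=\widehat r_n(0)-\widehat r_n(2),$$ $$\widehat\zeta_{n,k}:=\frac1{\widehat\sigma_W^2}\sum_{j=0}^kg_{k,j}^{(q)}(\widehat r_n(j)-\widehat r_n(j+2)),\qquad\widetilde\zeta_{n,k}:=\frac1{\sigma_W^2}\sum_{j=0}^kg_{k,j}^{(q)}(\widehat r_n(j)-\widehat r_n(j+2)),$$ $$\widehat\zeta_n(x):=\sum_{k=0}^{K_n}\widehat\zeta_{n,k}G_k^{(q)}(x),\qquad\widetilde\zeta_n(x):=\sum_{k=0}^{K_n}\widetilde\zeta_{n,k}G_k^{(q)}(x),$$ $$\widehat\phi_n(x):=\widehat\zeta_n(x)(1-x^2)^q,\qquad\widetilde\phi_n(x):=\widetilde\zeta_n(x)(1-x^2)^q .$$ *)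

theory Defs
  imports "HOL-Probability.Probability" "HOL-Computational_Algebra.Polynomial"
begin

section \<open>Infinitely divisible laws\<close>

definition Levy_measure :: "real measure \<Rightarrow> bool" where
  "Levy_measure \<pi> \<longleftrightarrow>
     sets \<pi> = sets borel \<and> emeasure \<pi> {0} = 0 \<and>
     (\<integral>\<^sup>+y. ennreal (min 1 (y\<^sup>2)) \<partial>\<pi>) < \<infinity>"

definition Levy_exponent :: "real \<Rightarrow> real \<Rightarrow> real measure \<Rightarrow> real \<Rightarrow> complex" where
  "Levy_exponent \<mu> \<sigma> \<pi> \<theta> =
     (CLINT y|\<pi>. iexp (\<theta> * y) - 1 - \<i> * of_real (\<theta> * y * indicator {-1..1} y))
     - of_real (\<theta>\<^sup>2 * \<sigma>\<^sup>2 / 2) + \<i> * of_real (\<theta> * \<mu>)"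

text \<open>The relation \<open>log E exp(i \<theta> W) = V(\<theta>)\<close> refers to the distinguished logarithm; it is written
  in exponential form, which determines the law of \<open>W\<close>.\<close>

definition inf_divisible ::
    "'b measure \<Rightarrow> ('b \<Rightarrow> real) \<Rightarrow> real \<Rightarrow> real \<Rightarrow> real measure \<Rightarrow> bool" where
  "inf_divisible Q W \<mu> \<sigma> \<pi> \<longleftrightarrow>
     prob_space Q \<and> W \<in> borel_measurable Q \<and> 0 \<le> \<sigma> \<and> Levy_measure \<pi> \<and>
     (\<forall>\<theta>. char (distr Q borel W) \<theta> = exp (Levy_exponent \<mu> \<sigma> \<pi> \<theta>))"

section \<open>Random measures and stochastic integrals\<close>

definition conv_in_prob :: "'a measure \<Rightarrow> (nat \<Rightarrow> 'a \<Rightarrow> real) \<Rightarrow> ('a \<Rightarrow> real) \<Rightarrow> bool" where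
  "conv_in_prob P Z Z' \<longleftrightarrow>
     (\<forall>n. Z n \<in> borel_measurable P) \<and> Z' \<in> borel_measurable P \<and>
     (\<forall>\<epsilon>>0. (\<lambda>n. measure P {\<omega> \<in> space P. \<bar>Z n \<omega> - Z' \<omega>\<bar> > \<epsilon>}) \<longlonglongrightarrow> 0)"

text \<open>\<open>M\<close> is a real-valued, independently scattered, a.s. \<open>\<sigma>\<close>-additive random measure on the
  \<open>\<sigma>\<close>-algebra of the finite measure \<open>\<Phi>\<close>, with \<open>E exp(i \<theta> M(A)) = exp(\<Phi>(A) V(\<theta>))\<close>. The
  exceptional null set in the \<open>\<sigma>\<close>-additivity may depend on the sequence of sets. These properties
  determine the joint law of \<open>(M(A))\<close>, \<open>A \<in> sets \<Phi>\<close>.\<close>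

definition id_random_measure ::
    "'a measure \<Rightarrow> real measure \<Rightarrow> (real \<Rightarrow> complex) \<Rightarrow> (real set \<Rightarrow> 'a \<Rightarrow> real) \<Rightarrow> bool" where
  "id_random_measure P \<Phi> V M \<longleftrightarrow>
     (\<forall>A\<in>sets \<Phi>. M A \<in> borel_measurable P) \<and>
     (\<forall>A::nat \<Rightarrow> real set. range A \<subseteq> sets \<Phi> \<longrightarrow> disjoint_family A \<longrightarrow>
        prob_space.indep_vars P (\<lambda>_. borel) (\<lambda>i. M (A i)) UNIV \<and>
        (AE \<omega> in P. (\<lambda>i. M (A i) \<omega>) sums M (\<Union>i. A i) \<omega>)) \<and>
     (\<forall>A\<in>sets \<Phi>. \<forall>\<theta>. char (distr P borel (M A)) \<theta> = exp (of_real (measure \<Phi> A) * V \<theta>))"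

text \<open>The family \<open>M s\<close>, \<open>s \<in> \<int>\<close>, of i.i.d. copies: each \<open>M s\<close> has the law described above, and the
  \<open>M s\<close> are independent as processes indexed by \<open>sets \<Phi>\<close>.\<close>

definition iid_id_random_measures ::
    "'a measure \<Rightarrow> real measure \<Rightarrow> (real \<Rightarrow> complex) \<Rightarrow> (int \<Rightarrow> real set \<Rightarrow> 'a \<Rightarrow> real) \<Rightarrow> bool" where
  "iid_id_random_measures P \<Phi> V M \<longleftrightarrow>
     (\<forall>s. id_random_measure P \<Phi> V (M s)) \<and>
     prob_space.indep_vars P (\<lambda>_. PiM (sets \<Phi>) (\<lambda>_. borel))
       (\<lambda>s \<omega>. \<lambda>A\<in>sets \<Phi>. M s A \<omega>) UNIV"

definition simple_stoch_integral ::
    "real measure \<Rightarrow> (real set \<Rightarrow> 'a \<Rightarrow> real) \<Rightarrow> real set \<Rightarrow> (real \<Rightarrow> real) \<Rightarrow> 'a \<Rightarrow> real" where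
  "simple_stoch_integral \<Phi> M A g \<omega> =
     (\<Sum>y\<in>g ` space \<Phi>. y * M (A \<inter> (g -` {y} \<inter> space \<Phi>)) \<omega>)"

text \<open>\<open>I\<close> is a version of \<open>\<integral> f dM\<close> in the sense of Rajput and Rosinski: there are simple functions
  \<open>g n\<close> converging to \<open>f\<close> almost everywhere such that \<open>\<integral>\<^sub>A g n dM\<close> converges in probability for
  every \<open>A\<close>, with limit \<open>I\<close> when \<open>A\<close> is the whole space.\<close>

definition has_stoch_integral ::
    "'a measure \<Rightarrow> real measure \<Rightarrow> (real set \<Rightarrow> 'a \<Rightarrow> real) \<Rightarrow> (real \<Rightarrow> real) \<Rightarrow> ('a \<Rightarrow> real) \<Rightarrow> bool" where
  "has_stoch_integral P \<Phi> M f I \<longleftrightarrow>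
     f \<in> borel_measurable \<Phi> \<and>
     (\<exists>g. (\<forall>n. simple_function \<Phi> (g n)) \<and>
          (AE x in \<Phi>. (\<lambda>n. g n x) \<longlonglongrightarrow> f x) \<and>
          (\<forall>A\<in>sets \<Phi>. \<exists>J. conv_in_prob P (\<lambda>n. simple_stoch_integral \<Phi> M A (g n)) J) \<and>
          conv_in_prob P (\<lambda>n. simple_stoch_integral \<Phi> M (space \<Phi>) (g n)) I)"

text \<open>\<open>X t = \<Sum>\<^sub>s\<^sub>\<le>\<^sub>t \<integral> x\<^bsup>t-s\<^esup> M s (dx)\<close>. The summands are independent, so convergence of the
  partial sums in probability is the same as almost sure convergence.\<close>

definition aggregated_AR1 ::
    "'a measure \<Rightarrow> real measure \<Rightarrow> (int \<Rightarrow> real set \<Rightarrow> 'a \<Rightarrow> real) \<Rightarrow> (int \<Rightarrow> 'a \<Rightarrow> real) \<Rightarrow> bool" where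
  "aggregated_AR1 P \<Phi> M X \<longleftrightarrow>
     (\<exists>Y. (\<forall>t s. s \<le> t \<longrightarrow> has_stoch_integral P \<Phi> (M s) (\<lambda>x. x ^ nat (t - s)) (Y t s)) \<and>
          (\<forall>t. conv_in_prob P (\<lambda>N \<omega>. \<Sum>s\<in>{t - int N..t}. Y t s \<omega>) (X t)))"

definition control_measure :: "(real \<Rightarrow> real) \<Rightarrow> real measure" where
  "control_measure \<phi> = density (restrict_space lborel {-1<..<1}) (\<lambda>x. ennreal (\<phi> x))"

section \<open>Gegenbauer polynomials and the estimators\<close>

text \<open>Orthonormality and the degrees determine each \<open>G n\<close> up to its sign; no sign is fixed here.\<close>

definition normalized_Gegenbauer :: "real \<Rightarrow> (nat \<Rightarrow> real poly) \<Rightarrow> bool" where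
  "normalized_Gegenbauer q G \<longleftrightarrow>
     (\<forall>n. G n \<noteq> 0 \<and> degree (G n) = n) \<and>
     (\<forall>j k. (LBINT x:{-1<..<1}. poly (G j) x * poly (G k) x * (1 - x\<^sup>2) powr q)
              = (if j = k then 1 else 0))"

text \<open>In the following, \<open>x\<close> is a sample path, of which only \<open>x 1, \<dots>, x n\<close> are used.\<close>

definition sample_mean :: "nat \<Rightarrow> (int \<Rightarrow> real) \<Rightarrow> real" where
  "sample_mean n x = (1 / real n) * (\<Sum>k=1..n. x (int k))"

text \<open>For \<open>j \<ge> n\<close> the sum is empty and the value is \<open>0\<close>.\<close>

definition sample_cov :: "nat \<Rightarrow> (int \<Rightarrow> real) \<Rightarrow> nat \<Rightarrow> real" where
  "sample_cov n x j =
     (1 / real n) * (\<Sum>i=1..n - j. (x (int i) - sample_mean n x) * (x (int (i + j)) - sample_mean n x))"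

definition sigma2_hat :: "nat \<Rightarrow> (int \<Rightarrow> real) \<Rightarrow> real" where
  "sigma2_hat n x = sample_cov n x 0 - sample_cov n x 2"

text \<open>The two estimators differ only in the normalising factor \<open>v\<close>, which is the estimate
  \<open>sigma2_hat n x\<close> in one case and the true variance of \<open>W\<close> in the other.\<close>

definition zeta_coeff :: "(nat \<Rightarrow> real poly) \<Rightarrow> real \<Rightarrow> nat \<Rightarrow> (int \<Rightarrow> real) \<Rightarrow> nat \<Rightarrow> real" where
  "zeta_coeff G v n x k =
     (1 / v) * (\<Sum>j=0..k. coeff (G k) j * (sample_cov n x j - sample_cov n x (j + 2)))"

definition phi_estimator ::
    "real \<Rightarrow> (nat \<Rightarrow> real poly) \<Rightarrow> real \<Rightarrow> nat \<Rightarrow> nat \<Rightarrow> (int \<Rightarrow> real) \<Rightarrow> real \<Rightarrow> real" where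
  "phi_estimator q G v K n x u =
     (\<Sum>k=0..K. zeta_coeff G v n x k * poly (G k) u) * (1 - u\<^sup>2) powr q"

definition phi_hat ::
    "real \<Rightarrow> (nat \<Rightarrow> real poly) \<Rightarrow> nat \<Rightarrow> nat \<Rightarrow> (int \<Rightarrow> real) \<Rightarrow> real \<Rightarrow> real" where
  "phi_hat q G K n x = phi_estimator q G (sigma2_hat n x) K n x"

definition phi_tilde ::
    "real \<Rightarrow> (nat \<Rightarrow> real poly) \<Rightarrow> real \<Rightarrow> nat \<Rightarrow> nat \<Rightarrow> (int \<Rightarrow> real) \<Rightarrow> real \<Rightarrow> real" where
  "phi_tilde q G \<sigma>W2 K n x = phi_estimator q G \<sigma>W2 K n x"

end

theory Submission
  imports Defs "HOL-Real_Asymp.Real_Asymp"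
begin

text \<open>Let \<open>\<Phi>\<close> be the law of \<open>a\<close>, and let \<open>\<zeta>\<^sub>k = \<integral> G\<^sub>k d\<Phi>\<close> be the coefficients of \<open>\<phi> / w\<close>, where
  \<open>w x = (1 - x\<^sup>2) powr q\<close>. The covariances of \<open>X\<close> satisfy \<open>r j - r (j + 2) = \<sigma>\<^sub>W\<^sup>2 E a\<^sup>j\<close>, so \<open>\<zeta>\<^sub>k\<close> is a
  linear combination of them. By Parseval, the squared error of an estimator is the sum of
  \<open>(estimate of \<zeta>\<^sub>k - \<zeta>\<^sub>k)\<^sup>2\<close> over \<open>k \<le> K\<close> plus the tail of a convergent series.

  Write \<open>\<epsilon>\<^sub>j\<close> for the error of the sample version of \<open>r j - r (j + 2)\<close>. The essential bound is
  \<open>E \<epsilon>\<^sub>j\<^sup>2 \<le> C (j + 2)\<^sup>2 / n\<close>. To prove it, \<open>X\<close> is approximated by linear forms in the centred, independent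
  variables \<open>M s A\<close> with \<open>A\<close> running through small cells. Their variances are proportional to \<open>\<Phi> A\<close>, and
  their fourth moments are finite and at most linear in \<open>\<Phi> A\<close>. The variance of the resulting quadratic form
  is of order \<open>n\<close>, because the kernel \<open>y\<^sup>l\<close> is summable in \<open>l\<close> and \<open>\<Phi>\<close>-integrably so, and the kernel
  \<open>y\<^sup>l - y\<^bsup>l+2\<^esup>\<close> belonging to a difference of covariances has sums bounded uniformly in \<open>\<bar>y\<bar> < 1\<close>.

  The coefficients of \<open>G\<^sub>k\<close> sum up to \<open>O(s\<^sup>k)\<close> in absolute value for every \<open>s > 1 + \<surd>2\<close>, hence the first part
  of the error is \<open>O((K + 2)\<^sup>3 s\<^bsup>2K\<^esup> / n)\<close>, which the choice of \<open>K = [\<gamma> log n]\<close> sends to \<open>0\<close>. The replacement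
  of \<open>\<sigma>\<^sub>W\<^sup>2\<close> by its estimate changes the coefficients by a factor that tends to \<open>1\<close> in probability.\<close>

section \<open>Convergence in probability\<close>

text \<open>The difficulty is that everything about \<open>X\<close> is given in probability only.
  The definition of the stochastic integral supplies some simple functions \<open>g n\<close>
  without any bound, and moments are assumed for \<open>W\<close>, which lives on another space, and
  for \<open>X 0\<close> alone. A gliding hump argument shows that every uniformly bounded sequence
  of step functions yields the same integral, so one discretization serves all lags. Fourth moments
  of \<open>M s A\<close> are extracted from \<open>X 0\<close>, of which
  \<open>M 0 (space \<Phi>)\<close> is an independent summand. The quadratic bounds are proved for
  finite linear forms and reach \<open>X\<close> by Fatou's lemma along an almost surely convergent
  subsequence; convergence in L2 or L4 is never established. The number 1 + sqrt 2 is the growth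
  rate of the Chebyshev polynomials of the second kind, to which every \<open>q\<close> is reduced
  by a power of 1 - x^2. This costs a polynomial factor, absorbed by taking \<open>s\<close>
  strictly larger; the strict bound on \<open>\<gamma>\<close> leaves room for that. Parseval needs
  completeness of the \<open>G k\<close>, which comes from density of the polynomials in the
  weighted L2 space.\<close>

definition prob_size :: "'a measure \<Rightarrow> ('a \<Rightarrow> real) \<Rightarrow> real" where
  "prob_size P Z = (\<integral>\<omega>. min 1 \<bar>Z \<omega>\<bar> \<partial>P)"

lemma prob_size_nonneg: "0 \<le> prob_size P Z"
  unfolding prob_size_def by (rule Bochner_Integration.integral_nonneg) auto

lemma prob_size_minus: "prob_size P (\<lambda>\<omega>. Z' \<omega> - Z \<omega>) = prob_size P (\<lambda>\<omega>. Z \<omega> - Z' \<omega>)"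
  unfolding prob_size_def by (simp add: abs_minus_commute)

lemma prob_size_cong_AE:
  assumes "AE \<omega> in P. Z \<omega> = Z' \<omega>" "Z \<in> borel_measurable P" "Z' \<in> borel_measurable P"
  shows "prob_size P Z = prob_size P Z'"
  unfolding prob_size_def using assms by (intro integral_cong_AE) auto

context prob_space
begin

lemma integrable_min_1_abs:
  assumes "Z \<in> borel_measurable M"
  shows "integrable M (\<lambda>\<omega>. min 1 \<bar>Z \<omega> :: real\<bar>)"
  using assms by (intro integrable_const_bound[where B=1]) auto

lemma prob_size_triangle:
  assumes "Z \<in> borel_measurable M" "Z' \<in> borel_measurable M"
  shows "prob_size M (\<lambda>\<omega>. Z \<omega> + Z' \<omega>) \<le> prob_size M Z + prob_size M Z'"
proof -
  have "prob_size M (\<lambda>\<omega>. Z \<omega> + Z' \<omega>) \<le> (\<integral>\<omega>. min 1 \<bar>Z \<omega>\<bar> + min 1 \<bar>Z' \<omega>\<bar> \<partial>M)"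
    unfolding prob_size_def using assms
    by (intro integral_mono integrable_min_1_abs Bochner_Integration.integrable_add) auto
  also have "\<dots> = prob_size M Z + prob_size M Z'"
    unfolding prob_size_def using assms by (intro Bochner_Integration.integral_add integrable_min_1_abs)
  finally show ?thesis .
qed

lemma prob_size_diff_le:
  assumes "Z \<in> borel_measurable M" "Z' \<in> borel_measurable M" "Z'' \<in> borel_measurable M"
  shows "prob_size M (\<lambda>\<omega>. Z \<omega> - Z'' \<omega>)
    \<le> prob_size M (\<lambda>\<omega>. Z \<omega> - Z' \<omega>) + prob_size M (\<lambda>\<omega>. Z' \<omega> - Z'' \<omega>)"
  using prob_size_triangle[of "\<lambda>\<omega>. Z \<omega> - Z' \<omega>" "\<lambda>\<omega>. Z' \<omega> - Z'' \<omega>"] assms by simp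

lemma prob_size_sum_le:
  assumes "finite I" "\<And>i. i \<in> I \<Longrightarrow> Z i \<in> borel_measurable M"
  shows "prob_size M (\<lambda>\<omega>. \<Sum>i\<in>I. Z i \<omega>) \<le> (\<Sum>i\<in>I. prob_size M (Z i))"
  using assms
proof (induction I rule: finite_induct)
  case empty
  show ?case by (simp add: prob_size_def)
next
  case (insert i I)
  have "prob_size M (\<lambda>\<omega>. \<Sum>i\<in>insert i I. Z i \<omega>)
      = prob_size M (\<lambda>\<omega>. Z i \<omega> + (\<Sum>i\<in>I. Z i \<omega>))"
    using insert by simp
  also have "\<dots> \<le> prob_size M (Z i) + prob_size M (\<lambda>\<omega>. \<Sum>i\<in>I. Z i \<omega>)"
    using insert by (intro prob_size_triangle borel_measurable_sum) auto
  also have "prob_size M (\<lambda>\<omega>. \<Sum>i\<in>I. Z i \<omega>) \<le> (\<Sum>i\<in>I. prob_size M (Z i))"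
    using insert by auto
  finally show ?case using insert by simp
qed

lemma prob_size_le_sqrt:
  assumes Z: "Z \<in> borel_measurable M" and i: "integrable M (\<lambda>\<omega>. (Z \<omega>)\<^sup>2)"
  shows "prob_size M Z \<le> sqrt (expectation (\<lambda>\<omega>. (Z \<omega>)\<^sup>2))"
proof -
  define Y where "Y \<omega> = min 1 \<bar>Z \<omega>\<bar>" for \<omega>
  have Y: "integrable M Y" unfolding Y_def by (rule integrable_min_1_abs[OF Z])
  have le: "(Y \<omega>)\<^sup>2 \<le> (Z \<omega>)\<^sup>2" for \<omega>
    unfolding Y_def by (subst power2_abs[of "Z \<omega>", symmetric]) (intro power_mono, auto)
  have Y2: "integrable M (\<lambda>\<omega>. (Y \<omega>)\<^sup>2)"
    using Y le by (intro Bochner_Integration.integrable_bound[OF i]) auto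
  \<comment> \<open>Jensen's inequality for the square, in the form that a variance is
    nonnegative.\<close>
  have "(expectation Y)\<^sup>2 \<le> expectation (\<lambda>\<omega>. (Y \<omega>)\<^sup>2)"
    using variance_eq[OF Y Y2] variance_positive[of Y] by linarith
  also have "\<dots> \<le> expectation (\<lambda>\<omega>. (Z \<omega>)\<^sup>2)"
    by (intro integral_mono Y2 i le)
  finally show ?thesis
    unfolding prob_size_def Y_def[symmetric, abs_def] by (rule real_le_rsqrt)
qed

text \<open>Convergence in probability is convergence in the metric with distance E min(1, |Z -
  Z'|): one direction splits at \<epsilon>, the other is Markov's inequality. The metric form has a
  triangle inequality, on which the approximation arguments below rely.\<close>

lemma conv_in_prob_iff:
  assumes [measurable]: "\<And>n. Z n \<in> borel_measurable M" "Z' \<in> borel_measurable M"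
  shows "conv_in_prob M Z Z' \<longleftrightarrow> (\<lambda>n. prob_size M (\<lambda>\<omega>. Z n \<omega> - Z' \<omega>)) \<longlonglongrightarrow> 0"
proof
  assume "conv_in_prob M Z Z'"
  then have lim: "(\<lambda>n. measure M {\<omega> \<in> space M. \<bar>Z n \<omega> - Z' \<omega>\<bar> > \<epsilon>}) \<longlonglongrightarrow> 0" if "\<epsilon> > 0" for \<epsilon>
    using that unfolding conv_in_prob_def by auto
  have le: "prob_size M (\<lambda>\<omega>. Z n \<omega> - Z' \<omega>)
      \<le> \<epsilon> + measure M {\<omega> \<in> space M. \<bar>Z n \<omega> - Z' \<omega>\<bar> > \<epsilon>}" if "\<epsilon> > 0" for \<epsilon> n
  proof -
    have "prob_size M (\<lambda>\<omega>. Z n \<omega> - Z' \<omega>)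
      \<le> (\<integral>\<omega>. \<epsilon> + indicator {\<omega> \<in> space M. \<bar>Z n \<omega> - Z' \<omega>\<bar> > \<epsilon>} \<omega> \<partial>M)"
      unfolding prob_size_def using that
      by (intro integral_mono integrable_min_1_abs Bochner_Integration.integrable_add
           integrable_real_indicator)
         (auto simp: indicator_def emeasure_eq_measure)
    also have "\<dots> = \<epsilon> + measure M {\<omega> \<in> space M. \<bar>Z n \<omega> - Z' \<omega>\<bar> > \<epsilon>}"
      by (subst Bochner_Integration.integral_add)
         (auto simp: prob_space emeasure_eq_measure Int_absorb1 intro!: integrable_real_indicator arg_cong[where f="measure M"])
    finally show ?thesis .
  qed
  show "(\<lambda>n. prob_size M (\<lambda>\<omega>. Z n \<omega> - Z' \<omega>)) \<longlonglongrightarrow> 0"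
  proof (rule LIMSEQ_I)
    fix r :: real assume r: "0 < r"
    from LIMSEQ_D[OF lim[of "r/2"], of "r/2"] r obtain N
      where N: "\<And>n. n \<ge> N \<Longrightarrow> measure M {\<omega> \<in> space M. \<bar>Z n \<omega> - Z' \<omega>\<bar> > r/2} < r/2" by auto
    have "norm (prob_size M (\<lambda>\<omega>. Z n \<omega> - Z' \<omega>) - 0) < r" if "n \<ge> N" for n
      using N[OF that] le[of "r/2" n] r prob_size_nonneg[of M "\<lambda>\<omega>. Z n \<omega> - Z' \<omega>"] by simp
    then show "\<exists>no. \<forall>n\<ge>no. norm (prob_size M (\<lambda>\<omega>. Z n \<omega> - Z' \<omega>) - 0) < r" by blast
  qed
next
  assume lim: "(\<lambda>n. prob_size M (\<lambda>\<omega>. Z n \<omega> - Z' \<omega>)) \<longlonglongrightarrow> 0"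
  have "(\<lambda>n. measure M {\<omega> \<in> space M. \<bar>Z n \<omega> - Z' \<omega>\<bar> > \<epsilon>}) \<longlonglongrightarrow> 0" if e: "\<epsilon> > 0" for \<epsilon>
  proof (rule tendsto_sandwich[OF _ _ tendsto_const])
    show "\<forall>\<^sub>F n in sequentially. 0 \<le> measure M {\<omega> \<in> space M. \<bar>Z n \<omega> - Z' \<omega>\<bar> > \<epsilon>}" by simp
    show "\<forall>\<^sub>F n in sequentially. measure M {\<omega> \<in> space M. \<bar>Z n \<omega> - Z' \<omega>\<bar> > \<epsilon>}
        \<le> prob_size M (\<lambda>\<omega>. Z n \<omega> - Z' \<omega>) / min 1 \<epsilon>"
    proof (rule always_eventually, rule allI)
      fix n
      \<comment> \<open>The truncation at 1 caps the threshold at \<open>min 1 \<epsilon>\<close>,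
        hence the divisor.\<close>
      have "measure M {\<omega> \<in> space M. \<bar>Z n \<omega> - Z' \<omega>\<bar> > \<epsilon>}
          \<le> measure M {\<omega> \<in> space M. min 1 \<bar>Z n \<omega> - Z' \<omega>\<bar> \<ge> min 1 \<epsilon>}"
      proof (rule finite_measure_mono)
        show "{\<omega> \<in> space M. \<bar>Z n \<omega> - Z' \<omega>\<bar> > \<epsilon>} \<subseteq> {\<omega> \<in> space M. min 1 \<bar>Z n \<omega> - Z' \<omega>\<bar> \<ge> min 1 \<epsilon>}"
          by (auto simp: min_def)
      qed measurable
      also have "\<dots> \<le> (\<integral>\<omega>. min 1 \<bar>Z n \<omega> - Z' \<omega>\<bar> \<partial>M) / min 1 \<epsilon>"
        using e by (intro integral_Markov_inequality_measure[where A="{}"] integrable_min_1_abs) auto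
      finally show "measure M {\<omega> \<in> space M. \<bar>Z n \<omega> - Z' \<omega>\<bar> > \<epsilon>}
        \<le> prob_size M (\<lambda>\<omega>. Z n \<omega> - Z' \<omega>) / min 1 \<epsilon>" by (simp add: prob_size_def)
    qed
    show "(\<lambda>n. prob_size M (\<lambda>\<omega>. Z n \<omega> - Z' \<omega>) / min 1 \<epsilon>) \<longlonglongrightarrow> 0"
      using tendsto_divide[OF lim tendsto_const, of "min 1 \<epsilon>"] e by simp
  qed
  then show "conv_in_prob M Z Z'" unfolding conv_in_prob_def by auto
qed

lemma prob_size_imp_AE_subseq:
  assumes [measurable]: "\<And>n. Z n \<in> borel_measurable M"
    and lim: "(\<lambda>n. prob_size M (Z n)) \<longlonglongrightarrow> 0"
  shows "\<exists>r. strict_mono r \<and> (AE \<omega> in M. (\<lambda>n. Z (r n) \<omega>) \<longlonglongrightarrow> 0)"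
proof -
  have "\<exists>r. strict_mono r \<and> (AE \<omega> in M. (\<lambda>n. min 1 \<bar>Z (r n) \<omega>\<bar>) \<longlonglongrightarrow> 0)"
    using lim by (intro tendsto_L1_AE_subseq integrable_min_1_abs) (auto simp: prob_size_def)
  then obtain r where r: "strict_mono r" "AE \<omega> in M. (\<lambda>n. min 1 \<bar>Z (r n) \<omega>\<bar>) \<longlonglongrightarrow> 0" by blast
  have "(\<lambda>n. Z (r n) \<omega>) \<longlonglongrightarrow> 0" if l: "(\<lambda>n. min 1 \<bar>Z (r n) \<omega>\<bar>) \<longlonglongrightarrow> 0" for \<omega>
  proof -
    have "\<forall>\<^sub>F n in sequentially. min 1 \<bar>Z (r n) \<omega>\<bar> < 1"
      using order_tendstoD(2)[OF l, of 1] by simp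
    then have "\<forall>\<^sub>F n in sequentially. min 1 \<bar>Z (r n) \<omega>\<bar> = \<bar>Z (r n) \<omega>\<bar>"
      by eventually_elim auto
    then show ?thesis
      using l tendsto_cong tendsto_rabs_zero_iff by fast
  qed
  then show ?thesis using r by (intro exI[of _ r]) auto
qed

text \<open>Repeated thinning of the subsequence. Finitely many indices suffice because a quadratic
  form in the sample involves only finitely many times.\<close>

lemma prob_size_imp_common_AE_subseq:
  assumes "finite T"
    and "\<And>t n. t \<in> T \<Longrightarrow> Z t n \<in> borel_measurable M"
    and "\<And>t. t \<in> T \<Longrightarrow> (\<lambda>n. prob_size M (Z t n)) \<longlonglongrightarrow> 0"
  shows "\<exists>r. strict_mono r \<and> (AE \<omega> in M. \<forall>t\<in>T. (\<lambda>n. Z t (r n) \<omega>) \<longlonglongrightarrow> 0)"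
  using assms
proof (induction T rule: finite_induct)
  case empty
  show ?case by (auto intro: exI[of _ id] simp: strict_mono_id)
next
  case (insert t T)
  then obtain r where r: "strict_mono r" "AE \<omega> in M. \<forall>t\<in>T. (\<lambda>n. Z t (r n) \<omega>) \<longlonglongrightarrow> 0" by auto
  have "(\<lambda>n. prob_size M (Z t (r n))) \<longlonglongrightarrow> 0"
    using LIMSEQ_subseq_LIMSEQ[OF insert.prems(2) r(1)] by (auto simp: o_def)
  from prob_size_imp_AE_subseq[OF _ this] insert.prems(1) obtain r'
    where r': "strict_mono r'" "AE \<omega> in M. (\<lambda>n. Z t (r (r' n)) \<omega>) \<longlonglongrightarrow> 0" by auto
  have "AE \<omega> in M. \<forall>t\<in>insert t T. (\<lambda>n. Z t ((r \<circ> r') n) \<omega>) \<longlonglongrightarrow> 0"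
    using r(2) r'(2)
    by eventually_elim (use LIMSEQ_subseq_LIMSEQ[OF _ r'(1)] in \<open>force simp: o_def\<close>)
  then show ?case using strict_mono_o[OF r(1) r'(1)] by blast
qed

text \<open>Fatou's lemma. Integrability of the limit is part of the conclusion, so uniform bounds
  for the approximations become moment bounds for \<open>X\<close>.\<close>

lemma AE_tendsto_expectation_bound:
  fixes Z :: "nat \<Rightarrow> 'a \<Rightarrow> real"
  assumes [measurable]: "\<And>n. Z n \<in> borel_measurable M" "Z' \<in> borel_measurable M"
    and lim: "AE \<omega> in M. (\<lambda>n. Z n \<omega>) \<longlonglongrightarrow> Z' \<omega>"
    and nn: "\<And>n \<omega>. 0 \<le> Z n \<omega>"
    and int: "\<And>n. integrable M (Z n)" and le: "\<And>n. expectation (Z n) \<le> c"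
  shows "integrable M Z' \<and> expectation Z' \<le> c \<and> (AE \<omega> in M. 0 \<le> Z' \<omega>)"
proof -
  have nn': "AE \<omega> in M. 0 \<le> Z' \<omega>"
    using lim by eventually_elim (rule LIMSEQ_le_const, auto simp: nn)
  have c: "0 \<le> c" using le[of 0] Bochner_Integration.integral_nonneg[of M "Z 0"] nn by (meson order_trans)
  have "(\<integral>\<^sup>+\<omega>. ennreal (Z' \<omega>) \<partial>M) = (\<integral>\<^sup>+\<omega>. liminf (\<lambda>n. ennreal (Z n \<omega>)) \<partial>M)"
    using lim
    by (intro nn_integral_cong_AE, eventually_elim)
       (auto intro!: lim_imp_Liminf[symmetric] tendsto_ennrealI)
  also have "\<dots> \<le> liminf (\<lambda>n. \<integral>\<^sup>+\<omega>. ennreal (Z n \<omega>) \<partial>M)"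
    by (rule nn_integral_liminf) auto
  also have "\<dots> \<le> liminf (\<lambda>n. ennreal c)"
    using int nn le by (intro Liminf_mono always_eventually allI)
      (auto simp: nn_integral_eq_integral intro!: ennreal_leI)
  also have "\<dots> = ennreal c" by (simp add: Liminf_const)
  finally have *: "(\<integral>\<^sup>+\<omega>. ennreal (Z' \<omega>) \<partial>M) \<le> ennreal c" .
  have i: "integrable M Z'"
    using nn' * by (intro integrableI_nonneg) (auto intro: le_less_trans)
  show ?thesis
    using i nn' * c by (auto simp: nn_integral_eq_integral)
qed

end

section \<open>Moments of independent variables\<close>

text \<open>Each of the three pairings of Wick's formula factorizes into two diagonal sums; the
  fully diagonal term, which will carry the fourth cumulant, stays a single sum.\<close>

lemma sum_four_delta:
  fixes a b c d v \<kappa> :: "'i \<Rightarrow> real"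
  assumes "finite I"
  shows "(\<Sum>i\<in>I. \<Sum>j\<in>I. \<Sum>k\<in>I. \<Sum>l\<in>I. a i * b j * c k * d l *
      ((if i = j \<and> k = l then v i * v k else 0) + (if i = k \<and> j = l then v i * v j else 0) +
       (if i = l \<and> j = k then v i * v j else 0) + (if i = j \<and> i = k \<and> i = l then \<kappa> i else 0)))
   = (\<Sum>i\<in>I. a i * b i * v i) * (\<Sum>i\<in>I. c i * d i * v i)
   + (\<Sum>i\<in>I. a i * c i * v i) * (\<Sum>i\<in>I. b i * d i * v i)
   + (\<Sum>i\<in>I. a i * d i * v i) * (\<Sum>i\<in>I. b i * c i * v i)
   + (\<Sum>i\<in>I. a i * b i * c i * d i * \<kappa> i)" (is "?L = _")
proof -
  \<comment> \<open>A pairing is a product of two such kernels, which separates the four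
    sums.\<close>
  define w where "w i j = (if i = j then v i else 0)" for i j
  have pick: "(\<Sum>j\<in>I. f j * w i j) = f i * v i" if "i \<in> I" for f i
  proof -
    have "(\<Sum>j\<in>I. f j * w i j) = (\<Sum>j\<in>I. if i = j then f j * v i else 0)"
      by (rule sum.cong) (auto simp: w_def)
    then show ?thesis using assms that by (simp add: sum.delta)
  qed
  have 1: "(\<Sum>k\<in>I. \<Sum>l\<in>I. a i * b j * c k * d l * (w i j * w k l))
      = a i * (b j * w i j) * (\<Sum>k\<in>I. c k * d k * v k)" for i j
  proof -
    have "(\<Sum>k\<in>I. \<Sum>l\<in>I. a i * b j * c k * d l * (w i j * w k l))
      = (\<Sum>k\<in>I. a i * (b j * w i j) * (c k * (\<Sum>l\<in>I. d l * w k l)))"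
      by (simp add: sum_distrib_left mult_ac)
    also have "\<dots> = (\<Sum>k\<in>I. a i * (b j * w i j) * (c k * d k * v k))"
      by (rule sum.cong) (auto simp: pick)
    finally show ?thesis by (simp add: sum_distrib_left)
  qed
  have 2: "(\<Sum>k\<in>I. \<Sum>l\<in>I. a i * b j * c k * d l * (w i k * w j l))
      = (a i * c i * v i) * (b j * d j * v j)" if "i \<in> I" "j \<in> I" for i j
  proof -
    have "(\<Sum>k\<in>I. \<Sum>l\<in>I. a i * b j * c k * d l * (w i k * w j l))
      = a i * b j * ((\<Sum>k\<in>I. c k * w i k) * (\<Sum>l\<in>I. d l * w j l))"
      by (subst sum_product) (simp add: sum_distrib_left mult_ac)
    then show ?thesis using that by (simp add: pick)
  qed
  have 3: "(\<Sum>k\<in>I. \<Sum>l\<in>I. a i * b j * c k * d l * (w i l * w j k))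
      = (a i * d i * v i) * (b j * c j * v j)" if "i \<in> I" "j \<in> I" for i j
  proof -
    have "(\<Sum>k\<in>I. \<Sum>l\<in>I. a i * b j * c k * d l * (w i l * w j k))
      = a i * b j * ((\<Sum>k\<in>I. c k * w j k) * (\<Sum>l\<in>I. d l * w i l))"
      by (subst sum_product) (simp add: sum_distrib_left mult_ac)
    then show ?thesis using that by (simp add: pick)
  qed
  have 4: "(\<Sum>j\<in>I. \<Sum>k\<in>I. \<Sum>l\<in>I. a i * b j * c k * d l * (if i = j \<and> i = k \<and> i = l then \<kappa> i else 0))
      = a i * b i * c i * d i * \<kappa> i" if "i \<in> I" for i
  proof -
    have "(\<Sum>j\<in>I. \<Sum>k\<in>I. \<Sum>l\<in>I. a i * b j * c k * d l * (if i = j \<and> i = k \<and> i = l then \<kappa> i else 0))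
      = (\<Sum>j\<in>I. if i = j then (\<Sum>k\<in>I. if i = k then (\<Sum>l\<in>I. if i = l then a i * b j * c k * d l * \<kappa> i else 0) else 0) else 0)"
      by (intro sum.cong refl) (auto intro!: sum.cong)
    then show ?thesis using that assms by (simp add: sum.delta)
  qed
  have if_w: "(if i = j \<and> k = l then v i * v k else 0) = w i j * w k l" for i j k l by (simp add: w_def)
  have "?L = (\<Sum>i\<in>I. \<Sum>j\<in>I. \<Sum>k\<in>I. \<Sum>l\<in>I. a i * b j * c k * d l * (w i j * w k l))
      + (\<Sum>i\<in>I. \<Sum>j\<in>I. \<Sum>k\<in>I. \<Sum>l\<in>I. a i * b j * c k * d l * (w i k * w j l))
      + (\<Sum>i\<in>I. \<Sum>j\<in>I. \<Sum>k\<in>I. \<Sum>l\<in>I. a i * b j * c k * d l * (w i l * w j k))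
      + (\<Sum>i\<in>I. \<Sum>j\<in>I. \<Sum>k\<in>I. \<Sum>l\<in>I. a i * b j * c k * d l * (if i = j \<and> i = k \<and> i = l then \<kappa> i else 0))"
    unfolding if_w by (simp only: distrib_left sum.distrib)
  also have "(\<Sum>i\<in>I. \<Sum>j\<in>I. \<Sum>k\<in>I. \<Sum>l\<in>I. a i * b j * c k * d l * (w i j * w k l))
      = (\<Sum>i\<in>I. a i * (\<Sum>j\<in>I. b j * w i j)) * (\<Sum>i\<in>I. c i * d i * v i)"
    unfolding 1 by (simp add: sum_distrib_left sum_distrib_right mult_ac)
  also have "(\<Sum>i\<in>I. a i * (\<Sum>j\<in>I. b j * w i j)) = (\<Sum>i\<in>I. a i * b i * v i)"
    by (rule sum.cong) (auto simp: pick)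
  finally show ?thesis
    by (simp add: 2 3 4 sum_product)
qed

context prob_space
begin

lemma integrable_power_le:
  fixes Z :: "'a \<Rightarrow> real"
  assumes "Z \<in> borel_measurable M" "integrable M (\<lambda>\<omega>. Z \<omega> ^ 4)" "n \<le> 4"
  shows "integrable M (\<lambda>\<omega>. Z \<omega> ^ n)"
proof (rule Bochner_Integration.integrable_bound[of _ "\<lambda>\<omega>. 1 + Z \<omega> ^ 4"])
  have "\<bar>x\<bar> ^ n \<le> 1 + x ^ 4" for x :: real
  proof (cases "\<bar>x\<bar> \<le> 1")
    case True
    then show ?thesis by (smt (verit) power_le_one abs_ge_zero zero_le_even_power even_numeral)
  next
    case False
    then have "\<bar>x\<bar> ^ n \<le> \<bar>x\<bar> ^ 4" using assms(3) by (intro power_increasing) auto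
    then show ?thesis by simp
  qed
  then show "AE \<omega> in M. norm (Z \<omega> ^ n) \<le> norm (1 + Z \<omega> ^ 4)"
    by (auto simp: power_abs)
qed (use assms in auto)

lemma indep_linear_forms_two_product:
  assumes I: "finite I" and indep: "indep_vars (\<lambda>_. borel) \<xi> I"
    and int2: "\<And>i. i \<in> I \<Longrightarrow> integrable M (\<lambda>\<omega>. (\<xi> i \<omega> :: real)\<^sup>2)"
    and cent: "\<And>i. i \<in> I \<Longrightarrow> expectation (\<xi> i) = 0"
  defines "L \<equiv> \<lambda>a \<omega>. \<Sum>i\<in>I. a i * \<xi> i \<omega>"
  shows "integrable M (\<lambda>\<omega>. L a \<omega> * L b \<omega>)" (is ?int)
    and "expectation (\<lambda>\<omega>. L a \<omega> * L b \<omega>) = (\<Sum>i\<in>I. a i * b i * expectation (\<lambda>\<omega>. (\<xi> i \<omega>)\<^sup>2))" (is ?eq)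
proof -
  have rv: "\<xi> r \<in> borel_measurable M" if "r \<in> I" for r
    using indep that unfolding indep_vars_def by auto
  have int1: "integrable M (\<xi> r)" if "r \<in> I" for r
    using square_integrable_imp_integrable[OF rv[OF that] int2[OF that]] .
  have prod: "integrable M (\<lambda>\<omega>. \<xi> i \<omega> * \<xi> j \<omega>)" "expectation (\<lambda>\<omega>. \<xi> i \<omega> * \<xi> j \<omega>) =
      (if i = j then expectation (\<lambda>\<omega>. (\<xi> i \<omega>)\<^sup>2) else 0)" if ij: "i \<in> I" "j \<in> I" for i j
  proof -
    have "integrable M (\<lambda>\<omega>. \<xi> i \<omega> * \<xi> j \<omega>) \<and> expectation (\<lambda>\<omega>. \<xi> i \<omega> * \<xi> j \<omega>) =
      (if i = j then expectation (\<lambda>\<omega>. (\<xi> i \<omega>)\<^sup>2) else 0)"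
    proof (cases "i = j")
      case True
      then show ?thesis using int2[OF ij(1)] by (simp add: power2_eq_square)
    next
      case False
      have ind: "indep_vars (\<lambda>_. borel) \<xi> {i, j}" using indep ij by (rule_tac indep_vars_subset) auto
      have i1: "integrable M (\<xi> r)" if "r \<in> {i, j}" for r using that int1 ij by auto
      show ?thesis
        using indep_vars_integrable[OF _ ind i1] indep_vars_lebesgue_integral[OF _ ind i1] False cent ij by simp
    qed
    then show "integrable M (\<lambda>\<omega>. \<xi> i \<omega> * \<xi> j \<omega>)" "expectation (\<lambda>\<omega>. \<xi> i \<omega> * \<xi> j \<omega>) =
      (if i = j then expectation (\<lambda>\<omega>. (\<xi> i \<omega>)\<^sup>2) else 0)" by auto
  qed
  have eq: "L a \<omega> * L b \<omega> = (\<Sum>i\<in>I. \<Sum>j\<in>I. a i * b j * (\<xi> i \<omega> * \<xi> j \<omega>))" for \<omega>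
    unfolding L_def sum_product by (intro sum.cong refl) (simp only: mult_ac)
  show ?int unfolding eq
    by (intro Bochner_Integration.integrable_sum integrable_mult_right prod)
  have "expectation (\<lambda>\<omega>. L a \<omega> * L b \<omega>)
      = (\<Sum>i\<in>I. \<Sum>j\<in>I. a i * b j * (if i = j then expectation (\<lambda>\<omega>. (\<xi> i \<omega>)\<^sup>2) else 0))"
    unfolding eq
    apply (subst Bochner_Integration.integral_sum, intro Bochner_Integration.integrable_sum integrable_mult_right prod, assumption+)
    apply (intro sum.cong refl)
    apply (subst Bochner_Integration.integral_sum, intro Bochner_Integration.integrable_sum integrable_mult_right prod, assumption+)
    apply (intro sum.cong refl)
    apply (subst Bochner_Integration.integral_mult_right_zero)
    by (subst prod(2), assumption+) (rule refl)
  also have "\<dots> = (\<Sum>i\<in>I. \<Sum>j\<in>I. if i = j then a i * b j * expectation (\<lambda>\<omega>. (\<xi> i \<omega>)\<^sup>2) else 0)"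
    by (intro sum.cong refl) simp
  also have "\<dots> = (\<Sum>i\<in>I. a i * b i * expectation (\<lambda>\<omega>. (\<xi> i \<omega>)\<^sup>2))"
    using I by (simp add: sum.delta)
  finally show ?eq .
qed

text \<open>An index that occurs exactly once makes the expectation vanish, by independence and
  centring. What survives are two pairs or four equal indices. In the latter case all three pairings
  contribute v^2, so the correction \<open>\<kappa>\<close> is the fourth moment minus 3 v^2, that
  is, the fourth cumulant.\<close>

lemma indep_four_product_expectation:
  assumes I: "finite I" and indep: "indep_vars (\<lambda>_. borel) \<xi> I"
    and int4: "\<And>i. i \<in> I \<Longrightarrow> integrable M (\<lambda>\<omega>. \<xi> i \<omega> ^ 4 :: real)"
    and cent: "\<And>i. i \<in> I \<Longrightarrow> expectation (\<xi> i) = 0"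
    and ijkl: "i \<in> I" "j \<in> I" "k \<in> I" "l \<in> I"
  defines "v \<equiv> \<lambda>i. expectation (\<lambda>\<omega>. (\<xi> i \<omega>)\<^sup>2)"
  defines "\<kappa> \<equiv> \<lambda>i. expectation (\<lambda>\<omega>. \<xi> i \<omega> ^ 4) - 3 * (v i)\<^sup>2"
  shows "integrable M (\<lambda>\<omega>. \<xi> i \<omega> * \<xi> j \<omega> * \<xi> k \<omega> * \<xi> l \<omega>)"
    and "expectation (\<lambda>\<omega>. \<xi> i \<omega> * \<xi> j \<omega> * \<xi> k \<omega> * \<xi> l \<omega>) =
      (if i = j \<and> k = l then v i * v k else 0) + (if i = k \<and> j = l then v i * v j else 0) +
      (if i = l \<and> j = k then v i * v j else 0) + (if i = j \<and> i = k \<and> i = l then \<kappa> i else 0)"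
proof -
  \<comment> \<open>Multiplicities turn the product into one over distinct indices, where
    independence applies.\<close>
  define m :: "'b \<Rightarrow> nat" where
    "m r = of_bool (r = i) + of_bool (r = j) + of_bool (r = k) + of_bool (r = l)" for r
  define e where "e r n = expectation (\<lambda>\<omega>. \<xi> r \<omega> ^ n)" for r n
  have rv: "\<xi> r \<in> borel_measurable M" if "r \<in> I" for r
    using indep that unfolding indep_vars_def by auto
  have delta: "(\<Prod>r\<in>I. \<xi> r \<omega> ^ of_bool (r = s)) = \<xi> s \<omega>" if "s \<in> I" for s \<omega>
  proof -
    have "(\<Prod>r\<in>I. \<xi> r \<omega> ^ of_bool (r = s)) = (\<Prod>r\<in>I. if r = s then \<xi> r \<omega> else 1)"
      by (rule prod.cong) auto
    then show ?thesis using that I by (simp add: prod.delta)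
  qed
  have eq: "\<xi> i \<omega> * \<xi> j \<omega> * \<xi> k \<omega> * \<xi> l \<omega> = (\<Prod>r\<in>I. \<xi> r \<omega> ^ m r)" for \<omega>
    unfolding m_def power_add prod.distrib by (simp only: delta ijkl)
  have m4: "m r \<le> 4" for r unfolding m_def by auto
  have ind: "indep_vars (\<lambda>_. borel) (\<lambda>r \<omega>. \<xi> r \<omega> ^ m r) I"
    using indep by (rule indep_vars_compose2) auto
  have int: "integrable M (\<lambda>\<omega>. \<xi> r \<omega> ^ m r)" if "r \<in> I" for r
    using rv[OF that] int4[OF that] m4 by (rule integrable_power_le)
  show "integrable M (\<lambda>\<omega>. \<xi> i \<omega> * \<xi> j \<omega> * \<xi> k \<omega> * \<xi> l \<omega>)"
    unfolding eq by (rule indep_vars_integrable[OF I ind int])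
  have e0: "e r 0 = 1" for r by (simp add: e_def prob_space)
  have e1: "e r (Suc 0) = 0" if "r \<in> I" for r using cent[OF that] by (simp add: e_def)
  have e2: "e r 2 = v r" for r by (simp add: e_def v_def)
  have e2': "e r (Suc (Suc 0)) = v r" for r using e2 by (simp add: numeral_2_eq_2)
  have e4: "e r 4 = \<kappa> r + 3 * (v r)\<^sup>2" for r by (simp add: e_def \<kappa>_def)
  have e4': "e r (Suc (Suc (Suc (Suc 0)))) = \<kappa> r + 3 * (v r)\<^sup>2" for r
    using e4[of r] by (simp add: numeral_eq_Suc)
  have "expectation (\<lambda>\<omega>. \<xi> i \<omega> * \<xi> j \<omega> * \<xi> k \<omega> * \<xi> l \<omega>) = (\<Prod>r\<in>I. e r (m r))"
    unfolding eq e_def by (rule indep_vars_lebesgue_integral[OF I ind int])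
  also have "\<dots> = (if i = j \<and> k = l then v i * v k else 0) + (if i = k \<and> j = l then v i * v j else 0) +
      (if i = l \<and> j = k then v i * v j else 0) + (if i = j \<and> i = k \<and> i = l then \<kappa> i else 0)" (is "_ = ?R")
  proof -
    have small: "(\<Prod>r\<in>I. e r (m r)) = (\<Prod>r\<in>{i,j,k,l}. e r (m r))"
      using ijkl I by (intro prod.mono_neutral_right) (auto simp: m_def e0)
    \<comment> \<open>Either some index is isolated, or all four coincide, or they split into two
      different pairs.\<close>
    consider (i) "i \<noteq> j" "i \<noteq> k" "i \<noteq> l" | (j) "j \<noteq> i" "j \<noteq> k" "j \<noteq> l"
      | (k) "k \<noteq> i" "k \<noteq> j" "k \<noteq> l" | (l) "l \<noteq> i" "l \<noteq> j" "l \<noteq> k"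
      | (all) "j = i" "k = i" "l = i" | (ij) "j = i" "l = k" "i \<noteq> k"
      | (ik) "k = i" "l = j" "i \<noteq> j" | (il) "l = i" "k = j" "i \<noteq> j" by metis
    then show ?thesis
    proof cases
      case i
      then have "e i (m i) = 0" using e1[OF ijkl(1)] by (simp add: m_def)
      then have "(\<Prod>r\<in>I. e r (m r)) = 0" using I ijkl by (auto simp: prod_zero_iff)
      then show ?thesis using i by simp
    next
      case j
      then have "e j (m j) = 0" using e1[OF ijkl(2)] by (simp add: m_def)
      then have "(\<Prod>r\<in>I. e r (m r)) = 0" using I ijkl by (auto simp: prod_zero_iff)
      then show ?thesis using j by auto
    next
      case k
      then have "e k (m k) = 0" using e1[OF ijkl(3)] by (simp add: m_def)
      then have "(\<Prod>r\<in>I. e r (m r)) = 0" using I ijkl by (auto simp: prod_zero_iff)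
      then show ?thesis using k by auto
    next
      case l
      then have "e l (m l) = 0" using e1[OF ijkl(4)] by (simp add: m_def)
      then have "(\<Prod>r\<in>I. e r (m r)) = 0" using I ijkl by (auto simp: prod_zero_iff)
      then show ?thesis using l by auto
    next
      case all
      then show ?thesis unfolding small by (simp add: m_def e4' power2_eq_square)
    next
      case ij
      then show ?thesis unfolding small by (simp add: m_def e2' )
    next
      case ik
      then show ?thesis unfolding small by (simp add: m_def e2' insert_commute)
    next
      case il
      then show ?thesis unfolding small by (simp add: m_def e2' insert_commute)
    qed
  qed
  finally show "expectation (\<lambda>\<omega>. \<xi> i \<omega> * \<xi> j \<omega> * \<xi> k \<omega> * \<xi> l \<omega>) =
      (if i = j \<and> k = l then v i * v k else 0) + (if i = k \<and> j = l then v i * v j else 0) +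
      (if i = l \<and> j = k then v i * v j else 0) + (if i = j \<and> i = k \<and> i = l then \<kappa> i else 0)" .
qed

lemma indep_linear_forms_four_product:
  assumes I: "finite I" and indep: "indep_vars (\<lambda>_. borel) \<xi> I"
    and int4: "\<And>i. i \<in> I \<Longrightarrow> integrable M (\<lambda>\<omega>. \<xi> i \<omega> ^ 4 :: real)"
    and cent: "\<And>i. i \<in> I \<Longrightarrow> expectation (\<xi> i) = 0"
  defines "v \<equiv> \<lambda>i. expectation (\<lambda>\<omega>. (\<xi> i \<omega>)\<^sup>2)"
  defines "\<kappa> \<equiv> \<lambda>i. expectation (\<lambda>\<omega>. \<xi> i \<omega> ^ 4) - 3 * (v i)\<^sup>2"
  defines "L \<equiv> \<lambda>a \<omega>. \<Sum>i\<in>I. a i * \<xi> i \<omega>"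
  shows "integrable M (\<lambda>\<omega>. L a \<omega> * L b \<omega> * L c \<omega> * L d \<omega>)" (is ?int)
    and "expectation (\<lambda>\<omega>. L a \<omega> * L b \<omega> * L c \<omega> * L d \<omega>) =
      (\<Sum>i\<in>I. a i * b i * v i) * (\<Sum>i\<in>I. c i * d i * v i)
   + (\<Sum>i\<in>I. a i * c i * v i) * (\<Sum>i\<in>I. b i * d i * v i)
   + (\<Sum>i\<in>I. a i * d i * v i) * (\<Sum>i\<in>I. b i * c i * v i)
   + (\<Sum>i\<in>I. a i * b i * c i * d i * \<kappa> i)" (is ?eq)
proof -
  note four = indep_four_product_expectation[OF I indep int4 cent, folded v_def, folded \<kappa>_def]
  have eq: "L a \<omega> * L b \<omega> * L c \<omega> * L d \<omega>
    = (\<Sum>i\<in>I. \<Sum>j\<in>I. \<Sum>k\<in>I. \<Sum>l\<in>I. a i * b j * c k * d l * (\<xi> i \<omega> * \<xi> j \<omega> * \<xi> k \<omega> * \<xi> l \<omega>))" for \<omega>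
  proof -
    have "(\<Sum>i\<in>I. \<Sum>j\<in>I. \<Sum>k\<in>I. \<Sum>l\<in>I. a i * b j * c k * d l * (\<xi> i \<omega> * \<xi> j \<omega> * \<xi> k \<omega> * \<xi> l \<omega>))
        = (\<Sum>i\<in>I. \<Sum>j\<in>I. \<Sum>k\<in>I. \<Sum>l\<in>I. ((a i * \<xi> i \<omega>) * (b j * \<xi> j \<omega>)) * (c k * \<xi> k \<omega>) * (d l * \<xi> l \<omega>))"
      by (intro sum.cong refl) (simp only: mult_ac)
    also have "\<dots> = L a \<omega> * L b \<omega> * L c \<omega> * L d \<omega>"
      unfolding L_def
      by (simp only: sum_distrib_left[symmetric] sum_distrib_right[symmetric])
    finally show ?thesis by simp
  qed
  show ?int unfolding eq
    by (intro Bochner_Integration.integrable_sum integrable_mult_right four)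
  show ?eq unfolding eq
    apply (subst Bochner_Integration.integral_sum, intro Bochner_Integration.integrable_sum integrable_mult_right four, assumption+)
    apply (subst sum_four_delta[OF I, symmetric])
    apply (intro sum.cong refl)
    apply (subst Bochner_Integration.integral_sum, intro Bochner_Integration.integrable_sum integrable_mult_right four, assumption+)
    apply (intro sum.cong refl)
    apply (subst Bochner_Integration.integral_sum, intro Bochner_Integration.integrable_sum integrable_mult_right four, assumption+)
    apply (intro sum.cong refl)
    apply (subst Bochner_Integration.integral_sum, intro Bochner_Integration.integrable_sum integrable_mult_right four, assumption+)
    apply (intro sum.cong refl)
    apply (subst Bochner_Integration.integral_mult_right_zero)
    apply (subst four(2), assumption+)
    by (simp only: v_def \<kappa>_def)
qed

end

lemma power_add_le_two_power:
  fixes x y :: real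
  assumes "0 \<le> x" "0 \<le> y"
  shows "(x + y) ^ p \<le> 2 ^ p * x ^ p + 2 ^ p * y ^ p"
proof -
  have "(x + y) ^ p \<le> (2 * max x y) ^ p" using assms by (intro power_mono) auto
  also have "\<dots> \<le> 2 ^ p * x ^ p + 2 ^ p * y ^ p"
    using assms by (simp add: power_mult_distrib max_def)
  finally show ?thesis .
qed

context prob_space
begin

text \<open>No independence of the limit is needed: on \<open>\<bar>R k\<bar> \<le> c + 1\<close>, up to the small event \<open>\<bar>R k - R'\<bar> > 1\<close>,
  \<open>\<bar>A\<bar>\<close> is bounded by \<open>\<bar>A + R'\<bar> + c + 2\<close>.\<close>

lemma even_moment_indep_summand:
  fixes A R' :: "'a \<Rightarrow> real" and R :: "nat \<Rightarrow> 'a \<Rightarrow> real"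
  assumes p: "even p"
    and [measurable]: "A \<in> borel_measurable M" "\<And>k. R k \<in> borel_measurable M" "R' \<in> borel_measurable M"
    and lim: "(\<lambda>k. prob_size M (\<lambda>\<omega>. R k \<omega> - R' \<omega>)) \<longlonglongrightarrow> 0"
    and indep: "\<And>k. indep_var borel A borel (R k)"
    and int: "integrable M (\<lambda>\<omega>. (A \<omega> + R' \<omega>) ^ p)"
  shows "integrable M (\<lambda>\<omega>. A \<omega> ^ p)"
proof -
  \<comment> \<open>A finite variable is tight: some \<open>c\<close> leaves mass below 1/4
    outside.\<close>
  have "(\<lambda>n. measure M {\<omega> \<in> space M. \<bar>R' \<omega>\<bar> > real n}) \<longlonglongrightarrow> measure M (\<Inter>n. {\<omega> \<in> space M. \<bar>R' \<omega>\<bar> > real n})"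
    by (rule finite_Lim_measure_decseq) (auto simp: decseq_def)
  also have "(\<Inter>n. {\<omega> \<in> space M. \<bar>R' \<omega>\<bar> > real n}) = {}"
  proof (intro equals0I)
    fix \<omega> assume "\<omega> \<in> (\<Inter>n. {\<omega> \<in> space M. \<bar>R' \<omega>\<bar> > real n})"
    moreover obtain n where "\<bar>R' \<omega>\<bar> < real n" using reals_Archimedean2 by blast
    ultimately have "real n < \<bar>R' \<omega>\<bar>" "\<bar>R' \<omega>\<bar> < real n" by blast+
    then show False by simp
  qed
  finally have "(\<lambda>n. measure M {\<omega> \<in> space M. \<bar>R' \<omega>\<bar> > real n}) \<longlonglongrightarrow> 0" by simp
  then have "\<forall>\<^sub>F n in sequentially. measure M {\<omega> \<in> space M. \<bar>R' \<omega>\<bar> > real n} < 1 / 4"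
    by (rule order_tendstoD) simp
  then obtain n0 where n0: "measure M {\<omega> \<in> space M. \<bar>R' \<omega>\<bar> > real n0} < 1 / 4"
    by (auto simp: eventually_sequentially)
  define c where "c = real n0"
  have c: "0 \<le> c" "measure M {\<omega> \<in> space M. \<bar>R' \<omega>\<bar> > c} < 1 / 4" using n0 by (auto simp: c_def)
  define \<delta> where "\<delta> k = measure M {\<omega> \<in> space M. \<bar>R k \<omega> - R' \<omega>\<bar> > 1}" for k
  have "conv_in_prob M R R'" using lim by (subst conv_in_prob_iff) auto
  then have \<delta>: "\<delta> \<longlonglongrightarrow> 0" unfolding conv_in_prob_def \<delta>_def by auto
  define B where "B = expectation (\<lambda>\<omega>. 2 ^ p * (A \<omega> + R' \<omega>) ^ p + 2 ^ p * (c + 2) ^ p)"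
  have intB: "integrable M (\<lambda>\<omega>. 2 ^ p * (A \<omega> + R' \<omega>) ^ p + 2 ^ p * (c + 2) ^ p)" using int by auto
  \<comment> \<open>The truncation at \<open>L\<close> makes the expectation finite before the
    moment is known to exist; the bound \<open>2 * B\<close> does not depend on
    \<open>L\<close>.\<close>
  have fL: "expectation (\<lambda>\<omega>. min \<bar>A \<omega>\<bar> L ^ p) \<le> 2 * B" if L: "L \<ge> 0" for L
  proof -
    define g where "g = (\<lambda>r::real. indicator {-(c+1)..c+1} r :: real)"
    define f where "f = (\<lambda>x::real. min \<bar>x\<bar> L ^ p)"
    have [measurable]: "f \<in> borel_measurable borel" "g \<in> borel_measurable borel"
      unfolding f_def g_def by measurable
    have f0: "0 \<le> f x" "f x \<le> L ^ p" for x using L by (auto simp: f_def intro!: power_mono zero_le_power)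
    have g0: "0 \<le> g x" "g x \<le> 1" for x by (auto simp: g_def indicator_def)
    have intf: "integrable M (\<lambda>\<omega>. f (A \<omega>))"
      by (rule integrable_const_bound[where B="L^p"]) (use f0 in auto)
    have intg: "integrable M (\<lambda>\<omega>. g (R k \<omega>))" for k
      by (rule integrable_const_bound[where B="1"]) (use g0 in auto)
    have eg: "expectation (\<lambda>\<omega>. g (R k \<omega>)) \<ge> 3 / 4 - \<delta> k" for k
    proof -
      have "1 - (indicator {\<omega> \<in> space M. \<bar>R' \<omega>\<bar> > c} \<omega> + indicator {\<omega> \<in> space M. \<bar>R k \<omega> - R' \<omega>\<bar> > 1} \<omega>)
          \<le> g (R k \<omega>)" if "\<omega> \<in> space M" for \<omega>
        using that by (auto simp: g_def indicator_def)
      then have "expectation (\<lambda>\<omega>. 1 - (indicator {\<omega> \<in> space M. \<bar>R' \<omega>\<bar> > c} \<omega> + indicator {\<omega> \<in> space M. \<bar>R k \<omega> - R' \<omega>\<bar> > 1} \<omega>))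
          \<le> expectation (\<lambda>\<omega>. g (R k \<omega>))"
        by (intro integral_mono intg Bochner_Integration.integrable_diff Bochner_Integration.integrable_add
             integrable_real_indicator) (auto simp: emeasure_eq_measure)
      also have "expectation (\<lambda>\<omega>. 1 - (indicator {\<omega> \<in> space M. \<bar>R' \<omega>\<bar> > c} \<omega> + indicator {\<omega> \<in> space M. \<bar>R k \<omega> - R' \<omega>\<bar> > 1} \<omega>))
         = 1 - (measure M {\<omega> \<in> space M. \<bar>R' \<omega>\<bar> > c} + \<delta> k)"
        by (subst Bochner_Integration.integral_diff Bochner_Integration.integral_add,
            auto intro!: Bochner_Integration.integrable_add integrable_real_indicator
              simp: emeasure_eq_measure prob_space \<delta>_def)+
      finally show ?thesis using c by simp
    qed
    have prod: "expectation (\<lambda>\<omega>. f (A \<omega>) * g (R k \<omega>))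
        = expectation (\<lambda>\<omega>. f (A \<omega>)) * expectation (\<lambda>\<omega>. g (R k \<omega>))" for k
    proof (rule indep_var_lebesgue_integral[OF _ intf intg])
      show "indep_var borel (\<lambda>\<omega>. f (A \<omega>)) borel (\<lambda>\<omega>. g (R k \<omega>))"
        using indep_var_compose[OF indep[of k], of f borel g borel] by (simp add: o_def)
    qed
    have le: "expectation (\<lambda>\<omega>. f (A \<omega>) * g (R k \<omega>)) \<le> B + L ^ p * \<delta> k" for k
    proof -
      have pt: "f (A \<omega>) * g (R k \<omega>) \<le> 2 ^ p * (A \<omega> + R' \<omega>) ^ p + 2 ^ p * (c + 2) ^ p
          + L ^ p * indicator {\<omega> \<in> space M. \<bar>R k \<omega> - R' \<omega>\<bar> > 1} \<omega>" if w: "\<omega> \<in> space M" for \<omega>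
      proof (cases "\<bar>R k \<omega> - R' \<omega>\<bar> > 1")
        case True
        have "f (A \<omega>) * g (R k \<omega>) \<le> L ^ p * 1"
          using f0 g0 L by (intro mult_mono) auto
        moreover have "0 \<le> 2 ^ p * (A \<omega> + R' \<omega>) ^ p + 2 ^ p * (c + 2) ^ p"
          using p c by (intro add_nonneg_nonneg mult_nonneg_nonneg zero_le_even_power) auto
        moreover have ind: "indicator {\<omega> \<in> space M. \<bar>R k \<omega> - R' \<omega>\<bar> > 1} \<omega> = (1::real)" using True w by simp
        ultimately show ?thesis unfolding ind by linarith
      next
        case False
        show ?thesis
        proof (cases "\<bar>R k \<omega>\<bar> \<le> c + 1")
          case True
          then have "\<bar>A \<omega>\<bar> \<le> \<bar>A \<omega> + R' \<omega>\<bar> + (c + 2)" using False by linarith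
          then have "min \<bar>A \<omega>\<bar> L ^ p \<le> (\<bar>A \<omega> + R' \<omega>\<bar> + (c + 2)) ^ p"
            using L by (intro power_mono) auto
          also have "\<dots> \<le> 2 ^ p * (A \<omega> + R' \<omega>) ^ p + 2 ^ p * (c + 2) ^ p"
            using power_add_le_two_power[of "\<bar>A \<omega> + R' \<omega>\<bar>" "c + 2" p] p c by (simp add: power_even_abs)
          finally have "f (A \<omega>) \<le> 2 ^ p * (A \<omega> + R' \<omega>) ^ p + 2 ^ p * (c + 2) ^ p" by (simp add: f_def)
          moreover have "f (A \<omega>) * g (R k \<omega>) \<le> f (A \<omega>) * 1" using f0 g0 by (intro mult_left_mono) auto
          moreover have "0 \<le> L ^ p * indicator {\<omega> \<in> space M. \<bar>R k \<omega> - R' \<omega>\<bar> > 1} \<omega>" using L by simp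
          ultimately show ?thesis by linarith
        next
          case False
          then show ?thesis using L p c by (auto simp: g_def indicator_def intro!: add_nonneg_nonneg mult_nonneg_nonneg zero_le_even_power)
        qed
      qed
      have "expectation (\<lambda>\<omega>. f (A \<omega>) * g (R k \<omega>)) \<le> expectation (\<lambda>\<omega>. 2 ^ p * (A \<omega> + R' \<omega>) ^ p + 2 ^ p * (c + 2) ^ p
          + L ^ p * indicator {\<omega> \<in> space M. \<bar>R k \<omega> - R' \<omega>\<bar> > 1} \<omega>)"
      proof (rule integral_mono)
        have "norm (f (A \<omega>) * g (R k \<omega>)) \<le> L ^ p" for \<omega>
          using mult_mono[OF f0(2)[of "A \<omega>"] g0(2)[of "R k \<omega>"]] f0 g0 L by simp
        then show "integrable M (\<lambda>\<omega>. f (A \<omega>) * g (R k \<omega>))"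
          by (intro integrable_const_bound[where B="L^p"]) auto
        show "integrable M (\<lambda>\<omega>. 2 ^ p * (A \<omega> + R' \<omega>) ^ p + 2 ^ p * (c + 2) ^ p
          + L ^ p * indicator {\<omega> \<in> space M. \<bar>R k \<omega> - R' \<omega>\<bar> > 1} \<omega>)"
          using intB by (intro Bochner_Integration.integrable_add[OF intB] integrable_mult_right integrable_real_indicator)
             (auto simp: emeasure_eq_measure)
      qed (use pt in auto)
      also have "\<dots> = B + L ^ p * \<delta> k"
        unfolding B_def \<delta>_def
        by (subst Bochner_Integration.integral_add[OF intB])
           (auto intro!: integrable_mult_right integrable_real_indicator simp: emeasure_eq_measure)
      finally show ?thesis .
    qed
    \<comment> \<open>As \<open>k\<close> grows with \<open>L\<close> fixed,
      \<open>\<delta> k\<close> disappears, and 3/4 of the truncated moment is at most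
      \<open>B\<close>.\<close>
    have "(\<lambda>k. expectation (\<lambda>\<omega>. f (A \<omega>)) * (3 / 4 - \<delta> k) - (B + L ^ p * \<delta> k)) \<longlonglongrightarrow>
        expectation (\<lambda>\<omega>. f (A \<omega>)) * (3 / 4 - 0) - (B + L ^ p * 0)"
      by (intro tendsto_intros \<delta>)
    moreover have "expectation (\<lambda>\<omega>. f (A \<omega>)) * (3 / 4 - \<delta> k) - (B + L ^ p * \<delta> k) \<le> 0" for k
    proof -
      have "expectation (\<lambda>\<omega>. f (A \<omega>)) * (3 / 4 - \<delta> k) \<le> expectation (\<lambda>\<omega>. f (A \<omega>)) * expectation (\<lambda>\<omega>. g (R k \<omega>))"
        using eg f0 by (intro mult_left_mono Bochner_Integration.integral_nonneg) auto
      then show ?thesis using le[of k] prod[of k] by linarith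
    qed
    ultimately have "expectation (\<lambda>\<omega>. f (A \<omega>)) * (3 / 4 - 0) - (B + L ^ p * 0) \<le> 0"
      by (intro LIMSEQ_le_const2) auto
    moreover have "0 \<le> expectation (\<lambda>\<omega>. f (A \<omega>))" using f0 by (intro Bochner_Integration.integral_nonneg) auto
    moreover have "x \<le> 2 * B" if "x * (3 / 4 - 0) - (B + L ^ p * 0) \<le> 0" "0 \<le> x" for x
      using that by (simp add: field_simps)
    ultimately have "expectation (\<lambda>\<omega>. f (A \<omega>)) \<le> 2 * B" by blast
    then show ?thesis by (simp only: f_def)
  qed
  \<comment> \<open>The truncation is removed by letting \<open>L\<close> run through the
    integers.\<close>
  have "integrable M (\<lambda>\<omega>. A \<omega> ^ p) \<and> expectation (\<lambda>\<omega>. A \<omega> ^ p) \<le> 2 * B \<and> (AE \<omega> in M. 0 \<le> A \<omega> ^ p)"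
  proof (rule AE_tendsto_expectation_bound[where Z="\<lambda>n \<omega>. min \<bar>A \<omega>\<bar> (real n) ^ p"])
    have "(\<lambda>n. min \<bar>x\<bar> (real n) ^ p) \<longlonglongrightarrow> x ^ p" for x :: real
    proof (rule tendsto_eventually)
      show "\<forall>\<^sub>F n in sequentially. min \<bar>x\<bar> (real n) ^ p = x ^ p"
        using eventually_ge_at_top[of "nat \<lceil>\<bar>x\<bar>\<rceil>"]
      proof eventually_elim
        case (elim n)
        then have "\<bar>x\<bar> \<le> real n" by linarith
        then show ?case using p by (simp add: min_absorb1 power_even_abs)
      qed
    qed
    then show "AE \<omega> in M. (\<lambda>n. min \<bar>A \<omega>\<bar> (real n) ^ p) \<longlonglongrightarrow> A \<omega> ^ p" by simp
    show "integrable M (\<lambda>\<omega>. min \<bar>A \<omega>\<bar> (real n) ^ p)" for n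
      by (rule integrable_const_bound[where B="real n^p"]) (auto intro!: power_mono)
  qed (use fL in auto)
  then show ?thesis by simp
qed

end

section \<open>Mean and variance from the characteristic exponent\<close>

text \<open>The relation \<open>char = exp V\<close> fixes \<open>V\<close> only modulo 2 pi i.
  Smallness of the exponent near 0 removes the ambiguity there, so that moments can be read off
  it.\<close>

lemma Levy_exponent_tendsto_0:
  assumes \<pi>: "Levy_measure \<pi>" and \<theta>: "\<theta> \<longlonglongrightarrow> 0" "\<And>n. \<bar>\<theta> n\<bar> \<le> 1"
  shows "(\<lambda>n. Levy_exponent \<mu> \<sigma> \<pi> (\<theta> n)) \<longlonglongrightarrow> 0"
proof -
  have [measurable_cong, simp]: "sets \<pi> = sets borel" using \<pi> by (simp add: Levy_measure_def)
  define f where "f t y = iexp (t * y) - 1 - \<i> * of_real (t * y * indicator {-1..1} y)" for t y :: real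
  \<comment> \<open>For \<open>|y| <= 1\<close> the compensated integrand is of second order;
    beyond, the compensator is absent and the trivial bound 2 applies.\<close>
  have bound: "norm (f t y) \<le> 2 * min 1 (y\<^sup>2)" if t: "\<bar>t\<bar> \<le> 1" for t y
  proof (cases "\<bar>y\<bar> \<le> 1")
    case True
    have "norm (f t y) = norm (iexp (t * y) - (\<Sum>k\<le>1. (\<i> * (t * y))^k / fact k))"
      using True by (simp add: f_def abs_le_iff algebra_simps)
    also have "\<dots> \<le> \<bar>t * y\<bar> ^ 2 / 2"
      using iexp_approx1[of "t * y" 1] by (simp add: numeral_2_eq_2)
    also have "\<dots> \<le> y\<^sup>2"
    proof -
      have "\<bar>t * y\<bar>\<^sup>2 \<le> (1 * \<bar>y\<bar>)\<^sup>2" unfolding abs_mult using t by (intro power_mono mult_right_mono) auto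
      then show ?thesis by (simp add: zero_le_power2) (smt (verit) zero_le_power2)
    qed
    finally have "norm (f t y) \<le> y\<^sup>2" .
    moreover have "y\<^sup>2 \<le> 1" using True by (simp add: abs_square_le_1)
    moreover have "min 1 (y\<^sup>2) = y\<^sup>2" using calculation by simp
    moreover have "0 \<le> y\<^sup>2" by simp
    ultimately show ?thesis by linarith
  next
    case False
    then have "indicator {-1..1} y = (0::real)" by (auto simp: indicator_def)
    then have "norm (f t y) = norm (iexp (t * y) - 1)" by (simp add: f_def)
    also have "\<dots> \<le> 1 + 1" by (rule order_trans[OF norm_triangle_ineq4]) simp
    also have "\<dots> = 2 * min 1 (y\<^sup>2)" using False abs_le_square_iff[of 1 y] by simp
    finally show ?thesis .
  qed
  have "(\<lambda>n. CLINT y|\<pi>. f (\<theta> n) y) \<longlonglongrightarrow> (CLINT y|\<pi>. 0)"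
  proof (rule integral_dominated_convergence[where w="\<lambda>y. 2 * min 1 (y\<^sup>2)"])
    show "integrable \<pi> (\<lambda>y. 2 * min 1 (y\<^sup>2) :: real)"
      using \<pi> by (intro integrable_mult_right integrableI_nonneg) (auto simp: Levy_measure_def)
    show "AE y in \<pi>. (\<lambda>n. f (\<theta> n) y) \<longlonglongrightarrow> 0"
    proof (rule AE_I2)
      fix y
      have "(\<lambda>n. f (\<theta> n) y) \<longlonglongrightarrow> iexp (0 * y) - 1 - \<i> * of_real (0 * y * indicator {-1..1} y)"
        unfolding f_def by (intro tendsto_intros \<theta>)
      then show "(\<lambda>n. f (\<theta> n) y) \<longlonglongrightarrow> 0" by simp
    qed
    show "(\<lambda>y. f (\<theta> n) y) \<in> borel_measurable \<pi>" for n unfolding f_def by measurable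
  qed (use bound \<theta> in auto)
  then have "(\<lambda>n. (CLINT y|\<pi>. f (\<theta> n) y) - of_real ((\<theta> n)\<^sup>2 * \<sigma>\<^sup>2 / 2) + \<i> * of_real (\<theta> n * \<mu>))
     \<longlonglongrightarrow> (CLINT y|\<pi>. 0) - of_real (0\<^sup>2 * \<sigma>\<^sup>2 / 2) + \<i> * of_real (0 * \<mu>)"
    by (intro tendsto_intros \<theta>) simp_all
  then show ?thesis by (simp add: Levy_exponent_def f_def)
qed

lemma norm_exp_minus_1_le:
  fixes z :: complex
  assumes "norm z \<le> 1"
  shows "norm (exp z - 1 - z) \<le> 3 * norm z ^ 2" "norm (exp z - 1 - z - z\<^sup>2 / 2) \<le> 3 * norm z ^ 3"
proof -
  have e: "exp \<bar>Re z\<bar> \<le> 3"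
    using exp_le abs_Re_le_cmod[of z] assms by (smt (verit) exp_le_cancel_iff)
  have "norm (exp z - 1 - z) \<le> exp \<bar>Re z\<bar> * norm z ^ 2"
    using Taylor_exp[of z 1] by (simp add: diff_diff_eq numeral_2_eq_2)
  also have "\<dots> \<le> 3 * norm z ^ 2" using e by (intro mult_right_mono) auto
  finally show "norm (exp z - 1 - z) \<le> 3 * norm z ^ 2" .
  have "norm (exp z - 1 - z - z\<^sup>2 / 2) \<le> exp \<bar>Re z\<bar> * norm z ^ 3 / 2"
    using Taylor_exp[of z 2] by (simp add: diff_diff_eq numeral_2_eq_2 numeral_3_eq_3)
  also have "\<dots> \<le> 3 * norm z ^ 3 / 1" using e by (intro frac_le mult_right_mono) auto
  finally show "norm (exp z - 1 - z - z\<^sup>2 / 2) \<le> 3 * norm z ^ 3" by simp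
qed

text \<open>A logarithm of the characteristic function that is small at 0 starts with the cumulants:
  \<open>i t E Z - t^2 Var Z / 2\<close>. The exponent is given only at the points
  \<open>1 / (n + 1)\<close>, so its first two Taylor coefficients are expressed as limits of
  rescaled values.\<close>

lemma (in prob_space) char_exponent_expansion:
  fixes Z :: "'a \<Rightarrow> real" and U :: "nat \<Rightarrow> complex"
  assumes [measurable]: "Z \<in> borel_measurable M" and int2: "integrable M (\<lambda>\<omega>. (Z \<omega>)\<^sup>2)"
    and U: "U \<longlonglongrightarrow> 0" and char: "\<And>n. char (distr M borel Z) (1 / real (Suc n)) = exp (U n)"
  shows "(\<lambda>n. of_nat (Suc n) * U n) \<longlonglongrightarrow> \<i> * of_real (expectation Z)" (is ?th1)
    and "(\<lambda>n. of_nat (Suc n) * (of_nat (Suc n) * U n - \<i> * of_real (expectation Z)))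
      \<longlonglongrightarrow> of_real (- variance Z / 2)" (is ?th2)
proof -
  define N :: "nat \<Rightarrow> complex" where "N n = of_nat (Suc n)" for n
  have N0: "N n \<noteq> 0" for n unfolding N_def by (simp del: of_nat_Suc)
  have int1: "integrable M Z"
    using square_integrable_imp_integrable[OF _ int2] by simp
  \<comment> \<open>The rescaled second-order remainder of the integrand. It is dominated by
    \<open>Z^2\<close>, so its expectation converges without any higher moment.\<close>
  define F where "F n \<omega> = (N n)\<^sup>2 * (iexp (1 / real (Suc n) * Z \<omega>) - 1 - \<i> * (of_real (Z \<omega>) / N n))" for n \<omega>
  have NR: "\<i> * (of_real z / N n) = \<i> * of_real (1 / real (Suc n) * z)" for n z
    by (simp add: N_def)
  have Fb: "norm (F n \<omega>) \<le> (Z \<omega>)\<^sup>2" for n \<omega>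
  proof -
    have "norm (iexp (1 / real (Suc n) * Z \<omega>) - 1 - \<i> * (of_real (Z \<omega>) / N n)) \<le> \<bar>1 / real (Suc n) * Z \<omega>\<bar> ^ 2 / 2"
      unfolding NR using iexp_approx1[of "1 / real (Suc n) * Z \<omega>" 1]
      by (simp add: numeral_2_eq_2 diff_diff_eq)
    then have "norm (F n \<omega>) \<le> (real (Suc n))\<^sup>2 * (\<bar>1 / real (Suc n) * Z \<omega>\<bar> ^ 2 / 2)"
      unfolding F_def norm_mult norm_power by (intro mult_mono) (auto simp: N_def simp del: of_nat_Suc)
    also have "\<dots> = (Z \<omega>)\<^sup>2 / 2"
      by (simp add: power_mult_distrib power_divide del: of_nat_Suc)
    finally show ?thesis by (smt (verit) zero_le_power2 field_sum_of_halves)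
  qed
  have Fl: "(\<lambda>n. F n \<omega>) \<longlonglongrightarrow> of_real (- (Z \<omega>)\<^sup>2 / 2)" for \<omega>
  proof (rule LIM_zero_cancel)
    have b: "norm (F n \<omega> - of_real (- (Z \<omega>)\<^sup>2 / 2)) \<le> \<bar>Z \<omega>\<bar> ^ 3 * (1 / real (Suc n))" for n
    proof -
      define x where "x = 1 / real (Suc n) * Z \<omega>"
      have "F n \<omega> - of_real (- (Z \<omega>)\<^sup>2 / 2)
          = (N n)\<^sup>2 * (iexp x - 1 - \<i> * of_real x + of_real (x\<^sup>2 / 2))"
        unfolding F_def NR x_def[symmetric]
        by (simp add: x_def N_def distrib_left power_mult_distrib power_divide del: of_nat_Suc)
      also have "iexp x - 1 - \<i> * of_real x + of_real (x\<^sup>2 / 2) = iexp x - (\<Sum>k \<le> 2. (\<i> * x)^k / fact k)"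
        by (simp add: numeral_2_eq_2 power_mult_distrib algebra_simps)
      finally have "norm (F n \<omega> - of_real (- (Z \<omega>)\<^sup>2 / 2)) = (real (Suc n))\<^sup>2 * norm (iexp x - (\<Sum>k \<le> 2. (\<i> * x)^k / fact k))"
        by (simp add: norm_mult norm_power N_def del: of_nat_Suc sum.atMost_Suc)
      also have "\<dots> \<le> (real (Suc n))\<^sup>2 * (\<bar>x\<bar> ^ 3 / 1)"
      proof (intro mult_left_mono)
        have "\<bar>x\<bar> ^ 3 / fact 3 \<le> \<bar>x\<bar> ^ 3 / 1" by (intro divide_left_mono) (auto simp: fact_numeral)
        moreover have "norm (iexp x - (\<Sum>k \<le> 2. (\<i> * x)^k / fact k)) \<le> \<bar>x\<bar> ^ 3 / fact 3"
          using iexp_approx1[of x 2] by (simp only: Suc_numeral Num.add_num_simps)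
        ultimately show "norm (iexp x - (\<Sum>k \<le> 2. (\<i> * x)^k / fact k)) \<le> \<bar>x\<bar> ^ 3 / 1"
          by (rule order_trans[rotated])
      qed simp
      also have "\<dots> = \<bar>Z \<omega>\<bar> ^ 3 * (1 / real (Suc n))"
        unfolding x_def by (simp add: abs_mult power_mult_distrib power_divide power2_eq_square power3_eq_cube del: of_nat_Suc)
      finally show ?thesis .
    qed
    have l: "(\<lambda>n. \<bar>Z \<omega>\<bar> ^ 3 * (1 / real (Suc n))) \<longlonglongrightarrow> \<bar>Z \<omega>\<bar> ^ 3 * 0"
      by (intro tendsto_mult tendsto_const LIMSEQ_Suc[OF lim_1_over_n])
    show "(\<lambda>n. F n \<omega> - of_real (- (Z \<omega>)\<^sup>2 / 2)) \<longlonglongrightarrow> 0"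
      using Lim_null_comparison[OF always_eventually[OF allI[OF b]]] l by simp
  qed
  have "(\<lambda>n. CLINT \<omega>|M. F n \<omega>) \<longlonglongrightarrow> (CLINT \<omega>|M. of_real (- (Z \<omega>)\<^sup>2 / 2))"
    by (rule integral_dominated_convergence[where w="\<lambda>\<omega>. (Z \<omega>)\<^sup>2"])
       (use Fl Fb int2 in \<open>auto simp: F_def\<close>)
  also have "(CLINT \<omega>|M. of_real (- (Z \<omega>)\<^sup>2 / 2)) = of_real (- expectation (\<lambda>\<omega>. (Z \<omega>)\<^sup>2) / 2)"
    by (subst integral_complex_of_real) simp
  also have "(\<lambda>n. CLINT \<omega>|M. F n \<omega>)
      = (\<lambda>n. (N n)\<^sup>2 * (exp (U n) - 1 - \<i> * (of_real (expectation Z) / N n)))"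
  proof
    fix n
    have "integrable M (\<lambda>\<omega>. iexp (1 / real (Suc n) * Z \<omega>))" by (intro integrable_iexp) auto
    then have "(CLINT \<omega>|M. F n \<omega>) = (N n)\<^sup>2 * ((CLINT \<omega>|M. iexp (1 / real (Suc n) * Z \<omega>)) - 1
        - \<i> * ((CLINT \<omega>|M. of_real (Z \<omega>)) / N n))"
      unfolding F_def using int1 by (simp add: prob_space)
    then show "(CLINT \<omega>|M. F n \<omega>) = (N n)\<^sup>2 * (exp (U n) - 1 - \<i> * (of_real (expectation Z) / N n))"
      using char[of n] by (simp add: char_def integral_distr del: of_nat_Suc)
  qed
  finally have A: "(\<lambda>n. (N n)\<^sup>2 * (exp (U n) - 1 - \<i> * (of_real (expectation Z) / N n)))
      \<longlonglongrightarrow> of_real (- expectation (\<lambda>\<omega>. (Z \<omega>)\<^sup>2) / 2)" .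
  have iN: "(\<lambda>n. 1 / N n) \<longlonglongrightarrow> 0"
    unfolding N_def using LIMSEQ_Suc[OF lim_1_over_n[where 'a=complex]] by simp
  have "(\<lambda>n. (1 / N n) * ((N n)\<^sup>2 * (exp (U n) - 1 - \<i> * (of_real (expectation Z) / N n))) + \<i> * of_real (expectation Z))
     \<longlonglongrightarrow> 0 * of_real (- expectation (\<lambda>\<omega>. (Z \<omega>)\<^sup>2) / 2) + \<i> * of_real (expectation Z)"
    by (intro tendsto_intros A iN)
  moreover have "(1 / N n) * ((N n)\<^sup>2 * (exp (U n) - 1 - \<i> * (of_real (expectation Z) / N n))) + \<i> * of_real (expectation Z)
      = N n * (exp (U n) - 1)" for n
    using N0[of n] by (simp add: field_simps power2_eq_square)
  ultimately have B: "(\<lambda>n. N n * (exp (U n) - 1)) \<longlonglongrightarrow> \<i> * of_real (expectation Z)"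
    by simp
  \<comment> \<open>Below 1/6 the remainder \<open>3 * norm U ^ 2\<close> is at most half of
    \<open>norm U\<close>, so \<open>U\<close> inherits the size of \<open>exp U - 1\<close>, which
    is of order 1/n.\<close>
  have small: "\<forall>\<^sub>F n in sequentially. norm (U n) < 1 / 6"
    using tendsto_norm_zero[OF U] by (rule order_tendstoD) simp
  have UB: "\<forall>\<^sub>F n in sequentially. norm (U n) \<le> 2 * norm (exp (U n) - 1)"
    using small
  proof eventually_elim
    case (elim n)
    have "norm (U n) \<le> norm (exp (U n) - 1) + norm (exp (U n) - 1 - U n)"
      using norm_triangle_ineq4[of "exp (U n) - 1" "exp (U n) - 1 - U n"] by simp
    also have "norm (exp (U n) - 1 - U n) \<le> (3 * norm (U n)) * norm (U n)"
      using norm_exp_minus_1_le(1)[of "U n"] elim by (simp add: power2_eq_square mult.assoc)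
    also have "\<dots> \<le> (1 / 2) * norm (U n)" using elim by (intro mult_right_mono) auto
    finally show ?case by simp
  qed
  have C: "(\<lambda>n. N n * (exp (U n) - 1 - U n)) \<longlonglongrightarrow> 0"
  proof (rule Lim_null_comparison)
    show "\<forall>\<^sub>F n in sequentially. norm (N n * (exp (U n) - 1 - U n)) \<le> 6 * norm (N n * (exp (U n) - 1)) * norm (U n)"
      using small UB
    proof eventually_elim
      case (elim n)
      have "norm (N n * (exp (U n) - 1 - U n)) \<le> norm (N n) * (3 * norm (U n) * norm (U n))"
        unfolding norm_mult using norm_exp_minus_1_le(1)[of "U n"] elim
        by (intro mult_left_mono) (auto simp: power2_eq_square mult.assoc)
      also have "\<dots> \<le> norm (N n) * (3 * (2 * norm (exp (U n) - 1)) * norm (U n))"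
        using elim by (intro mult_left_mono mult_right_mono) auto
      finally show ?case by (simp add: norm_mult mult_ac)
    qed
    have "(\<lambda>n. 6 * norm (N n * (exp (U n) - 1)) * norm (U n)) \<longlonglongrightarrow> 6 * norm (\<i> * of_real (expectation Z)) * norm (0::complex)"
      by (intro tendsto_intros B U)
    then show "(\<lambda>n. 6 * norm (N n * (exp (U n) - 1)) * norm (U n)) \<longlonglongrightarrow> 0" by simp
  qed
  from tendsto_diff[OF B C] have D: "(\<lambda>n. N n * U n) \<longlonglongrightarrow> \<i> * of_real (expectation Z)"
    by (simp add: algebra_simps)
  then show ?th1 by (simp add: N_def)
  have E: "(\<lambda>n. (N n)\<^sup>2 * (exp (U n) - 1 - U n - (U n)\<^sup>2 / 2)) \<longlonglongrightarrow> 0"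
  proof (rule Lim_null_comparison)
    show "\<forall>\<^sub>F n in sequentially. norm ((N n)\<^sup>2 * (exp (U n) - 1 - U n - (U n)\<^sup>2 / 2)) \<le> 3 * (norm (N n * U n))\<^sup>2 * norm (U n)"
      using small
    proof eventually_elim
      case (elim n)
      have "norm ((N n)\<^sup>2 * (exp (U n) - 1 - U n - (U n)\<^sup>2 / 2)) \<le> norm ((N n)\<^sup>2) * (3 * norm (U n) ^ 3)"
        unfolding norm_mult using norm_exp_minus_1_le(2)[of "U n"] elim
        by (intro mult_left_mono) auto
      then show ?case by (simp add: norm_mult norm_power power_mult_distrib power2_eq_square power3_eq_cube mult_ac)
    qed
    have "(\<lambda>n. 3 * (norm (N n * U n))\<^sup>2 * norm (U n)) \<longlonglongrightarrow> 3 * (norm (\<i> * of_real (expectation Z)))\<^sup>2 * norm (0::complex)"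
      by (intro tendsto_intros D U)
    then show "(\<lambda>n. 3 * (norm (N n * U n))\<^sup>2 * norm (U n)) \<longlonglongrightarrow> 0" by simp
  qed
  \<comment> \<open>Subtracting the second-order expansion of \<open>exp\<close> isolates
    \<open>U\<close>. The term \<open>(N U)^2 / 2\<close> tends to minus half the squared mean,
    which turns the second moment into the variance.\<close>
  have "(\<lambda>n. (N n)\<^sup>2 * (exp (U n) - 1 - \<i> * (of_real (expectation Z) / N n))
       - (N n)\<^sup>2 * (exp (U n) - 1 - U n - (U n)\<^sup>2 / 2) - (N n * U n)\<^sup>2 / 2)
    \<longlonglongrightarrow> of_real (- expectation (\<lambda>\<omega>. (Z \<omega>)\<^sup>2) / 2) - 0 - (\<i> * of_real (expectation Z))\<^sup>2 / 2"
    by (intro tendsto_intros A D E) simp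
  moreover have "(N n)\<^sup>2 * (exp (U n) - 1 - \<i> * (of_real (expectation Z) / N n))
       - (N n)\<^sup>2 * (exp (U n) - 1 - U n - (U n)\<^sup>2 / 2) - (N n * U n)\<^sup>2 / 2
     = N n * (N n * U n - \<i> * of_real (expectation Z))" for n
    using N0[of n] by (simp add: field_simps power2_eq_square)
  moreover have "of_real (- expectation (\<lambda>\<omega>. (Z \<omega>)\<^sup>2) / 2) - 0 - (\<i> * of_real (expectation Z))\<^sup>2 / 2
     = (of_real (- variance Z / 2) :: complex)"
  proof -
    have e2: "expectation (\<lambda>\<omega>. (Z \<omega>)\<^sup>2) = variance Z + (expectation Z)\<^sup>2"
      using variance_eq[OF int1 int2] by simp
    show ?thesis unfolding e2 by (simp add: power_mult_distrib add_divide_distrib diff_divide_distrib)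
  qed
  ultimately show ?th2 by (simp add: N_def)
qed

text \<open>The variables \<open>M A\<close> and \<open>W\<close> live on different spaces and only their characteristic functions are
  related, so the moments are compared through the expansion of the exponent at \<open>0\<close>.\<close>

lemma mean_variance_scaled_exponent:
  fixes Z :: "'a \<Rightarrow> real" and W :: "'b \<Rightarrow> real" and V :: "real \<Rightarrow> complex" and p :: real
  assumes Q: "prob_space Q" "W \<in> borel_measurable Q" "integrable Q (\<lambda>\<omega>. (W \<omega>)\<^sup>2)"
    and P: "prob_space P" "Z \<in> borel_measurable P" "integrable P (\<lambda>\<omega>. (Z \<omega>)\<^sup>2)"
    and W: "\<And>\<theta>. char (distr Q borel W) \<theta> = exp (V \<theta>)"
    and Z: "\<And>\<theta>. char (distr P borel Z) \<theta> = exp (of_real p * V \<theta>)"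
    and V: "(\<lambda>n. V (1 / real (Suc n))) \<longlonglongrightarrow> 0"
  shows "integral\<^sup>L P Z = p * integral\<^sup>L Q W"
    and "prob_space.variance P Z = p * prob_space.variance Q W"
proof -
  let ?V = "\<lambda>n. V (1 / real (Suc n))"
  have pV: "(\<lambda>n. of_real p * ?V n) \<longlonglongrightarrow> 0" using tendsto_mult[OF tendsto_const V] by simp
  note 1 = prob_space.char_exponent_expansion[OF Q V W]
  note 2 = prob_space.char_exponent_expansion[OF P pV Z]
  have "(\<lambda>n. of_real p * (of_nat (Suc n) * ?V n)) \<longlonglongrightarrow> of_real p * (\<i> * of_real (integral\<^sup>L Q W))"
    by (intro tendsto_intros 1(1))
  with 2(1) have "\<i> * of_real (integral\<^sup>L P Z) = of_real p * (\<i> * of_real (integral\<^sup>L Q W))"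
    by (intro LIMSEQ_unique[OF 2(1)]) (simp add: mult_ac)
  then have "(of_real (integral\<^sup>L P Z) :: complex) = of_real (p * integral\<^sup>L Q W)" by (simp add: mult_ac)
  then show mean: "integral\<^sup>L P Z = p * integral\<^sup>L Q W" by (simp only: of_real_eq_iff)
  have "(\<lambda>n. of_real p * (of_nat (Suc n) * (of_nat (Suc n) * ?V n - \<i> * of_real (integral\<^sup>L Q W))))
     \<longlonglongrightarrow> of_real p * of_real (- prob_space.variance Q W / 2)"
    by (intro tendsto_intros 1(2))
  then have "of_real (- prob_space.variance P Z / 2) = (of_real p * of_real (- prob_space.variance Q W / 2) :: complex)"
    by (intro LIMSEQ_unique[OF 2(2)]) (simp add: mean algebra_simps)
  then have "(of_real (prob_space.variance P Z) :: complex) = of_real (p * prob_space.variance Q W)" by simp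
  then show "prob_space.variance P Z = p * prob_space.variance Q W" by (simp only: of_real_eq_iff)
qed

section \<open>Random measures and stochastic integrals\<close>

text \<open>A rectangle event over \<open>S \<times> I\<close> is an intersection over
  \<open>s\<close> of events about the whole process \<open>Y s\<close>, so its probability factors
  first across the processes and then inside each one.\<close>

lemma (in prob_space) indep_vars_product_index:
  fixes X :: "'s \<Rightarrow> 'i \<Rightarrow> 'a \<Rightarrow> real"
  assumes fin: "finite S" "finite I"
    and proc: "indep_vars (\<lambda>_. PiM T (\<lambda>_. borel)) (\<lambda>s \<omega>. \<lambda>A\<in>T. Y s A \<omega>) S"
    and C: "\<And>i. i \<in> I \<Longrightarrow> C i \<in> T"
    and ind: "\<And>s. s \<in> S \<Longrightarrow> indep_vars (\<lambda>_. borel) (\<lambda>i. Y s (C i)) I"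
  shows "indep_vars (\<lambda>_. borel :: real measure) (\<lambda>(s, i). Y s (C i)) (S \<times> I)"
proof (cases "S \<times> I = {}")
  case True
  then show ?thesis by (simp only: indep_vars_def indep_sets_def) simp
next
  case False
  then have ne: "S \<noteq> {}" "I \<noteq> {}" by auto
  have rv: "Y s (C i) \<in> borel_measurable M" if "s \<in> S" "i \<in> I" for s i
    using ind[OF that(1)] that by (auto simp: indep_vars_def)
  have "prob (\<Inter>j\<in>S \<times> I. (case j of (s, i) \<Rightarrow> Y s (C i)) -` B j \<inter> space M)
      = (\<Prod>j\<in>S \<times> I. prob ((case j of (s, i) \<Rightarrow> Y s (C i)) -` B j \<inter> space M))"
    if B: "B \<in> (\<Pi> j\<in>S \<times> I. sets borel)" for B
  proof -
    \<comment> \<open>The cylinder set of paths satisfying all constraints at time \<open>s\<close>;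
      it is measurable because \<open>I\<close> is finite and each \<open>C i\<close> is a
      coordinate in \<open>T\<close>.\<close>
    define E where "E s = {w \<in> space (PiM T (\<lambda>_. borel :: real measure)). \<forall>i\<in>I. w (C i) \<in> B (s, i)}" for s
    have E: "E s \<in> sets (PiM T (\<lambda>_. borel))" if "s \<in> S" for s
      unfolding E_def
    proof (rule sets.sets_Collect_finite_All[OF _ fin(2)])
      fix i assume i: "i \<in> I"
      have "(\<lambda>w. w (C i)) \<in> measurable (PiM T (\<lambda>_. borel)) borel"
        by (rule measurable_component_singleton) (rule C[OF i])
      then show "{w \<in> space (PiM T (\<lambda>_. borel)). w (C i) \<in> B (s, i)} \<in> sets (PiM T (\<lambda>_. borel))"
        using B i that by (auto intro!: measurable_sets simp: vimage_def Int_def conj_commute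
            dest!: measurable_sets[of _ _ _ "B (s, i)"])
    qed
    have pre: "(\<lambda>\<omega>. \<lambda>A\<in>T. Y s A \<omega>) -` E s \<inter> space M = (\<Inter>i\<in>I. Y s (C i) -` B (s, i) \<inter> space M)" for s
      using C ne by (auto simp: E_def space_PiM)
    have "(\<Inter>j\<in>S \<times> I. (case j of (s, i) \<Rightarrow> Y s (C i)) -` B j \<inter> space M)
        = (\<Inter>s\<in>S. (\<lambda>\<omega>. \<lambda>A\<in>T. Y s A \<omega>) -` E s \<inter> space M)"
      unfolding pre by auto
    then have "prob (\<Inter>j\<in>S \<times> I. (case j of (s, i) \<Rightarrow> Y s (C i)) -` B j \<inter> space M)
        = (\<Prod>s\<in>S. prob ((\<lambda>\<omega>. \<lambda>A\<in>T. Y s A \<omega>) -` E s \<inter> space M))"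
      using indep_varsD_finite[OF proc ne(1) fin(1) E] by simp
    also have "\<dots> = (\<Prod>s\<in>S. \<Prod>i\<in>I. prob (Y s (C i) -` B (s, i) \<inter> space M))"
      unfolding pre using B by (intro prod.cong refl indep_varsD_finite[OF ind ne(2) fin(2)]) auto
    finally show ?thesis by (simp add: prod.cartesian_product split_def)
  qed
  then show ?thesis
    using False fin rv
    by (subst indep_vars_finite[where E="\<lambda>_. sets borel"])
       (auto simp: sets.Int_stable sets.space_closed sets.sigma_sets_eq[of borel, simplified] split_def)
qed

locale random_field = prob_space P for P :: "'a measure" +
  fixes \<Phi> :: "real measure" and V :: "real \<Rightarrow> complex" and M :: "int \<Rightarrow> real set \<Rightarrow> 'a \<Rightarrow> real"
  assumes prob_Phi: "prob_space \<Phi>"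
    and field: "iid_id_random_measures P \<Phi> V M"
begin

lemma field_measurable[measurable (raw)]: "A \<in> sets \<Phi> \<Longrightarrow> M s A \<in> borel_measurable P"
  using field by (auto simp: iid_id_random_measures_def id_random_measure_def)

lemma field_char: "A \<in> sets \<Phi> \<Longrightarrow> char (distr P borel (M s A)) \<theta> = exp (of_real (measure \<Phi> A) * V \<theta>)"
  using field by (auto simp: iid_id_random_measures_def id_random_measure_def)

lemma field_sequence:
  assumes "range A \<subseteq> sets \<Phi>" "disjoint_family A"
  shows "indep_vars (\<lambda>_. borel) (\<lambda>i. M s (A i)) UNIV"
    and "AE \<omega> in P. (\<lambda>i. M s (A i) \<omega>) sums M s (\<Union>i. A i) \<omega>"
  using field assms by (auto simp: iid_id_random_measures_def id_random_measure_def)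

text \<open>A convergent series with constant terms has term 0. This allows finite families to be
  padded with empty sets, since additivity and independence are given for sequences.\<close>

lemma field_empty: "AE \<omega> in P. M s {} \<omega> = 0"
proof -
  have "AE \<omega> in P. (\<lambda>i::nat. M s {} \<omega>) sums M s (\<Union>i::nat. {}) \<omega>"
    by (rule field_sequence(2)) (auto simp: disjoint_family_on_def)
  then show ?thesis
  proof eventually_elim
    case (elim \<omega>)
    then have "(\<lambda>i::nat. M s {} \<omega>) \<longlonglongrightarrow> 0" by (intro summable_LIMSEQ_zero sums_summable)
    then show ?case by (simp add: LIMSEQ_const_iff)
  qed
qed

lemma finite_family_extend:
  fixes C :: "'i \<Rightarrow> real set"
  assumes "finite I" "disjoint_family_on C I" "\<And>i. i \<in> I \<Longrightarrow> C i \<in> sets \<Phi>"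
  obtains f and A :: "nat \<Rightarrow> real set" where "bij_betw f {..<card I} I" "range A \<subseteq> sets \<Phi>" "disjoint_family A"
    "\<And>k. k < card I \<Longrightarrow> A k = C (f k)" "\<And>k. k \<ge> card I \<Longrightarrow> A k = {}" "(\<Union>k. A k) = (\<Union>i\<in>I. C i)"
proof -
  obtain f where f: "bij_betw f {..<card I} I"
    using ex_bij_betw_nat_finite[OF assms(1)] by (auto simp: atLeast0LessThan)
  define A where "A k = (if k < card I then C (f k) else {})" for k
  have fI: "f k \<in> I" if "k < card I" for k using f that by (auto simp: bij_betw_def)
  show thesis
  proof (rule that[OF f])
    show "range A \<subseteq> sets \<Phi>" using assms(3) fI by (auto simp: A_def)
    show "disjoint_family A"
      using assms(2) fI f unfolding disjoint_family_on_def A_def bij_betw_def inj_on_def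
      by (smt (verit) inf_bot_left inf_bot_right lessThan_iff)
    show "(\<Union>k. A k) = (\<Union>i\<in>I. C i)"
    proof -
      have "(\<Union>i\<in>I. C i) = (\<Union>i\<in>f ` {..<card I}. C i)"
        using f by (simp only: bij_betw_def)
      also have "\<dots> = (\<Union>k. A k)" by (auto simp: A_def split: if_splits)
      finally show ?thesis ..
    qed
  qed (auto simp: A_def)
qed

lemma field_UN:
  assumes "finite I" "disjoint_family_on C I" "\<And>i. i \<in> I \<Longrightarrow> C i \<in> sets \<Phi>"
  shows "AE \<omega> in P. M s (\<Union>i\<in>I. C i) \<omega> = (\<Sum>i\<in>I. M s (C i) \<omega>)"
proof -
  obtain f A where f: "bij_betw f {..<card I} I" and A: "range A \<subseteq> sets \<Phi>" "disjoint_family A"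
    "\<And>k. k < card I \<Longrightarrow> A k = C (f k)" "\<And>k. k \<ge> card I \<Longrightarrow> A k = {}" "(\<Union>k. A k) = (\<Union>i\<in>I. C i)"
    using finite_family_extend[OF assms] by blast
  show ?thesis
    using field_sequence(2)[OF A(1,2), of s] field_empty[of s]
  proof eventually_elim
    case (elim \<omega>)
    have "(\<lambda>i. M s (A i) \<omega>) sums (\<Sum>k<card I. M s (A k) \<omega>)"
      using A(4) elim(2) by (intro sums_finite) (auto simp: not_less)
    with elim(1) have "M s (\<Union>i\<in>I. C i) \<omega> = (\<Sum>k<card I. M s (A k) \<omega>)"
      using A(5) sums_unique2 by metis
    also have "\<dots> = (\<Sum>k<card I. M s (C (f k)) \<omega>)" using A(3) by simp
    also have "\<dots> = (\<Sum>i\<in>I. M s (C i) \<omega>)" by (rule sum.reindex_bij_betw[OF f])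
    finally show ?case .
  qed
qed

lemma field_indep_one:
  assumes "finite I" "disjoint_family_on C I" "\<And>i. i \<in> I \<Longrightarrow> C i \<in> sets \<Phi>"
  shows "indep_vars (\<lambda>_. borel) (\<lambda>i. M s (C i)) I"
proof (cases "I = {}")
  case True
  then show ?thesis unfolding indep_vars_def indep_sets_def by simp
next
  case False
  obtain f A where f: "bij_betw f {..<card I} I" and A: "range A \<subseteq> sets \<Phi>" "disjoint_family A"
    "\<And>k. k < card I \<Longrightarrow> A k = C (f k)" "\<And>k. k \<ge> card I \<Longrightarrow> A k = {}" "(\<Union>k. A k) = (\<Union>i\<in>I. C i)"
    using finite_family_extend[OF assms] by blast
  have cI: "card I > 0" using False assms(1) by (simp add: card_gt_0_iff)
  have "prob (\<Inter>i\<in>I. M s (C i) -` B i \<inter> space P) = (\<Prod>i\<in>I. prob (M s (C i) -` B i \<inter> space P))"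
    if B: "B \<in> (\<Pi> i\<in>I. sets borel)" for B
  proof -
    have "(\<Inter>i\<in>I. M s (C i) -` B i \<inter> space P) = (\<Inter>i\<in>f ` {..<card I}. M s (C i) -` B i \<inter> space P)"
      using f by (simp only: bij_betw_def)
    also have "\<dots> = (\<Inter>k\<in>{..<card I}. M s (C (f k)) -` B (f k) \<inter> space P)" by simp
    also have "\<dots> = (\<Inter>k\<in>{..<card I}. M s (A k) -` B (f k) \<inter> space P)"
      using A(3) by auto
    also have "prob \<dots> = (\<Prod>k<card I. prob (M s (A k) -` B (f k) \<inter> space P))"
      using f B cI by (intro indep_varsD[OF field_sequence(1)[OF A(1,2)]]) (auto simp: bij_betw_def)
    also have "\<dots> = (\<Prod>k<card I. prob (M s (C (f k)) -` B (f k) \<inter> space P))" using A(3) by simp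
    also have "\<dots> = (\<Prod>i\<in>I. prob (M s (C i) -` B i \<inter> space P))" by (rule prod.reindex_bij_betw[OF f])
    finally show ?thesis .
  qed
  then show ?thesis
    using False assms(1,3)
    by (subst indep_vars_finite[where E="\<lambda>_. sets borel"])
       (auto simp: sets.Int_stable sets.space_closed sets.sigma_sets_eq[of borel, simplified])
qed

lemma field_indep:
  assumes "finite S" "finite I" "disjoint_family_on C I" "\<And>i. i \<in> I \<Longrightarrow> C i \<in> sets \<Phi>"
  shows "indep_vars (\<lambda>_. borel) (\<lambda>(s, i). M s (C i)) (S \<times> I)"
proof (rule indep_vars_product_index[where T="sets \<Phi>"])
  show "indep_vars (\<lambda>_. Pi\<^sub>M (sets \<Phi>) (\<lambda>_. borel)) (\<lambda>s \<omega>. \<lambda>A\<in>sets \<Phi>. M s A \<omega>) S"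
    using field unfolding iid_id_random_measures_def by (auto intro: indep_vars_subset)
qed (use assms field_indep_one in auto)

lemma field_distr_eq:
  assumes "A \<in> sets \<Phi>" "B \<in> sets \<Phi>" "measure \<Phi> A = measure \<Phi> B"
  shows "distr P borel (M s A) = distr P borel (M s' B)"
  using assms by (intro Levy_uniqueness real_distribution_distr ext) (auto simp: field_char)

lemma field_moment_eq:
  fixes f :: "real \<Rightarrow> real"
  assumes "A \<in> sets \<Phi>" "B \<in> sets \<Phi>" "measure \<Phi> A = measure \<Phi> B" and [measurable]: "f \<in> borel_measurable borel"
  shows "integrable P (\<lambda>\<omega>. f (M s A \<omega>)) \<longleftrightarrow> integrable P (\<lambda>\<omega>. f (M s' B \<omega>))"
    and "expectation (\<lambda>\<omega>. f (M s A \<omega>)) = expectation (\<lambda>\<omega>. f (M s' B \<omega>))"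
proof -
  note [measurable] = field_measurable[OF assms(1), of s] field_measurable[OF assms(2), of s']
  note eq = field_distr_eq[OF assms(1-3), of s s']
  show "integrable P (\<lambda>\<omega>. f (M s A \<omega>)) \<longleftrightarrow> integrable P (\<lambda>\<omega>. f (M s' B \<omega>))"
    using integrable_distr_eq[of "M s A" P borel f] integrable_distr_eq[of "M s' B" P borel f] by (simp add: eq)
  show "expectation (\<lambda>\<omega>. f (M s A \<omega>)) = expectation (\<lambda>\<omega>. f (M s' B \<omega>))"
    using integral_distr[of "M s A" P borel f] integral_distr[of "M s' B" P borel f] by (simp add: eq)
qed

text \<open>\<open>M s A\<close> and \<open>M s (space \<Phi> - A)\<close> are independent and add
  up to the value on the whole space, which has the moment. The sequence in the criterion for
  independent summands is constant here.\<close>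

lemma field_even_moment:
  assumes A: "A \<in> sets \<Phi>" and p: "even p" and int: "integrable P (\<lambda>\<omega>. M 0 (space \<Phi>) \<omega> ^ p)"
  shows "integrable P (\<lambda>\<omega>. M s A \<omega> ^ p)"
proof (rule even_moment_indep_summand[OF p])
  define C where "C b = (if b then A else space \<Phi> - A)" for b
  have C: "C b \<in> sets \<Phi>" "disjoint_family_on C UNIV" for b
    using A by (auto simp: C_def disjoint_family_on_def)
  show [measurable]: "M s A \<in> borel_measurable P" by (rule field_measurable[OF A])
  show [measurable]: "M s (space \<Phi> - A) \<in> borel_measurable P"
    by (rule field_measurable[OF sets.compl_sets[OF A]])
  then show "M s (space \<Phi> - A) \<in> borel_measurable P" .
  show "(\<lambda>k. prob_size P (\<lambda>\<omega>. M s (space \<Phi> - A) \<omega> - M s (space \<Phi> - A) \<omega>)) \<longlonglongrightarrow> 0"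
    by (simp add: prob_size_def)
  have "indep_vars (\<lambda>_. borel) (\<lambda>b. M s (C b)) UNIV" by (rule field_indep_one) (use C in auto)
  then show "indep_var borel (M s A) borel (M s (space \<Phi> - A))" for k :: nat
    unfolding indep_var_def
    by (rule indep_vars_cong[THEN iffD1, rotated -1]) (auto simp: C_def split: bool.splits)
  have "AE \<omega> in P. M s (\<Union>b\<in>UNIV. C b) \<omega> = (\<Sum>b\<in>UNIV. M s (C b) \<omega>)" by (rule field_UN) (use C in auto)
  moreover have "(\<Union>b\<in>UNIV. C b) = space \<Phi>" using sets.sets_into_space[OF A] by (auto simp: C_def UNIV_bool)
  ultimately have ae: "AE \<omega> in P. M s (space \<Phi>) \<omega> = M s A \<omega> + M s (space \<Phi> - A) \<omega>"
    by (simp add: UNIV_bool C_def add.commute)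
  have "integrable P (\<lambda>\<omega>. M s (space \<Phi>) \<omega> ^ p)"
    using int field_moment_eq(1)[of "space \<Phi>" "space \<Phi>" "\<lambda>x. x ^ p" 0 s] by simp
  then show "integrable P (\<lambda>\<omega>. (M s A \<omega> + M s (space \<Phi> - A) \<omega>) ^ p)"
  proof (rule integrable_cong_AE_imp)
    show "(\<lambda>\<omega>. (M s A \<omega> + M s (space \<Phi> - A) \<omega>) ^ p) \<in> borel_measurable P" by measurable
    show "AE \<omega> in P. M s (space \<Phi>) \<omega> ^ p = (M s A \<omega> + M s (space \<Phi> - A) \<omega>) ^ p"
      using ae by eventually_elim simp
  qed
qed

end

locale square_integrable_field = random_field +
  assumes V_lim: "(\<lambda>n. V (1 / real (Suc n))) \<longlonglongrightarrow> 0"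
    and int2: "integrable P (\<lambda>\<omega>. (M 0 (space \<Phi>) \<omega>)\<^sup>2)"
begin

definition mean :: real where "mean = expectation (M 0 (space \<Phi>))"
definition vari :: real where "vari = variance (M 0 (space \<Phi>))"

definition \<xi> :: "int \<Rightarrow> real set \<Rightarrow> 'a \<Rightarrow> real" where
  "\<xi> s A \<omega> = M s A \<omega> - measure \<Phi> A * mean"

lemma vari_nonneg: "0 \<le> vari" unfolding vari_def by (rule variance_positive)

lemma field_square_integrable: "A \<in> sets \<Phi> \<Longrightarrow> integrable P (\<lambda>\<omega>. (M s A \<omega>)\<^sup>2)"
  using field_even_moment[OF _ _ int2] by simp

lemma field_integrable: "A \<in> sets \<Phi> \<Longrightarrow> integrable P (M s A)"
  using square_integrable_imp_integrable[OF field_measurable field_square_integrable] .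

lemma field_mean_variance:
  assumes A: "A \<in> sets \<Phi>"
  shows "expectation (M s A) = measure \<Phi> A * mean" "variance (M s A) = measure \<Phi> A * vari"
proof -
  have 1: "char (distr P borel (M 0 (space \<Phi>))) \<theta> = exp (V \<theta>)" for \<theta>
    using field_char[of "space \<Phi>" 0 \<theta>] prob_space.prob_space[OF prob_Phi] by simp
  note * = mean_variance_scaled_exponent[OF prob_space_axioms field_measurable[OF sets.top] int2
      prob_space_axioms field_measurable[OF A] field_square_integrable[OF A] 1 field_char[OF A] V_lim]
  show "expectation (M s A) = measure \<Phi> A * mean" "variance (M s A) = measure \<Phi> A * vari"
    unfolding mean_def vari_def by (rule *)+
qed

lemma xi_measurable[measurable (raw)]: "A \<in> sets \<Phi> \<Longrightarrow> \<xi> s A \<in> borel_measurable P"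
  unfolding \<xi>_def using field_measurable by (auto intro!: borel_measurable_diff)

lemma xi_mean: "A \<in> sets \<Phi> \<Longrightarrow> expectation (\<xi> s A) = 0"
  unfolding \<xi>_def using field_integrable by (simp add: field_mean_variance prob_space)

lemma xi_square: "A \<in> sets \<Phi> \<Longrightarrow> integrable P (\<lambda>\<omega>. (\<xi> s A \<omega>)\<^sup>2)"
  unfolding \<xi>_def power2_diff using field_integrable field_square_integrable
  by (intro Bochner_Integration.integrable_add Bochner_Integration.integrable_diff) auto

lemma xi_variance: "A \<in> sets \<Phi> \<Longrightarrow> expectation (\<lambda>\<omega>. (\<xi> s A \<omega>)\<^sup>2) = vari * measure \<Phi> A"
  unfolding \<xi>_def using field_mean_variance[of A s] by simp

lemma xi_indep:
  assumes "finite S" "finite I" "disjoint_family_on C I" "\<And>i. i \<in> I \<Longrightarrow> C i \<in> sets \<Phi>"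
  shows "indep_vars (\<lambda>_. borel) (\<lambda>(s, i). \<xi> s (C i)) (S \<times> I)"
proof -
  have "indep_vars (\<lambda>_. borel) (\<lambda>si. (\<lambda>x. x - measure \<Phi> (C (snd si)) * mean) \<circ> (case si of (s, i) \<Rightarrow> M s (C i))) (S \<times> I)"
    by (rule indep_vars_compose[OF field_indep[OF assms]]) auto
  then show ?thesis
    by (rule indep_vars_cong[THEN iffD1, rotated -1]) (auto simp: \<xi>_def)
qed

lemma xi_indep_one:
  assumes "finite I" "disjoint_family_on C I" "\<And>i. i \<in> I \<Longrightarrow> C i \<in> sets \<Phi>"
  shows "indep_vars (\<lambda>_. borel) (\<lambda>i. \<xi> s (C i)) I"
proof -
  have "indep_vars (\<lambda>_. borel) (\<lambda>i. (\<lambda>x. x - measure \<Phi> (C i) * mean) \<circ> M s (C i)) I"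
    by (rule indep_vars_compose[OF field_indep_one[OF assms]]) auto
  then show ?thesis by (rule indep_vars_cong[THEN iffD1, rotated -1]) (auto simp: \<xi>_def)
qed

text \<open>The variance of the form contributes \<open>vari\<close>; its mean contributes
  \<open>mean\<^sup>2\<close> through the Cauchy-Schwarz inequality on a space of total mass 1. The
  sum on the right is the squared L2 norm of a step function, so integration of step functions is
  bounded from L2 of \<open>\<Phi>\<close> to L2 of \<open>P\<close>.\<close>

lemma linear_form_square_le:
  assumes I: "finite I" and C: "disjoint_family_on C I" "\<And>i. i \<in> I \<Longrightarrow> C i \<in> sets \<Phi>"
  shows "integrable P (\<lambda>\<omega>. (\<Sum>i\<in>I. \<gamma> i * M s (C i) \<omega>)\<^sup>2)"
    and "expectation (\<lambda>\<omega>. (\<Sum>i\<in>I. \<gamma> i * M s (C i) \<omega>)\<^sup>2)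
       \<le> (vari + mean\<^sup>2) * (\<Sum>i\<in>I. (\<gamma> i)\<^sup>2 * measure \<Phi> (C i))"
proof -
  define b where "b = mean * (\<Sum>i\<in>I. \<gamma> i * measure \<Phi> (C i))"
  define L where "L \<omega> = (\<Sum>i\<in>I. \<gamma> i * \<xi> s (C i) \<omega>)" for \<omega>
  have eq: "(\<Sum>i\<in>I. \<gamma> i * M s (C i) \<omega>) = L \<omega> + b" for \<omega>
    unfolding L_def b_def \<xi>_def by (simp add: right_diff_distrib sum_subtractf sum_distrib_left mult_ac)
  note two = indep_linear_forms_two_product[OF I xi_indep_one[OF I C, where s=s] xi_square[OF C(2), where s=s]
      xi_mean[OF C(2), where s=s], where a = \<gamma> and b = \<gamma>, folded L_def]
  have L2: "integrable P (\<lambda>\<omega>. (L \<omega>)\<^sup>2)" "expectation (\<lambda>\<omega>. (L \<omega>)\<^sup>2) = vari * (\<Sum>i\<in>I. (\<gamma> i)\<^sup>2 * measure \<Phi> (C i))"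
    using two C(2)
    by (auto simp: power2_eq_square[symmetric] xi_variance sum_distrib_left mult_ac intro!: sum.cong)
  have L1: "integrable P L" "expectation L = 0"
  proof -
    have i: "integrable P (\<xi> s (C i))" if "i \<in> I" for i
      using C(2)[OF that] square_integrable_imp_integrable[OF xi_measurable xi_square] by blast
    then show "integrable P L" unfolding L_def[abs_def] by auto
    show "expectation L = 0" unfolding L_def[abs_def]
      using i C(2) xi_mean by (subst Bochner_Integration.integral_sum) auto
  qed
  show "integrable P (\<lambda>\<omega>. (\<Sum>i\<in>I. \<gamma> i * M s (C i) \<omega>)\<^sup>2)"
    unfolding eq power2_sum using L1 L2 by (intro Bochner_Integration.integrable_add) auto
  have "expectation (\<lambda>\<omega>. (\<Sum>i\<in>I. \<gamma> i * M s (C i) \<omega>)\<^sup>2) = vari * (\<Sum>i\<in>I. (\<gamma> i)\<^sup>2 * measure \<Phi> (C i)) + b\<^sup>2"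
  proof -
    have "(\<lambda>\<omega>. (\<Sum>i\<in>I. \<gamma> i * M s (C i) \<omega>)\<^sup>2) = (\<lambda>\<omega>. (L \<omega>)\<^sup>2 + (2 * b * L \<omega> + b\<^sup>2))"
      unfolding eq power2_sum by (auto simp: mult_ac)
    then show ?thesis using L1 L2 by (simp add: prob_space)
  qed
  also have "b\<^sup>2 \<le> mean\<^sup>2 * (\<Sum>i\<in>I. (\<gamma> i)\<^sup>2 * measure \<Phi> (C i))"
  proof -
    interpret Phi: prob_space \<Phi> by (rule prob_Phi)
    have "(\<Sum>i\<in>I. (\<gamma> i * sqrt (measure \<Phi> (C i))) * sqrt (measure \<Phi> (C i)))\<^sup>2
       \<le> (\<Sum>i\<in>I. (\<gamma> i * sqrt (measure \<Phi> (C i)))\<^sup>2) * (\<Sum>i\<in>I. (sqrt (measure \<Phi> (C i)))\<^sup>2)"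
      by (rule Cauchy_Schwarz_ineq_sum)
    then have "(\<Sum>i\<in>I. \<gamma> i * measure \<Phi> (C i))\<^sup>2
        \<le> (\<Sum>i\<in>I. (\<gamma> i)\<^sup>2 * measure \<Phi> (C i)) * (\<Sum>i\<in>I. measure \<Phi> (C i))"
      by (simp add: power_mult_distrib mult.assoc)
    also have "(\<Sum>i\<in>I. measure \<Phi> (C i)) = measure \<Phi> (\<Union>i\<in>I. C i)"
      using C I by (subst Phi.finite_measure_finite_Union) auto
    also have "(\<Sum>i\<in>I. (\<gamma> i)\<^sup>2 * measure \<Phi> (C i)) * measure \<Phi> (\<Union>i\<in>I. C i)
        \<le> (\<Sum>i\<in>I. (\<gamma> i)\<^sup>2 * measure \<Phi> (C i)) * 1"
      by (intro mult_left_mono sum_nonneg) auto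
    finally show ?thesis unfolding b_def power_mult_distrib by (intro mult_left_mono) auto
  qed
  finally show "expectation (\<lambda>\<omega>. (\<Sum>i\<in>I. \<gamma> i * M s (C i) \<omega>)\<^sup>2)
       \<le> (vari + mean\<^sup>2) * (\<Sum>i\<in>I. (\<gamma> i)\<^sup>2 * measure \<Phi> (C i))" by (simp add: distrib_right)
qed

definition cell :: "(real \<Rightarrow> real) \<Rightarrow> real \<Rightarrow> real set" where
  "cell h y = h -` {y} \<inter> space \<Phi>"

text \<open>The integral over \<open>A\<close> of the step function \<open>f (h x)\<close>.
  Separating the partition, given by \<open>h\<close>, from the values \<open>f\<close> lets one
  discretization of the identity carry all powers of \<open>x\<close>.\<close>

definition cell_integral :: "int \<Rightarrow> (real \<Rightarrow> real) \<Rightarrow> (real \<Rightarrow> real) \<Rightarrow> real set \<Rightarrow> 'a \<Rightarrow> real" where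
  "cell_integral s h f A \<omega> = (\<Sum>y\<in>h ` space \<Phi>. f y * M s (A \<inter> cell h y) \<omega>)"

lemma cell_sets: "simple_function \<Phi> h \<Longrightarrow> cell h y \<in> sets \<Phi>"
  unfolding cell_def by (rule simple_functionD)

lemma simple_stoch_integral_eq_cell: "simple_stoch_integral \<Phi> (M s) A g = cell_integral s g (\<lambda>y. y) A"
  by (rule ext) (simp add: simple_stoch_integral_def cell_integral_def cell_def)

lemma cell_integral_measurable[measurable (raw)]:
  "simple_function \<Phi> h \<Longrightarrow> A \<in> sets \<Phi> \<Longrightarrow> cell_integral s h f A \<in> borel_measurable P"
  unfolding cell_integral_def[abs_def]
  by (intro borel_measurable_sum borel_measurable_times borel_measurable_const field_measurable sets.Int cell_sets)

lemma cell_integral_union: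
  assumes h: "simple_function \<Phi> h" and AB: "A \<in> sets \<Phi>" "B \<in> sets \<Phi>" "A \<inter> B = {}"
  shows "AE \<omega> in P. cell_integral s h f (A \<union> B) \<omega> = cell_integral s h f A \<omega> + cell_integral s h f B \<omega>"
proof -
  have "AE \<omega> in P. M s ((A \<union> B) \<inter> cell h y) \<omega> = M s (A \<inter> cell h y) \<omega> + M s (B \<inter> cell h y) \<omega>" for y
  proof -
    define C where "C b = (if b then A else B) \<inter> cell h y" for b
    have "AE \<omega> in P. M s (\<Union>b\<in>UNIV. C b) \<omega> = (\<Sum>b\<in>UNIV. M s (C b) \<omega>)"
      using AB cell_sets[OF h, of y] by (intro field_UN) (auto simp: C_def disjoint_family_on_def)
    moreover have "(\<Union>b\<in>UNIV. C b) = (A \<union> B) \<inter> cell h y" by (auto simp: C_def UNIV_bool)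
    ultimately show ?thesis by (simp add: UNIV_bool C_def add.commute)
  qed
  then have "AE \<omega> in P. \<forall>y\<in>h ` space \<Phi>. M s ((A \<union> B) \<inter> cell h y) \<omega> = M s (A \<inter> cell h y) \<omega> + M s (B \<inter> cell h y) \<omega>"
    by (subst AE_finite_all[OF simple_functionD(1)[OF h]]) blast
  then show ?thesis
    by eventually_elim (auto simp: cell_integral_def distrib_left[symmetric] sum.distrib[symmetric] intro!: sum.cong)
qed

lemma cell_integral_refine:
  assumes h: "simple_function \<Phi> h" and g: "simple_function \<Phi> g" and A: "A \<in> sets \<Phi>"
  shows "AE \<omega> in P. cell_integral s h f A \<omega>
    = (\<Sum>(u, v)\<in>h ` space \<Phi> \<times> g ` space \<Phi>. f u * M s (A \<inter> (cell h u \<inter> cell g v)) \<omega>)"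
proof -
  have fin: "finite (h ` space \<Phi>)" "finite (g ` space \<Phi>)" using simple_functionD(1) h g by auto
  have "AE \<omega> in P. M s (A \<inter> cell h u) \<omega> = (\<Sum>v\<in>g ` space \<Phi>. M s (A \<inter> (cell h u \<inter> cell g v)) \<omega>)" for u
  proof -
    have "AE \<omega> in P. M s (\<Union>v\<in>g ` space \<Phi>. A \<inter> (cell h u \<inter> cell g v)) \<omega>
        = (\<Sum>v\<in>g ` space \<Phi>. M s (A \<inter> (cell h u \<inter> cell g v)) \<omega>)"
      using A h g fin cell_sets
      by (intro field_UN) (auto simp: disjoint_family_on_def cell_def)
    moreover have "(\<Union>v\<in>g ` space \<Phi>. A \<inter> (cell h u \<inter> cell g v)) = A \<inter> cell h u"
      by (auto simp: cell_def)
    ultimately show ?thesis by simp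
  qed
  then have "AE \<omega> in P. \<forall>u\<in>h ` space \<Phi>. M s (A \<inter> cell h u) \<omega> = (\<Sum>v\<in>g ` space \<Phi>. M s (A \<inter> (cell h u \<inter> cell g v)) \<omega>)"
    by (subst AE_finite_all[OF fin(1)]) blast
  then show ?thesis
    by eventually_elim
      (auto simp: cell_integral_def sum.cartesian_product[symmetric] sum_distrib_left[symmetric] intro!: sum.cong)
qed

text \<open>On the common refinement of the two partitions the difference is a single linear form
  over disjoint cells, to which the L2 bound applies.\<close>

lemma cell_integral_diff_square:
  assumes h: "simple_function \<Phi> h" and g: "simple_function \<Phi> g" and A: "A \<in> sets \<Phi>"
  shows "integrable P (\<lambda>\<omega>. (cell_integral s h f A \<omega> - cell_integral s g f' A \<omega>)\<^sup>2)"
    and "expectation (\<lambda>\<omega>. (cell_integral s h f A \<omega> - cell_integral s g f' A \<omega>)\<^sup>2)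
      \<le> (vari + mean\<^sup>2) * (\<integral>x. indicator A x * (f (h x) - f' (g x))\<^sup>2 \<partial>\<Phi>)"
proof -
  interpret Phi: prob_space \<Phi> by (rule prob_Phi)
  define I where "I = h ` space \<Phi> \<times> g ` space \<Phi>"
  define C where "C = (\<lambda>(u, v). A \<inter> (cell h u \<inter> cell g v))"
  define \<gamma> where "\<gamma> = (\<lambda>(u, v). f u - f' v)"
  have fin: "finite I" using simple_functionD(1) h g by (auto simp: I_def)
  have C: "disjoint_family_on C I" "\<And>i. i \<in> I \<Longrightarrow> C i \<in> sets \<Phi>"
    using A cell_sets[OF h] cell_sets[OF g] by (auto simp: C_def disjoint_family_on_def cell_def)
  note [measurable] = cell_integral_measurable[OF h A] cell_integral_measurable[OF g A]
  have [measurable]: "(\<lambda>\<omega>. (\<Sum>i\<in>I. \<gamma> i * M s (C i) \<omega>)\<^sup>2) \<in> borel_measurable P"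
    using linear_form_square_le(1)[OF fin C] by blast
  have "AE \<omega> in P. cell_integral s g f' A \<omega>
    = (\<Sum>(u, v)\<in>g ` space \<Phi> \<times> h ` space \<Phi>. f' u * M s (A \<inter> (cell g u \<inter> cell h v)) \<omega>)"
    by (rule cell_integral_refine[OF g h A])
  then have ae: "AE \<omega> in P. (\<Sum>i\<in>I. \<gamma> i * M s (C i) \<omega>)\<^sup>2 = (cell_integral s h f A \<omega> - cell_integral s g f' A \<omega>)\<^sup>2"
    using cell_integral_refine[OF h g A, of s f]
  proof eventually_elim
    case (elim \<omega>)
    have "(\<Sum>(u, v)\<in>g ` space \<Phi> \<times> h ` space \<Phi>. f' u * M s (A \<inter> (cell g u \<inter> cell h v)) \<omega>)
       = (\<Sum>(v, u)\<in>I. f' u * M s (A \<inter> (cell h v \<inter> cell g u)) \<omega>)"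
      unfolding I_def sum.cartesian_product[symmetric] by (subst sum.swap) (simp add: Int_commute)
    then show ?case unfolding elim I_def \<gamma>_def C_def
      by (simp add: split_def left_diff_distrib sum_subtractf)
  qed
  show "integrable P (\<lambda>\<omega>. (cell_integral s h f A \<omega> - cell_integral s g f' A \<omega>)\<^sup>2)"
    by (rule integrable_cong_AE_imp[OF linear_form_square_le(1)[OF fin C, of \<gamma> s] _ ae]) measurable
  have "expectation (\<lambda>\<omega>. (cell_integral s h f A \<omega> - cell_integral s g f' A \<omega>)\<^sup>2)
      = expectation (\<lambda>\<omega>. (\<Sum>i\<in>I. \<gamma> i * M s (C i) \<omega>)\<^sup>2)"
    by (rule integral_cong_AE) (use ae in \<open>auto elim: eventually_mono\<close>)
  also have "\<dots> \<le> (vari + mean\<^sup>2) * (\<Sum>i\<in>I. (\<gamma> i)\<^sup>2 * measure \<Phi> (C i))"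
    by (rule linear_form_square_le(2)[OF fin C])
  also have "(\<Sum>i\<in>I. (\<gamma> i)\<^sup>2 * measure \<Phi> (C i)) = (\<integral>x. (\<Sum>i\<in>I. (\<gamma> i)\<^sup>2 * indicator (C i) x) \<partial>\<Phi>)"
    using C by (subst Bochner_Integration.integral_sum)
      (auto intro!: sum.cong integrable_mult_right integrable_real_indicator simp: Phi.emeasure_eq_measure)
  also have "\<dots> = (\<integral>x. indicator A x * (f (h x) - f' (g x))\<^sup>2 \<partial>\<Phi>)"
  proof (rule Bochner_Integration.integral_cong[OF refl])
    fix x assume x: "x \<in> space \<Phi>"
    have "(\<Sum>i\<in>I. (\<gamma> i)\<^sup>2 * indicator (C i) x) = (\<Sum>i\<in>I. if i = (h x, g x) then (\<gamma> i)\<^sup>2 * indicator A x else 0)"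
      using x by (intro sum.cong refl) (auto simp: C_def cell_def indicator_def)
    also have "\<dots> = indicator A x * (f (h x) - f' (g x))\<^sup>2"
      using x fin by (simp add: sum.delta' I_def \<gamma>_def)
    finally show "(\<Sum>i\<in>I. (\<gamma> i)\<^sup>2 * indicator (C i) x) = indicator A x * (f (h x) - f' (g x))\<^sup>2" .
  qed
  finally show "expectation (\<lambda>\<omega>. (cell_integral s h f A \<omega> - cell_integral s g f' A \<omega>)\<^sup>2)
      \<le> (vari + mean\<^sup>2) * (\<integral>x. indicator A x * (f (h x) - f' (g x))\<^sup>2 \<partial>\<Phi>)" .
qed

end

section \<open>Independence of the stochastic integral from the approximating step functions\<close>

context square_integrable_field
begin

lemma cell_integral_diff_prob_size:
  assumes h: "simple_function \<Phi> h" and g: "simple_function \<Phi> g" and A: "A \<in> sets \<Phi>"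
  shows "prob_size P (\<lambda>\<omega>. cell_integral s h f A \<omega> - cell_integral s g f' A \<omega>)
      \<le> sqrt ((vari + mean\<^sup>2) * (\<integral>x. indicator A x * (f (h x) - f' (g x))\<^sup>2 \<partial>\<Phi>))"
proof -
  note [measurable] = cell_integral_measurable[OF h A] cell_integral_measurable[OF g A]
  have "prob_size P (\<lambda>\<omega>. cell_integral s h f A \<omega> - cell_integral s g f' A \<omega>)
     \<le> sqrt (expectation (\<lambda>\<omega>. (cell_integral s h f A \<omega> - cell_integral s g f' A \<omega>)\<^sup>2))"
    by (rule prob_size_le_sqrt[OF _ cell_integral_diff_square(1)[OF h g A]]) measurable
  also have "\<dots> \<le> sqrt ((vari + mean\<^sup>2) * (\<integral>x. indicator A x * (f (h x) - f' (g x))\<^sup>2 \<partial>\<Phi>))"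
    by (rule real_sqrt_le_mono[OF cell_integral_diff_square(2)[OF h g A]])
  finally show ?thesis .
qed

text \<open>A gliding hump: if \<open>T n (space \<Phi>)\<close> stayed large, then infinitely many disjoint pieces \<open>B j\<close> would carry
  it, and \<open>T n\<close> of the union of every other piece would not be Cauchy.\<close>

lemma gliding_hump:
  fixes s :: int and g h :: "nat \<Rightarrow> real \<Rightarrow> real" and f f' :: "real \<Rightarrow> real"
  assumes g: "\<And>n. simple_function \<Phi> (g n)" and h: "\<And>n. simple_function \<Phi> (h n)"
    and ae: "AE x in \<Phi>. (\<lambda>n. f (g n x) - f' (h n x)) \<longlonglongrightarrow> 0"
  defines "T \<equiv> \<lambda>n A \<omega>. cell_integral s (g n) f A \<omega> - cell_integral s (h n) f' A \<omega>"
  assumes cauchy: "\<And>A e. A \<in> sets \<Phi> \<Longrightarrow> e > 0 \<Longrightarrow>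
      \<exists>N. \<forall>m\<ge>N. \<forall>n\<ge>N. prob_size P (\<lambda>\<omega>. T m A \<omega> - T n A \<omega>) < e"
  shows "(\<lambda>n. prob_size P (T n (space \<Phi>))) \<longlonglongrightarrow> 0"
proof (rule ccontr)
  interpret Phi: prob_space \<Phi> by (rule prob_Phi)
  assume "\<not> (\<lambda>n. prob_size P (T n (space \<Phi>))) \<longlonglongrightarrow> 0"
  then obtain \<epsilon> where \<epsilon>: "\<epsilon> > 0" and bad: "\<And>N. \<exists>n\<ge>N. prob_size P (T n (space \<Phi>)) \<ge> \<epsilon>"
    unfolding LIMSEQ_def dist_real_def
    by (auto simp: not_less abs_of_nonneg[OF prob_size_nonneg])
  define d where "d n x = f (g n x) - f' (h n x)" for n x
  have sd: "simple_function \<Phi> (d n)" for n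
    unfolding d_def[abs_def]
    by (rule simple_function_diff[OF simple_function_compose1[OF g] simple_function_compose1[OF h]])
  have [measurable]: "d n \<in> borel_measurable \<Phi>" for n using borel_measurable_simple_function[OF sd] .
  define J where "J n A = (\<integral>x. indicator A x * (d n x)\<^sup>2 \<partial>\<Phi>)" for n A
  have dbound: "\<exists>B\<ge>0. \<forall>x\<in>space \<Phi>. (d n x)\<^sup>2 \<le> B" for n
  proof -
    have "finite ((\<lambda>x. (d n x)\<^sup>2) ` space \<Phi>)"
      using simple_functionD(1)[OF sd, of n] by (simp add: image_image[of "\<lambda>y. y\<^sup>2" "d n", symmetric])
    then have "\<forall>x\<in>space \<Phi>. (d n x)\<^sup>2 \<le> max 0 (Max ((\<lambda>x. (d n x)\<^sup>2) ` space \<Phi>))"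
      by (auto intro!: max.coboundedI2 Max_ge)
    then show ?thesis by (intro exI[of _ "max 0 (Max ((\<lambda>x. (d n x)\<^sup>2) ` space \<Phi>))"]) auto
  qed
  have Jint: "integrable \<Phi> (\<lambda>x. indicator A x * (d n x)\<^sup>2)" if "A \<in> sets \<Phi>" for n A
  proof -
    obtain B where B: "0 \<le> B" "\<And>x. x \<in> space \<Phi> \<Longrightarrow> (d n x)\<^sup>2 \<le> B" using dbound by blast
    show ?thesis using that B
      by (intro Phi.integrable_const_bound[where B=B]) (auto simp: indicator_def intro!: AE_I2)
  qed
  have Jmono: "J n A \<le> J n B" if "A \<in> sets \<Phi>" "B \<in> sets \<Phi>" "A \<subseteq> B" for n A B
    unfolding J_def using that by (intro integral_mono Jint mult_right_mono) (auto simp: indicator_def)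
  define Cq where "Cq = vari + mean\<^sup>2"
  have Cq: "0 \<le> Cq" using vari_nonneg by (simp add: Cq_def)
  have TJ: "prob_size P (T n A) \<le> sqrt (Cq * J n A)" if "A \<in> sets \<Phi>" for n A
    unfolding T_def J_def Cq_def d_def using cell_integral_diff_prob_size[OF g h that] .
  note [measurable] = cell_integral_measurable[OF g] cell_integral_measurable[OF h]
  have T_meas[measurable]: "T n A \<in> borel_measurable P" if "A \<in> sets \<Phi>" for n A
    unfolding T_def using that by measurable
  have Tadd: "AE \<omega> in P. T n (A \<union> B) \<omega> = T n A \<omega> + T n B \<omega>"
    if "A \<in> sets \<Phi>" "B \<in> sets \<Phi>" "A \<inter> B = {}" for n A B
    using cell_integral_union[OF g that, of s n f] cell_integral_union[OF h that, of s n f']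
    unfolding T_def by eventually_elim simp
  have Tadd': "prob_size P (T n (A \<union> B)) \<le> prob_size P (T n A) + prob_size P (T n B)"
    if AB: "A \<in> sets \<Phi>" "B \<in> sets \<Phi>" "A \<inter> B = {}" for n A B
  proof -
    have "prob_size P (T n (A \<union> B)) = prob_size P (\<lambda>\<omega>. T n A \<omega> + T n B \<omega>)"
      using AB by (intro prob_size_cong_AE Tadd borel_measurable_add T_meas) auto
    also have "\<dots> \<le> prob_size P (T n A) + prob_size P (T n B)"
      using AB by (intro prob_size_triangle T_meas)
    finally show ?thesis .
  qed
  \<comment> \<open>Budget: outside its hump \<open>T (n j)\<close> costs at most
    \<open>2 * \<delta>\<close>. The set \<open>A\<close> below then keeps at least
    \<open>6 * \<delta>\<close> at even steps and at most \<open>2 * \<delta>\<close> at odd ones, a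
    gap wider than the Cauchy tolerance \<open>\<delta>\<close>.\<close>
  define \<delta> where "\<delta> = \<epsilon> / 8"
  define \<eta> where "\<eta> = \<delta>\<^sup>2 / (Cq + 1)"
  have \<delta>: "\<delta> > 0" "\<epsilon> = 8 * \<delta>" and \<eta>: "\<eta> > 0" using \<epsilon> Cq by (auto simp: \<delta>_def \<eta>_def)
  have small: "prob_size P (T n A) \<le> \<delta>" if "A \<in> sets \<Phi>" "J n A \<le> \<eta>" for n A
  proof -
    have "Cq * J n A \<le> Cq * \<eta>" using that Cq by (intro mult_left_mono)
    also have "\<dots> \<le> \<delta>\<^sup>2" using Cq by (simp add: \<eta>_def field_simps)
    finally have "sqrt (Cq * J n A) \<le> \<delta>" using \<delta> by (simp add: real_le_lsqrt)
    then show ?thesis using TJ[OF that(1), of n] by linarith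
  qed
  \<comment> \<open>As in Egorov's theorem: these sets increase to almost the whole space, and on
    \<open>E k\<close> all \<open>d n\<close> with \<open>n >= k\<close> are bounded by 1.\<close>
  define E where "E k = {x \<in> space \<Phi>. \<forall>n\<ge>k. \<bar>d n x\<bar> \<le> 1}" for k
  have E_sets[measurable]: "E k \<in> sets \<Phi>" for k
    unfolding E_def by measurable
  have E_mono: "E k \<subseteq> E k'" if "k \<le> k'" for k k' using that by (auto simp: E_def)
  have a: "\<exists>N. \<forall>n\<ge>N. J n (E k) \<le> \<eta>" for k
  proof -
    have "(\<lambda>n. \<integral>x. indicator (E k) x * (d (n + k) x)\<^sup>2 \<partial>\<Phi>) \<longlonglongrightarrow> (\<integral>x. 0 \<partial>\<Phi>)"
    proof (rule integral_dominated_convergence[where w="\<lambda>_. 1"])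
      show "AE x in \<Phi>. (\<lambda>n. indicator (E k) x * (d (n + k) x)\<^sup>2) \<longlonglongrightarrow> 0"
        using ae
      proof eventually_elim
        case (elim x)
        then have "(\<lambda>n. d (n + k) x) \<longlonglongrightarrow> 0" unfolding d_def by (rule LIMSEQ_ignore_initial_segment)
        then have "(\<lambda>n. indicator (E k) x * (d (n + k) x)\<^sup>2) \<longlonglongrightarrow> indicator (E k) x * 0\<^sup>2"
          by (intro tendsto_intros)
        then show ?case by simp
      qed
      show "AE x in \<Phi>. norm (indicator (E k) x * (d (n + k) x)\<^sup>2) \<le> 1" for n
        by (intro AE_I2) (auto simp: indicator_def E_def abs_square_le_1)
    qed auto
    then have "\<forall>\<^sub>F n in sequentially. J (n + k) (E k) < \<eta>"
      unfolding J_def using \<eta> by (intro order_tendstoD) auto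
    then obtain N where "\<And>n. n \<ge> N \<Longrightarrow> J (n + k) (E k) < \<eta>" by (auto simp: eventually_sequentially)
    then have "J n (E k) \<le> \<eta>" if "n \<ge> N + k" for n
      using that by (metis add_le_imp_le_diff le_add_diff_inverse2 le_trans le_add2 less_imp_le)
    then show ?thesis by blast
  qed
  have b: "\<exists>K. \<forall>k\<ge>K. J n (space \<Phi> - E k) \<le> \<eta>" for n
  proof -
    obtain B where B: "0 \<le> B" "\<And>x. x \<in> space \<Phi> \<Longrightarrow> (d n x)\<^sup>2 \<le> B" using dbound by blast
    have "(\<lambda>k. \<integral>x. indicator (space \<Phi> - E k) x * (d n x)\<^sup>2 \<partial>\<Phi>) \<longlonglongrightarrow> (\<integral>x. 0 \<partial>\<Phi>)"
    proof (rule integral_dominated_convergence[where w="\<lambda>_. B"])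
      show "AE x in \<Phi>. (\<lambda>k. indicator (space \<Phi> - E k) x * (d n x)\<^sup>2) \<longlonglongrightarrow> 0"
        using ae AE_space
      proof eventually_elim
        case (elim x)
        then have "(\<lambda>n. \<bar>d n x\<bar>) \<longlonglongrightarrow> 0" unfolding d_def by (intro tendsto_rabs_zero)
        then have "\<forall>\<^sub>F n in sequentially. \<bar>d n x\<bar> < 1" by (rule order_tendstoD) simp
        then obtain K where K: "\<And>n. n \<ge> K \<Longrightarrow> \<bar>d n x\<bar> < 1" by (auto simp: eventually_sequentially)
        have "indicator (space \<Phi> - E k) x * (d n x)\<^sup>2 = 0" if "k \<ge> K" for k
          using K that elim by (auto simp: indicator_def E_def less_imp_le)
        then show ?case by (intro tendsto_eventually) (auto simp: eventually_sequentially)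
      qed
      show "AE x in \<Phi>. norm (indicator (space \<Phi> - E k) x * (d n x)\<^sup>2) \<le> B" for k
        using B by (intro AE_I2) (auto simp: indicator_def)
    qed auto
    then have "\<forall>\<^sub>F k in sequentially. J n (space \<Phi> - E k) < \<eta>"
      unfolding J_def using \<eta> by (intro order_tendstoD) auto
    then show ?thesis by (auto simp: eventually_sequentially intro: less_imp_le)
  qed
  define Good where "Good kn \<longleftrightarrow> J (snd kn) (E (fst kn)) \<le> \<eta> \<and> prob_size P (T (snd kn) (space \<Phi>)) \<ge> \<epsilon>" for kn
  have ex: "\<exists>n>n0. Good (k, n)" for k n0
  proof -
    obtain N where N: "\<And>n. n \<ge> N \<Longrightarrow> J n (E k) \<le> \<eta>" using a by blast
    obtain n where "n \<ge> max N (Suc n0)" "prob_size P (T n (space \<Phi>)) \<ge> \<epsilon>" using bad by blast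
    then show ?thesis using N by (intro exI[of _ n]) (auto simp: Good_def)
  qed
  \<comment> \<open>Alternating choice: the next \<open>k\<close> is taken so late that the current
    \<open>T n\<close> is small outside \<open>E k\<close>, and the next \<open>n\<close> so late
    that \<open>T n\<close> is small on that \<open>E k\<close>. Each \<open>T n\<close> is thus
    concentrated on a difference of consecutive sets.\<close>
  have "\<exists>kn. \<forall>j. Good (kn j) \<and> (fst (kn j) \<le> fst (kn (Suc j)) \<and> snd (kn j) < snd (kn (Suc j)) \<and>
      J (snd (kn j)) (space \<Phi> - E (fst (kn (Suc j)))) \<le> \<eta>)"
  proof (rule dependent_nat_choice)
    show "\<exists>kn. Good kn" using ex by blast
    fix kn :: "nat \<times> nat" and j :: nat assume "Good kn"
    obtain K where K: "\<And>k. k \<ge> K \<Longrightarrow> J (snd kn) (space \<Phi> - E k) \<le> \<eta>" using b by blast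
    obtain n where "n > snd kn" "Good (max K (fst kn), n)" using ex by blast
    then show "\<exists>kn'. Good kn' \<and> (fst kn \<le> fst kn' \<and> snd kn < snd kn' \<and> J (snd kn) (space \<Phi> - E (fst kn')) \<le> \<eta>)"
      using K by (intro exI[of _ "(max K (fst kn), n)"]) auto
  qed
  then obtain kn where kn: "\<And>j. Good (kn j)" "\<And>j. fst (kn j) \<le> fst (kn (Suc j))" "\<And>j. snd (kn j) < snd (kn (Suc j))"
    "\<And>j. J (snd (kn j)) (space \<Phi> - E (fst (kn (Suc j)))) \<le> \<eta>" by blast
  define F where "F j = E (fst (kn j))" for j
  define n where "n j = snd (kn j)" for j
  have n_mono: "strict_mono n" using kn(3) by (simp add: strict_mono_Suc_iff n_def)
  have F_sets[measurable]: "F j \<in> sets \<Phi>" for j by (simp add: F_def)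
  have F_mono: "F i \<subseteq> F j" if "i \<le> j" for i j
  proof -
    have "fst (kn i) \<le> fst (kn j)" using that kn(2) by (rule lift_Suc_mono_le[rotated])
    then show ?thesis unfolding F_def by (rule E_mono)
  qed
  have J1: "J (n j) (F j) \<le> \<eta>" and big: "prob_size P (T (n j) (space \<Phi>)) \<ge> \<epsilon>" for j
    using kn(1)[of j] by (auto simp: Good_def n_def F_def)
  have J2: "J (n j) (space \<Phi> - F (Suc j)) \<le> \<eta>" for j using kn(4) by (simp add: n_def F_def)
  \<comment> \<open>Every second hump: at an even step the hump lies inside \<open>A\<close>, at an
    odd step it is disjoint from \<open>A\<close>.\<close>
  define A where "A = (\<Union>j\<in>{j. even j}. F (Suc j) - F j)"
  have A[measurable]: "A \<in> sets \<Phi>" unfolding A_def by (intro sets.countable_UN'') auto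
  have part: "i = j" if "x \<in> F (Suc i) - F i" "x \<in> F (Suc j) - F j" for x i j
    using that F_mono[of "Suc i" j] F_mono[of "Suc j" i] by (metis DiffD1 DiffD2 Suc_leI linorder_neqE_nat subsetD)
  have sm: "prob_size P (T (n j) (D \<inter> F j)) + prob_size P (T (n j) (D - F (Suc j))) \<le> 2 * \<delta>"
    if D: "D \<in> sets \<Phi>" for D j
  proof -
    have "J (n j) (D \<inter> F j) \<le> \<eta>" using D Jmono[of "D \<inter> F j" "F j" "n j"] J1[of j] by auto
    moreover have "J (n j) (D - F (Suc j)) \<le> \<eta>"
    proof (rule order_trans[OF Jmono J2])
      show "D - F (Suc j) \<subseteq> space \<Phi> - F (Suc j)" using sets.sets_into_space[OF D] by blast
    qed (use D in auto)
    ultimately have "prob_size P (T (n j) (D \<inter> F j)) \<le> \<delta>" "prob_size P (T (n j) (D - F (Suc j))) \<le> \<delta>"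
      using D by (auto intro!: small)
    then show ?thesis by simp
  qed
  have sm': "prob_size P (T (n j) D) \<le> 2 * \<delta>" if D: "D \<in> sets \<Phi>" "D \<inter> (F (Suc j) - F j) = {}" for D j
  proof -
    have "D = (D \<inter> F j) \<union> (D - F (Suc j))" using D(2) F_mono[of j "Suc j"] by auto
    then have "prob_size P (T (n j) D) \<le> prob_size P (T (n j) (D \<inter> F j)) + prob_size P (T (n j) (D - F (Suc j)))"
      using Tadd'[of "D \<inter> F j" "D - F (Suc j)" "n j"] D(1) F_mono[of j "Suc j"] by auto
    then show ?thesis using sm[OF D(1), of j] by linarith
  qed
  have even: "prob_size P (T (n j) A) \<ge> 6 * \<delta>" if "even j" for j
  proof -
    have "prob_size P (T (n j) (space \<Phi> - A)) \<le> 2 * \<delta>"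
      using that A by (intro sm') (auto simp: A_def)
    moreover have "prob_size P (T (n j) (space \<Phi>)) \<le> prob_size P (T (n j) A) + prob_size P (T (n j) (space \<Phi> - A))"
      using Tadd'[of A "space \<Phi> - A" "n j"] A sets.sets_into_space[OF A] by (auto simp: Un_absorb1)
    ultimately show ?thesis using big[of j] \<delta> by linarith
  qed
  have odd: "prob_size P (T (n j) A) \<le> 2 * \<delta>" if "odd j" for j
  proof (rule sm'[OF A], rule equals0I)
    fix x assume x: "x \<in> A \<inter> (F (Suc j) - F j)"
    then obtain i where "even i" "x \<in> F (Suc i) - F i" by (auto simp: A_def)
    with part[of x i j] x that show False by auto
  qed
  obtain N where N: "\<And>m n. m \<ge> N \<Longrightarrow> n \<ge> N \<Longrightarrow> prob_size P (\<lambda>\<omega>. T m A \<omega> - T n A \<omega>) < \<delta>"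
    using cauchy[OF A \<delta>(1)] by blast
  have nN: "n j \<ge> N" if "j \<ge> N" for j using seq_suble[OF n_mono, of j] that by linarith
  have "prob_size P (\<lambda>\<omega>. (T (n (2 * N)) A \<omega> - T (n (Suc (2 * N))) A \<omega>) + T (n (Suc (2 * N))) A \<omega>)
     \<le> prob_size P (\<lambda>\<omega>. T (n (2 * N)) A \<omega> - T (n (Suc (2 * N))) A \<omega>) + prob_size P (T (n (Suc (2 * N))) A)"
    by (intro prob_size_triangle borel_measurable_diff T_meas A)
  also have "\<dots> < \<delta> + 2 * \<delta>" using N[OF nN nN, of "2 * N" "Suc (2 * N)"] odd[of "Suc (2 * N)"] by simp
  finally show False using even[of "2 * N"] \<delta> by simp
qed

end

context square_integrable_field
begin

text \<open>The definition yields step functions \<open>g n\<close> that converge almost everywhere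
  and have convergent integrals over all sets, but nothing bounds them in L2. For the bounded
  functions \<open>f (h n x)\<close> dominated convergence gives the Cauchy property on every set,
  so the difference of the two sequences satisfies the assumptions of the gliding hump.\<close>

lemma stoch_integral_approximation:
  assumes I: "has_stoch_integral P \<Phi> (M s) F I" and h: "\<And>n. simple_function \<Phi> (h n)"
    and lim: "AE x in \<Phi>. (\<lambda>n. f (h n x)) \<longlonglongrightarrow> F x"
    and bound: "\<And>n x. x \<in> space \<Phi> \<Longrightarrow> \<bar>f (h n x)\<bar> \<le> B"
  shows "(\<lambda>n. prob_size P (\<lambda>\<omega>. cell_integral s (h n) f (space \<Phi>) \<omega> - I \<omega>)) \<longlonglongrightarrow> 0"
proof -
  interpret Phi: prob_space \<Phi> by (rule prob_Phi)
  obtain g where F[measurable]: "F \<in> borel_measurable \<Phi>" and g: "\<And>n. simple_function \<Phi> (g n)"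
    and glim: "AE x in \<Phi>. (\<lambda>n. g n x) \<longlonglongrightarrow> F x"
    and gA: "\<And>A. A \<in> sets \<Phi> \<Longrightarrow> \<exists>J. conv_in_prob P (\<lambda>n. cell_integral s (g n) (\<lambda>y. y) A) J"
    and gI: "conv_in_prob P (\<lambda>n. cell_integral s (g n) (\<lambda>y. y) (space \<Phi>)) I"
    using I unfolding has_stoch_integral_def simple_stoch_integral_eq_cell by blast
  note [measurable] = cell_integral_measurable[OF g] cell_integral_measurable[OF h]
  have I_meas[measurable]: "I \<in> borel_measurable P" using gI by (simp add: conv_in_prob_def)
  have [measurable]: "(\<lambda>x. f (h n x)) \<in> borel_measurable \<Phi>" for n
    by (rule borel_measurable_simple_function, rule simple_function_compose1[OF h])
  define J where "J n = (\<integral>x. (f (h n x) - F x)\<^sup>2 \<partial>\<Phi>)" for n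
  have FB: "AE x in \<Phi>. \<bar>F x\<bar> \<le> B"
    using lim AE_space
  proof eventually_elim
    case (elim x)
    show ?case using bound[OF elim(2)] by (intro LIMSEQ_le_const2[OF tendsto_rabs[OF elim(1)]]) auto
  qed
  have dB: "AE x in \<Phi>. (f (h n x) - F x)\<^sup>2 \<le> (2 * B)\<^sup>2" for n
    using FB AE_space
  proof eventually_elim
    case (elim x)
    then have "\<bar>f (h n x) - F x\<bar> \<le> 2 * B" using bound[OF elim(2), of n] by linarith
    then show ?case by (metis abs_ge_zero power2_abs power_mono)
  qed
  have Jint: "integrable \<Phi> (\<lambda>x. (f (h n x) - F x)\<^sup>2)" for n
    using dB[of n] by (intro Phi.integrable_const_bound[where B="(2 * B)\<^sup>2"]) auto
  have "(\<lambda>n. \<integral>x. (f (h n x) - F x)\<^sup>2 \<partial>\<Phi>) \<longlonglongrightarrow> (\<integral>x. 0 \<partial>\<Phi>)"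
  proof (rule integral_dominated_convergence[where w="\<lambda>_. (2 * B)\<^sup>2"])
    show "AE x in \<Phi>. (\<lambda>n. (f (h n x) - F x)\<^sup>2) \<longlonglongrightarrow> 0"
      using lim
    proof eventually_elim
      case (elim x)
      have "(\<lambda>n. (f (h n x) - F x)\<^sup>2) \<longlonglongrightarrow> (F x - F x)\<^sup>2" by (intro tendsto_intros elim)
      then show ?case by simp
    qed
  qed (use dB in auto)
  then have Jlim: "J \<longlonglongrightarrow> 0" by (simp add: J_def[abs_def])
  define Cq where "Cq = vari + mean\<^sup>2"
  have Cq: "0 \<le> Cq" using vari_nonneg by (simp add: Cq_def)
  \<comment> \<open>The estimate is uniform in \<open>A\<close>, since restricting to
    \<open>A\<close> only decreases the L2 norm.\<close>
  have hh: "prob_size P (\<lambda>\<omega>. cell_integral s (h m) f A \<omega> - cell_integral s (h n) f A \<omega>) \<le> sqrt (Cq * (2 * J m + 2 * J n))"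
    if A: "A \<in> sets \<Phi>" for A m n
  proof -
    have pt: "indicator A x * (f (h m x) - f (h n x))\<^sup>2 \<le> 2 * (f (h m x) - F x)\<^sup>2 + 2 * (f (h n x) - F x)\<^sup>2" for x
    proof -
      have "(f (h m x) - f (h n x))\<^sup>2 + ((f (h m x) - F x) + (f (h n x) - F x))\<^sup>2
          = 2 * (f (h m x) - F x)\<^sup>2 + 2 * (f (h n x) - F x)\<^sup>2" by (simp add: power2_eq_square algebra_simps)
      then have "(f (h m x) - f (h n x))\<^sup>2 \<le> 2 * (f (h m x) - F x)\<^sup>2 + 2 * (f (h n x) - F x)\<^sup>2"
        by (smt (verit) zero_le_power2)
      then show ?thesis by (auto simp: indicator_def)
    qed
    have "(\<integral>x. indicator A x * (f (h m x) - f (h n x))\<^sup>2 \<partial>\<Phi>) \<le> (\<integral>x. 2 * (f (h m x) - F x)\<^sup>2 + 2 * (f (h n x) - F x)\<^sup>2 \<partial>\<Phi>)"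
    proof (rule integral_mono)
      show "integrable \<Phi> (\<lambda>x. 2 * (f (h m x) - F x)\<^sup>2 + 2 * (f (h n x) - F x)\<^sup>2)" using Jint by auto
      then show "integrable \<Phi> (\<lambda>x. indicator A x * (f (h m x) - f (h n x))\<^sup>2)"
        by (rule Bochner_Integration.integrable_bound) (use A pt in \<open>auto intro!: AE_I2\<close>)
    qed (rule pt)
    also have "\<dots> = 2 * J m + 2 * J n" using Jint by (simp add: J_def)
    finally have "sqrt (Cq * (\<integral>x. indicator A x * (f (h m x) - f (h n x))\<^sup>2 \<partial>\<Phi>)) \<le> sqrt (Cq * (2 * J m + 2 * J n))"
      using Cq by (intro real_sqrt_le_mono mult_left_mono)
    then show ?thesis using cell_integral_diff_prob_size[OF h h A, where f=f and f'=f and s=s] unfolding Cq_def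
      by (meson order_trans)
  qed
  define T where "T = (\<lambda>n A \<omega>. cell_integral s (g n) (\<lambda>y. y) A \<omega> - cell_integral s (h n) f A \<omega>)"
  have T0: "(\<lambda>n. prob_size P (T n (space \<Phi>))) \<longlonglongrightarrow> 0"
    unfolding T_def
  proof (rule gliding_hump[OF g h, where f="\<lambda>y. y" and f'=f and s=s])
    show "AE x in \<Phi>. (\<lambda>n. g n x - f (h n x)) \<longlonglongrightarrow> 0"
      using glim lim
    proof eventually_elim
      case (elim x)
      from tendsto_diff[OF elim] show ?case by simp
    qed
    fix A e assume A: "A \<in> sets \<Phi>" and e: "(e::real) > 0"
    obtain J' where J': "conv_in_prob P (\<lambda>n. cell_integral s (g n) (\<lambda>y. y) A) J'" using gA[OF A] by blast
    then have [measurable]: "J' \<in> borel_measurable P" by (simp add: conv_in_prob_def)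
    have "(\<lambda>n. prob_size P (\<lambda>\<omega>. cell_integral s (g n) (\<lambda>y. y) A \<omega> - J' \<omega>)) \<longlonglongrightarrow> 0"
      using J' A by (subst (asm) conv_in_prob_iff) auto
    then have "\<forall>\<^sub>F n in sequentially. prob_size P (\<lambda>\<omega>. cell_integral s (g n) (\<lambda>y. y) A \<omega> - J' \<omega>) < e / 4"
      using e by (intro order_tendstoD) auto
    moreover have "(\<lambda>n. sqrt (Cq * (4 * J n))) \<longlonglongrightarrow> sqrt (Cq * (4 * 0))" by (intro tendsto_intros Jlim)
    then have "\<forall>\<^sub>F n in sequentially. sqrt (Cq * (4 * J n)) < e / 2" using e by (intro order_tendstoD) auto
    ultimately have "\<forall>\<^sub>F n in sequentially. prob_size P (\<lambda>\<omega>. cell_integral s (g n) (\<lambda>y. y) A \<omega> - J' \<omega>) < e / 4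
        \<and> sqrt (Cq * (4 * J n)) < e / 2"
      by (rule eventually_conj)
    then obtain N where N: "\<And>n. n \<ge> N \<Longrightarrow> prob_size P (\<lambda>\<omega>. cell_integral s (g n) (\<lambda>y. y) A \<omega> - J' \<omega>) < e / 4"
      "\<And>n. n \<ge> N \<Longrightarrow> sqrt (Cq * (4 * J n)) < e / 2"
      unfolding eventually_sequentially by blast
    have "prob_size P (\<lambda>\<omega>. (cell_integral s (g m) (\<lambda>y. y) A \<omega> - cell_integral s (h m) f A \<omega>)
        - (cell_integral s (g n) (\<lambda>y. y) A \<omega> - cell_integral s (h n) f A \<omega>)) < e" if mn: "m \<ge> N" "n \<ge> N" for m n
    proof -
      have "prob_size P (\<lambda>\<omega>. (cell_integral s (g m) (\<lambda>y. y) A \<omega> - cell_integral s (h m) f A \<omega>)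
          - (cell_integral s (g n) (\<lambda>y. y) A \<omega> - cell_integral s (h n) f A \<omega>))
        = prob_size P (\<lambda>\<omega>. (cell_integral s (g m) (\<lambda>y. y) A \<omega> - cell_integral s (g n) (\<lambda>y. y) A \<omega>)
           + (cell_integral s (h n) f A \<omega> - cell_integral s (h m) f A \<omega>))" by (simp add: algebra_simps)
      also have "\<dots> \<le> prob_size P (\<lambda>\<omega>. cell_integral s (g m) (\<lambda>y. y) A \<omega> - cell_integral s (g n) (\<lambda>y. y) A \<omega>)
          + prob_size P (\<lambda>\<omega>. cell_integral s (h n) f A \<omega> - cell_integral s (h m) f A \<omega>)"
        using A by (intro prob_size_triangle) auto
      also have "prob_size P (\<lambda>\<omega>. cell_integral s (g m) (\<lambda>y. y) A \<omega> - cell_integral s (g n) (\<lambda>y. y) A \<omega>)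
         \<le> prob_size P (\<lambda>\<omega>. cell_integral s (g m) (\<lambda>y. y) A \<omega> - J' \<omega>) + prob_size P (\<lambda>\<omega>. J' \<omega> - cell_integral s (g n) (\<lambda>y. y) A \<omega>)"
        using A by (intro prob_size_diff_le) auto
      also have "\<dots> < e / 4 + e / 4"
        using N(1)[OF mn(1)] N(1)[OF mn(2)] by (subst (2) prob_size_minus) linarith
      also have "prob_size P (\<lambda>\<omega>. cell_integral s (h n) f A \<omega> - cell_integral s (h m) f A \<omega>) \<le> sqrt (Cq * (2 * J n + 2 * J m))"
        by (rule hh[OF A])
      also have "\<dots> \<le> max (sqrt (Cq * (4 * J n))) (sqrt (Cq * (4 * J m)))"
      proof (cases "J n \<le> J m")
        case True
        then have "sqrt (Cq * (2 * J n + 2 * J m)) \<le> sqrt (Cq * (4 * J m))" using Cq by (intro real_sqrt_le_mono mult_left_mono) auto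
        then show ?thesis by (rule max.coboundedI2)
      next
        case False
        then have "sqrt (Cq * (2 * J n + 2 * J m)) \<le> sqrt (Cq * (4 * J n))" using Cq by (intro real_sqrt_le_mono mult_left_mono) auto
        then show ?thesis by (rule max.coboundedI1)
      qed
      also have "\<dots> < e / 2" using N(2)[OF mn(1)] N(2)[OF mn(2)] unfolding max_less_iff_conj by blast
      finally show ?thesis by simp
    qed
    then show "\<exists>N. \<forall>m\<ge>N. \<forall>n\<ge>N. prob_size P (\<lambda>\<omega>. (cell_integral s (g m) (\<lambda>y. y) A \<omega> - cell_integral s (h m) f A \<omega>)
        - (cell_integral s (g n) (\<lambda>y. y) A \<omega> - cell_integral s (h n) f A \<omega>)) < e" by blast
  qed
  have "(\<lambda>n. prob_size P (\<lambda>\<omega>. cell_integral s (g n) (\<lambda>y. y) (space \<Phi>) \<omega> - I \<omega>)) \<longlonglongrightarrow> 0"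
    using gI by (subst (asm) conv_in_prob_iff) auto
  from tendsto_add[OF T0 this]
  have lim0: "(\<lambda>n. prob_size P (T n (space \<Phi>)) + prob_size P (\<lambda>\<omega>. cell_integral s (g n) (\<lambda>y. y) (space \<Phi>) \<omega> - I \<omega>)) \<longlonglongrightarrow> 0"
    by simp
  show ?thesis
  proof (rule tendsto_sandwich[OF _ _ tendsto_const lim0])
    show "\<forall>\<^sub>F n in sequentially. 0 \<le> prob_size P (\<lambda>\<omega>. cell_integral s (h n) f (space \<Phi>) \<omega> - I \<omega>)"
      by (simp add: prob_size_nonneg)
    show "\<forall>\<^sub>F n in sequentially. prob_size P (\<lambda>\<omega>. cell_integral s (h n) f (space \<Phi>) \<omega> - I \<omega>)
      \<le> prob_size P (T n (space \<Phi>)) + prob_size P (\<lambda>\<omega>. cell_integral s (g n) (\<lambda>y. y) (space \<Phi>) \<omega> - I \<omega>)"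
    proof (rule always_eventually, rule allI)
      fix n
      have "prob_size P (\<lambda>\<omega>. cell_integral s (h n) f (space \<Phi>) \<omega> - I \<omega>)
        \<le> prob_size P (\<lambda>\<omega>. cell_integral s (h n) f (space \<Phi>) \<omega> - cell_integral s (g n) (\<lambda>y. y) (space \<Phi>) \<omega>)
          + prob_size P (\<lambda>\<omega>. cell_integral s (g n) (\<lambda>y. y) (space \<Phi>) \<omega> - I \<omega>)"
        by (intro prob_size_diff_le) auto
      then show "prob_size P (\<lambda>\<omega>. cell_integral s (h n) f (space \<Phi>) \<omega> - I \<omega>)
        \<le> prob_size P (T n (space \<Phi>)) + prob_size P (\<lambda>\<omega>. cell_integral s (g n) (\<lambda>y. y) (space \<Phi>) \<omega> - I \<omega>)"
        unfolding T_def by (subst (asm) (2) prob_size_minus)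
    qed
  qed
qed

end

section \<open>The aggregated process\<close>

text \<open>Rounding towards 0, so that \<open>|trunc n x| <= |x|\<close>: the integrable function
  \<open>1 / (1 - |x|)\<close> then dominates the kernels of all discretizations.\<close>

definition trunc :: "nat \<Rightarrow> real \<Rightarrow> real" where
  "trunc n x = sgn x * of_int \<lfloor>real (Suc n) * \<bar>x\<bar>\<rfloor> / real (Suc n)"

lemma abs_trunc_le: "\<bar>trunc n x\<bar> \<le> \<bar>x\<bar>"
proof -
  have "\<bar>trunc n x\<bar> = \<bar>sgn x\<bar> * (of_int \<lfloor>real (Suc n) * \<bar>x\<bar>\<rfloor> / real (Suc n))"
    by (simp add: trunc_def abs_mult del: of_nat_Suc)
  also have "\<dots> \<le> 1 * ((real (Suc n) * \<bar>x\<bar>) / real (Suc n))"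
    by (intro mult_mono divide_right_mono of_int_floor_le) (auto simp: abs_sgn_eq)
  finally show ?thesis by (simp del: of_nat_Suc)
qed

lemma abs_trunc_diff_le: "\<bar>trunc n x - x\<bar> \<le> 1 / real (Suc n)"
proof -
  have "x = sgn x * (real (Suc n) * \<bar>x\<bar>) / real (Suc n)"
    by (simp add: sgn_mult_abs mult.left_commute del: of_nat_Suc)
  then have "trunc n x - x = sgn x * (of_int \<lfloor>real (Suc n) * \<bar>x\<bar>\<rfloor> - real (Suc n) * \<bar>x\<bar>) / real (Suc n)"
    unfolding trunc_def by (metis (no_types, lifting) diff_divide_distrib right_diff_distrib')
  also have "\<bar>\<dots>\<bar> = \<bar>sgn x\<bar> * \<bar>of_int \<lfloor>real (Suc n) * \<bar>x\<bar>\<rfloor> - real (Suc n) * \<bar>x\<bar>\<bar> / real (Suc n)"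
    by (simp add: abs_mult del: of_nat_Suc)
  also have "\<dots> \<le> 1 * 1 / real (Suc n)"
    by (intro divide_right_mono mult_mono) (auto simp: abs_sgn_eq, linarith)
  finally show ?thesis by simp
qed

lemma trunc_tendsto: "(\<lambda>n. trunc n x) \<longlonglongrightarrow> x"
proof (rule LIM_zero_cancel, rule Lim_null_comparison[OF always_eventually[OF allI]])
  show "norm (trunc n x - x) \<le> 1 / real (Suc n)" for n using abs_trunc_diff_le by simp
  show "(\<lambda>n. 1 / real (Suc n)) \<longlonglongrightarrow> 0" using LIMSEQ_Suc[OF lim_1_over_n] .
qed

lemma trunc_measurable[measurable]: "trunc n \<in> borel_measurable borel"
  unfolding trunc_def[abs_def] by measurable

locale aggregated_field = square_integrable_field +
  fixes X :: "int \<Rightarrow> 'a \<Rightarrow> real"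
  assumes agg: "aggregated_AR1 P \<Phi> M X"
    and space_Phi: "space \<Phi> = {-1<..<1}" and sets_Phi: "sets \<Phi> = sets (restrict_space borel {-1<..<1})"
    and no_atoms: "\<And>x. measure \<Phi> {x} = 0"
    and moment: "integrable \<Phi> (\<lambda>x. 1 / (1 - \<bar>x\<bar>))"
    and X_int4: "integrable P (\<lambda>\<omega>. X 0 \<omega> ^ 4)"
begin

lemma borel_measurable_Phi[measurable (raw)]: "f \<in> borel_measurable borel \<Longrightarrow> f \<in> borel_measurable \<Phi>"
  by (subst measurable_cong_sets[OF sets_Phi refl]) (rule measurable_restrict_space1)

lemma trunc_simple: "simple_function \<Phi> (trunc n)"
proof (rule simple_function_borel_measurable)
  show "trunc n \<in> borel_measurable \<Phi>" by measurable
  have "trunc n x \<in> (\<lambda>(s, k). s * of_int k / real (Suc n)) ` ({-1, 0, 1} \<times> {0..int (Suc n)})" if "x \<in> space \<Phi>" for x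
  proof (rule image_eqI)
    have "real (Suc n) * \<bar>x\<bar> \<le> real (Suc n) * 1"
      using that by (intro mult_left_mono) (auto simp: space_Phi)
    then have "\<lfloor>real (Suc n) * \<bar>x\<bar>\<rfloor> \<le> \<lfloor>real (Suc n)\<rfloor>" by (intro floor_mono) simp
    then have "\<lfloor>real (Suc n) * \<bar>x\<bar>\<rfloor> \<in> {0..int (Suc n)}" by (simp del: of_nat_Suc)
    then show "(sgn x, \<lfloor>real (Suc n) * \<bar>x\<bar>\<rfloor>) \<in> {-1, 0, 1} \<times> {0..int (Suc n)}"
      by (simp add: sgn_if del: of_nat_Suc)
  qed (simp add: trunc_def)
  then have "trunc n ` space \<Phi> \<subseteq> (\<lambda>(s, k). s * of_int k / real (Suc n)) ` ({-1, 0, 1} \<times> {0..int (Suc n)})" by blast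
  then show "finite (trunc n ` space \<Phi>)" by (rule finite_subset) auto
qed

definition approx_term :: "nat \<Rightarrow> int \<Rightarrow> int \<Rightarrow> 'a \<Rightarrow> real" where
  "approx_term n t s = cell_integral s (trunc n) (\<lambda>y. y ^ nat (t - s)) (space \<Phi>)"

text \<open>All times share the window \<open>{- int N..int N}\<close>, with the future masked, so
  that the values at different times are forms in the same noise variables.\<close>

definition approx :: "nat \<Rightarrow> nat \<Rightarrow> int \<Rightarrow> 'a \<Rightarrow> real" where
  "approx n N t \<omega> = (\<Sum>s\<in>{- int N..int N}. if s \<le> t then approx_term n t s \<omega> else 0)"

lemma approx_term_measurable[measurable]: "approx_term n t s \<in> borel_measurable P"
  unfolding approx_term_def by (rule cell_integral_measurable[OF trunc_simple sets.top])

lemma approx_measurable[measurable]: "approx n N t \<in> borel_measurable P"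
  unfolding approx_def[abs_def] by measurable

lemma X_measurable[measurable]: "X t \<in> borel_measurable P"
  using agg by (auto simp: aggregated_AR1_def conv_in_prob_def)

lemma approx_eq:
  assumes "int N \<ge> t"
  shows "approx n N t \<omega> = (\<Sum>s\<in>{- int N..t}. approx_term n t s \<omega>)"
  unfolding approx_def using assms by (intro sum.mono_neutral_cong_right) auto

text \<open>A diagonal argument: for each \<open>N\<close> the mesh is made so fine that all
  integrals with times in the window are accurate. A single \<open>\<nu>\<close> serves all
  \<open>t\<close>, because joint limits at several times are needed later.\<close>

lemma approximation:
  "\<exists>\<nu>. (\<forall>N. \<nu> N \<ge> N) \<and> (\<forall>t. (\<lambda>N. prob_size P (\<lambda>\<omega>. approx (\<nu> N) N t \<omega> - X t \<omega>)) \<longlonglongrightarrow> 0)"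
proof -
  obtain Y where Y: "\<And>t s. s \<le> t \<Longrightarrow> has_stoch_integral P \<Phi> (M s) (\<lambda>x. x ^ nat (t - s)) (Y t s)"
    and YX: "\<And>t. conv_in_prob P (\<lambda>N \<omega>. \<Sum>s\<in>{t - int N..t}. Y t s \<omega>) (X t)"
    using agg unfolding aggregated_AR1_def by blast
  have Y_meas: "Y t s \<in> borel_measurable P" if "s \<le> t" for t s
    using Y[OF that] by (auto simp: has_stoch_integral_def conv_in_prob_def)
  have approx_Y: "(\<lambda>n. prob_size P (\<lambda>\<omega>. approx_term n t s \<omega> - Y t s \<omega>)) \<longlonglongrightarrow> 0" if "s \<le> t" for t s
    unfolding approx_term_def
  proof (rule stoch_integral_approximation[OF Y[OF that] trunc_simple])
    show "AE x in \<Phi>. (\<lambda>n. trunc n x ^ nat (t - s)) \<longlonglongrightarrow> x ^ nat (t - s)"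
      by (intro AE_I2 tendsto_power trunc_tendsto)
    show "\<bar>trunc n x ^ nat (t - s)\<bar> \<le> 1" if "x \<in> space \<Phi>" for n x
    proof -
      have "\<bar>x\<bar> < 1" using that by (auto simp: space_Phi)
      then have "\<bar>trunc n x\<bar> \<le> 1" using abs_trunc_le[of n x] by linarith
      then show ?thesis by (simp add: power_abs power_le_one)
    qed
  qed
  \<comment> \<open>This tolerance beats the number of terms in the window, which is at most
    \<open>2 * Suc N\<close>.\<close>
  have "\<exists>n\<ge>N. \<forall>t\<in>{- int N..int N}. \<forall>s\<in>{- int N..t}.
      prob_size P (\<lambda>\<omega>. approx_term n t s \<omega> - Y t s \<omega>) < 1 / (real (Suc N))\<^sup>2" for N
  proof -
    have "\<forall>\<^sub>F n in sequentially. n \<ge> N \<and> (\<forall>t\<in>{- int N..int N}. \<forall>s\<in>{- int N..t}.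
      prob_size P (\<lambda>\<omega>. approx_term n t s \<omega> - Y t s \<omega>) < 1 / (real (Suc N))\<^sup>2)"
      by (intro eventually_conj eventually_ge_at_top eventually_ball_finite ballI order_tendstoD[OF approx_Y]) auto
    then show ?thesis by (auto simp: eventually_sequentially)
  qed
  then obtain \<nu> where \<nu>: "\<And>N. \<nu> N \<ge> N" and close: "\<And>N t s. t \<in> {- int N..int N} \<Longrightarrow> s \<in> {- int N..t} \<Longrightarrow>
      prob_size P (\<lambda>\<omega>. approx_term (\<nu> N) t s \<omega> - Y t s \<omega>) < 1 / (real (Suc N))\<^sup>2"
    by metis
  have "(\<lambda>N. prob_size P (\<lambda>\<omega>. approx (\<nu> N) N t \<omega> - X t \<omega>)) \<longlonglongrightarrow> 0" for t
  proof -
    define e where "e K = prob_size P (\<lambda>\<omega>. (\<Sum>s\<in>{t - int K..t}. Y t s \<omega>) - X t \<omega>)" for K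
    have e: "e \<longlonglongrightarrow> 0"
      using YX[of t] Y_meas unfolding e_def[abs_def]
      by (subst (asm) conv_in_prob_iff) (auto intro!: borel_measurable_sum)
    \<comment> \<open>With \<open>t + N\<close> lags the partial sum for \<open>X t\<close> starts
      exactly at the left end \<open>- N\<close> of the window.\<close>
    have "filterlim (\<lambda>N. nat (t + int N)) at_top sequentially"
      unfolding filterlim_at_top
    proof
      fix Z
      show "\<forall>\<^sub>F N in sequentially. Z \<le> nat (t + int N)"
        using eventually_ge_at_top[of "Z + nat \<bar>t\<bar>"] by eventually_elim linarith
    qed
    with e have "(\<lambda>N. e (nat (t + int N))) \<longlonglongrightarrow> 0" by (rule filterlim_compose)
    moreover have "(\<lambda>N. 2 * (1 / real (Suc N))) \<longlonglongrightarrow> 2 * 0"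
      by (intro tendsto_intros LIMSEQ_Suc[OF lim_1_over_n])
    ultimately have lim: "(\<lambda>N. 2 * (1 / real (Suc N)) + e (nat (t + int N))) \<longlonglongrightarrow> 0"
      using tendsto_add by fastforce
    have "\<forall>\<^sub>F N in sequentially. prob_size P (\<lambda>\<omega>. approx (\<nu> N) N t \<omega> - X t \<omega>) \<le> 2 * (1 / real (Suc N)) + e (nat (t + int N))"
      using eventually_ge_at_top[of "nat \<bar>t\<bar>"]
    proof eventually_elim
      case (elim N)
      then have t: "t \<in> {- int N..int N}" by auto
      then have tN: "t - int (nat (t + int N)) = - int N" by auto
      have Ym: "Y t s \<in> borel_measurable P" if "s \<in> {- int N..t}" for s using Y_meas that by auto
      have "prob_size P (\<lambda>\<omega>. approx (\<nu> N) N t \<omega> - X t \<omega>)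
        \<le> prob_size P (\<lambda>\<omega>. approx (\<nu> N) N t \<omega> - (\<Sum>s\<in>{- int N..t}. Y t s \<omega>))
          + prob_size P (\<lambda>\<omega>. (\<Sum>s\<in>{- int N..t}. Y t s \<omega>) - X t \<omega>)"
        using Ym by (intro prob_size_diff_le borel_measurable_sum) auto
      also have "prob_size P (\<lambda>\<omega>. (\<Sum>s\<in>{- int N..t}. Y t s \<omega>) - X t \<omega>) = e (nat (t + int N))"
        unfolding e_def tN ..
      also have "(\<lambda>\<omega>. approx (\<nu> N) N t \<omega> - (\<Sum>s\<in>{- int N..t}. Y t s \<omega>))
          = (\<lambda>\<omega>. \<Sum>s\<in>{- int N..t}. approx_term (\<nu> N) t s \<omega> - Y t s \<omega>)"
        using t by (auto simp: approx_eq sum_subtractf)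
      also have "prob_size P \<dots> \<le> (\<Sum>s\<in>{- int N..t}. prob_size P (\<lambda>\<omega>. approx_term (\<nu> N) t s \<omega> - Y t s \<omega>))"
        using Ym by (intro prob_size_sum_le) auto
      also have "\<dots> \<le> real (card {- int N..t}) * (1 / (real (Suc N))\<^sup>2)"
        using close[OF t] by (intro sum_bounded_above) (auto intro: less_imp_le)
      also have "\<dots> \<le> (2 * real (Suc N)) * (1 / (real (Suc N))\<^sup>2)"
        using t by (intro mult_right_mono) auto
      also have "\<dots> = 2 * (1 / real (Suc N))" by (simp add: power2_eq_square field_simps del: of_nat_Suc)
      finally show ?case by simp
    qed
    then show ?thesis
      by (intro tendsto_sandwich[OF _ _ tendsto_const lim]) (auto simp: prob_size_nonneg)
  qed
  then show ?thesis using \<nu> by blast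
qed

text \<open>At lag 0 the integrand is 1, so \<open>M 0 (space \<Phi>)\<close> is a summand of
  \<open>X 0\<close>. The rest is a limit of variables \<open>R N\<close> built from the earlier
  \<open>M s\<close>, each of which is independent of that summand.\<close>

lemma field_int4: "integrable P (\<lambda>\<omega>. M 0 (space \<Phi>) \<omega> ^ 4)"
proof -
  obtain \<nu> where lim: "(\<lambda>N. prob_size P (\<lambda>\<omega>. approx (\<nu> N) N 0 \<omega> - X 0 \<omega>)) \<longlonglongrightarrow> 0"
    using approximation by blast
  define R where "R N \<omega> = (\<Sum>s\<in>{- int N..-1}. approx_term (\<nu> N) 0 s \<omega>)" for N \<omega>
  have [measurable]: "R N \<in> borel_measurable P" for N unfolding R_def[abs_def] by measurable
  note [measurable] = field_measurable[OF sets.top]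
  have ae: "AE \<omega> in P. approx (\<nu> N) N 0 \<omega> = R N \<omega> + M 0 (space \<Phi>) \<omega>" for N
  proof -
    let ?h = "trunc (\<nu> N)"
    have "AE \<omega> in P. M 0 (\<Union>y\<in>?h ` space \<Phi>. space \<Phi> \<inter> cell ?h y) \<omega> = (\<Sum>y\<in>?h ` space \<Phi>. M 0 (space \<Phi> \<inter> cell ?h y) \<omega>)"
      using simple_functionD(1)[OF trunc_simple] cell_sets[OF trunc_simple]
      by (intro field_UN) (auto simp: disjoint_family_on_def cell_def)
    moreover have "(\<Union>y\<in>?h ` space \<Phi>. space \<Phi> \<inter> cell ?h y) = space \<Phi>" by (auto simp: cell_def)
    ultimately have "AE \<omega> in P. M 0 (space \<Phi>) \<omega> = (\<Sum>y\<in>?h ` space \<Phi>. M 0 (space \<Phi> \<inter> cell ?h y) \<omega>)"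
      by simp
    then have "AE \<omega> in P. approx_term (\<nu> N) 0 0 \<omega> = M 0 (space \<Phi>) \<omega>"
      by eventually_elim (simp add: approx_term_def cell_integral_def)
    then show ?thesis
    proof eventually_elim
      case (elim \<omega>)
      have "{- int N..0} = insert 0 {- int N..-1}" by auto
      then show ?case using elim by (simp add: approx_eq R_def)
    qed
  qed
  show ?thesis
  proof (rule even_moment_indep_summand)
    show "(\<lambda>k. prob_size P (\<lambda>\<omega>. R k \<omega> - (X 0 \<omega> - M 0 (space \<Phi>) \<omega>))) \<longlonglongrightarrow> 0"
    proof (rule Lim_transform_eventually[OF lim], rule always_eventually, rule allI)
      fix N show "prob_size P (\<lambda>\<omega>. approx (\<nu> N) N 0 \<omega> - X 0 \<omega>) = prob_size P (\<lambda>\<omega>. R N \<omega> - (X 0 \<omega> - M 0 (space \<Phi>) \<omega>))"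
        by (rule prob_size_cong_AE) (use ae[of N] in \<open>auto elim: eventually_mono\<close>)
    qed
    show "indep_var borel (M 0 (space \<Phi>)) borel (R N)" for N
    proof -
      let ?T = "PiM (sets \<Phi>) (\<lambda>_. borel :: real measure)"
      let ?K = "{- int N..-1}"
      let ?h = "trunc (\<nu> N)"
      have "indep_vars (\<lambda>_. ?T) (\<lambda>s \<omega>. \<lambda>A\<in>sets \<Phi>. M s A \<omega>) UNIV"
        using field by (simp add: iid_id_random_measures_def)
      then have "indep_var (PiM {0} (\<lambda>_. ?T)) (\<lambda>\<omega>. \<lambda>s\<in>{0}. \<lambda>A\<in>sets \<Phi>. M s A \<omega>)
          (PiM ?K (\<lambda>_. ?T)) (\<lambda>\<omega>. \<lambda>s\<in>?K. \<lambda>A\<in>sets \<Phi>. M s A \<omega>)"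
        by (rule indep_var_restrict) auto
      then have "indep_var borel ((\<lambda>w. w 0 (space \<Phi>)) \<circ> (\<lambda>\<omega>. \<lambda>s\<in>{0}. \<lambda>A\<in>sets \<Phi>. M s A \<omega>))
        borel ((\<lambda>w. \<Sum>s\<in>?K. \<Sum>y\<in>?h ` space \<Phi>. y ^ nat (0 - s) * w s (space \<Phi> \<inter> cell ?h y)) \<circ> (\<lambda>\<omega>. \<lambda>s\<in>?K. \<lambda>A\<in>sets \<Phi>. M s A \<omega>))"
      proof (rule indep_var_compose)
        have m: "(\<lambda>w. w s A) \<in> borel_measurable (PiM K (\<lambda>_. ?T))" if "s \<in> K" "A \<in> sets \<Phi>" for s :: int and A K
          using measurable_compose[OF measurable_component_singleton[OF that(1)] measurable_component_singleton[OF that(2)]] .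
        show "(\<lambda>w. w 0 (space \<Phi>)) \<in> borel_measurable (PiM {0 :: int} (\<lambda>_. ?T))" by (rule m) auto
        show "(\<lambda>w. \<Sum>s\<in>?K. \<Sum>y\<in>?h ` space \<Phi>. y ^ nat (0 - s) * w s (space \<Phi> \<inter> cell ?h y)) \<in> borel_measurable (PiM ?K (\<lambda>_. ?T))"
          by (intro borel_measurable_sum borel_measurable_times borel_measurable_const m sets.Int sets.top cell_sets trunc_simple)
      qed
      also have "(\<lambda>w. w 0 (space \<Phi>)) \<circ> (\<lambda>\<omega>. \<lambda>s\<in>{0}. \<lambda>A\<in>sets \<Phi>. M s A \<omega>) = M 0 (space \<Phi>)" by auto
      also have "(\<lambda>w. \<Sum>s\<in>?K. \<Sum>y\<in>?h ` space \<Phi>. y ^ nat (0 - s) * w s (space \<Phi> \<inter> cell ?h y)) \<circ> (\<lambda>\<omega>. \<lambda>s\<in>?K. \<lambda>A\<in>sets \<Phi>. M s A \<omega>) = R N"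
        using cell_sets[OF trunc_simple]
        by (intro ext) (auto simp: R_def approx_term_def cell_integral_def intro!: sum.cong)
      finally show ?thesis .
    qed
  qed (use X_int4 in auto)
qed

end

section \<open>Moment bounds for the sample covariances\<close>

context prob_space
begin

text \<open>Centring removes one of the three pairings. In each remaining pairing one covariance is
  bounded uniformly, and the sum over \<open>t'\<close> of the other is controlled by summing
  \<open>|d t' i|\<close> over the times first; the cumulant term is treated in the same way. Row
  sums are thus bounded independently of \<open>card T\<close>, which makes the variance linear in
  the number of times. This is why \<open>d\<close> is bounded both over the indices and over the
  times, whereas \<open>x\<close> needs a bound over the indices only.\<close>

lemma indep_quadratic_form_variance_le:
  fixes x d :: "'t \<Rightarrow> 'i \<Rightarrow> real" and p :: "'i \<Rightarrow> real"
  assumes I: "finite I" and indep: "indep_vars (\<lambda>_. borel) \<xi> I"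
    and int4: "\<And>i. i \<in> I \<Longrightarrow> integrable M (\<lambda>\<omega>. \<xi> i \<omega> ^ 4 :: real)"
    and cent: "\<And>i. i \<in> I \<Longrightarrow> expectation (\<xi> i) = 0"
  defines "v \<equiv> \<lambda>i. expectation (\<lambda>\<omega>. (\<xi> i \<omega>)\<^sup>2)"
  defines "\<kappa> \<equiv> \<lambda>i. expectation (\<lambda>\<omega>. \<xi> i \<omega> ^ 4) - 3 * (v i)\<^sup>2"
  defines "L \<equiv> \<lambda>a \<omega>. \<Sum>i\<in>I. a i * \<xi> i \<omega>"
  assumes p: "\<And>i. i \<in> I \<Longrightarrow> 0 \<le> p i" and cv: "0 \<le> cv" and ck: "0 \<le> ck" and BD: "0 \<le> B" "0 \<le> D"
    and v: "\<And>i. i \<in> I \<Longrightarrow> v i \<le> cv * p i" and \<kappa>: "\<And>i. i \<in> I \<Longrightarrow> \<bar>\<kappa> i\<bar> \<le> ck * p i"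
    and T: "finite T"
    and x1: "\<And>t i. t \<in> T \<Longrightarrow> i \<in> I \<Longrightarrow> \<bar>x t i\<bar> \<le> 1"
    and xB: "\<And>t. t \<in> T \<Longrightarrow> (\<Sum>i\<in>I. \<bar>x t i\<bar> * p i) \<le> B"
    and dD: "\<And>t. t \<in> T \<Longrightarrow> (\<Sum>i\<in>I. \<bar>d t i\<bar> * p i) \<le> D"
    and dD': "\<And>i. i \<in> I \<Longrightarrow> (\<Sum>t\<in>T. \<bar>d t i\<bar>) \<le> D"
  shows "integrable M (\<lambda>\<omega>. (\<Sum>t\<in>T. L (x t) \<omega> * L (d t) \<omega> - (\<Sum>i\<in>I. x t i * d t i * v i))\<^sup>2)" (is ?int)
    and "expectation (\<lambda>\<omega>. (\<Sum>t\<in>T. L (x t) \<omega> * L (d t) \<omega> - (\<Sum>i\<in>I. x t i * d t i * v i))\<^sup>2)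
      \<le> real (card T) * (D\<^sup>2 * (2 * cv\<^sup>2 * B + ck))" (is ?le)
proof -
  have rv: "\<xi> r \<in> borel_measurable M" if "r \<in> I" for r
    using indep that unfolding indep_vars_def by auto
  have int2: "integrable M (\<lambda>\<omega>. (\<xi> r \<omega>)\<^sup>2)" if "r \<in> I" for r
    using integrable_power_le[OF rv[OF that] int4[OF that], of 2] by simp
  have four: "integrable M (\<lambda>\<omega>. L a \<omega> * L b \<omega> * L c \<omega> * L e \<omega>)"
    "expectation (\<lambda>\<omega>. L a \<omega> * L b \<omega> * L c \<omega> * L e \<omega>) =
      (\<Sum>i\<in>I. a i * b i * v i) * (\<Sum>i\<in>I. c i * e i * v i)
   + (\<Sum>i\<in>I. a i * c i * v i) * (\<Sum>i\<in>I. b i * e i * v i)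
   + (\<Sum>i\<in>I. a i * e i * v i) * (\<Sum>i\<in>I. b i * c i * v i)
   + (\<Sum>i\<in>I. a i * b i * c i * e i * \<kappa> i)" for a b c e
    unfolding L_def \<kappa>_def v_def by (rule indep_linear_forms_four_product[OF I indep int4 cent]; assumption)+
  have two: "integrable M (\<lambda>\<omega>. L a \<omega> * L b \<omega>)" "expectation (\<lambda>\<omega>. L a \<omega> * L b \<omega>) = (\<Sum>i\<in>I. a i * b i * v i)" for a b
    using indep_linear_forms_two_product[OF I indep int2 cent] by (auto simp: L_def v_def)
  define Cv where "Cv a b = (\<Sum>i\<in>I. a i * b i * v i)" for a b
  define Ck where "Ck t t' = (\<Sum>i\<in>I. x t i * d t i * x t' i * d t' i * \<kappa> i)" for t t'
  have v0: "0 \<le> v i" for i by (simp add: v_def)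
  define Z where "Z t \<omega> = L (x t) \<omega> * L (d t) \<omega> - Cv (x t) (d t)" for t \<omega>
  have ZZ: "Z t \<omega> * Z t' \<omega> = L (x t) \<omega> * L (d t) \<omega> * L (x t') \<omega> * L (d t') \<omega>
      - Cv (x t') (d t') * (L (x t) \<omega> * L (d t) \<omega>) - Cv (x t) (d t) * (L (x t') \<omega> * L (d t') \<omega>)
      + Cv (x t) (d t) * Cv (x t') (d t')" for t t' \<omega>
    unfolding Z_def by (simp add: algebra_simps)
  have intZ: "integrable M (\<lambda>\<omega>. Z t \<omega> * Z t' \<omega>)" for t t'
    unfolding ZZ by (intro Bochner_Integration.integrable_add Bochner_Integration.integrable_diff
        integrable_mult_right four two integrable_const)
  have EZ: "expectation (\<lambda>\<omega>. Z t \<omega> * Z t' \<omega>)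
      = Cv (x t) (x t') * Cv (d t) (d t') + Cv (x t) (d t') * Cv (d t) (x t') + Ck t t'" for t t'
  proof -
    have "expectation (\<lambda>\<omega>. Z t \<omega> * Z t' \<omega>)
      = expectation (\<lambda>\<omega>. L (x t) \<omega> * L (d t) \<omega> * L (x t') \<omega> * L (d t') \<omega>) - Cv (x t) (d t) * Cv (x t') (d t')"
      unfolding ZZ using four(1)[of "x t" "d t" "x t'" "d t'"] two
      by (simp add: prob_space Cv_def)
    then show ?thesis unfolding four(2) by (simp add: Cv_def Ck_def)
  qed
  have sq: "(\<Sum>t\<in>T. L (x t) \<omega> * L (d t) \<omega> - (\<Sum>i\<in>I. x t i * d t i * v i))\<^sup>2
      = (\<Sum>t\<in>T. \<Sum>t'\<in>T. Z t \<omega> * Z t' \<omega>)" for \<omega>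
    by (simp add: power2_eq_square sum_product Z_def Cv_def)
  show ?int unfolding sq by (intro Bochner_Integration.integrable_sum intZ)
  have E: "expectation (\<lambda>\<omega>. (\<Sum>t\<in>T. L (x t) \<omega> * L (d t) \<omega> - (\<Sum>i\<in>I. x t i * d t i * v i))\<^sup>2)
      = (\<Sum>t\<in>T. \<Sum>t'\<in>T. expectation (\<lambda>\<omega>. Z t \<omega> * Z t' \<omega>))"
    unfolding sq using intZ by simp
  have Cv_le: "\<bar>Cv a b\<bar> \<le> (\<Sum>i\<in>I. \<bar>a i\<bar> * \<bar>b i\<bar> * (cv * p i))" for a b
  proof -
    have "\<bar>Cv a b\<bar> \<le> (\<Sum>i\<in>I. \<bar>a i * b i * v i\<bar>)" unfolding Cv_def by (rule sum_abs)
    also have "\<dots> \<le> (\<Sum>i\<in>I. \<bar>a i\<bar> * \<bar>b i\<bar> * (cv * p i))"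
      using v v0 by (intro sum_mono) (auto simp: abs_mult intro!: mult_left_mono)
    finally show ?thesis .
  qed
  have Cv_sum: "(\<Sum>t'\<in>T. \<bar>Cv a (d t')\<bar>) \<le> cv * D * (\<Sum>i\<in>I. \<bar>a i\<bar> * p i)" for a
  proof -
    have "(\<Sum>t'\<in>T. \<bar>Cv a (d t')\<bar>) \<le> (\<Sum>t'\<in>T. \<Sum>i\<in>I. \<bar>a i\<bar> * \<bar>d t' i\<bar> * (cv * p i))"
      by (intro sum_mono Cv_le)
    also have "\<dots> = (\<Sum>i\<in>I. (\<Sum>t'\<in>T. \<bar>d t' i\<bar>) * (\<bar>a i\<bar> * (cv * p i)))"
      by (subst sum.swap) (simp add: sum_distrib_left sum_distrib_right mult_ac)
    also have "\<dots> \<le> (\<Sum>i\<in>I. D * (\<bar>a i\<bar> * (cv * p i)))"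
      using dD' p cv by (intro sum_mono mult_right_mono) auto
    finally show ?thesis by (simp add: sum_distrib_left mult_ac)
  qed
  have row: "(\<Sum>t'\<in>T. expectation (\<lambda>\<omega>. Z t \<omega> * Z t' \<omega>)) \<le> D\<^sup>2 * (2 * cv\<^sup>2 * B + ck)" if t: "t \<in> T" for t
  proof -
    have xx: "\<bar>Cv (x t) (x t')\<bar> \<le> cv * B" if t': "t' \<in> T" for t'
    proof -
      have "\<bar>Cv (x t) (x t')\<bar> \<le> (\<Sum>i\<in>I. \<bar>x t i\<bar> * \<bar>x t' i\<bar> * (cv * p i))" by (rule Cv_le)
      also have "\<dots> \<le> (\<Sum>i\<in>I. \<bar>x t i\<bar> * 1 * (cv * p i))"
        using x1[OF t'] p cv by (intro sum_mono mult_right_mono mult_left_mono) auto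
      also have "\<dots> = cv * (\<Sum>i\<in>I. \<bar>x t i\<bar> * p i)" by (simp add: sum_distrib_left mult_ac)
      also have "\<dots> \<le> cv * B" using xB[OF t] cv by (intro mult_left_mono)
      finally show ?thesis .
    qed
    have dx: "\<bar>Cv (d t) (x t')\<bar> \<le> cv * D" if t': "t' \<in> T" for t'
    proof -
      have "\<bar>Cv (d t) (x t')\<bar> \<le> (\<Sum>i\<in>I. \<bar>d t i\<bar> * \<bar>x t' i\<bar> * (cv * p i))" by (rule Cv_le)
      also have "\<dots> \<le> (\<Sum>i\<in>I. \<bar>d t i\<bar> * 1 * (cv * p i))"
        using x1[OF t'] p cv by (intro sum_mono mult_right_mono mult_left_mono) auto
      also have "\<dots> = cv * (\<Sum>i\<in>I. \<bar>d t i\<bar> * p i)" by (simp add: sum_distrib_left mult_ac)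
      also have "\<dots> \<le> cv * D" using dD[OF t] cv by (intro mult_left_mono)
      finally show ?thesis .
    qed
    have 1: "(\<Sum>t'\<in>T. Cv (x t) (x t') * Cv (d t) (d t')) \<le> (cv * B) * (cv * D * D)"
    proof -
      have "(\<Sum>t'\<in>T. Cv (x t) (x t') * Cv (d t) (d t')) \<le> (\<Sum>t'\<in>T. (cv * B) * \<bar>Cv (d t) (d t')\<bar>)"
      proof (rule sum_mono)
        fix t' assume "t' \<in> T"
        then have "\<bar>Cv (x t) (x t') * Cv (d t) (d t')\<bar> \<le> (cv * B) * \<bar>Cv (d t) (d t')\<bar>"
          unfolding abs_mult by (intro mult_right_mono xx) auto
        then show "Cv (x t) (x t') * Cv (d t) (d t') \<le> (cv * B) * \<bar>Cv (d t) (d t')\<bar>" by linarith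
      qed
      also have "\<dots> = (cv * B) * (\<Sum>t'\<in>T. \<bar>Cv (d t) (d t')\<bar>)" by (simp add: sum_distrib_left)
      also have "\<dots> \<le> (cv * B) * (cv * D * (\<Sum>i\<in>I. \<bar>d t i\<bar> * p i))"
        using cv BD by (intro mult_left_mono Cv_sum) auto
      also have "\<dots> \<le> (cv * B) * (cv * D * D)" using cv BD dD[OF t] by (intro mult_left_mono) auto
      finally show ?thesis .
    qed
    have 2: "(\<Sum>t'\<in>T. Cv (x t) (d t') * Cv (d t) (x t')) \<le> (cv * D) * (cv * D * B)"
    proof -
      have "(\<Sum>t'\<in>T. Cv (x t) (d t') * Cv (d t) (x t')) \<le> (\<Sum>t'\<in>T. (cv * D) * \<bar>Cv (x t) (d t')\<bar>)"
      proof (rule sum_mono)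
        fix t' assume "t' \<in> T"
        then have "\<bar>Cv (d t) (x t') * Cv (x t) (d t')\<bar> \<le> (cv * D) * \<bar>Cv (x t) (d t')\<bar>"
          unfolding abs_mult by (intro mult_right_mono dx) auto
        then show "Cv (x t) (d t') * Cv (d t) (x t') \<le> (cv * D) * \<bar>Cv (x t) (d t')\<bar>"
          unfolding mult.commute[of "Cv (x t) (d t')"] by linarith
      qed
      also have "\<dots> = (cv * D) * (\<Sum>t'\<in>T. \<bar>Cv (x t) (d t')\<bar>)" by (simp add: sum_distrib_left)
      also have "\<dots> \<le> (cv * D) * (cv * D * (\<Sum>i\<in>I. \<bar>x t i\<bar> * p i))"
        using cv BD by (intro mult_left_mono Cv_sum) auto
      also have "\<dots> \<le> (cv * D) * (cv * D * B)" using cv BD xB[OF t] by (intro mult_left_mono) auto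
      finally show ?thesis .
    qed
    have 3: "(\<Sum>t'\<in>T. Ck t t') \<le> D * (ck * D)"
    proof -
      have "(\<Sum>t'\<in>T. Ck t t') \<le> (\<Sum>t'\<in>T. \<Sum>i\<in>I. \<bar>d t' i\<bar> * (\<bar>d t i\<bar> * (ck * p i)))"
        unfolding Ck_def
      proof (intro sum_mono)
        fix t' i assume t': "t' \<in> T" and i: "i \<in> I"
        have "\<bar>x t i * d t i * x t' i * d t' i * \<kappa> i\<bar> = \<bar>x t i\<bar> * \<bar>x t' i\<bar> * (\<bar>d t' i\<bar> * (\<bar>d t i\<bar> * \<bar>\<kappa> i\<bar>))"
          by (simp add: abs_mult mult_ac)
        also have "\<dots> \<le> 1 * 1 * (\<bar>d t' i\<bar> * (\<bar>d t i\<bar> * (ck * p i)))"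
          using x1[OF t i] x1[OF t' i] \<kappa>[OF i] by (intro mult_mono mult_left_mono) auto
        finally show "x t i * d t i * x t' i * d t' i * \<kappa> i \<le> \<bar>d t' i\<bar> * (\<bar>d t i\<bar> * (ck * p i))" by simp
      qed
      also have "\<dots> = (\<Sum>i\<in>I. (\<Sum>t'\<in>T. \<bar>d t' i\<bar>) * (\<bar>d t i\<bar> * (ck * p i)))"
        by (subst sum.swap) (simp add: sum_distrib_right)
      also have "\<dots> \<le> (\<Sum>i\<in>I. D * (\<bar>d t i\<bar> * (ck * p i)))"
        using dD' p ck by (intro sum_mono mult_right_mono) auto
      also have "\<dots> = D * (ck * (\<Sum>i\<in>I. \<bar>d t i\<bar> * p i))" by (simp add: sum_distrib_left mult_ac)
      also have "\<dots> \<le> D * (ck * D)" using dD[OF t] ck BD by (intro mult_left_mono) auto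
      finally show ?thesis .
    qed
    have "(\<Sum>t'\<in>T. expectation (\<lambda>\<omega>. Z t \<omega> * Z t' \<omega>)) \<le> (cv * B) * (cv * D * D) + (cv * D) * (cv * D * B) + D * (ck * D)"
      unfolding EZ sum.distrib using 1 2 3 by linarith
    then show ?thesis by (simp add: power2_eq_square algebra_simps)
  qed
  show ?le unfolding E
    using sum_bounded_above[of T "\<lambda>t. \<Sum>t'\<in>T. expectation (\<lambda>\<omega>. Z t \<omega> * Z t' \<omega>)", OF row] by simp
qed

text \<open>Since \<open>|x i| <= 1\<close>, higher powers of the coefficients may be replaced by
  the first, so the single bound \<open>B\<close> controls the pairings and the cumulant
  term.\<close>

lemma indep_linear_form_fourth_moment_le:
  fixes x p :: "'i \<Rightarrow> real"
  assumes I: "finite I" and indep: "indep_vars (\<lambda>_. borel) \<xi> I"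
    and int4: "\<And>i. i \<in> I \<Longrightarrow> integrable M (\<lambda>\<omega>. \<xi> i \<omega> ^ 4 :: real)"
    and cent: "\<And>i. i \<in> I \<Longrightarrow> expectation (\<xi> i) = 0"
  defines "v \<equiv> \<lambda>i. expectation (\<lambda>\<omega>. (\<xi> i \<omega>)\<^sup>2)"
  defines "\<kappa> \<equiv> \<lambda>i. expectation (\<lambda>\<omega>. \<xi> i \<omega> ^ 4) - 3 * (v i)\<^sup>2"
  assumes p: "\<And>i. i \<in> I \<Longrightarrow> 0 \<le> p i" and cv: "0 \<le> cv" and ck: "0 \<le> ck"
    and v: "\<And>i. i \<in> I \<Longrightarrow> v i \<le> cv * p i" and \<kappa>: "\<And>i. i \<in> I \<Longrightarrow> \<bar>\<kappa> i\<bar> \<le> ck * p i"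
    and x1: "\<And>i. i \<in> I \<Longrightarrow> \<bar>x i\<bar> \<le> 1"
    and xB: "(\<Sum>i\<in>I. \<bar>x i\<bar> * p i) \<le> B"
  shows "integrable M (\<lambda>\<omega>. (\<Sum>i\<in>I. x i * \<xi> i \<omega>) ^ 4)" (is ?int)
    and "expectation (\<lambda>\<omega>. (\<Sum>i\<in>I. x i * \<xi> i \<omega>) ^ 4) \<le> 3 * (cv * B)\<^sup>2 + ck * B" (is ?le)
proof -
  note four = indep_linear_forms_four_product[OF I indep int4 cent, where a=x and b=x and c=x and d=x]
  have p4': "(\<Sum>i\<in>I. x i * \<xi> i \<omega>) ^ 4 = (\<Sum>i\<in>I. x i * \<xi> i \<omega>) * (\<Sum>i\<in>I. x i * \<xi> i \<omega>)
      * (\<Sum>i\<in>I. x i * \<xi> i \<omega>) * (\<Sum>i\<in>I. x i * \<xi> i \<omega>)" for \<omega>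
    by (simp add: numeral_eq_Suc)
  show ?int using four(1) by (simp only: p4')
  have v0: "0 \<le> v i" for i by (simp add: v_def)
  have xx: "x i * x i \<le> \<bar>x i\<bar>" if "i \<in> I" for i
    using mult_left_mono[OF x1[OF that], of "\<bar>x i\<bar>"] by simp
  have 1: "(\<Sum>i\<in>I. x i * x i * v i) \<le> cv * B"
  proof -
    have "(\<Sum>i\<in>I. x i * x i * v i) \<le> (\<Sum>i\<in>I. \<bar>x i\<bar> * (cv * p i))"
    proof (rule sum_mono)
      fix i assume i: "i \<in> I"
      show "x i * x i * v i \<le> \<bar>x i\<bar> * (cv * p i)" by (rule mult_mono[OF xx[OF i] v[OF i] _ v0]) simp
    qed
    also have "\<dots> = cv * (\<Sum>i\<in>I. \<bar>x i\<bar> * p i)" by (simp add: sum_distrib_left mult_ac)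
    also have "\<dots> \<le> cv * B" using xB cv by (intro mult_left_mono)
    finally show ?thesis .
  qed
  have 0: "0 \<le> (\<Sum>i\<in>I. x i * x i * v i)"
    by (intro sum_nonneg) (rule mult_nonneg_nonneg[OF zero_le_square v0])
  have 2: "(\<Sum>i\<in>I. x i * x i * x i * x i * \<kappa> i) \<le> ck * B"
  proof -
    have "(\<Sum>i\<in>I. x i * x i * x i * x i * \<kappa> i) \<le> (\<Sum>i\<in>I. \<bar>x i\<bar> * (ck * p i))"
    proof (intro sum_mono)
      fix i assume i: "i \<in> I"
      have "\<bar>x i * x i * x i * x i * \<kappa> i\<bar> = \<bar>x i\<bar> * \<bar>x i\<bar> * \<bar>x i\<bar> * (\<bar>x i\<bar> * \<bar>\<kappa> i\<bar>)" by (simp add: abs_mult mult_ac)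
      also have "\<dots> \<le> 1 * 1 * 1 * (\<bar>x i\<bar> * (ck * p i))"
        using x1[OF i] \<kappa>[OF i] by (intro mult_mono mult_left_mono) auto
      finally show "x i * x i * x i * x i * \<kappa> i \<le> \<bar>x i\<bar> * (ck * p i)" by simp
    qed
    also have "\<dots> = ck * (\<Sum>i\<in>I. \<bar>x i\<bar> * p i)" by (simp add: sum_distrib_left mult_ac)
    also have "\<dots> \<le> ck * B" using xB ck by (intro mult_left_mono)
    finally show ?thesis .
  qed
  have "expectation (\<lambda>\<omega>. (\<Sum>i\<in>I. x i * \<xi> i \<omega>) ^ 4)
      = 3 * (\<Sum>i\<in>I. x i * x i * v i)\<^sup>2 + (\<Sum>i\<in>I. x i * x i * x i * x i * \<kappa> i)"
  proof -
    have "c * c + c * c + c * c + k = 3 * c\<^sup>2 + k" for c k :: real by (simp add: power2_eq_square)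
    then show ?thesis unfolding \<kappa>_def v_def using four(2) by (simp only: p4')
  qed
  also have "\<dots> \<le> 3 * (cv * B)\<^sup>2 + ck * B"
    using 0 1 2 by (intro add_mono mult_left_mono power_mono) auto
  finally show ?le .
qed

end

lemma kernel_sum_le:
  fixes y :: real and F :: "int set"
  assumes y: "\<bar>y\<bar> < 1" and F: "finite F"
  shows "(\<Sum>l\<in>F. \<bar>if 0 \<le> l then y ^ nat l else 0\<bar>) \<le> 1 / (1 - \<bar>y\<bar>)"
proof -
  have "(\<Sum>l\<in>F. \<bar>if 0 \<le> l then y ^ nat l else 0\<bar>) = (\<Sum>l\<in>{l\<in>F. 0 \<le> l}. \<bar>y\<bar> ^ nat l)"
    using F by (intro sum.mono_neutral_cong_right) (auto simp: power_abs)
  also have "\<dots> = (\<Sum>k\<in>nat ` {l\<in>F. 0 \<le> l}. \<bar>y\<bar> ^ k)"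
    by (subst sum.reindex) (auto simp: inj_on_def)
  also have "\<dots> \<le> (\<Sum>k. \<bar>y\<bar> ^ k)"
    using F y by (intro sum_le_suminf summable_geometric) auto
  also have "\<dots> = 1 / (1 - \<bar>y\<bar>)" using y by (simp add: suminf_geometric)
  finally show ?thesis .
qed

text \<open>The factor \<open>1 - y\<^sup>2\<close> of \<open>y\<^sup>l - y\<^bsup>l+2\<^esup>\<close> cancels the singularity of \<open>1 / (1 - \<bar>y\<bar>)\<close>.\<close>

lemma kernel_difference_sum_le:
  fixes y :: real and F :: "int set"
  assumes y: "\<bar>y\<bar> < 1" and F: "finite F"
  defines "k \<equiv> \<lambda>l. if 0 \<le> l then y ^ nat l else 0"
  shows "(\<Sum>l\<in>F. \<bar>k l - k (l + 2)\<bar>) \<le> 4"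
proof -
  have y2: "y\<^sup>2 \<le> 1" using y by (simp add: abs_square_le_1)
  \<comment> \<open>At the lags -1 and -2 only the shifted kernel is present and contributes at most
    1 each. Together with \<open>(1 - y^2) / (1 - |y|) = 1 + |y| <= 2\<close> this gives the
    constant 4.\<close>
  have le: "\<bar>k l - k (l + 2)\<bar> \<le> (1 - y\<^sup>2) * \<bar>k l\<bar> + (if l \<in> {-1, -2} then 1 else 0)" for l
  proof -
    consider "0 \<le> l" | "l = -1" | "l = -2" | "l < -2" by linarith
    then show ?thesis
    proof cases
      case 1
      then have "k l - k (l + 2) = (1 - y\<^sup>2) * k l"
        by (simp add: k_def nat_add_distrib power_add power2_eq_square algebra_simps)
      then show ?thesis using 1 y2 by (simp add: abs_mult)
    qed (use y in \<open>auto simp: k_def\<close>)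
  qed
  have "(\<Sum>l\<in>F. \<bar>k l - k (l + 2)\<bar>) \<le> (1 - y\<^sup>2) * (\<Sum>l\<in>F. \<bar>k l\<bar>) + (\<Sum>l\<in>F. if l \<in> {-1, -2} then 1 else 0)"
    unfolding sum_distrib_left sum.distrib[symmetric] by (intro sum_mono le)
  also have "(\<Sum>l\<in>F. if l \<in> {-1, -2} then 1 else 0) = real (card (F \<inter> {-1, -2}))"
    by (subst sum.inter_restrict[OF F, symmetric]) simp
  also have "\<dots> \<le> 2" using card_mono[of "{-1, -2 :: int}" "F \<inter> {-1, -2}"] by simp
  also have "(1 - y\<^sup>2) * (\<Sum>l\<in>F. \<bar>k l\<bar>) \<le> (1 - y\<^sup>2) * (1 / (1 - \<bar>y\<bar>))"
    unfolding k_def using y2 by (intro mult_left_mono kernel_sum_le[OF y F]) auto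
  also have "1 - y\<^sup>2 = (1 - \<bar>y\<bar>) * (1 + \<bar>y\<bar>)" by (simp add: power2_eq_square algebra_simps)
  finally show ?thesis using y by simp
qed

section \<open>Fourth moments of the field on small sets\<close>

context aggregated_field
begin

definition \<mu>4 :: real where "\<mu>4 = expectation (\<lambda>\<omega>. \<xi> 0 (space \<Phi>) \<omega> ^ 4)"

lemma mu4_nonneg: "0 \<le> \<mu>4" unfolding \<mu>4_def by simp

lemma xi_int4:
  assumes A: "A \<in> sets \<Phi>"
  shows "integrable P (\<lambda>\<omega>. \<xi> s A \<omega> ^ 4)"
proof (rule Bochner_Integration.integrable_bound)
  show "integrable P (\<lambda>\<omega>. 16 * M s A \<omega> ^ 4 + 16 * (measure \<Phi> A * mean) ^ 4)"
    using field_even_moment[OF A _ field_int4] by simp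
  show "AE \<omega> in P. norm (\<xi> s A \<omega> ^ 4) \<le> norm (16 * M s A \<omega> ^ 4 + 16 * (measure \<Phi> A * mean) ^ 4)"
  proof (rule AE_I2)
    fix \<omega>
    have "\<bar>\<xi> s A \<omega>\<bar> ^ 4 \<le> (\<bar>M s A \<omega>\<bar> + \<bar>measure \<Phi> A * mean\<bar>) ^ 4"
      unfolding \<xi>_def by (intro power_mono) auto
    also have "\<dots> \<le> 2 ^ 4 * \<bar>M s A \<omega>\<bar> ^ 4 + 2 ^ 4 * \<bar>measure \<Phi> A * mean\<bar> ^ 4"
      by (rule power_add_le_two_power) auto
    finally show "norm (\<xi> s A \<omega> ^ 4) \<le> norm (16 * M s A \<omega> ^ 4 + 16 * (measure \<Phi> A * mean) ^ 4)"
      by (simp add: power_even_abs)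
  qed
qed (use A in measurable)

text \<open>Without atoms the distribution function is continuous and takes every value
  \<open>i * p\<close>; the half-open intervals between consecutive quantiles are the parts.\<close>

lemma exists_equal_parts:
  assumes p: "0 < p" and N: "real N * p \<le> 1"
  shows "\<exists>C :: nat \<Rightarrow> real set. (\<forall>i. C i \<in> sets \<Phi>) \<and> disjoint_family C \<and> (\<forall>i<N. measure \<Phi> (C i) = p)"
proof -
  interpret Phi: prob_space \<Phi> by (rule prob_Phi)
  define D where "D = distr \<Phi> borel (\<lambda>x. x)"
  have m: "(\<lambda>x. x) \<in> borel_measurable \<Phi>" by measurable
  interpret D: real_distribution D unfolding D_def by (rule Phi.real_distribution_distr[OF m])
  have D: "measure D A = measure \<Phi> (A \<inter> space \<Phi>)" if "A \<in> sets borel" for A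
    unfolding D_def using measure_distr[OF m that] by simp
  have cont: "isCont (cdf D) x" for x
  proof -
    have "measure D {x} = measure \<Phi> ({x} \<inter> space \<Phi>)" by (rule D) simp
    also have "\<dots> = 0" using no_atoms[of x] by (cases "x \<in> space \<Phi>") auto
    finally show ?thesis by (simp add: D.isCont_cdf)
  qed
  have "\<exists>c. cdf D c = t" if t: "0 \<le> t" "t \<le> 1" for t
  proof -
    have "{..-1} \<inter> space \<Phi> = {}" "{..1} \<inter> space \<Phi> = space \<Phi>" by (auto simp: space_Phi)
    then have "cdf D (-1) = 0" "cdf D 1 = 1" by (auto simp: cdf_def D Phi.prob_space)
    then show ?thesis using IVT[of "cdf D" "-1" t 1] t cont by auto
  qed
  then have "\<exists>c. \<forall>i\<le>N. cdf D (c i) = real i * p"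
    using p N by (intro choice allI) (meson landau_o.R_mult_right_mono mult_nonneg_nonneg mult_right_mono of_nat_0_le_iff of_nat_le_iff order.strict_implies_order order_trans)
  then obtain c where c: "\<And>i. i \<le> N \<Longrightarrow> cdf D (c i) = real i * p" by blast
  have c_mono: "c i < c j" if "i < j" "j \<le> N" for i j
  proof (rule ccontr)
    assume "\<not> c i < c j"
    then have "cdf D (c j) \<le> cdf D (c i)" by (intro D.cdf_nondecreasing) simp
    then show False using c that p by simp
  qed
  define C where "C i = (if i < N then {c i<..c (Suc i)} \<inter> space \<Phi> else {})" for i
  have "C i \<in> sets \<Phi>" for i unfolding C_def by (auto simp: sets_Phi space_Phi sets_restrict_space)
  moreover have "disjoint_family C"
  proof -
    have "C i \<inter> C j = {}" if "i < j" for i j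
    proof (cases "j < N")
      case True
      then have "c (Suc i) \<le> c j" using c_mono[of "Suc i" j] that by (cases "Suc i = j") auto
      then show ?thesis by (auto simp: C_def)
    qed (auto simp: C_def)
    then show ?thesis unfolding disjoint_family_on_def by (metis Int_commute linorder_neqE_nat)
  qed
  moreover have "measure \<Phi> (C i) = p" if "i < N" for i
  proof -
    have "measure \<Phi> (C i) = measure D {c i<..c (Suc i)}" using that by (simp add: C_def D)
    also have "\<dots> = cdf D (c (Suc i)) - cdf D (c i)" using that c_mono[of i "Suc i"] by (intro D.cdf_diff_eq[symmetric]) auto
    also have "\<dots> = p" using c[of i] c[of "Suc i"] that by (simp add: algebra_simps)
    finally show ?thesis .
  qed
  ultimately show ?thesis by blast
qed

text \<open>The fourth moment is superadditive over disjoint sets and depends on the set only through its measure;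
  comparing with about \<open>1 / \<Phi> A\<close> disjoint sets of the same measure makes it at most linear.\<close>

lemma xi_fourth_moment_le:
  assumes A: "A \<in> sets \<Phi>"
  shows "expectation (\<lambda>\<omega>. \<xi> s A \<omega> ^ 4) \<le> 2 * \<mu>4 * measure \<Phi> A"
proof (cases "measure \<Phi> A = 0")
  case True
  \<comment> \<open>On a null set there are no copies to compare with, but the variance is 0 and the
    variable vanishes.\<close>
  have "expectation (\<lambda>\<omega>. (\<xi> s A \<omega>)\<^sup>2) = 0" using xi_variance[OF A] True by simp
  then have "AE \<omega> in P. (\<xi> s A \<omega>)\<^sup>2 = 0"
    using integral_nonneg_eq_0_iff_AE[OF xi_square[OF A]] by simp
  then have "AE \<omega> in P. \<xi> s A \<omega> ^ 4 = 0" by eventually_elim simp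
  then show ?thesis using True by (simp add: integral_eq_zero_AE)
next
  case False
  interpret Phi: prob_space \<Phi> by (rule prob_Phi)
  define p where "p = measure \<Phi> A"
  have p: "0 < p" "p \<le> 1" using False by (auto simp: p_def zero_less_measure_iff)
  \<comment> \<open>\<open>N\<close> copies of mass \<open>p\<close> fit into total mass 1, and
    \<open>1 <= (N + 1) * p <= 2 * N * p\<close> is the source of the factor 2.\<close>
  define N where "N = nat \<lfloor>1 / p\<rfloor>"
  have "1 \<le> \<lfloor>1 / p\<rfloor>" using p by simp
  then have N: "1 \<le> N" "real N \<le> 1 / p" "1 / p < real N + 1" unfolding N_def by linarith+
  then have Np: "real N * p \<le> 1" using p by (simp add: field_simps)
  obtain C :: "nat \<Rightarrow> real set" where C: "\<And>i. C i \<in> sets \<Phi>" "disjoint_family C" "\<And>i. i < N \<Longrightarrow> measure \<Phi> (C i) = p"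
    using exists_equal_parts[OF p(1) Np] by blast
  \<comment> \<open>The remainder becomes the part with index \<open>N\<close>, so that the parts
    fill the space and their values add up to \<open>\<xi> s (space \<Phi>)\<close>.\<close>
  define C' where "C' i = (if i < N then C i else space \<Phi> - (\<Union>j<N. C j))" for i
  have C': "C' i \<in> sets \<Phi>" "disjoint_family_on C' {..N}" for i
    using C(1,2) unfolding C'_def disjoint_family_on_def by auto
  have un: "(\<Union>i\<in>{..N}. C' i) = space \<Phi>"
    using C(1)[THEN sets.sets_into_space] by (auto simp: C'_def split: if_splits)
  have ae: "AE \<omega> in P. \<xi> s (space \<Phi>) \<omega> = (\<Sum>i\<le>N. 1 * \<xi> s (C' i) \<omega>)"
  proof -
    have "measure \<Phi> (space \<Phi>) = (\<Sum>i\<le>N. measure \<Phi> (C' i))"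
      unfolding un[symmetric] using C' by (intro Phi.finite_measure_finite_Union) auto
    moreover have "AE \<omega> in P. M s (space \<Phi>) \<omega> = (\<Sum>i\<le>N. M s (C' i) \<omega>)"
      using field_UN[of "{..N}" C' s] C' un by simp
    ultimately show ?thesis
      unfolding \<xi>_def by (auto simp: sum_subtractf sum_distrib_right elim!: eventually_mono)
  qed
  have ind: "indep_vars (\<lambda>_. borel) (\<lambda>i. \<xi> s (C' i)) {..N}" by (rule xi_indep_one) (use C' in auto)
  define v where "v i = expectation (\<lambda>\<omega>. (\<xi> s (C' i) \<omega>)\<^sup>2)" for i
  define m where "m i = expectation (\<lambda>\<omega>. \<xi> s (C' i) \<omega> ^ 4)" for i
  have v0: "0 \<le> v i" for i by (simp add: v_def)
  have p4: "y ^ 4 = y * y * y * y" for y :: real by (simp add: numeral_eq_Suc)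
  have "\<mu>4 = expectation (\<lambda>\<omega>. \<xi> s (space \<Phi>) \<omega> ^ 4)"
    unfolding \<mu>4_def \<xi>_def
    by (rule field_moment_eq(2)[where f="\<lambda>x. (x - measure \<Phi> (space \<Phi>) * mean) ^ 4"]) auto
  also have "\<dots> = expectation (\<lambda>\<omega>. (\<Sum>i\<le>N. 1 * \<xi> s (C' i) \<omega>) ^ 4)"
    using ae C' by (intro integral_cong_AE borel_measurable_power borel_measurable_sum borel_measurable_times) (auto elim!: eventually_mono)
  also have "\<dots> = 3 * (\<Sum>i\<le>N. v i)\<^sup>2 + (\<Sum>i\<le>N. m i - 3 * (v i)\<^sup>2)"
    using indep_linear_forms_four_product(2)[OF _ ind xi_int4[OF C'(1)] xi_mean[OF C'(1)], of "\<lambda>_. 1" "\<lambda>_. 1" "\<lambda>_. 1" "\<lambda>_. 1"]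
    by (simp add: p4 power2_eq_square v_def m_def)
  also have "\<dots> = 3 * ((\<Sum>i\<le>N. v i)\<^sup>2 - (\<Sum>i\<le>N. (v i)\<^sup>2)) + (\<Sum>i\<le>N. m i)"
    by (simp add: sum_subtractf sum_distrib_left)
  finally have eq: "\<mu>4 = 3 * ((\<Sum>i\<le>N. v i)\<^sup>2 - (\<Sum>i\<le>N. (v i)\<^sup>2)) + (\<Sum>i\<le>N. m i)" .
  \<comment> \<open>The cross terms of the fourth moment are nonnegative: this is the
    superadditivity.\<close>
  have "(\<Sum>i\<le>N. (v i)\<^sup>2) \<le> (\<Sum>i\<le>N. v i * (\<Sum>i\<le>N. v i))"
    using v0 by (intro sum_mono) (auto simp: power2_eq_square intro!: mult_left_mono member_le_sum)
  also have "\<dots> = (\<Sum>i\<le>N. v i)\<^sup>2" by (simp add: sum_distrib_right power2_eq_square)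
  finally have "0 \<le> 3 * ((\<Sum>i\<le>N. v i)\<^sup>2 - (\<Sum>i\<le>N. (v i)\<^sup>2))" by simp
  then have "(\<Sum>i\<le>N. m i) \<le> \<mu>4" unfolding eq by simp
  moreover have "(\<Sum>i<N. m i) \<le> (\<Sum>i\<le>N. m i)" by (intro sum_mono2) (auto simp: m_def)
  moreover have "m i = expectation (\<lambda>\<omega>. \<xi> s A \<omega> ^ 4)" if "i < N" for i
  proof -
    have "measure \<Phi> (C i) = measure \<Phi> A" using C(3)[OF that] by (simp add: p_def)
    then show ?thesis unfolding m_def \<xi>_def using that C(1) A
      by (simp add: C'_def) (rule field_moment_eq(2)[where f="\<lambda>x. (x - measure \<Phi> A * mean) ^ 4"], auto)
  qed
  then have "(\<Sum>i<N. m i) = real N * expectation (\<lambda>\<omega>. \<xi> s A \<omega> ^ 4)" by simp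
  ultimately have le: "real N * expectation (\<lambda>\<omega>. \<xi> s A \<omega> ^ 4) \<le> \<mu>4" by linarith
  have "1 \<le> (real N + 1) * p" using N(3) p by (simp add: field_simps)
  also have "\<dots> \<le> (2 * real N) * p" using N(1) p by (intro mult_right_mono) auto
  finally have "expectation (\<lambda>\<omega>. \<xi> s A \<omega> ^ 4) * 1 \<le> expectation (\<lambda>\<omega>. \<xi> s A \<omega> ^ 4) * ((2 * real N) * p)"
    by (intro mult_left_mono) auto
  also have "\<dots> = 2 * p * (real N * expectation (\<lambda>\<omega>. \<xi> s A \<omega> ^ 4))" by simp
  also have "\<dots> \<le> 2 * p * \<mu>4" using le p by (intro mult_left_mono) auto
  finally show ?thesis by (simp add: p_def mult_ac)
qed

end

text \<open>A causal kernel: the value 0 at negative lags takes over the restriction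
  \<open>s <= t\<close>.\<close>

definition kern :: "real \<Rightarrow> int \<Rightarrow> real" where
  "kern y l = (if 0 \<le> l then y ^ nat l else 0)"

lemma sum_int_interval_nat:
  fixes f :: "int \<Rightarrow> real"
  assumes "int N \<ge> t" "- int N \<le> t" "\<And>l. l < 0 \<Longrightarrow> f l = 0"
  shows "(\<Sum>s\<in>{- int N..int N}. f (t - s)) = (\<Sum>k<Suc (nat (t + int N)). f (int k))"
proof -
  have "(\<Sum>s\<in>{- int N..int N}. f (t - s)) = (\<Sum>s\<in>{- int N..t}. f (t - s))"
    using assms by (intro sum.mono_neutral_right) auto
  also have "\<dots> = (\<Sum>k<Suc (nat (t + int N)). f (int k))"
    using assms by (intro sum.reindex_bij_witness[of _ "\<lambda>k. t - int k" "\<lambda>s. nat (t - s)"]) auto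
  finally show ?thesis .
qed

context aggregated_field
begin

text \<open>The simple approximation of \<open>X t - E (X t)\<close> is \<open>form n N (coef t)\<close>, a linear form in the independent
  variables \<open>noise n (s, y)\<close>, indexed by the time \<open>s\<close> and the value \<open>y\<close> of the discretized identity
  \<open>trunc n\<close>. The mean of the approximation is split off as \<open>bias\<close>.\<close>

definition cells :: "nat \<Rightarrow> nat \<Rightarrow> (int \<times> real) set" where
  "cells n N = {- int N..int N} \<times> trunc n ` space \<Phi>"

definition noise :: "nat \<Rightarrow> int \<times> real \<Rightarrow> 'a \<Rightarrow> real" where
  "noise n = (\<lambda>(s, y). \<xi> s (space \<Phi> \<inter> cell (trunc n) y))"

definition mass :: "nat \<Rightarrow> int \<times> real \<Rightarrow> real" where
  "mass n = (\<lambda>(s, y). measure \<Phi> (space \<Phi> \<inter> cell (trunc n) y))"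

definition coef :: "int \<Rightarrow> int \<times> real \<Rightarrow> real" where
  "coef t = (\<lambda>(s, y). kern y (t - s))"

definition form :: "nat \<Rightarrow> nat \<Rightarrow> (int \<times> real \<Rightarrow> real) \<Rightarrow> 'a \<Rightarrow> real" where
  "form n N a \<omega> = (\<Sum>i\<in>cells n N. a i * noise n i \<omega>)"

definition bias :: "nat \<Rightarrow> nat \<Rightarrow> int \<Rightarrow> real" where
  "bias n N t = mean * (\<Sum>i\<in>cells n N. coef t i * mass n i)"

lemma finite_cells: "finite (cells n N)"
  using simple_functionD(1)[OF trunc_simple] by (auto simp: cells_def)

lemma approx_eq_form: "approx n N t \<omega> = form n N (coef t) \<omega> + bias n N t"
proof -
  have "approx n N t \<omega> = (\<Sum>s\<in>{- int N..int N}. \<Sum>y\<in>trunc n ` space \<Phi>. kern y (t - s) * M s (space \<Phi> \<inter> cell (trunc n) y) \<omega>)"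
    unfolding approx_def approx_term_def cell_integral_def by (intro sum.cong refl) (auto simp: kern_def)
  also have "\<dots> = (\<Sum>i\<in>cells n N. coef t i * (noise n i \<omega> + mean * mass n i))"
    unfolding sum.cartesian_product cells_def by (intro sum.cong refl) (auto simp: coef_def noise_def mass_def \<xi>_def)
  finally show ?thesis
    by (simp add: form_def bias_def distrib_left sum.distrib sum_distrib_left mult_ac)
qed

lemma cell_Int_sets: "space \<Phi> \<inter> cell (trunc n) y \<in> sets \<Phi>"
  by (intro sets.Int sets.top cell_sets trunc_simple)

lemma noise_indep: "indep_vars (\<lambda>_. borel) (noise n) (cells n N)"
  unfolding noise_def cells_def
proof (rule xi_indep[where C="\<lambda>y. space \<Phi> \<inter> cell (trunc n) y"])
  show "finite (trunc n ` space \<Phi>)" by (rule simple_functionD(1)[OF trunc_simple])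
  show "disjoint_family_on (\<lambda>y. space \<Phi> \<inter> cell (trunc n) y) (trunc n ` space \<Phi>)"
    by (auto simp: disjoint_family_on_def cell_def)
qed (auto intro: cell_Int_sets)

lemma noise_int4: "integrable P (\<lambda>\<omega>. noise n i \<omega> ^ 4)"
  by (cases i) (auto simp: noise_def intro!: xi_int4 cell_Int_sets)

lemma noise_mean: "expectation (noise n i) = 0"
  by (cases i) (auto simp: noise_def intro!: xi_mean cell_Int_sets)

lemma noise_variance: "expectation (\<lambda>\<omega>. (noise n i \<omega>)\<^sup>2) = vari * mass n i"
  by (cases i) (auto simp: noise_def mass_def intro!: xi_variance cell_Int_sets)

lemma mass_nonneg: "0 \<le> mass n i"
  by (cases i) (auto simp: mass_def)

definition ck :: real where "ck = 2 * \<mu>4 + 3 * vari\<^sup>2"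

lemma ck_nonneg: "0 \<le> ck" using mu4_nonneg by (simp add: ck_def)

text \<open>Fourth moment and squared variance are both at most linear in the mass, the latter
  because the mass is at most 1. Linear bounds add up over the cells to something independent of the
  mesh.\<close>

lemma noise_kappa: "\<bar>expectation (\<lambda>\<omega>. noise n i \<omega> ^ 4) - 3 * (expectation (\<lambda>\<omega>. (noise n i \<omega>)\<^sup>2))\<^sup>2\<bar> \<le> ck * mass n i"
proof -
  interpret Phi: prob_space \<Phi> by (rule prob_Phi)
  have "expectation (\<lambda>\<omega>. noise n i \<omega> ^ 4) \<le> 2 * \<mu>4 * mass n i"
    by (cases i) (auto simp: noise_def mass_def intro!: xi_fourth_moment_le cell_Int_sets)
  moreover have "0 \<le> expectation (\<lambda>\<omega>. noise n i \<omega> ^ 4)" by simp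
  moreover have "(expectation (\<lambda>\<omega>. (noise n i \<omega>)\<^sup>2))\<^sup>2 \<le> vari\<^sup>2 * mass n i"
  proof -
    have "mass n i \<le> 1" by (cases i) (auto simp: mass_def)
    then have "(mass n i)\<^sup>2 \<le> mass n i * 1" unfolding power2_eq_square using mass_nonneg by (intro mult_left_mono) auto
    then show ?thesis unfolding noise_variance power_mult_distrib by (intro mult_left_mono) auto
  qed
  moreover have "0 \<le> (expectation (\<lambda>\<omega>. (noise n i \<omega>)\<^sup>2))\<^sup>2" by simp
  ultimately have "\<bar>expectation (\<lambda>\<omega>. noise n i \<omega> ^ 4) - 3 * (expectation (\<lambda>\<omega>. (noise n i \<omega>)\<^sup>2))\<^sup>2\<bar>
     \<le> 2 * \<mu>4 * mass n i + 3 * (vari\<^sup>2 * mass n i)" by linarith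
  then show ?thesis by (simp add: ck_def algebra_simps)
qed

text \<open>The masses are the measures of the cells of a step function, so weighted sums become
  integrals and dominated convergence is available as the mesh shrinks.\<close>

lemma sum_mass_eq_integral:
  "(\<Sum>i\<in>cells n N. F (fst i) (snd i) * mass n i) = (\<integral>x. (\<Sum>s\<in>{- int N..int N}. F s (trunc n x)) \<partial>\<Phi>)"
proof -
  interpret Phi: prob_space \<Phi> by (rule prob_Phi)
  let ?C = "trunc n ` space \<Phi>" and ?cell = "\<lambda>y. space \<Phi> \<inter> cell (trunc n) y"
  have "(\<Sum>i\<in>cells n N. F (fst i) (snd i) * mass n i)
      = (\<Sum>y\<in>?C. (\<Sum>s\<in>{- int N..int N}. F s y) * measure \<Phi> (?cell y))"
  proof -
    have "(\<Sum>i\<in>cells n N. F (fst i) (snd i) * mass n i)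
        = (\<Sum>(s, y)\<in>{- int N..int N} \<times> ?C. F s y * measure \<Phi> (?cell y))"
      unfolding cells_def mass_def by (intro sum.cong) auto
    also have "\<dots> = (\<Sum>s\<in>{- int N..int N}. \<Sum>y\<in>?C. F s y * measure \<Phi> (?cell y))"
      by (rule sum.cartesian_product[symmetric])
    also have "\<dots> = (\<Sum>y\<in>?C. \<Sum>s\<in>{- int N..int N}. F s y * measure \<Phi> (?cell y))" by (rule sum.swap)
    finally show ?thesis by (simp add: sum_distrib_right)
  qed
  also have "\<dots> = (\<integral>x. (\<Sum>y\<in>?C. (\<Sum>s\<in>{- int N..int N}. F s y) * indicator (?cell y) x) \<partial>\<Phi>)"
    using cell_Int_sets
    by (subst Bochner_Integration.integral_sum)
      (auto intro!: sum.cong integrable_mult_right integrable_real_indicator simp: Phi.emeasure_eq_measure)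
  also have "\<dots> = (\<integral>x. (\<Sum>s\<in>{- int N..int N}. F s (trunc n x)) \<partial>\<Phi>)"
  proof (rule Bochner_Integration.integral_cong[OF refl])
    fix x assume x: "x \<in> space \<Phi>"
    have "(\<Sum>y\<in>?C. (\<Sum>s\<in>{- int N..int N}. F s y) * indicator (?cell y) x)
        = (\<Sum>y\<in>?C. if y = trunc n x then (\<Sum>s\<in>{- int N..int N}. F s y) else 0)"
      using x by (intro sum.cong refl) (auto simp: cell_def indicator_def)
    then show "(\<Sum>y\<in>?C. (\<Sum>s\<in>{- int N..int N}. F s y) * indicator (?cell y) x) = (\<Sum>s\<in>{- int N..int N}. F s (trunc n x))"
      using x simple_functionD(1)[OF trunc_simple] by (simp add: sum.delta')
  qed
  finally show ?thesis .
qed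

lemma abs_trunc_less: "x \<in> space \<Phi> \<Longrightarrow> \<bar>trunc n x\<bar> < 1"
  using abs_trunc_le[of n x] by (auto simp: space_Phi)

lemma cells_less: "i \<in> cells n N \<Longrightarrow> \<bar>snd i\<bar> < 1"
  using abs_trunc_less by (auto simp: cells_def)

lemma simple_integrable: "integrable \<Phi> (\<lambda>x. f (trunc n x) :: real)"
proof -
  interpret Phi: prob_space \<Phi> by (rule prob_Phi)
  show ?thesis
    by (rule integrableI_simple_bochner_integrable, rule simple_bochner_integrable.intros)
      (auto intro!: simple_function_compose1[OF trunc_simple] simp: Phi.emeasure_eq_measure)
qed

definition Bm :: real where "Bm = (\<integral>x. 1 / (1 - \<bar>x\<bar>) \<partial>\<Phi>)"

lemma Bm_nonneg: "0 \<le> Bm"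
  unfolding Bm_def by (rule Bochner_Integration.integral_nonneg_AE, rule AE_I2) (auto simp: space_Phi)

lemma kern_sum_le:
  assumes "\<bar>y\<bar> < 1"
  shows "(\<Sum>s\<in>{- int N..int N}. \<bar>kern y (t - s)\<bar>) \<le> 1 / (1 - \<bar>y\<bar>)"
proof -
  have "(\<Sum>s\<in>{- int N..int N}. \<bar>kern y (t - s)\<bar>) = (\<Sum>l\<in>(\<lambda>s. t - s) ` {- int N..int N}. \<bar>kern y l\<bar>)"
    by (subst sum.reindex) (auto simp: inj_on_def)
  also have "\<dots> \<le> 1 / (1 - \<bar>y\<bar>)" unfolding kern_def by (rule kernel_sum_le[OF assms]) auto
  finally show ?thesis .
qed

lemma kern_difference_sum_le:
  assumes "\<bar>y\<bar> < 1"
  shows "(\<Sum>s\<in>{- int N..int N}. \<bar>kern y (t - s) - kern y (t + 2 - s)\<bar>) \<le> 4"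
proof -
  have "(\<Sum>s\<in>{- int N..int N}. \<bar>kern y (t - s) - kern y (t + 2 - s)\<bar>)
      = (\<Sum>l\<in>(\<lambda>s. t - s) ` {- int N..int N}. \<bar>kern y l - kern y (l + 2)\<bar>)"
    by (subst sum.reindex) (auto simp: inj_on_def algebra_simps)
  also have "\<dots> \<le> 4" unfolding kern_def by (rule kernel_difference_sum_le[OF assms]) auto
  finally show ?thesis .
qed

lemma abs_kern_le: "\<bar>y\<bar> < 1 \<Longrightarrow> \<bar>kern y l\<bar> \<le> 1"
  by (auto simp: kern_def power_abs power_le_one)

lemma coef_sum_le: "(\<Sum>i\<in>cells n N. \<bar>coef t i\<bar> * mass n i) \<le> Bm"
proof -
  have "(\<Sum>i\<in>cells n N. \<bar>coef t i\<bar> * mass n i) = (\<integral>x. (\<Sum>s\<in>{- int N..int N}. \<bar>kern (trunc n x) (t - s)\<bar>) \<partial>\<Phi>)"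
    using sum_mass_eq_integral[of "\<lambda>s y. \<bar>kern y (t - s)\<bar>" n N] by (simp add: coef_def split_def)
  also have "\<dots> \<le> Bm" unfolding Bm_def
  proof (rule integral_mono_AE[OF simple_integrable moment], rule AE_I2)
    fix x assume x: "x \<in> space \<Phi>"
    have "(\<Sum>s\<in>{- int N..int N}. \<bar>kern (trunc n x) (t - s)\<bar>) \<le> 1 / (1 - \<bar>trunc n x\<bar>)"
      by (rule kern_sum_le[OF abs_trunc_less[OF x]])
    also have "\<dots> \<le> 1 / (1 - \<bar>x\<bar>)"
      using abs_trunc_le[of n x] x by (intro divide_left_mono mult_pos_pos) (auto simp: space_Phi)
    finally show "(\<Sum>s\<in>{- int N..int N}. \<bar>kern (trunc n x) (t - s)\<bar>) \<le> 1 / (1 - \<bar>x\<bar>)" .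
  qed
  finally show ?thesis .
qed

definition dcoef :: "int \<Rightarrow> int \<times> real \<Rightarrow> real" where "dcoef t i = coef t i - coef (t + 2) i"

lemma dcoef_sum_le: "(\<Sum>i\<in>cells n N. \<bar>dcoef t i\<bar> * mass n i) \<le> 4"
proof -
  interpret Phi: prob_space \<Phi> by (rule prob_Phi)
  have "(\<Sum>i\<in>cells n N. \<bar>dcoef t i\<bar> * mass n i)
      = (\<integral>x. (\<Sum>s\<in>{- int N..int N}. \<bar>kern (trunc n x) (t - s) - kern (trunc n x) (t + 2 - s)\<bar>) \<partial>\<Phi>)"
    using sum_mass_eq_integral[of "\<lambda>s y. \<bar>kern y (t - s) - kern y (t + 2 - s)\<bar>" n N]
    by (simp add: dcoef_def coef_def split_def)
  also have "\<dots> \<le> (\<integral>x. 4 \<partial>\<Phi>)"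
    by (rule integral_mono_AE[OF simple_integrable], simp, rule AE_I2, rule kern_difference_sum_le, rule abs_trunc_less)
  finally show ?thesis by (simp add: Phi.prob_space)
qed

lemma dcoef_time_sum_le:
  assumes i: "i \<in> cells n N" and T: "finite T"
  shows "(\<Sum>t\<in>T. \<bar>dcoef t i\<bar>) \<le> 4"
proof -
  have "(\<Sum>t\<in>T. \<bar>dcoef t i\<bar>) = (\<Sum>l\<in>(\<lambda>t. t - fst i) ` T. \<bar>kern (snd i) l - kern (snd i) (l + 2)\<bar>)"
    by (subst sum.reindex) (auto simp: inj_on_def dcoef_def coef_def split_def algebra_simps)
  also have "\<dots> \<le> 4"
    unfolding kern_def by (rule kernel_difference_sum_le[OF cells_less[OF i]]) (use T in auto)
  finally show ?thesis .
qed

lemma form_diff: "form n N a \<omega> - form n N b \<omega> = form n N (\<lambda>i. a i - b i) \<omega>"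
  by (simp add: form_def left_diff_distrib sum_subtractf)

text \<open>The covariance of \<open>form n N (coef t)\<close> and
  \<open>form n N (dcoef u)\<close>, as the independent noise variables have variance
  \<open>vari * mass n i\<close>.\<close>

definition ecov :: "nat \<Rightarrow> nat \<Rightarrow> int \<Rightarrow> int \<Rightarrow> real" where
  "ecov n N t u = (\<Sum>i\<in>cells n N. coef t i * dcoef u i * (vari * mass n i))"

lemma form_quadratic_le:
  assumes T: "finite T"
  shows "integrable P (\<lambda>\<omega>. (\<Sum>t\<in>T. form n N (coef t) \<omega> * form n N (dcoef (t + j)) \<omega> - ecov n N t (t + j))\<^sup>2)"
    and "expectation (\<lambda>\<omega>. (\<Sum>t\<in>T. form n N (coef t) \<omega> * form n N (dcoef (t + j)) \<omega> - ecov n N t (t + j))\<^sup>2)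
      \<le> real (card T) * (16 * (2 * vari\<^sup>2 * Bm + ck))"
proof -
  have dT: "(\<Sum>t\<in>T. \<bar>dcoef (t + j) i\<bar>) \<le> 4" if "i \<in> cells n N" for i
  proof -
    have "(\<Sum>t\<in>T. \<bar>dcoef (t + j) i\<bar>) = (\<Sum>t\<in>(\<lambda>t. t + j) ` T. \<bar>dcoef t i\<bar>)"
      by (subst sum.reindex) (auto simp: inj_on_def)
    also have "\<dots> \<le> 4" by (rule dcoef_time_sum_le[OF that]) (use T in auto)
    finally show ?thesis .
  qed
  have c1: "\<bar>coef t i\<bar> \<le> 1" if "i \<in> cells n N" for t i
    using abs_kern_le[OF cells_less[OF that]] by (simp add: coef_def split_def)
  have four: "(0::real) \<le> 4" by simp
  note * = indep_quadratic_form_variance_le[OF finite_cells noise_indep noise_int4 noise_mean mass_nonneg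
      vari_nonneg ck_nonneg Bm_nonneg four eq_refl[OF noise_variance] noise_kappa T c1 coef_sum_le dcoef_sum_le dT,
      unfolded noise_variance, folded form_def ecov_def]
  show "integrable P (\<lambda>\<omega>. (\<Sum>t\<in>T. form n N (coef t) \<omega> * form n N (dcoef (t + j)) \<omega> - ecov n N t (t + j))\<^sup>2)"
    "expectation (\<lambda>\<omega>. (\<Sum>t\<in>T. form n N (coef t) \<omega> * form n N (dcoef (t + j)) \<omega> - ecov n N t (t + j))\<^sup>2)
      \<le> real (card T) * (16 * (2 * vari\<^sup>2 * Bm + ck))"
    using * by auto
qed

lemma form_fourth_le:
  shows "integrable P (\<lambda>\<omega>. form n N (coef t) \<omega> ^ 4)"
    and "expectation (\<lambda>\<omega>. form n N (coef t) \<omega> ^ 4) \<le> 3 * (vari * Bm)\<^sup>2 + ck * Bm"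
proof -
  have c1: "\<bar>coef t i\<bar> \<le> 1" if "i \<in> cells n N" for t i
    using abs_kern_le[OF cells_less[OF that]] by (simp add: coef_def split_def)
  note * = indep_linear_form_fourth_moment_le[OF finite_cells noise_indep noise_int4 noise_mean mass_nonneg
      vari_nonneg ck_nonneg eq_refl[OF noise_variance] noise_kappa c1 coef_sum_le, folded form_def]
  show "integrable P (\<lambda>\<omega>. form n N (coef t) \<omega> ^ 4)"
    "expectation (\<lambda>\<omega>. form n N (coef t) \<omega> ^ 4) \<le> 3 * (vari * Bm)\<^sup>2 + ck * Bm"
    using * by auto
qed

text \<open>The kernel sums to the geometric series \<open>1 / (1 - x)\<close>, with dominating
  function \<open>1 / (1 - |x|)\<close>. The limit provides the centring of
  \<open>X t\<close>.\<close>

lemma bias_tendsto: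
  assumes \<nu>: "\<And>N. \<nu> N \<ge> (N::nat)"
  shows "(\<lambda>N. bias (\<nu> N) N t) \<longlonglongrightarrow> mean * (\<integral>x. 1 / (1 - x) \<partial>\<Phi>)"
proof -
  have b: "bias (\<nu> N) N t = mean * (\<integral>x. (\<Sum>s\<in>{- int N..int N}. kern (trunc (\<nu> N) x) (t - s)) \<partial>\<Phi>)" for N
    using sum_mass_eq_integral[of "\<lambda>s y. kern y (t - s)" "\<nu> N" N] by (simp add: bias_def coef_def split_def)
  have \<nu>lim: "filterlim \<nu> at_top sequentially"
    by (rule filterlim_at_top_mono[OF filterlim_ident]) (simp add: \<nu>)
  have "(\<lambda>N. \<integral>x. (\<Sum>s\<in>{- int N..int N}. kern (trunc (\<nu> N) x) (t - s)) \<partial>\<Phi>) \<longlonglongrightarrow> (\<integral>x. 1 / (1 - x) \<partial>\<Phi>)"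
  proof (rule integral_dominated_convergence[OF _ _ moment])
    show "(\<lambda>x. 1 / (1 - x)) \<in> borel_measurable \<Phi>" by measurable
    show "(\<lambda>x. \<Sum>s\<in>{- int N..int N}. kern (trunc (\<nu> N) x) (t - s)) \<in> borel_measurable \<Phi>" for N
      using simple_integrable[of "\<lambda>y. \<Sum>s\<in>{- int N..int N}. kern y (t - s)" "\<nu> N"] by auto
    show "AE x in \<Phi>. (\<lambda>N. \<Sum>s\<in>{- int N..int N}. kern (trunc (\<nu> N) x) (t - s)) \<longlonglongrightarrow> 1 / (1 - x)"
    proof (rule AE_I2)
      fix x assume x: "x \<in> space \<Phi>"
      then have x1: "\<bar>x\<bar> < 1" by (auto simp: space_Phi)
      have yl: "(\<lambda>N. trunc (\<nu> N) x) \<longlonglongrightarrow> x" by (rule filterlim_compose[OF trunc_tendsto \<nu>lim])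
      have pw: "(\<lambda>N. trunc (\<nu> N) x ^ Suc (nat (t + int N))) \<longlonglongrightarrow> 0"
      proof (rule Lim_null_comparison[OF always_eventually[OF allI]])
        show "norm (trunc (\<nu> N) x ^ Suc (nat (t + int N))) \<le> \<bar>x\<bar> ^ Suc (nat (t + int N))" for N
          unfolding real_norm_def power_abs by (intro power_mono abs_trunc_le zero_le_power abs_ge_zero)
        have "filterlim (\<lambda>N. Suc (nat (t + int N))) at_top sequentially"
          unfolding filterlim_at_top
        proof
          fix Z show "\<forall>\<^sub>F N in sequentially. Z \<le> Suc (nat (t + int N))"
            using eventually_ge_at_top[of "Z + nat \<bar>t\<bar>"] by eventually_elim linarith
        qed
        then show "(\<lambda>N. \<bar>x\<bar> ^ Suc (nat (t + int N))) \<longlonglongrightarrow> 0"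
          using LIMSEQ_realpow_zero[of "\<bar>x\<bar>"] x1 by (intro filterlim_compose[where f="\<lambda>N. Suc (nat (t + int N))" and g="\<lambda>k. \<bar>x\<bar> ^ k"]) auto
      qed
      \<comment> \<open>The window cuts the geometric series after the power \<open>t + N\<close>.
        The discretized point never exceeds \<open>|x|\<close> in modulus, so the leftover power
        vanishes although the point moves with \<open>N\<close>.\<close>
      have "(\<lambda>N. (1 - trunc (\<nu> N) x ^ Suc (nat (t + int N))) / (1 - trunc (\<nu> N) x)) \<longlonglongrightarrow> (1 - 0) / (1 - x)"
        using x1 by (intro tendsto_intros yl pw) auto
      moreover have "\<forall>\<^sub>F N in sequentially. (1 - trunc (\<nu> N) x ^ Suc (nat (t + int N))) / (1 - trunc (\<nu> N) x)
          = (\<Sum>s\<in>{- int N..int N}. kern (trunc (\<nu> N) x) (t - s))"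
        using eventually_ge_at_top[of "nat \<bar>t\<bar>"]
      proof eventually_elim
        case (elim N)
        have "(\<Sum>s\<in>{- int N..int N}. kern (trunc (\<nu> N) x) (t - s)) = (\<Sum>k<Suc (nat (t + int N)). trunc (\<nu> N) x ^ k)"
          using elim by (subst sum_int_interval_nat[where f="\<lambda>l. kern (trunc (\<nu> N) x) l"]) (auto simp: kern_def simp del: sum.lessThan_Suc)
        then show ?case using abs_trunc_less[OF x, of "\<nu> N"] by (simp add: sum_gp_strict del: sum.lessThan_Suc power_Suc)
      qed
      ultimately show "(\<lambda>N. \<Sum>s\<in>{- int N..int N}. kern (trunc (\<nu> N) x) (t - s)) \<longlonglongrightarrow> 1 / (1 - x)"
        by (auto dest: Lim_transform_eventually)
    qed
    show "AE x in \<Phi>. norm (\<Sum>s\<in>{- int N..int N}. kern (trunc (\<nu> N) x) (t - s)) \<le> 1 / (1 - \<bar>x\<bar>)" for N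
    proof (rule AE_I2)
      fix x assume x: "x \<in> space \<Phi>"
      have "norm (\<Sum>s\<in>{- int N..int N}. kern (trunc (\<nu> N) x) (t - s)) \<le> (\<Sum>s\<in>{- int N..int N}. \<bar>kern (trunc (\<nu> N) x) (t - s)\<bar>)"
        by (simp add: sum_abs)
      also have "\<dots> \<le> 1 / (1 - \<bar>trunc (\<nu> N) x\<bar>)" by (rule kern_sum_le[OF abs_trunc_less[OF x]])
      also have "\<dots> \<le> 1 / (1 - \<bar>x\<bar>)"
        using abs_trunc_le[of "\<nu> N" x] x by (intro divide_left_mono mult_pos_pos) (auto simp: space_Phi)
      finally show "norm (\<Sum>s\<in>{- int N..int N}. kern (trunc (\<nu> N) x) (t - s)) \<le> 1 / (1 - \<bar>x\<bar>)" .
    qed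
  qed
  then show ?thesis unfolding b by (intro tendsto_mult tendsto_const)
qed

text \<open>Summing \<open>y^k * (y^(k+j) - y^(k+j+2))\<close> over \<open>k\<close> gives
  \<open>y^j\<close> up to a vanishing power, because \<open>1 - y^2\<close> cancels the geometric
  series in \<open>y^2\<close>. This is how covariances two lags apart produce a plain moment of
  \<open>\<Phi>\<close>.\<close>

lemma ecov_tendsto:
  assumes \<nu>: "\<And>N. \<nu> N \<ge> (N::nat)"
  shows "(\<lambda>N. ecov (\<nu> N) N t (t + int j)) \<longlonglongrightarrow> vari * (\<integral>x. x ^ j \<partial>\<Phi>)"
proof -
  interpret Phi: prob_space \<Phi> by (rule prob_Phi)
  define G where "G N y = (\<Sum>s\<in>{- int N..int N}. kern y (t - s) * (kern y (t + int j - s) - kern y (t + int j + 2 - s)))" for N y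
  have b: "ecov (\<nu> N) N t (t + int j) = vari * (\<integral>x. G N (trunc (\<nu> N) x) \<partial>\<Phi>)" for N
  proof -
    have "ecov (\<nu> N) N t (t + int j) = vari * (\<Sum>i\<in>cells (\<nu> N) N. coef t i * dcoef (t + int j) i * mass (\<nu> N) i)"
      by (simp add: ecov_def sum_distrib_left mult_ac)
    then show ?thesis
      using sum_mass_eq_integral[of "\<lambda>s y. kern y (t - s) * (kern y (t + int j - s) - kern y (t + int j + 2 - s))" "\<nu> N" N]
      by (simp add: coef_def dcoef_def split_def G_def)
  qed
  have \<nu>lim: "filterlim \<nu> at_top sequentially"
    by (rule filterlim_at_top_mono[OF filterlim_ident]) (simp add: \<nu>)
  have "(\<lambda>N. \<integral>x. G N (trunc (\<nu> N) x) \<partial>\<Phi>) \<longlonglongrightarrow> (\<integral>x. x ^ j \<partial>\<Phi>)"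
  proof (rule integral_dominated_convergence[where w="\<lambda>_. 4"])
    show "(\<lambda>x. x ^ j) \<in> borel_measurable \<Phi>" by measurable
    show "(\<lambda>x. G N (trunc (\<nu> N) x)) \<in> borel_measurable \<Phi>" for N
      using simple_integrable[of "G N" "\<nu> N"] by auto
    show "AE x in \<Phi>. (\<lambda>N. G N (trunc (\<nu> N) x)) \<longlonglongrightarrow> x ^ j"
    proof (rule AE_I2)
      fix x assume x: "x \<in> space \<Phi>"
      then have x1: "\<bar>x\<bar> < 1" by (auto simp: space_Phi)
      have yl: "(\<lambda>N. trunc (\<nu> N) x) \<longlonglongrightarrow> x" by (rule filterlim_compose[OF trunc_tendsto \<nu>lim])
      have pw: "(\<lambda>N. ((trunc (\<nu> N) x)\<^sup>2) ^ Suc (nat (t + int N))) \<longlonglongrightarrow> 0"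
      proof (rule Lim_null_comparison[OF always_eventually[OF allI]])
        show "norm (((trunc (\<nu> N) x)\<^sup>2) ^ Suc (nat (t + int N))) \<le> (\<bar>x\<bar>\<^sup>2) ^ Suc (nat (t + int N))" for N
          unfolding real_norm_def power_abs by (intro power_mono abs_trunc_le zero_le_power abs_ge_zero)
        have "filterlim (\<lambda>N. Suc (nat (t + int N))) at_top sequentially"
          unfolding filterlim_at_top
        proof
          fix Z show "\<forall>\<^sub>F N in sequentially. Z \<le> Suc (nat (t + int N))"
            using eventually_ge_at_top[of "Z + nat \<bar>t\<bar>"] by eventually_elim linarith
        qed
        moreover have "\<bar>x\<bar>\<^sup>2 < 1" using x1 by (simp add: abs_square_less_1)
        ultimately show "(\<lambda>N. (\<bar>x\<bar>\<^sup>2) ^ Suc (nat (t + int N))) \<longlonglongrightarrow> 0"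
          using LIMSEQ_realpow_zero[of "\<bar>x\<bar>\<^sup>2"] by (intro filterlim_compose[where f="\<lambda>N. Suc (nat (t + int N))" and g="\<lambda>k. (\<bar>x\<bar>\<^sup>2) ^ k"]) auto
      qed
      have "(\<lambda>N. trunc (\<nu> N) x ^ j * (1 - ((trunc (\<nu> N) x)\<^sup>2) ^ Suc (nat (t + int N)))) \<longlonglongrightarrow> x ^ j * (1 - 0)"
        by (intro tendsto_intros yl pw)
      moreover have "\<forall>\<^sub>F N in sequentially. trunc (\<nu> N) x ^ j * (1 - ((trunc (\<nu> N) x)\<^sup>2) ^ Suc (nat (t + int N))) = G N (trunc (\<nu> N) x)"
        using eventually_ge_at_top[of "nat \<bar>t\<bar>"]
      proof eventually_elim
        case (elim N)
        define y where "y = trunc (\<nu> N) x"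
        define n where "n = Suc (nat (t + int N))"
        have y: "\<bar>y\<bar> < 1" using abs_trunc_less[OF x] by (simp add: y_def)
        have "G N y = (\<Sum>s\<in>{- int N..int N}. (\<lambda>l. kern y l * (kern y (l + int j) - kern y (l + int j + 2))) (t - s))"
          unfolding G_def by (intro sum.cong refl) (simp add: algebra_simps)
        also have "\<dots> = (\<Sum>k<n. kern y (int k) * (kern y (int k + int j) - kern y (int k + int j + 2)))"
          unfolding n_def using elim by (subst sum_int_interval_nat) (auto simp: kern_def simp del: sum.lessThan_Suc)
        also have "\<dots> = (\<Sum>k<n. y ^ j * ((1 - y\<^sup>2) * (y\<^sup>2) ^ k))"
          by (intro sum.cong refl)
             (simp add: kern_def nat_add_distrib power_add power_mult[symmetric] mult_2 power2_eq_square algebra_simps)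
        also have "\<dots> = y ^ j * (1 - (y\<^sup>2) ^ n)"
          using y by (simp add: sum_distrib_left[symmetric] one_diff_power_eq)
        finally show ?case by (simp add: y_def n_def)
      qed
      ultimately show "(\<lambda>N. G N (trunc (\<nu> N) x)) \<longlonglongrightarrow> x ^ j"
        by (auto dest: Lim_transform_eventually)
    qed
    show "AE x in \<Phi>. norm (G N (trunc (\<nu> N) x)) \<le> 4" for N
    proof (rule AE_I2)
      fix x assume x: "x \<in> space \<Phi>"
      let ?y = "trunc (\<nu> N) x"
      have "norm (G N ?y) \<le> (\<Sum>s\<in>{- int N..int N}. \<bar>kern ?y (t - s)\<bar> * \<bar>kern ?y (t + int j - s) - kern ?y (t + int j + 2 - s)\<bar>)"
        unfolding G_def real_norm_def by (rule order_trans[OF sum_abs]) (simp add: abs_mult)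
      also have "\<dots> \<le> (\<Sum>s\<in>{- int N..int N}. 1 * \<bar>kern ?y (t + int j - s) - kern ?y (t + int j + 2 - s)\<bar>)"
        by (intro sum_mono mult_right_mono abs_kern_le abs_trunc_less[OF x]) auto
      also have "\<dots> \<le> 4" using kern_difference_sum_le[OF abs_trunc_less[OF x]] by simp
      finally show "norm (G N ?y) \<le> 4" .
    qed
  qed auto
  then show ?thesis unfolding b by (intro tendsto_mult tendsto_const)
qed

end

section \<open>Passage from the linear forms to the process\<close>

context aggregated_field
begin

definition cX :: real where "cX = mean * (\<integral>x. 1 / (1 - x) \<partial>\<Phi>)"

definition C4 :: real where "C4 = 3 * (vari * Bm)\<^sup>2 + ck * Bm"

definition C2 :: real where "C2 = 16 * (2 * vari\<^sup>2 * Bm + ck)"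

definition rho :: "nat \<Rightarrow> real" where "rho j = vari * (\<integral>x. x ^ j \<partial>\<Phi>)"

text \<open>One subsequence serves all times of \<open>T\<close>, as the limit of a quadratic form
  requires joint convergence.\<close>

lemma form_approximation:
  assumes T: "finite T"
  shows "\<exists>\<nu> N. (AE \<omega> in P. \<forall>t\<in>T. (\<lambda>n. form (\<nu> n) (N n) (coef t) \<omega>) \<longlonglongrightarrow> X t \<omega> - cX) \<and>
    (\<forall>t j. (\<lambda>n. ecov (\<nu> n) (N n) t (t + int j)) \<longlonglongrightarrow> rho j)"
proof -
  obtain \<mu> where \<mu>: "\<And>N. \<mu> N \<ge> N" and lim: "\<And>t. (\<lambda>N. prob_size P (\<lambda>\<omega>. approx (\<mu> N) N t \<omega> - X t \<omega>)) \<longlonglongrightarrow> 0"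
    using approximation by blast
  obtain r where r: "strict_mono r" "AE \<omega> in P. \<forall>t\<in>T. (\<lambda>n. approx (\<mu> (r n)) (r n) t \<omega> - X t \<omega>) \<longlonglongrightarrow> 0"
    using prob_size_imp_common_AE_subseq[OF T, of "\<lambda>t N \<omega>. approx (\<mu> N) N t \<omega> - X t \<omega>"] lim by auto
  have bl: "(\<lambda>n. bias (\<mu> (r n)) (r n) t) \<longlonglongrightarrow> cX" for t
    using LIMSEQ_subseq_LIMSEQ[OF bias_tendsto[OF \<mu>] r(1)] by (simp add: cX_def o_def)
  show ?thesis
  proof (intro exI conjI allI)
    show "AE \<omega> in P. \<forall>t\<in>T. (\<lambda>n. form (\<mu> (r n)) (r n) (coef t) \<omega>) \<longlonglongrightarrow> X t \<omega> - cX"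
      using r(2)
    proof eventually_elim
      case (elim \<omega>)
      show ?case
      proof
        fix t assume "t \<in> T"
        then have "(\<lambda>n. (approx (\<mu> (r n)) (r n) t \<omega> - X t \<omega>) + X t \<omega> - bias (\<mu> (r n)) (r n) t) \<longlonglongrightarrow> 0 + X t \<omega> - cX"
          using elim by (intro tendsto_intros bl) auto
        then show "(\<lambda>n. form (\<mu> (r n)) (r n) (coef t) \<omega>) \<longlonglongrightarrow> X t \<omega> - cX"
          by (simp add: approx_eq_form)
      qed
    qed
    show "(\<lambda>n. ecov (\<mu> (r n)) (r n) t (t + int j)) \<longlonglongrightarrow> rho j" for t j
      using LIMSEQ_subseq_LIMSEQ[OF ecov_tendsto[OF \<mu>] r(1)] by (simp add: rho_def o_def)
  qed
qed

lemma X_fourth_moment: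
  "integrable P (\<lambda>\<omega>. (X t \<omega> - cX) ^ 4)" "expectation (\<lambda>\<omega>. (X t \<omega> - cX) ^ 4) \<le> C4"
proof -
  obtain \<nu> N where l: "AE \<omega> in P. \<forall>t\<in>{t}. (\<lambda>n. form (\<nu> n) (N n) (coef t) \<omega>) \<longlonglongrightarrow> X t \<omega> - cX"
    using form_approximation[of "{t}"] by auto
  have "integrable P (\<lambda>\<omega>. (X t \<omega> - cX) ^ 4) \<and> expectation (\<lambda>\<omega>. (X t \<omega> - cX) ^ 4) \<le> C4
      \<and> (AE \<omega> in P. 0 \<le> (X t \<omega> - cX) ^ 4)"
  proof (rule AE_tendsto_expectation_bound[where Z="\<lambda>n \<omega>. form (\<nu> n) (N n) (coef t) \<omega> ^ 4"])
    show "AE \<omega> in P. (\<lambda>n. form (\<nu> n) (N n) (coef t) \<omega> ^ 4) \<longlonglongrightarrow> (X t \<omega> - cX) ^ 4"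
      using l by eventually_elim (auto intro!: tendsto_power)
  qed (use form_fourth_le in \<open>auto simp: C4_def\<close>)
  then show "integrable P (\<lambda>\<omega>. (X t \<omega> - cX) ^ 4)" "expectation (\<lambda>\<omega>. (X t \<omega> - cX) ^ 4) \<le> C4" by auto
qed

lemma X_quadratic_moment:
  fixes j :: nat
  assumes T: "finite T"
  defines "S \<equiv> \<lambda>\<omega>. \<Sum>t\<in>T. (X t \<omega> - cX) * (X (t + int j) \<omega> - X (t + int j + 2) \<omega>) - rho j"
  shows "integrable P (\<lambda>\<omega>. (S \<omega>)\<^sup>2)" "expectation (\<lambda>\<omega>. (S \<omega>)\<^sup>2) \<le> real (card T) * C2"
proof -
  \<comment> \<open>The term at time \<open>t\<close> also involves the times \<open>t + j\<close>
    and \<open>t + j + 2\<close>.\<close>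
  have f: "finite (T \<union> (\<lambda>t. t + int j) ` T \<union> (\<lambda>t. t + int j + 2) ` T)" using T by auto
  obtain \<nu> N where l: "AE \<omega> in P. \<forall>t\<in>T \<union> (\<lambda>t. t + int j) ` T \<union> (\<lambda>t. t + int j + 2) ` T.
      (\<lambda>n. form (\<nu> n) (N n) (coef t) \<omega>) \<longlonglongrightarrow> X t \<omega> - cX"
    and el: "\<forall>t j. (\<lambda>n. ecov (\<nu> n) (N n) t (t + int j)) \<longlonglongrightarrow> rho j"
    using form_approximation[OF f] by (elim exE conjE) (rule that)
  have "integrable P (\<lambda>\<omega>. (S \<omega>)\<^sup>2) \<and> expectation (\<lambda>\<omega>. (S \<omega>)\<^sup>2) \<le> real (card T) * C2
      \<and> (AE \<omega> in P. 0 \<le> (S \<omega>)\<^sup>2)"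
  proof (rule AE_tendsto_expectation_bound[where Z="\<lambda>n \<omega>. (\<Sum>t\<in>T. form (\<nu> n) (N n) (coef t) \<omega> *
        form (\<nu> n) (N n) (dcoef (t + int j)) \<omega> - ecov (\<nu> n) (N n) t (t + int j))\<^sup>2"])
    show "AE \<omega> in P. (\<lambda>n. (\<Sum>t\<in>T. form (\<nu> n) (N n) (coef t) \<omega> *
        form (\<nu> n) (N n) (dcoef (t + int j)) \<omega> - ecov (\<nu> n) (N n) t (t + int j))\<^sup>2) \<longlonglongrightarrow> (S \<omega>)\<^sup>2"
      using l
    proof eventually_elim
      case (elim \<omega>)
      have d: "form n N (dcoef t) \<omega> = form n N (coef t) \<omega> - form n N (coef (t + 2)) \<omega>" for n N t
        by (simp add: form_diff dcoef_def[abs_def])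
      have lt: "(\<lambda>n. form (\<nu> n) (N n) (coef t) \<omega> * (form (\<nu> n) (N n) (coef (t + int j)) \<omega> - form (\<nu> n) (N n) (coef (t + int j + 2)) \<omega>)
          - ecov (\<nu> n) (N n) t (t + int j)) \<longlonglongrightarrow> (X t \<omega> - cX) * ((X (t + int j) \<omega> - cX) - (X (t + int j + 2) \<omega> - cX)) - rho j"
        if t: "t \<in> T" for t
        using elim t by (intro tendsto_intros el[rule_format]) auto
      have "(\<lambda>n. (\<Sum>t\<in>T. form (\<nu> n) (N n) (coef t) \<omega> * (form (\<nu> n) (N n) (coef (t + int j)) \<omega> - form (\<nu> n) (N n) (coef (t + int j + 2)) \<omega>)
          - ecov (\<nu> n) (N n) t (t + int j))\<^sup>2) \<longlonglongrightarrow> (\<Sum>t\<in>T. (X t \<omega> - cX) * ((X (t + int j) \<omega> - cX) - (X (t + int j + 2) \<omega> - cX)) - rho j)\<^sup>2"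
        by (intro tendsto_power tendsto_sum lt)
      then show ?case unfolding d S_def by simp
    qed
    show "(\<lambda>\<omega>. (S \<omega>)\<^sup>2) \<in> borel_measurable P" unfolding S_def by measurable
  qed (use form_quadratic_le[OF T] in \<open>auto simp: C2_def\<close>)
  then show "integrable P (\<lambda>\<omega>. (S \<omega>)\<^sup>2)" "expectation (\<lambda>\<omega>. (S \<omega>)\<^sup>2) \<le> real (card T) * C2" by auto
qed

end

section \<open>Algebra and errors of the sample covariances\<close>

lemma sample_mean_shift: "n \<ge> 1 \<Longrightarrow> sample_mean n (\<lambda>t. x t - c) = sample_mean n x - c"
  by (simp add: sample_mean_def sum_subtractf right_diff_distrib)

lemma sample_cov_shift: "n \<ge> 1 \<Longrightarrow> sample_cov n (\<lambda>t. x t - c) j = sample_cov n x j"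
  by (simp add: sample_cov_def sample_mean_shift)

text \<open>The difference of two sample covariances is a sum of products plus finitely many boundary terms, since
  the contribution of the sample mean telescopes.\<close>

lemma telescoping_two_step:
  fixes x :: "int \<Rightarrow> real"
  shows "(\<Sum>i=1..L. x (int (i + j)) - x (int (i + j) + 2))
    = x (int j + 1) + x (int j + 2) - x (int (L + j) + 1) - x (int (L + j) + 2)"
  by (induction L) (simp_all add: algebra_simps)

text \<open>With \<open>n = L + j + 2\<close> the two sums share \<open>L\<close> indices; the sum
  of lag \<open>j\<close> has two more, which appear as the last two products.\<close>

lemma sample_cov_difference:
  fixes x :: "int \<Rightarrow> real"
  assumes n: "n = L + j + 2"
  defines "m \<equiv> sample_mean n x"
  shows "real n * (sample_cov n x j - sample_cov n x (j + 2))
    = (\<Sum>i=1..L. x (int i) * (x (int (i + j)) - x (int (i + j) + 2)))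
      - m * (x (int j + 1) + x (int j + 2) - x (int (L + j) + 1) - x (int (L + j) + 2))
      + (x (int L + 1) - m) * (x (int (L + j) + 1) - m) + (x (int L + 2) - m) * (x (int (L + j) + 2) - m)"
proof -
  have e1: "{1..n - j} = {1..Suc (Suc L)}" and e2: "{1..n - (j + 2)} = {1..L}" using n by auto
  have "real n * (sample_cov n x j - sample_cov n x (j + 2))
     = (\<Sum>i=1..n - j. (x (int i) - m) * (x (int (i + j)) - m)) - (\<Sum>i=1..n - (j + 2). (x (int i) - m) * (x (int (i + (j + 2))) - m))"
  proof -
    have "real n \<noteq> 0" using n by simp
    then have "real n * (1 / real n * A - 1 / real n * B) = A - B" for A B by (simp add: right_diff_distrib)
    then show ?thesis unfolding sample_cov_def m_def .
  qed
  also have "(\<Sum>i=1..n - j. (x (int i) - m) * (x (int (i + j)) - m)) = (\<Sum>i=1..L. (x (int i) - m) * (x (int (i + j)) - m))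
      + (x (int L + 1) - m) * (x (int (L + j) + 1) - m) + (x (int L + 2) - m) * (x (int (L + j) + 2) - m)"
    unfolding e1 by (simp add: algebra_simps)
  also have "(\<Sum>i=1..n - (j + 2). (x (int i) - m) * (x (int (i + (j + 2))) - m)) = (\<Sum>i=1..L. (x (int i) - m) * (x (int (i + j) + 2) - m))"
    unfolding e2 by (simp add: algebra_simps)
  finally have "real n * (sample_cov n x j - sample_cov n x (j + 2))
     = ((\<Sum>i=1..L. (x (int i) - m) * (x (int (i + j)) - m)) - (\<Sum>i=1..L. (x (int i) - m) * (x (int (i + j) + 2) - m)))
      + (x (int L + 1) - m) * (x (int (L + j) + 1) - m) + (x (int L + 2) - m) * (x (int (L + j) + 2) - m)" by simp
  also have "(\<Sum>i=1..L. (x (int i) - m) * (x (int (i + j)) - m)) - (\<Sum>i=1..L. (x (int i) - m) * (x (int (i + j) + 2) - m))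
      = (\<Sum>i=1..L. x (int i) * (x (int (i + j)) - x (int (i + j) + 2))) - m * (\<Sum>i=1..L. x (int (i + j)) - x (int (i + j) + 2))"
    unfolding sum_subtractf[symmetric] sum_distrib_left by (intro sum.cong refl) (simp add: algebra_simps)
  finally show ?thesis unfolding telescoping_two_step by simp
qed

lemma sum_square_le_card:
  fixes f :: "'i \<Rightarrow> real"
  shows "(\<Sum>i\<in>I. f i)\<^sup>2 \<le> real (card I) * (\<Sum>i\<in>I. (f i)\<^sup>2)"
  using Cauchy_Schwarz_ineq_sum[of "\<lambda>_. 1" f I] by simp

text \<open>Jensen's inequality, from the Cauchy-Schwarz inequality applied twice.\<close>

lemma sample_mean_fourth_le: "sample_mean n x ^ 4 \<le> 1 / real n * (\<Sum>k=1..n. x (int k) ^ 4)"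
proof (cases "n = 0")
  case False
  have p4: "y ^ 4 = (y\<^sup>2)\<^sup>2" for y :: real by simp
  have "(\<Sum>k=1..n. x (int k))\<^sup>2 \<le> real n * (\<Sum>k=1..n. (x (int k))\<^sup>2)"
    using sum_square_le_card[of "\<lambda>k. x (int k)" "{1..n}"] by simp
  then have "((\<Sum>k=1..n. x (int k))\<^sup>2)\<^sup>2 \<le> (real n * (\<Sum>k=1..n. (x (int k))\<^sup>2))\<^sup>2" by (intro power_mono) auto
  also have "\<dots> \<le> (real n)\<^sup>2 * (real n * (\<Sum>k=1..n. ((x (int k))\<^sup>2)\<^sup>2))"
    unfolding power_mult_distrib using sum_square_le_card[of "\<lambda>k. (x (int k))\<^sup>2" "{1..n}"]
    by (intro mult_left_mono) auto
  finally have "(\<Sum>k=1..n. x (int k)) ^ 4 \<le> real n ^ 3 * (\<Sum>k=1..n. x (int k) ^ 4)"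
    unfolding p4 by (simp add: power3_eq_cube power2_eq_square[of "real n"] mult.assoc)
  then have "(\<Sum>k=1..n. x (int k)) ^ 4 / real n ^ 4 \<le> real n ^ 3 * (\<Sum>k=1..n. x (int k) ^ 4) / real n ^ 4"
    by (intro divide_right_mono) auto
  then show ?thesis using False
    by (simp add: sample_mean_def power_divide field_simps numeral_eq_Suc)
qed (simp add: sample_mean_def)

lemma abs_mult_square_le: "(a * b)\<^sup>2 \<le> a ^ 4 + b ^ 4" for a b :: real
proof -
  have "2 * (a\<^sup>2 * b\<^sup>2) \<le> (a\<^sup>2)\<^sup>2 + (b\<^sup>2)\<^sup>2" using sum_squares_bound[of "a\<^sup>2" "b\<^sup>2"] by simp
  moreover have "0 \<le> a\<^sup>2 * b\<^sup>2" by simp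
  ultimately have "a\<^sup>2 * b\<^sup>2 \<le> (a\<^sup>2)\<^sup>2 + (b\<^sup>2)\<^sup>2" by linarith
  then show ?thesis by (simp add: power_mult_distrib)
qed

lemma diff_fourth_le: "(a - b) ^ 4 \<le> 16 * a ^ 4 + 16 * b ^ 4" for a b :: real
proof -
  have "\<bar>a - b\<bar> ^ 4 \<le> (\<bar>a\<bar> + \<bar>b\<bar>) ^ 4" by (intro power_mono) auto
  also have "\<dots> \<le> 2 ^ 4 * \<bar>a\<bar> ^ 4 + 2 ^ 4 * \<bar>b\<bar> ^ 4" by (rule power_add_le_two_power) auto
  finally show ?thesis by (simp add: power_even_abs)
qed

context aggregated_field
begin

text \<open>The 8 bounds the square of a sum of eight terms. The fourth moments that occur have
  total weight 136, rounded up to 140.\<close>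

definition Ce :: real where "Ce = 8 * (C2 + 140 * C4 + vari\<^sup>2)"

lemma C4_nonneg: "0 \<le> C4" using ck_nonneg Bm_nonneg by (simp add: C4_def)

lemma C2_nonneg: "0 \<le> C2" using ck_nonneg Bm_nonneg by (simp add: C2_def)

lemma Ce_nonneg: "0 \<le> Ce" using C4_nonneg C2_nonneg by (simp add: Ce_def)

lemma abs_rho_le: "\<bar>rho j\<bar> \<le> vari"
proof -
  interpret Phi: prob_space \<Phi> by (rule prob_Phi)
  have "\<bar>\<integral>x. x ^ j \<partial>\<Phi>\<bar> \<le> (\<integral>x. \<bar>x ^ j\<bar> \<partial>\<Phi>)" by (rule integral_abs_bound)
  also have "\<dots> \<le> (\<integral>x. 1 \<partial>\<Phi>)"
    by (rule integral_mono_AE', simp, rule AE_I2) (auto simp: space_Phi power_abs power_le_one)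
  finally show ?thesis using vari_nonneg by (simp add: rho_def abs_mult Phi.prob_space mult_left_le)
qed

text \<open>Only the sum \<open>S\<close> over the sample has a second moment of order
  \<open>n\<close>. The boundary terms have bounded second moments, and
  \<open>(j + 2) * rho j\<close> arises because \<open>L\<close> products are centred while
  \<open>n\<close> copies of \<open>rho j\<close> are subtracted; this term is the source of the
  factor \<open>(real (j + 2))\<^sup>2\<close>.\<close>

lemma sample_cov_error:
  assumes n: "j + 2 \<le> n"
  defines "e \<equiv> \<lambda>\<omega>. sample_cov n (\<lambda>t. X t \<omega>) j - sample_cov n (\<lambda>t. X t \<omega>) (j + 2) - rho j"
  shows "integrable P (\<lambda>\<omega>. (e \<omega>)\<^sup>2)" "expectation (\<lambda>\<omega>. (e \<omega>)\<^sup>2) \<le> Ce * (real (j + 2))\<^sup>2 / real n"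
proof -
  obtain L where L: "n = L + j + 2" using n by (metis add.commute add.left_commute le_Suc_ex)
  have n1: "n \<ge> 1" using n by simp
  define x where "x \<omega> t = X t \<omega> - cX" for \<omega> t
  define m where "m \<omega> = sample_mean n (x \<omega>)" for \<omega>
  define S where "S \<omega> = (\<Sum>i=1..L. x \<omega> (int i) * (x \<omega> (int (i + j)) - x \<omega> (int (i + j) + 2)) - rho j)" for \<omega>
  have [measurable]: "(\<lambda>\<omega>. x \<omega> t) \<in> borel_measurable P" for t unfolding x_def by measurable
  have [measurable]: "m \<in> borel_measurable P" unfolding m_def[abs_def] sample_mean_def by measurable
  have Sint: "integrable P (\<lambda>\<omega>. (S \<omega>)\<^sup>2)" and SE: "expectation (\<lambda>\<omega>. (S \<omega>)\<^sup>2) \<le> real L * C2"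
  proof -
    have *: "S \<omega> = (\<Sum>t\<in>int ` {1..L}. (X t \<omega> - cX) * (X (t + int j) \<omega> - X (t + int j + 2) \<omega>) - rho j)" for \<omega>
      unfolding S_def by (subst sum.reindex) (auto simp: x_def)
    have "card (int ` {1..L}) = L" by (simp add: card_image)
    then show "integrable P (\<lambda>\<omega>. (S \<omega>)\<^sup>2)" "expectation (\<lambda>\<omega>. (S \<omega>)\<^sup>2) \<le> real L * C2"
      unfolding * using X_quadratic_moment[of "int ` {1..L}" j] by auto
  qed
  have xint: "integrable P (\<lambda>\<omega>. x \<omega> t ^ 4)" and xE: "expectation (\<lambda>\<omega>. x \<omega> t ^ 4) \<le> C4" for t
    unfolding x_def by (rule X_fourth_moment)+
  \<comment> \<open>The fourth power of the sample mean is dominated by an average of fourth powers,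
    whose expectation is known term by term.\<close>
  define m4 where "m4 \<omega> = 1 / real n * (\<Sum>k=1..n. x \<omega> (int k) ^ 4)" for \<omega>
  have m4: "m \<omega> ^ 4 \<le> m4 \<omega>" for \<omega> unfolding m_def m4_def by (rule sample_mean_fourth_le)
  have m4int: "integrable P m4" unfolding m4_def[abs_def] using xint by auto
  have m4E: "expectation m4 \<le> C4"
  proof -
    have "expectation m4 = 1 / real n * (\<Sum>k=1..n. expectation (\<lambda>\<omega>. x \<omega> (int k) ^ 4))"
      unfolding m4_def[abs_def] using xint by simp
    also have "\<dots> \<le> 1 / real n * (real n * C4)"
      using xE sum_bounded_above[of "{1..n}" "\<lambda>k. expectation (\<lambda>\<omega>. x \<omega> (int k) ^ 4)" C4] by (intro mult_left_mono) auto
    also have "\<dots> = C4" using n1 by simp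
    finally show ?thesis .
  qed
  define a b c d u w where "a = int j + 1" and "b = int j + 2" and "c = int (L + j) + 1" and "d = int (L + j) + 2"
    and "u = int L + 1" and "w = int L + 2"
  have eq: "real n * e \<omega> = S \<omega> + (x \<omega> u - m \<omega>) * (x \<omega> c - m \<omega>) + (x \<omega> w - m \<omega>) * (x \<omega> d - m \<omega>)
      - m \<omega> * x \<omega> a - m \<omega> * x \<omega> b + m \<omega> * x \<omega> c + m \<omega> * x \<omega> d - real (j + 2) * rho j" for \<omega>
  proof -
    have "e \<omega> = sample_cov n (x \<omega>) j - sample_cov n (x \<omega>) (j + 2) - rho j"
      unfolding e_def x_def by (simp add: sample_cov_shift[OF n1])
    then have "real n * e \<omega> = real n * (sample_cov n (x \<omega>) j - sample_cov n (x \<omega>) (j + 2)) - real n * rho j"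
      by (simp add: right_diff_distrib)
    also have "real n * rho j = real L * rho j + real (j + 2) * rho j" using L by (simp add: algebra_simps)
    also have "real L * rho j = (\<Sum>i=1..L. rho j)" by simp
    finally show ?thesis
      unfolding sample_cov_difference[OF L] m_def[symmetric] S_def sum_subtractf a_def b_def c_def d_def u_def w_def
      by (simp add: algebra_simps)
  qed
  define Dm where "Dm \<omega> = 8 / (real n)\<^sup>2 * ((S \<omega>)\<^sup>2
      + ((16 * x \<omega> u ^ 4 + 16 * m4 \<omega>) + (16 * x \<omega> c ^ 4 + 16 * m4 \<omega>))
      + ((16 * x \<omega> w ^ 4 + 16 * m4 \<omega>) + (16 * x \<omega> d ^ 4 + 16 * m4 \<omega>))
      + (m4 \<omega> + x \<omega> a ^ 4) + (m4 \<omega> + x \<omega> b ^ 4) + (m4 \<omega> + x \<omega> c ^ 4) + (m4 \<omega> + x \<omega> d ^ 4) + (real (j + 2) * rho j)\<^sup>2)" for \<omega>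
  have le: "(e \<omega>)\<^sup>2 \<le> Dm \<omega>" for \<omega>
  proof -
    have sq8: "(a1 + a2 + a3 - a4 - a5 + a6 + a7 - a8)\<^sup>2 \<le> 8 * (a1\<^sup>2 + a2\<^sup>2 + a3\<^sup>2 + a4\<^sup>2 + a5\<^sup>2 + a6\<^sup>2 + a7\<^sup>2 + a8\<^sup>2)"
      for a1 a2 a3 a4 a5 a6 a7 a8 :: real
    proof -
      have s2: "(p + q)\<^sup>2 \<le> 2 * p\<^sup>2 + 2 * q\<^sup>2" for p q :: real
        using sum_squares_bound[of p q] by (simp add: power2_sum)
      define p1 p2 p3 p4 where "p1 = a1 + a2" and "p2 = a3 + - a4" and "p3 = - a5 + a6" and "p4 = a7 + - a8"
      have "a1 + a2 + a3 - a4 - a5 + a6 + a7 - a8 = (p1 + p2) + (p3 + p4)"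
        by (simp add: p1_def p2_def p3_def p4_def)
      then have "(a1 + a2 + a3 - a4 - a5 + a6 + a7 - a8)\<^sup>2 \<le> 2 * (p1 + p2)\<^sup>2 + 2 * (p3 + p4)\<^sup>2"
        using s2[of "p1 + p2" "p3 + p4"] by simp
      also have "\<dots> \<le> 2 * (2 * p1\<^sup>2 + 2 * p2\<^sup>2) + 2 * (2 * p3\<^sup>2 + 2 * p4\<^sup>2)"
        by (intro add_mono mult_left_mono s2) auto
      also have "\<dots> \<le> 2 * (2 * (2 * a1\<^sup>2 + 2 * a2\<^sup>2) + 2 * (2 * a3\<^sup>2 + 2 * (- a4)\<^sup>2))
          + 2 * (2 * (2 * (- a5)\<^sup>2 + 2 * a6\<^sup>2) + 2 * (2 * a7\<^sup>2 + 2 * (- a8)\<^sup>2))"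
        unfolding p1_def p2_def p3_def p4_def by (intro add_mono mult_left_mono s2) auto
      finally show ?thesis by simp
    qed
    have z: "(x \<omega> t - m \<omega>) ^ 4 \<le> 16 * x \<omega> t ^ 4 + 16 * m4 \<omega>" for t
      using diff_fourth_le[of "x \<omega> t" "m \<omega>"] m4[of \<omega>] by linarith
    have zz: "((x \<omega> t - m \<omega>) * (x \<omega> s - m \<omega>))\<^sup>2 \<le> (16 * x \<omega> t ^ 4 + 16 * m4 \<omega>) + (16 * x \<omega> s ^ 4 + 16 * m4 \<omega>)" for t s
      using abs_mult_square_le[of "x \<omega> t - m \<omega>" "x \<omega> s - m \<omega>"] z[of t] z[of s] by linarith
    have mx: "(m \<omega> * x \<omega> t)\<^sup>2 \<le> m4 \<omega> + x \<omega> t ^ 4" for t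
      using abs_mult_square_le[of "m \<omega>" "x \<omega> t"] m4[of \<omega>] by linarith
    have "(real n * e \<omega>)\<^sup>2 \<le> 8 * ((S \<omega>)\<^sup>2 + ((x \<omega> u - m \<omega>) * (x \<omega> c - m \<omega>))\<^sup>2 + ((x \<omega> w - m \<omega>) * (x \<omega> d - m \<omega>))\<^sup>2
        + (m \<omega> * x \<omega> a)\<^sup>2 + (m \<omega> * x \<omega> b)\<^sup>2 + (m \<omega> * x \<omega> c)\<^sup>2 + (m \<omega> * x \<omega> d)\<^sup>2 + (real (j + 2) * rho j)\<^sup>2)"
      unfolding eq by (rule sq8)
    also have "\<dots> \<le> (real n)\<^sup>2 * Dm \<omega>"
    proof -
      have "(real n)\<^sup>2 * Dm \<omega> = 8 * ((S \<omega>)\<^sup>2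
        + ((16 * x \<omega> u ^ 4 + 16 * m4 \<omega>) + (16 * x \<omega> c ^ 4 + 16 * m4 \<omega>))
        + ((16 * x \<omega> w ^ 4 + 16 * m4 \<omega>) + (16 * x \<omega> d ^ 4 + 16 * m4 \<omega>))
        + (m4 \<omega> + x \<omega> a ^ 4) + (m4 \<omega> + x \<omega> b ^ 4) + (m4 \<omega> + x \<omega> c ^ 4) + (m4 \<omega> + x \<omega> d ^ 4) + (real (j + 2) * rho j)\<^sup>2)"
        using n1 by (simp add: Dm_def)
      show ?thesis
        unfolding \<open>(real n)\<^sup>2 * Dm \<omega> = _\<close> by (intro mult_left_mono add_mono zz mx order_refl) simp
    qed
    finally have "(real n)\<^sup>2 * (e \<omega>)\<^sup>2 \<le> (real n)\<^sup>2 * Dm \<omega>" by (simp add: power_mult_distrib)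
    then show ?thesis using n1 by simp
  qed
  have Dmint: "integrable P Dm"
    unfolding Dm_def[abs_def] using Sint xint m4int by auto
  have [measurable]: "e \<in> borel_measurable P"
    unfolding e_def sample_cov_def sample_mean_def by measurable
  show ei: "integrable P (\<lambda>\<omega>. (e \<omega>)\<^sup>2)"
    using le by (intro Bochner_Integration.integrable_bound[OF Dmint]) (auto intro!: AE_I2 order_trans[OF le abs_ge_self])
  have "expectation (\<lambda>\<omega>. (e \<omega>)\<^sup>2) \<le> expectation Dm" by (rule integral_mono[OF ei Dmint le])
  also have "expectation Dm = 8 / (real n)\<^sup>2 * (expectation (\<lambda>\<omega>. (S \<omega>)\<^sup>2)
      + ((16 * expectation (\<lambda>\<omega>. x \<omega> u ^ 4) + 16 * expectation m4) + (16 * expectation (\<lambda>\<omega>. x \<omega> c ^ 4) + 16 * expectation m4))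
      + ((16 * expectation (\<lambda>\<omega>. x \<omega> w ^ 4) + 16 * expectation m4) + (16 * expectation (\<lambda>\<omega>. x \<omega> d ^ 4) + 16 * expectation m4))
      + (expectation m4 + expectation (\<lambda>\<omega>. x \<omega> a ^ 4)) + (expectation m4 + expectation (\<lambda>\<omega>. x \<omega> b ^ 4))
      + (expectation m4 + expectation (\<lambda>\<omega>. x \<omega> c ^ 4)) + (expectation m4 + expectation (\<lambda>\<omega>. x \<omega> d ^ 4)) + (real (j + 2) * rho j)\<^sup>2)"
    unfolding Dm_def[abs_def] using Sint xint m4int by (simp add: prob_space)
  also have "\<dots> \<le> 8 / (real n)\<^sup>2 * (real n * C2 + 136 * C4 + (real (j + 2))\<^sup>2 * vari\<^sup>2)"
  proof (intro mult_left_mono)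
    have "real L * C2 \<le> real n * C2" using L C2_nonneg by (intro mult_right_mono) auto
    moreover have "(real (j + 2) * rho j)\<^sup>2 \<le> (real (j + 2))\<^sup>2 * vari\<^sup>2"
      unfolding power_mult_distrib using abs_rho_le[of j] power_mono[OF abs_rho_le[of j], of 2] by (intro mult_left_mono) auto
    ultimately show "expectation (\<lambda>\<omega>. (S \<omega>)\<^sup>2)
      + ((16 * expectation (\<lambda>\<omega>. x \<omega> u ^ 4) + 16 * expectation m4) + (16 * expectation (\<lambda>\<omega>. x \<omega> c ^ 4) + 16 * expectation m4))
      + ((16 * expectation (\<lambda>\<omega>. x \<omega> w ^ 4) + 16 * expectation m4) + (16 * expectation (\<lambda>\<omega>. x \<omega> d ^ 4) + 16 * expectation m4))
      + (expectation m4 + expectation (\<lambda>\<omega>. x \<omega> a ^ 4)) + (expectation m4 + expectation (\<lambda>\<omega>. x \<omega> b ^ 4))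
      + (expectation m4 + expectation (\<lambda>\<omega>. x \<omega> c ^ 4)) + (expectation m4 + expectation (\<lambda>\<omega>. x \<omega> d ^ 4)) + (real (j + 2) * rho j)\<^sup>2
     \<le> real n * C2 + 136 * C4 + (real (j + 2))\<^sup>2 * vari\<^sup>2"
      using SE m4E xE[of u] xE[of c] xE[of w] xE[of d] xE[of a] xE[of b] by linarith
  qed simp
  also have "\<dots> \<le> 8 / (real n)\<^sup>2 * (real n * (real (j + 2))\<^sup>2 * (C2 + 140 * C4 + vari\<^sup>2))"
  proof (intro mult_left_mono)
    define J where "J = (real (j + 2))\<^sup>2"
    have J: "1 \<le> J" unfolding J_def by (rule one_le_power) simp
    have n': "1 \<le> real n" using n1 by simp
    have "real n * C2 * 1 \<le> real n * C2 * J" using J C2_nonneg by (intro mult_left_mono) auto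
    moreover have "136 * C4 \<le> (140 * C4) * (real n * J)"
    proof -
      have "1 * 1 \<le> real n * J" using J n' by (intro mult_mono) auto
      then have "136 * C4 * 1 \<le> (140 * C4) * (real n * J)" using C4_nonneg by (intro mult_mono) auto
      then show ?thesis by simp
    qed
    moreover have "1 * (J * vari\<^sup>2) \<le> real n * (J * vari\<^sup>2)" using n' J by (intro mult_right_mono) auto
    ultimately show "real n * C2 + 136 * C4 + (real (j + 2))\<^sup>2 * vari\<^sup>2 \<le> real n * (real (j + 2))\<^sup>2 * (C2 + 140 * C4 + vari\<^sup>2)"
      unfolding J_def[symmetric] by (simp add: algebra_simps)
  qed simp
  also have "\<dots> = Ce * (real (j + 2))\<^sup>2 / real n"
    using n1 by (simp add: Ce_def power2_eq_square field_simps)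
  finally show "expectation (\<lambda>\<omega>. (e \<omega>)\<^sup>2) \<le> Ce * (real (j + 2))\<^sup>2 / real n" .
qed

end

section \<open>Growth of the coefficients of Gegenbauer polynomials\<close>

definition coeff_norm :: "real poly \<Rightarrow> real" where
  "coeff_norm p = (\<Sum>i\<le>degree p. \<bar>coeff p i\<bar>)"

lemma coeff_norm_eq: "degree p \<le> n \<Longrightarrow> coeff_norm p = (\<Sum>i\<le>n. \<bar>coeff p i\<bar>)"
  unfolding coeff_norm_def by (intro sum.mono_neutral_left) (auto simp: coeff_eq_0)

lemma coeff_norm_add_le: "coeff_norm (p + q) \<le> coeff_norm p + coeff_norm q"
proof -
  define n where "n = max (degree p) (degree q)"
  have "degree (p + q) \<le> n" "degree p \<le> n" "degree q \<le> n" using degree_add_le_max[of p q] by (auto simp: n_def)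
  then show ?thesis
    by (simp add: coeff_norm_eq[of _ n] sum.distrib[symmetric] sum_mono abs_triangle_ineq)
qed

lemma coeff_norm_smult: "coeff_norm (smult c p) = \<bar>c\<bar> * coeff_norm p"
  by (simp add: coeff_norm_eq[of _ "degree p"] degree_smult_le abs_mult sum_distrib_left)

lemma coeff_norm_minus: "coeff_norm (- p) = coeff_norm p"
  by (simp add: coeff_norm_def)

lemma coeff_norm_pCons_0: "coeff_norm (pCons 0 p) = coeff_norm p"
proof -
  have "coeff_norm (pCons 0 p) = (\<Sum>i\<le>Suc (degree p). \<bar>coeff (pCons 0 p) i\<bar>)"
    by (rule coeff_norm_eq) (rule degree_pCons_le)
  also have "\<dots> = coeff_norm p" by (simp add: coeff_norm_def sum.atMost_Suc_shift del: sum.atMost_Suc)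
  finally show ?thesis .
qed

lemma coeff_norm_sum_le: "finite A \<Longrightarrow> coeff_norm (\<Sum>a\<in>A. f a) \<le> (\<Sum>a\<in>A. coeff_norm (f a))"
  by (induction A rule: finite_induct) (auto simp: coeff_norm_def[of 0] intro: order_trans[OF coeff_norm_add_le])

text \<open>Chebyshev polynomials of the second kind. Their coefficients satisfy the recurrence of the powers of
  \<open>1 + \<surd>2\<close>, the larger root of \<open>x\<^sup>2 = 2 x + 1\<close>.\<close>

fun ChebU :: "nat \<Rightarrow> real poly" where
  "ChebU 0 = 1"
| "ChebU (Suc 0) = [:0, 2:]"
| "ChebU (Suc (Suc n)) = [:0, 2:] * ChebU (Suc n) - ChebU n"

lemma ChebU_degree: "degree (ChebU n) = n \<and> lead_coeff (ChebU n) = 2 ^ n"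
proof (induction n rule: ChebU.induct)
  case (3 n)
  have d1: "degree (ChebU (Suc n)) = Suc n" using 3 by blast
  have l1: "coeff (ChebU (Suc n)) (Suc n) = 2 ^ Suc n" using 3 d1 by metis
  have nz: "ChebU (Suc n) \<noteq> 0" using d1 by auto
  have d: "degree ([:0, 2:] * ChebU (Suc n)) = Suc (Suc n)"
    using 3 nz by (subst degree_mult_eq) auto
  have "degree (ChebU n) < degree ([:0, 2:] * ChebU (Suc n))" using 3 d by simp
  then have "degree (ChebU (Suc (Suc n))) = Suc (Suc n)"
    using d degree_add_eq_left[of "- ChebU n" "[:0, 2:] * ChebU (Suc n)"] by (simp del: mult_pCons_left)
  moreover have "coeff (ChebU (Suc (Suc n))) (Suc (Suc n)) = 2 ^ Suc (Suc n)"
    using 3 l1 by (simp add: coeff_eq_0)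
  ultimately show ?case by simp
qed auto

lemma ChebU_nonzero: "ChebU n \<noteq> 0"
  using ChebU_degree[of n] by auto

lemma ChebU_sin: "sin t * poly (ChebU n) (cos t) = sin (real (Suc n) * t)"
proof (induction n rule: ChebU.induct)
  case (3 n)
  have "sin (real (Suc (Suc (Suc n))) * t) = 2 * cos t * sin (real (Suc (Suc n)) * t) - sin (real (Suc n) * t)"
  proof -
    have e: "real (Suc (Suc (Suc n))) * t = real (Suc (Suc n)) * t + t" "real (Suc n) * t = real (Suc (Suc n)) * t - t"
      by (auto simp: algebra_simps)
    show ?thesis unfolding e sin_add sin_diff by simp
  qed
  then show ?case using 3 by (simp add: algebra_simps)
next
  case 2
  have "sin (real (Suc (Suc 0)) * t) = sin (2 * t)" by simp
  then show ?case by (simp add: sin_double)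
qed auto

lemma coeff_norm_ChebU: "coeff_norm (ChebU n) \<le> (1 + sqrt 2) ^ Suc n"
proof (induction n rule: ChebU.induct)
  case (3 n)
  have "coeff_norm (ChebU (Suc (Suc n))) = coeff_norm (smult 2 (pCons 0 (ChebU (Suc n))) + smult (-1) (ChebU n))"
    by simp
  also have "\<dots> \<le> 2 * coeff_norm (ChebU (Suc n)) + coeff_norm (ChebU n)"
    by (rule order_trans[OF coeff_norm_add_le]) (simp add: coeff_norm_smult coeff_norm_minus coeff_norm_pCons_0 del: smult_pCons)
  also have "\<dots> \<le> 2 * (1 + sqrt 2) ^ Suc (Suc n) + (1 + sqrt 2) ^ Suc n" using 3 by simp
  also have "\<dots> = (1 + sqrt 2) ^ Suc n * (2 * (1 + sqrt 2) + 1)" by (simp add: algebra_simps)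
  also have "2 * (1 + sqrt 2) + 1 = (1 + sqrt 2) * (1 + sqrt (2::real))" by (simp add: algebra_simps)
  also have "(1 + sqrt 2) ^ Suc n * ((1 + sqrt 2) * (1 + sqrt 2)) = (1 + sqrt (2::real)) ^ Suc (Suc (Suc n))"
    by (simp only: power_Suc mult_ac)
  finally show ?case .
qed (auto simp: coeff_norm_def algebra_simps)

lemma graded_basis_expansion:
  fixes G :: "nat \<Rightarrow> 'a :: field poly"
  assumes G: "\<And>m. G m \<noteq> 0" "\<And>m. degree (G m) = m" and "degree p \<le> n"
  shows "\<exists>c. p = (\<Sum>m\<le>n. smult (c m) (G m))"
  using assms(3)
proof (induction n arbitrary: p)
  case 0
  then obtain b where "p = [:b:]" by (auto elim: degree_eq_zeroE)
  moreover obtain a where "G 0 = [:a:]" using G(2)[of 0] by (auto elim: degree_eq_zeroE)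
  ultimately show ?case using G(1)[of 0] by (intro exI[of _ "\<lambda>_. b / a"]) simp
next
  case (Suc n)
  define c where "c = coeff p (Suc n) / coeff (G (Suc n)) (Suc n)"
  have lc: "coeff (G (Suc n)) (Suc n) \<noteq> 0" using G[of "Suc n"] by (metis leading_coeff_0_iff)
  have "degree (p - smult c (G (Suc n))) \<le> n"
  proof (rule degree_le, intro allI impI)
    fix i assume i: "n < i"
    show "coeff (p - smult c (G (Suc n))) i = 0"
    proof (cases "i = Suc n")
      case True
      then show ?thesis using lc by (simp add: c_def)
    next
      case False
      then have "Suc n < i" using i by simp
      then show ?thesis using Suc.prems G(2)[of "Suc n"] by (simp add: coeff_eq_0)
    qed
  qed
  from Suc.IH[OF this] obtain c' where c': "p - smult c (G (Suc n)) = (\<Sum>m\<le>n. smult (c' m) (G m))" by blast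
  have "p = (\<Sum>m\<le>Suc n. smult ((c'(Suc n := c)) m) (G m))"
    using c' by (simp add: algebra_simps)
  then show ?case by blast
qed

lemma integral_sin_sin:
  fixes m k :: nat
  shows "((\<lambda>t. sin (real (Suc m) * t) * sin (real (Suc k) * t)) has_integral (if m = k then pi / 2 else 0)) {0..pi}"
proof -
  have c: "((\<lambda>t. cos (of_int j * t)) has_integral (if j = 0 then pi else 0)) {0..pi}" for j :: int
  proof (cases "j = 0")
    case True
    then show ?thesis using has_integral_const_real[of "1::real" 0 pi] by simp
  next
    case False
    have "((\<lambda>t. cos (of_int j * t)) has_integral (sin (of_int j * pi) / of_int j - sin (of_int j * 0) / of_int j)) {0..pi}"
      using False
      by (intro fundamental_theorem_of_calculus)
         (auto intro!: derivative_eq_intros simp: has_real_derivative_iff_has_vector_derivative[symmetric])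
    then show ?thesis using False by (simp add: sin_int_times_real mult.commute[of _ pi] sin_times_pi_eq_0)
  qed
  have "((\<lambda>t. (cos (of_int (int m - int k) * t) - cos (of_int (int m + int k + 2) * t)) / 2) has_integral
      ((if int m - int k = 0 then pi else 0) - (if int m + int k + 2 = 0 then pi else 0)) / 2) {0..pi}"
    by (intro has_integral_divide has_integral_diff c)
  moreover have "(cos (of_int (int m - int k) * t) - cos (of_int (int m + int k + 2) * t)) / 2
      = sin (real (Suc m) * t) * sin (real (Suc k) * t)" for t
    unfolding sin_times_sin by (simp add: algebra_simps)
  ultimately show ?thesis by (auto split: if_splits)
qed

lemma poly_antiderivative: "\<exists>q :: real poly. pderiv q = p"
proof (induction p)
  case 0
  show ?case by (intro exI[of _ 0]) simp
next
  case (pCons a p)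
  define q where "q = (\<Sum>i\<le>degree (pCons a p). monom (coeff (pCons a p) i / real (Suc i)) (Suc i))"
  have "pderiv q = (\<Sum>i\<le>degree (pCons a p). monom (coeff (pCons a p) i) i)"
  proof -
    have "pderiv (\<Sum>i\<in>A. f i) = (\<Sum>i\<in>A. pderiv (f i))" if "finite A" for A and f :: "nat \<Rightarrow> real poly"
      using that by (induction A rule: finite_induct) (auto simp: pderiv_add)
    then show ?thesis unfolding q_def by (simp add: pderiv_monom del: of_nat_Suc)
  qed
  then show ?case using poly_as_sum_of_monoms[of "pCons a p"] by auto
qed

text \<open>The substitution x = cos t, carried out on a polynomial antiderivative.\<close>

lemma has_integral_poly_cos_sin:
  fixes p :: "real poly"
  shows "((\<lambda>t. poly p (cos t) * sin t) has_integral integral {-1..1} (poly p)) {0..pi}"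
proof -
  obtain q where q: "pderiv q = p" using poly_antiderivative by blast
  have "(poly p has_integral (poly q 1 - poly q (-1))) {-1..1}"
    using q by (intro fundamental_theorem_of_calculus)
      (auto intro!: derivative_eq_intros simp: has_real_derivative_iff_has_vector_derivative[symmetric] poly_DERIV[of q, unfolded q])
  then have i: "integral {-1..1} (poly p) = poly q 1 - poly q (-1)" by (rule integral_unique)
  have "((\<lambda>t. poly p (cos t) * sin t) has_integral (- poly q (cos pi) - (- poly q (cos 0)))) {0..pi}"
  proof (rule fundamental_theorem_of_calculus)
    fix t :: real
    have "((\<lambda>t. poly q (cos t)) has_real_derivative (poly (pderiv q) (cos t) * (- sin t))) (at t within {0..pi})"
      by (rule DERIV_chain2[OF poly_DERIV]) (auto intro!: derivative_eq_intros)
    from DERIV_minus[OF this] show "((\<lambda>t. - poly q (cos t)) has_vector_derivative poly p (cos t) * sin t) (at t within {0..pi})"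
      by (simp add: q has_real_derivative_iff_has_vector_derivative)
  qed simp
  then show ?thesis by (simp add: i)
qed

text \<open>With x = cos t, \<open>sin t * poly p (cos t)\<close> is a sine polynomial with
  coefficients \<open>c m\<close>, whose squared norm is pi / 2 times the sum of their squares.
  Replacing sin^2 by sin on \<open>[0, pi]\<close> bounds that norm by the unweighted L2 norm of
  \<open>p\<close>, although the \<open>ChebU m\<close> are orthogonal for another weight.\<close>

lemma ChebU_coeffs_le:
  assumes p: "p = (\<Sum>m\<le>n. smult (c m) (ChebU m))"
  shows "(\<Sum>m\<le>n. (c m)\<^sup>2) \<le> integral {-1..1} (\<lambda>x. (poly p x)\<^sup>2)"
proof -
  have s: "sin t * poly p (cos t) = (\<Sum>m\<le>n. c m * sin (real (Suc m) * t))" for t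
    unfolding p poly_sum sum_distrib_left
    by (intro sum.cong refl, unfold ChebU_sin[symmetric]) simp
  have "((\<lambda>t. \<Sum>m\<le>n. \<Sum>k\<le>n. c m * c k * (sin (real (Suc m) * t) * sin (real (Suc k) * t))) has_integral
      (\<Sum>m\<le>n. \<Sum>k\<le>n. c m * c k * (if m = k then pi / 2 else 0))) {0..pi}"
    by (intro has_integral_sum has_integral_mult_right integral_sin_sin) auto
  moreover have "(\<Sum>m\<le>n. \<Sum>k\<le>n. c m * c k * (sin (real (Suc m) * t) * sin (real (Suc k) * t))) = (sin t * poly p (cos t))\<^sup>2" for t
    unfolding s power2_eq_square sum_product by (intro sum.cong refl) (simp only: mult_ac)
  moreover have "(\<Sum>m\<le>n. \<Sum>k\<le>n. c m * c k * (if m = k then pi / 2 else 0)) = pi / 2 * (\<Sum>m\<le>n. (c m)\<^sup>2)"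
  proof -
    have "(\<Sum>m\<le>n. \<Sum>k\<le>n. c m * c k * (if m = k then pi / 2 else 0)) = (\<Sum>m\<le>n. \<Sum>k\<le>n. if m = k then c m * c k * (pi / 2) else 0)"
      by (intro sum.cong refl) simp
    then show ?thesis by (simp add: sum.delta power2_eq_square sum_distrib_left mult_ac)
  qed
  ultimately have 1: "((\<lambda>t. (sin t * poly p (cos t))\<^sup>2) has_integral pi / 2 * (\<Sum>m\<le>n. (c m)\<^sup>2)) {0..pi}" by simp
  have 2: "((\<lambda>t. poly (p * p) (cos t) * sin t) has_integral integral {-1..1} (poly (p * p))) {0..pi}"
    by (rule has_integral_poly_cos_sin)
  have "pi / 2 * (\<Sum>m\<le>n. (c m)\<^sup>2) \<le> integral {-1..1} (poly (p * p))"
  proof (rule has_integral_le[OF 1 2])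
    fix t :: real assume t: "t \<in> {0..pi}"
    have "(sin t)\<^sup>2 \<le> sin t * 1" unfolding power2_eq_square using sin_ge_zero[of t] t by (intro mult_left_mono) auto
    then have "(sin t)\<^sup>2 * (poly p (cos t))\<^sup>2 \<le> sin t * (poly p (cos t))\<^sup>2" by (intro mult_right_mono) auto
    then show "(sin t * poly p (cos t))\<^sup>2 \<le> poly (p * p) (cos t) * sin t"
      by (simp add: power_mult_distrib power2_eq_square mult_ac)
  qed
  moreover have "1 * (\<Sum>m\<le>n. (c m)\<^sup>2) \<le> pi / 2 * (\<Sum>m\<le>n. (c m)\<^sup>2)"
    using pi_ge_two by (intro mult_right_mono sum_nonneg) auto
  moreover have "poly (p * p) = (\<lambda>x. (poly p x)\<^sup>2)" by (auto simp: power2_eq_square)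
  ultimately show ?thesis by simp
qed

text \<open>Every Chebyshev coefficient of \<open>p\<close> is at most 1 in modulus, so the
  coefficient norms of the \<open>Suc n\<close> Chebyshev polynomials simply add up.\<close>

lemma coeff_norm_le_L2:
  assumes d: "degree p \<le> n" and i: "integral {-1..1} (\<lambda>x. (poly p x)\<^sup>2) \<le> 1"
  shows "coeff_norm p \<le> real (Suc n) * (1 + sqrt 2) ^ Suc n"
proof -
  obtain c where c: "p = (\<Sum>m\<le>n. smult (c m) (ChebU m))"
    using graded_basis_expansion[of ChebU p n, OF ChebU_nonzero _ d] ChebU_degree by blast
  have s1: "1 \<le> 1 + sqrt (2::real)" by simp
  have c1: "\<bar>c m\<bar> \<le> 1" if "m \<le> n" for m
  proof -
    have "(c m)\<^sup>2 \<le> (\<Sum>m\<le>n. (c m)\<^sup>2)" using that by (intro member_le_sum) auto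
    also have "\<dots> \<le> 1" using ChebU_coeffs_le[OF c] i by linarith
    finally show ?thesis by (simp add: abs_square_le_1)
  qed
  have "coeff_norm p \<le> (\<Sum>m\<le>n. coeff_norm (smult (c m) (ChebU m)))" unfolding c by (rule coeff_norm_sum_le) simp
  also have "\<dots> \<le> (\<Sum>m\<le>n. 1 * (1 + sqrt 2) ^ Suc n)"
    unfolding coeff_norm_smult
  proof (intro sum_mono mult_mono)
    fix m assume m: "m \<in> {..n}"
    show "\<bar>c m\<bar> \<le> 1" using c1 m by simp
    have "coeff_norm (ChebU m) \<le> (1 + sqrt 2) ^ Suc m" by (rule coeff_norm_ChebU)
    also have "\<dots> \<le> (1 + sqrt 2) ^ Suc n" using m by (intro power_increasing s1) auto
    finally show "coeff_norm (ChebU m) \<le> (1 + sqrt 2) ^ Suc n" .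
  qed (auto simp: coeff_norm_def sum_nonneg)
  finally show ?thesis by simp
qed

text \<open>The coefficients of \<open>p\<close> are the partial sums \<open>P\<^sub>i + P\<^sub>i\<^sub>-\<^sub>2 + P\<^sub>i\<^sub>-\<^sub>4 + \<dots>\<close> of those of
  \<open>P = (1 - x\<^sup>2) p\<close>.\<close>

lemma coeff_norm_divide_one_minus_square:
  fixes p :: "real poly"
  shows "coeff_norm p \<le> real (Suc (degree p)) * coeff_norm ([:1, 0, -1:] * p)"
proof -
  define P where "P = [:1, 0, -1:] * p"
  have P0: "coeff P 0 = coeff p 0" "coeff P (Suc 0) = coeff p (Suc 0)" and PS: "coeff P (Suc (Suc i)) = coeff p (Suc (Suc i)) - coeff p i" for i
    by (auto simp: P_def coeff_pCons split: nat.split)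
  have ab: "\<bar>coeff p i\<bar> \<le> (\<Sum>k\<le>i. \<bar>coeff P k\<bar>)" for i
  proof (induction i rule: induct_nat_012)
    case (ge2 i)
    have "\<bar>coeff p (Suc (Suc i))\<bar> \<le> \<bar>coeff P (Suc (Suc i))\<bar> + \<bar>coeff p i\<bar>" using PS[of i] by linarith
    also have "\<dots> \<le> \<bar>coeff P (Suc (Suc i))\<bar> + (\<Sum>k\<le>i. \<bar>coeff P k\<bar>)" using ge2 by simp
    also have "\<dots> \<le> (\<Sum>k\<le>Suc (Suc i). \<bar>coeff P k\<bar>)" by simp
    finally show ?case .
  qed (auto simp: P0)
  have "coeff_norm p \<le> (\<Sum>i\<le>degree p. coeff_norm P)"
    unfolding coeff_norm_def[of p]
  proof (rule sum_mono)
    fix i assume "i \<in> {..degree p}"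
    have "(\<Sum>k\<le>i. \<bar>coeff P k\<bar>) \<le> (\<Sum>k\<le>max i (degree P). \<bar>coeff P k\<bar>)" by (intro sum_mono2) auto
    also have "\<dots> = coeff_norm P" by (rule coeff_norm_eq[symmetric]) simp
    finally show "\<bar>coeff p i\<bar> \<le> coeff_norm P" using ab[of i] by linarith
  qed
  then show ?thesis by (simp add: P_def)
qed

lemma coeff_norm_divide_power:
  fixes p :: "real poly"
  shows "coeff_norm p \<le> real (Suc (degree p + 2 * r)) ^ r * coeff_norm ([:1, 0, -1:] ^ r * p)"
proof (induction r arbitrary: p)
  case (Suc r)
  have d: "degree ([:1, 0, -1:] * p) \<le> degree p + 2" using degree_mult_le[of "[:1, 0, -1:]" p] by simp
  have nn: "0 \<le> coeff_norm q" for q by (simp add: coeff_norm_def sum_nonneg)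
  have "coeff_norm p \<le> real (Suc (degree p)) * coeff_norm ([:1, 0, -1:] * p)"
    by (rule coeff_norm_divide_one_minus_square)
  also have "\<dots> \<le> real (Suc (degree p)) * (real (Suc (degree ([:1, 0, -1:] * p) + 2 * r)) ^ r * coeff_norm ([:1, 0, -1:] ^ r * ([:1, 0, -1:] * p)))"
    by (intro mult_left_mono Suc.IH) auto
  also have "\<dots> \<le> real (Suc (degree p + 2 * Suc r)) * (real (Suc (degree p + 2 * Suc r)) ^ r * coeff_norm ([:1, 0, -1:] ^ r * ([:1, 0, -1:] * p)))"
    using d by (intro mult_mono power_mono nn mult_nonneg_nonneg) auto
  also have "\<dots> = real (Suc (degree p + 2 * Suc r)) ^ Suc r * coeff_norm ([:1, 0, -1:] ^ Suc r * p)"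
    by (simp add: mult_ac del: mult_pCons_left mult_pCons_right of_nat_Suc)
  finally show ?case .
qed simp

lemma power_times_geometric_tendsto_0:
  fixes c :: real
  assumes c: "0 < c" "c < 1"
  shows "(\<lambda>n. real n ^ k * c ^ n) \<longlonglongrightarrow> 0"
proof -
  define d where "d = - ln c"
  have d: "0 < d" using c by (simp add: d_def)
  have "filterlim (\<lambda>n. real n * d) at_top sequentially"
    by (rule filterlim_at_top_mult_tendsto_pos[OF tendsto_const d filterlim_real_sequentially])
  then have "(\<lambda>n. (real n * d) ^ k / exp (real n * d)) \<longlonglongrightarrow> 0"
    by (rule filterlim_compose[OF tendsto_power_div_exp_0])
  then have "(\<lambda>n. (real n * d) ^ k / exp (real n * d) / d ^ k) \<longlonglongrightarrow> 0 / d ^ k"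
    using d by (intro tendsto_divide tendsto_const) auto
  moreover have "(real n * d) ^ k / exp (real n * d) / d ^ k = real n ^ k * c ^ n" for n
  proof -
    have "exp (real n * d) = inverse (c ^ n)"
      unfolding exp_of_nat_mult using c by (simp add: d_def exp_minus power_inverse)
    then show ?thesis using d by (simp add: power_mult_distrib divide_inverse)
  qed
  ultimately show ?thesis by simp
qed

text \<open>Multiplication by a power of 1 - x^2 removes the weight: \<open>H n\<close> has
  unweighted L2 norm at most 1, so the Chebyshev bound applies to it. Dividing the power out again
  costs only a factor polynomial in \<open>n\<close>, which the strict inequality for
  \<open>s\<close> absorbs.\<close>

lemma coeff_norm_growth:
  fixes G :: "nat \<Rightarrow> real poly" and q s :: real
  assumes deg: "\<And>n. degree (G n) = n"
    and int: "\<And>n. (LBINT x:{-1<..<1}. poly (G n) x * poly (G n) x * (1 - x\<^sup>2) powr q) = 1"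
    and s: "1 + sqrt 2 < s"
  shows "\<exists>C\<ge>0. \<forall>n. coeff_norm (G n) \<le> C * s ^ n"
proof -
  \<comment> \<open>\<open>2 * r >= q\<close> makes \<open>(1 - x^2)^(2 r)\<close> at most the
    weight; for negative \<open>q\<close> this is \<open>r = 0\<close>.\<close>
  define r where "r = nat \<lceil>q\<rceil>"
  have r: "q \<le> 2 * real r" unfolding r_def by linarith
  define H where "H n = [:1, 0, -1:] ^ r * G n" for n
  have Hd: "degree (H n) \<le> n + 2 * r" for n
  proof -
    have "degree (H n) \<le> degree ([:1, 0, -1:] ^ r :: real poly) + degree (G n)" unfolding H_def by (rule degree_mult_le)
    also have "degree ([:1, 0, -1:] ^ r :: real poly) \<le> degree [:1, 0, -1 :: real:] * r" by (rule degree_power_le)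
    finally show ?thesis by (simp add: deg)
  qed
  have Hp: "(poly (H n) x)\<^sup>2 \<le> poly (G n) x * poly (G n) x * (1 - x\<^sup>2) powr q" if x: "x \<in> {-1<..<1}" for n x
  proof -
    have w: "0 < 1 - x\<^sup>2" "1 - x\<^sup>2 \<le> 1" using x by (auto simp: abs_square_less_1[unfolded abs_less_iff])
    have "((1 - x\<^sup>2) ^ r)\<^sup>2 = (1 - x\<^sup>2) ^ (2 * r)" by (rule power_even_eq[symmetric])
    also have "\<dots> = (1 - x\<^sup>2) powr real (2 * r)" by (rule powr_realpow[OF w(1), symmetric])
    also have "\<dots> = (1 - x\<^sup>2) powr (2 * real r)" by simp
    also have "\<dots> \<le> (1 - x\<^sup>2) powr q" using w r by (intro powr_mono') auto
    finally have "((1 - x\<^sup>2) ^ r)\<^sup>2 * (poly (G n) x)\<^sup>2 \<le> (1 - x\<^sup>2) powr q * (poly (G n) x)\<^sup>2" by (intro mult_right_mono) auto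
    moreover have "poly (H n) x = (1 - x\<^sup>2) ^ r * poly (G n) x" by (simp add: H_def poly_power power2_eq_square)
    ultimately show ?thesis by (simp add: power_mult_distrib power2_eq_square mult_ac)
  qed
  have Hi: "integral {-1..1} (\<lambda>x. (poly (H n) x)\<^sup>2) \<le> 1" for n
  proof -
    \<comment> \<open>A non-integrable function would have integral 0 by convention, so the value 1
      proves integrability.\<close>
    have i1: "set_integrable lborel {-1<..<1} (\<lambda>x. poly (G n) x * poly (G n) x * (1 - x\<^sup>2) powr q)"
      using int[of n] not_integrable_integral_eq unfolding set_lebesgue_integral_def set_integrable_def by fastforce
    have i2: "set_integrable lborel {-1<..<1} (\<lambda>x. (poly (H n) x)\<^sup>2)"
    proof (rule set_integrable_subset[of _ "{-1..1}"])
      show "set_integrable lborel {-1..1} (\<lambda>x. (poly (H n) x)\<^sup>2)"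
        by (rule borel_integrable_atLeastAtMost') (auto intro!: continuous_intros)
    qed auto
    have "integral {-1..1} (\<lambda>x. (poly (H n) x)\<^sup>2) = integral {-1<..<1} (\<lambda>x. (poly (H n) x)\<^sup>2)"
      by (rule integral_open_interval_real)
    also have "\<dots> = (LBINT x:{-1<..<1}. (poly (H n) x)\<^sup>2)" by (rule set_borel_integral_eq_integral(2)[OF i2, symmetric])
    also have "\<dots> \<le> (LBINT x:{-1<..<1}. poly (G n) x * poly (G n) x * (1 - x\<^sup>2) powr q)"
      by (rule set_integral_mono[OF i2 i1 Hp])
    finally show ?thesis using int[of n] by simp
  qed
  define a where "a = 1 + sqrt (2::real)"
  have a: "1 \<le> a" "a < s" using s by (auto simp: a_def)
  define N where "N n = real (Suc (n + 2 * r))" for n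
  have bound: "coeff_norm (G n) \<le> N n ^ Suc r * a ^ Suc (n + 2 * r)" for n
  proof -
    have "coeff_norm (G n) \<le> N n ^ r * coeff_norm (H n)"
      using coeff_norm_divide_power[of "G n" r] by (simp add: deg H_def N_def)
    also have "\<dots> \<le> N n ^ r * (N n * a ^ Suc (n + 2 * r))"
      using coeff_norm_le_L2[OF Hd Hi, of n] by (intro mult_left_mono) (auto simp: N_def a_def)
    finally show ?thesis by (simp add: mult_ac)
  qed
  have "(\<lambda>n. N n ^ Suc r * a ^ Suc (n + 2 * r) / s ^ n) \<longlonglongrightarrow> 0"
  proof -
    have as: "0 < a / s" "a / s < 1" using a by auto
    have "(\<lambda>n. real n ^ Suc r * (a / s) ^ n) \<longlonglongrightarrow> 0"
      using as by (intro power_times_geometric_tendsto_0)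
    then have l: "(\<lambda>n. real (n + Suc (2 * r)) ^ Suc r * (a / s) ^ (n + Suc (2 * r))) \<longlonglongrightarrow> 0" by (rule LIMSEQ_ignore_initial_segment)
    have "(\<lambda>n. s ^ Suc (2 * r) * (real (n + Suc (2 * r)) ^ Suc r * (a / s) ^ (n + Suc (2 * r)))) \<longlonglongrightarrow> s ^ Suc (2 * r) * 0"
      by (intro tendsto_intros l)
    moreover have "s ^ Suc (2 * r) * (real (n + Suc (2 * r)) ^ Suc r * (a / s) ^ (n + Suc (2 * r))) = N n ^ Suc r * a ^ Suc (n + 2 * r) / s ^ n" for n
      using a by (simp add: N_def power_divide power_add field_simps)
    ultimately show ?thesis by simp
  qed
  then have "Bseq (\<lambda>n. N n ^ Suc r * a ^ Suc (n + 2 * r) / s ^ n)" by (intro convergent_imp_Bseq convergentI)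
  then obtain C where C: "0 < C" "\<And>n. norm (N n ^ Suc r * a ^ Suc (n + 2 * r) / s ^ n) \<le> C" by (auto elim: BseqE)
  have "coeff_norm (G n) \<le> C * s ^ n" for n
  proof -
    have "N n ^ Suc r * a ^ Suc (n + 2 * r) / s ^ n \<le> C" using C(2)[of n] unfolding real_norm_def by (rule order_trans[OF abs_ge_self])
    then have "N n ^ Suc r * a ^ Suc (n + 2 * r) \<le> C * s ^ n" using a by (simp add: divide_le_eq)
    then show ?thesis using bound[of n] by linarith
  qed
  then show ?thesis using C(1) by (intro exI[of _ C]) auto
qed

section \<open>Orthogonal expansion\<close>

lemma real_polynomial_function_poly:
  fixes g :: "real \<Rightarrow> real"
  assumes "real_polynomial_function g"
  shows "\<exists>p. g = poly p"
  using assms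
proof (induction rule: real_polynomial_function.induct)
  case (linear f)
  then obtain c where "f = (\<lambda>x. x * c)" using real_bounded_linear by auto
  then show ?case by (intro exI[of _ "[:0, c:]"]) (auto simp: mult.commute)
next
  case (const c)
  show ?case by (intro exI[of _ "[:c:]"]) auto
next
  case (add f g)
  then obtain p q where "f = poly p" "g = poly q" by blast
  then show ?case by (intro exI[of _ "p + q"]) auto
next
  case (mult f g)
  then obtain p q where "f = poly p" "g = poly q" by blast
  then show ?case by (intro exI[of _ "p * q"]) auto
qed

lemma poly_borel[measurable]: "poly p \<in> borel_measurable (borel :: real measure)" for p :: "real poly"
  by (intro borel_measurable_continuous_onI continuous_intros)

locale interval_measure_space = finite_measure \<mu> for \<mu> :: "real measure" +
  assumes sets_mu: "sets \<mu> = sets borel" and concentrated: "AE x in \<mu>. x \<in> {-1<..<1}"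
begin

lemma borel_mu[measurable_cong]: "sets \<mu> = sets borel" by (rule sets_mu)

text \<open>Membership in the L2 closure of the polynomials.\<close>

definition poly_approx :: "(real \<Rightarrow> real) \<Rightarrow> bool" where
  "poly_approx f \<longleftrightarrow> f \<in> borel_measurable borel \<and> integrable \<mu> (\<lambda>x. (f x)\<^sup>2) \<and>
    (\<forall>e>0. \<exists>p. (\<integral>x. (f x - poly p x)\<^sup>2 \<partial>\<mu>) < e)"

lemma poly_bounded: "\<exists>B\<ge>0. \<forall>x\<in>{-1..1}. \<bar>poly p x\<bar> \<le> (B::real)"
proof -
  have "compact (poly p ` {-1..1})" by (intro compact_continuous_image continuous_intros) auto
  then obtain B where "\<forall>y\<in>poly p ` {-1..1}. norm y \<le> B" using compact_imp_bounded bounded_iff by metis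
  then show ?thesis by (intro exI[of _ "max 0 B"]) (auto simp: le_max_iff_disj)
qed

lemma square_integrable_poly: "integrable \<mu> (\<lambda>x. (poly p x)\<^sup>2)"
proof -
  obtain B where B: "\<And>x. x \<in> {-1..1} \<Longrightarrow> \<bar>poly p x\<bar> \<le> (B::real)" using poly_bounded by blast
  show ?thesis
  proof (rule integrable_const_bound[where B="B\<^sup>2"])
    show "AE x in \<mu>. norm ((poly p x)\<^sup>2) \<le> B\<^sup>2"
      using concentrated
    proof eventually_elim
      case (elim x)
      then have "\<bar>poly p x\<bar>\<^sup>2 \<le> B\<^sup>2" using B[of x] by (intro power_mono) auto
      then show ?case by simp
    qed
  qed measurable
qed

lemma square_integrable_diff:
  assumes "f \<in> borel_measurable \<mu>" "g \<in> borel_measurable \<mu>"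
    "integrable \<mu> (\<lambda>x. (f x)\<^sup>2)" "integrable \<mu> (\<lambda>x. (g x)\<^sup>2 :: real)"
  shows "integrable \<mu> (\<lambda>x. (f x - g x)\<^sup>2)"
    "(\<integral>x. (f x - g x)\<^sup>2 \<partial>\<mu>) \<le> 2 * (\<integral>x. (f x)\<^sup>2 \<partial>\<mu>) + 2 * (\<integral>x. (g x)\<^sup>2 \<partial>\<mu>)"
proof -
  have le: "(a - b)\<^sup>2 \<le> 2 * a\<^sup>2 + 2 * b\<^sup>2" for a b :: real
    using sum_squares_bound[of a "-b"] by (simp add: power2_diff)
  have i: "integrable \<mu> (\<lambda>x. 2 * (f x)\<^sup>2 + 2 * (g x)\<^sup>2)" using assms by auto
  show i': "integrable \<mu> (\<lambda>x. (f x - g x)\<^sup>2)"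
    by (rule Bochner_Integration.integrable_bound[OF i]) (use assms le in \<open>auto intro!: AE_I2\<close>)
  have "(\<integral>x. (f x - g x)\<^sup>2 \<partial>\<mu>) \<le> (\<integral>x. 2 * (f x)\<^sup>2 + 2 * (g x)\<^sup>2 \<partial>\<mu>)"
    by (rule integral_mono[OF i' i le])
  then show "(\<integral>x. (f x - g x)\<^sup>2 \<partial>\<mu>) \<le> 2 * (\<integral>x. (f x)\<^sup>2 \<partial>\<mu>) + 2 * (\<integral>x. (g x)\<^sup>2 \<partial>\<mu>)"
    using assms by simp
qed

lemma poly_approx_limit:
  assumes f: "f \<in> borel_measurable borel" "integrable \<mu> (\<lambda>x. (f x)\<^sup>2)"
    and g: "\<And>n. poly_approx (g n)" and lim: "(\<lambda>n. \<integral>x. (f x - g n x)\<^sup>2 \<partial>\<mu>) \<longlonglongrightarrow> 0"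
  shows "poly_approx f"
  unfolding poly_approx_def
proof (intro conjI allI impI f)
  fix e :: real assume e: "0 < e"
  have "\<forall>\<^sub>F n in sequentially. (\<integral>x. (f x - g n x)\<^sup>2 \<partial>\<mu>) < e / 4"
    using e by (intro order_tendstoD[OF lim]) auto
  then obtain n where n: "(\<integral>x. (f x - g n x)\<^sup>2 \<partial>\<mu>) < e / 4" by (auto simp: eventually_sequentially)
  obtain p where p: "(\<integral>x. (g n x - poly p x)\<^sup>2 \<partial>\<mu>) < e / 4"
    using g[of n] e unfolding poly_approx_def by (metis zero_less_divide_iff zero_less_numeral)
  have [measurable]: "g n \<in> borel_measurable borel" and gi: "integrable \<mu> (\<lambda>x. (g n x)\<^sup>2)"
    using g[of n] by (auto simp: poly_approx_def)
  note [measurable] = f(1)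
  have eq: "f x - poly p x = (f x - g n x) - (poly p x - g n x)" for x by simp
  have "(\<integral>x. (f x - poly p x)\<^sup>2 \<partial>\<mu>) \<le> 2 * (\<integral>x. (f x - g n x)\<^sup>2 \<partial>\<mu>) + 2 * (\<integral>x. (poly p x - g n x)\<^sup>2 \<partial>\<mu>)"
    unfolding eq by (rule square_integrable_diff(2)[OF _ _ square_integrable_diff(1)[OF _ _ f(2) gi]
        square_integrable_diff(1)[OF _ _ square_integrable_poly gi]]; measurable)
  also have "\<dots> < e" using n p by (simp add: power2_commute)
  finally show "\<exists>p. (\<integral>x. (f x - poly p x)\<^sup>2 \<partial>\<mu>) < e" by blast
qed

lemma poly_approx_add_smult:
  assumes f: "poly_approx f" and g: "poly_approx g"
  shows "poly_approx (\<lambda>x. f x + c * g x)"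
proof -
  have [measurable]: "f \<in> borel_measurable borel" "g \<in> borel_measurable borel"
    and i: "integrable \<mu> (\<lambda>x. (f x)\<^sup>2)" "integrable \<mu> (\<lambda>x. (g x)\<^sup>2)"
    using f g by (auto simp: poly_approx_def)
  have i2: "integrable \<mu> (\<lambda>x. (- c * g x)\<^sup>2)" using i by (simp add: power_mult_distrib)
  show ?thesis unfolding poly_approx_def
  proof (intro conjI allI impI)
    show "(\<lambda>x. f x + c * g x) \<in> borel_measurable borel" by measurable
    have "integrable \<mu> (\<lambda>x. (f x - - c * g x)\<^sup>2)"
      by (rule square_integrable_diff(1)[OF _ _ i(1) i2]; measurable)
    then show "integrable \<mu> (\<lambda>x. (f x + c * g x)\<^sup>2)" by simp
    fix e :: real assume e: "0 < e"
    obtain p where p: "(\<integral>x. (f x - poly p x)\<^sup>2 \<partial>\<mu>) < e / 4"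
      using f e unfolding poly_approx_def by (metis zero_less_divide_iff zero_less_numeral)
    have "0 < e / (4 * (c\<^sup>2 + 1))" using e by (intro divide_pos_pos) (auto intro!: add_nonneg_pos)
    then obtain q where q: "(\<integral>x. (g x - poly q x)\<^sup>2 \<partial>\<mu>) < e / (4 * (c\<^sup>2 + 1))"
      using g unfolding poly_approx_def by blast
    have fp: "integrable \<mu> (\<lambda>x. (f x - poly p x)\<^sup>2)"
      by (rule square_integrable_diff(1)[OF _ _ i(1) square_integrable_poly]; measurable)
    have gq: "integrable \<mu> (\<lambda>x. (g x - poly q x)\<^sup>2)"
      by (rule square_integrable_diff(1)[OF _ _ i(2) square_integrable_poly]; measurable)
    have gq': "integrable \<mu> (\<lambda>x. (- c * (g x - poly q x))\<^sup>2)" using gq by (simp add: power_mult_distrib)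
    have eq: "f x + c * g x - poly (p + smult c q) x = (f x - poly p x) - (- c * (g x - poly q x))" for x
      by (simp add: algebra_simps)
    have "(\<integral>x. (f x + c * g x - poly (p + smult c q) x)\<^sup>2 \<partial>\<mu>)
        \<le> 2 * (\<integral>x. (f x - poly p x)\<^sup>2 \<partial>\<mu>) + 2 * (\<integral>x. (- c * (g x - poly q x))\<^sup>2 \<partial>\<mu>)"
      unfolding eq by (rule square_integrable_diff(2)[OF _ _ fp gq']; measurable)
    also have "(\<integral>x. (- c * (g x - poly q x))\<^sup>2 \<partial>\<mu>) = c\<^sup>2 * (\<integral>x. (g x - poly q x)\<^sup>2 \<partial>\<mu>)"
      by (simp add: power_mult_distrib)
    also have "c\<^sup>2 * (\<integral>x. (g x - poly q x)\<^sup>2 \<partial>\<mu>) \<le> (c\<^sup>2 + 1) * (e / (4 * (c\<^sup>2 + 1)))"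
      using q by (intro mult_mono) auto
    also have "\<dots> = e / 4"
    proof -
      have "c\<^sup>2 + 1 \<noteq> 0" using zero_le_power2[of c] by linarith
      then show ?thesis by (simp add: field_simps)
    qed
    finally have "(\<integral>x. (f x + c * g x - poly (p + smult c q) x)\<^sup>2 \<partial>\<mu>) < e" using p by linarith
    then show "\<exists>r. (\<integral>x. (f x + c * g x - poly r x)\<^sup>2 \<partial>\<mu>) < e" by blast
  qed
qed

text \<open>Weierstrass approximation on the compact interval where the measure is concentrated; a
  uniform error is small in L2 because the measure is finite.\<close>

lemma poly_approx_continuous:
  assumes f: "continuous_on UNIV f" and B: "\<And>x. \<bar>f x\<bar> \<le> B"
  shows "poly_approx f"
  unfolding poly_approx_def
proof (intro conjI allI impI)
  show [measurable]: "f \<in> borel_measurable borel" by (rule borel_measurable_continuous_onI[OF f])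
  have "(f x)\<^sup>2 \<le> B\<^sup>2" for x using B[of x] by (metis abs_ge_zero power2_abs power_mono)
  then show "integrable \<mu> (\<lambda>x. (f x)\<^sup>2)"
    by (intro integrable_const_bound[where B="B\<^sup>2"]) (auto intro!: AE_I2)
  fix e :: real assume e: "0 < e"
  define d where "d = sqrt (e / (2 * (measure \<mu> (space \<mu>) + 1)))"
  have m: "0 < measure \<mu> (space \<mu>) + 1" using measure_nonneg[of \<mu> "space \<mu>"] by linarith
  have d: "0 < d" "d\<^sup>2 = e / (2 * (measure \<mu> (space \<mu>) + 1))" using e m by (auto simp: d_def)
  obtain g where g: "real_polynomial_function g" "\<And>x. x \<in> {-1..1} \<Longrightarrow> \<bar>f x - g x\<bar> < d"
    using Stone_Weierstrass_real_polynomial_function[of "{-1..1::real}" f d] continuous_on_subset[OF f, of "{-1..1}"] d by auto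
  obtain p where p: "g = poly p" using real_polynomial_function_poly[OF g(1)] by blast
  have "(\<integral>x. (f x - poly p x)\<^sup>2 \<partial>\<mu>) \<le> (\<integral>x. d\<^sup>2 \<partial>\<mu>)"
  proof (rule integral_mono_AE')
    show "AE x in \<mu>. (f x - poly p x)\<^sup>2 \<le> d\<^sup>2"
      using concentrated
    proof eventually_elim
      case (elim x)
      then have "\<bar>f x - poly p x\<bar>\<^sup>2 \<le> d\<^sup>2" using g(2)[of x] by (intro power_mono) (auto simp: p)
      then show ?case by simp
    qed
  qed auto
  also have "\<dots> = measure \<mu> (space \<mu>) * (e / (2 * (measure \<mu> (space \<mu>) + 1)))" by (simp add: d)
  also have "\<dots> \<le> (measure \<mu> (space \<mu>) + 1) * (e / (2 * (measure \<mu> (space \<mu>) + 1)))"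
    using e m by (intro mult_right_mono) auto
  also have "\<dots> < e"
  proof -
    have "t * (e / (2 * t)) < e" if "0 < t" for t :: real using e that by simp
    then show ?thesis using m .
  qed
  finally show "\<exists>p. (\<integral>x. (f x - poly p x)\<^sup>2 \<partial>\<mu>) < e" by blast
qed

text \<open>Dominated convergence on a finite measure turns bounded pointwise limits into L2
  limits.\<close>

lemma poly_approx_bounded_limit:
  assumes f: "f \<in> borel_measurable borel" and g: "\<And>n. poly_approx (g n)"
    and B: "\<And>n x. \<bar>g n x\<bar> \<le> B" and lim: "\<And>x. (\<lambda>n. g n x) \<longlonglongrightarrow> f x"
  shows "poly_approx f"
proof -
  note [measurable] = f
  have [measurable]: "g n \<in> borel_measurable borel" for n using g[of n] by (simp add: poly_approx_def)
  have fB: "\<bar>f x\<bar> \<le> B" for x using B by (intro LIMSEQ_le_const2[OF tendsto_rabs[OF lim]]) auto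
  have f2: "(f x)\<^sup>2 \<le> B\<^sup>2" for x using fB[of x] by (metis abs_ge_zero power2_abs power_mono)
  have d2: "(f x - g n x)\<^sup>2 \<le> (2 * B)\<^sup>2" for n x
  proof -
    have "\<bar>f x - g n x\<bar> \<le> 2 * B" using fB[of x] B[of n x] by linarith
    then show ?thesis by (metis abs_ge_zero power2_abs power_mono)
  qed
  have "(\<lambda>n. \<integral>x. (f x - g n x)\<^sup>2 \<partial>\<mu>) \<longlonglongrightarrow> (\<integral>x. 0 \<partial>\<mu>)"
  proof (rule integral_dominated_convergence[where w="\<lambda>_. (2 * B)\<^sup>2"])
    show "AE x in \<mu>. (\<lambda>n. (f x - g n x)\<^sup>2) \<longlonglongrightarrow> 0"
    proof (rule AE_I2)
      fix x
      have "(\<lambda>n. (f x - g n x)\<^sup>2) \<longlonglongrightarrow> (f x - f x)\<^sup>2" by (intro tendsto_intros lim)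
      then show "(\<lambda>n. (f x - g n x)\<^sup>2) \<longlonglongrightarrow> 0" by simp
    qed
  qed (use d2 in auto)
  moreover have "integrable \<mu> (\<lambda>x. (f x)\<^sup>2)"
    using f2 by (intro integrable_const_bound[where B="B\<^sup>2"]) (auto intro!: AE_I2)
  ultimately show ?thesis by (intro poly_approx_limit[OF f _ g]) auto
qed

lemma poly_approx_Iic: "poly_approx (indicator {..a})"
proof (rule poly_approx_bounded_limit[where B=1])
  \<comment> \<open>Ramps falling from 1 to 0 to the right of \<open>a\<close>, ever more
    steeply.\<close>
  define g where "g n x = max 0 (min 1 (1 - real n * (x - a)))" for n :: nat and x :: real
  show "poly_approx (g n)" for n
    by (rule poly_approx_continuous[where B=1]) (auto simp: g_def intro!: continuous_intros)
  show "\<bar>g n x\<bar> \<le> 1" for n x by (auto simp: g_def)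
  show "(\<lambda>n. g n x) \<longlonglongrightarrow> indicator {..a} x" for x
  proof (cases "x \<le> a")
    case True
    then have "g n x = 1" for n by (auto simp: g_def mult_le_0_iff min_def max_def)
    then show ?thesis using True by simp
  next
    case False
    obtain N where N: "1 < real N * (x - a)" using reals_Archimedean3[of "x - a"] False by auto
    have "g n x = 0" if "n \<ge> N" for n
    proof -
      have "real N * (x - a) \<le> real n * (x - a)" using that False by (intro mult_right_mono) auto
      then show ?thesis using N by (simp add: g_def)
    qed
    then show ?thesis using False
      by (intro tendsto_eventually) (auto simp: eventually_sequentially)
  qed
qed auto

text \<open>Half-lines are stable under intersection and generate the Borel sets, so closure under
  complements and countable disjoint unions suffices.\<close>

lemma poly_approx_indicator:
  assumes "A \<in> sets borel"
  shows "poly_approx (indicator A)"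
proof -
  have 1: "Int_stable (range (\<lambda>a::real. {..a}))" by (auto simp: Int_stable_def)
  have 2: "range (\<lambda>a::real. {..a}) \<subseteq> Pow UNIV" by simp
  have "A \<in> sigma_sets UNIV (range (\<lambda>a::real. {..a}))"
    using assms by (simp add: borel_eq_atMost)
  from 1 2 this show ?thesis
  proof (induction rule: sigma_sets_induct_disjoint)
    case (basic A)
    then show ?case using poly_approx_Iic by auto
  next
    case empty
    show ?case using poly_approx_continuous[of "\<lambda>_. 0" 0] by (simp add: indicator_def[abs_def])
  next
    case (compl A)
    have "poly_approx (\<lambda>x. 1 + (-1) * indicator A x)"
      by (rule poly_approx_add_smult[OF poly_approx_continuous[of "\<lambda>_. 1" 1] compl(2)]) auto
    moreover have "(\<lambda>x. 1 + (-1) * indicator A x) = (indicator (UNIV - A) :: real \<Rightarrow> real)" by (auto simp: indicator_def)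
    ultimately show ?case by simp
  next
    case (union A)
    have As: "A i \<in> sets borel" for i using union(2) by (auto simp: borel_eq_atMost)
    define g where "g n x = (\<Sum>i<n. indicator (A i) x :: real)" for n and x :: real
    have gi: "g n x = indicator (\<Union>i<n. A i) x" for n x
      unfolding g_def by (rule indicator_UN_disjoint[symmetric]) (use union(1) in \<open>auto simp: disjoint_family_on_def\<close>)
    show ?case
    proof (rule poly_approx_bounded_limit[where B=1 and g=g])
      show "poly_approx (g n)" for n
      proof (induction n)
        case 0
        show ?case using poly_approx_continuous[of "\<lambda>_. 0" 0] by (simp add: g_def[abs_def])
      next
        case (Suc n)
        have "poly_approx (\<lambda>x. g n x + 1 * indicator (A n) x)" by (rule poly_approx_add_smult[OF Suc union(3)])
        then show ?case by (simp add: g_def[abs_def])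
      qed
      show "\<bar>g n x\<bar> \<le> 1" for n x by (simp add: gi indicator_def)
      show "(\<lambda>n. g n x) \<longlonglongrightarrow> indicator (\<Union>i. A i) x" for x
        unfolding gi by (rule LIMSEQ_indicator_UN)
    qed (use As in auto)
  qed
qed

text \<open>Simple functions dominated by \<open>2 * |f|\<close> converge to \<open>f\<close> in L2,
  and each of them is a finite combination of indicators.\<close>

lemma polynomials_dense:
  assumes f: "f \<in> borel_measurable borel" and f2: "integrable \<mu> (\<lambda>x. (f x)\<^sup>2)" and e: "e > 0"
  shows "\<exists>p. (\<integral>x. (f x - poly p x)\<^sup>2 \<partial>\<mu>) < e"
proof -
  obtain F where F: "\<And>i. simple_function borel (F i)" "\<And>x. (\<lambda>i. F i x) \<longlonglongrightarrow> f x"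
    "\<And>i x. \<bar>F i x\<bar> \<le> 2 * \<bar>f x\<bar>"
    using borel_measurable_implies_sequence_metric[OF f, of 0] by auto
  have "poly_approx f"
  proof (rule poly_approx_limit[OF f f2])
    show "poly_approx (F i)" for i
    proof -
      have fin: "finite (range (F i))" using simple_functionD(1)[OF F(1)[of i]] by simp
      have sets: "F i -` {y} \<in> sets borel" for y using simple_functionD(2)[OF F(1)[of i], of "{y}"] by simp
      have "poly_approx (\<lambda>x. \<Sum>y\<in>Y. y * indicator (F i -` {y}) x)" if "finite Y" for Y
        using that
      proof (induction Y rule: finite_induct)
        case empty
        show ?case using poly_approx_continuous[of "\<lambda>_. 0" 0] by simp
      next
        case (insert y Y)
        have "poly_approx (\<lambda>x. (\<Sum>y\<in>Y. y * indicator (F i -` {y}) x) + y * indicator (F i -` {y}) x)"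
          by (rule poly_approx_add_smult[OF insert(3) poly_approx_indicator[OF sets]])
        then show ?case unfolding sum.insert[OF insert(1,2)] by (simp only: add.commute)
      qed
      from this[OF fin] have "poly_approx (\<lambda>x. \<Sum>y\<in>range (F i). y * indicator (F i -` {y}) x)" .
      moreover have "(\<Sum>y\<in>range (F i). y * indicator (F i -` {y}) x) = F i x" for x
      proof -
        have "(\<Sum>y\<in>range (F i). y * indicator (F i -` {y}) x) = (\<Sum>y\<in>range (F i). if y = F i x then y else 0)"
          by (intro sum.cong refl) (auto simp: indicator_def)
        then show ?thesis using fin by (simp add: sum.delta')
      qed
      ultimately show ?thesis by simp
    qed
    have [measurable]: "F i \<in> borel_measurable borel" for i by (rule borel_measurable_simple_function[OF F(1)])
    note [measurable] = f
    have "(\<lambda>n. \<integral>x. (f x - F n x)\<^sup>2 \<partial>\<mu>) \<longlonglongrightarrow> (\<integral>x. 0 \<partial>\<mu>)"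
    proof (rule integral_dominated_convergence[where w="\<lambda>x. 9 * (f x)\<^sup>2"])
      show "AE x in \<mu>. (\<lambda>n. (f x - F n x)\<^sup>2) \<longlonglongrightarrow> 0"
      proof (rule AE_I2)
        fix x
        have "(\<lambda>n. (f x - F n x)\<^sup>2) \<longlonglongrightarrow> (f x - f x)\<^sup>2" by (intro tendsto_intros F)
        then show "(\<lambda>n. (f x - F n x)\<^sup>2) \<longlonglongrightarrow> 0" by simp
      qed
      show "AE x in \<mu>. norm ((f x - F n x)\<^sup>2) \<le> 9 * (f x)\<^sup>2" for n
      proof (rule AE_I2)
        fix x
        have "\<bar>f x - F n x\<bar> \<le> 3 * \<bar>f x\<bar>" using F(3)[of n x] by linarith
        then have "\<bar>f x - F n x\<bar>\<^sup>2 \<le> (3 * \<bar>f x\<bar>)\<^sup>2" by (intro power_mono) auto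
        then show "norm ((f x - F n x)\<^sup>2) \<le> 9 * (f x)\<^sup>2" by (simp add: power_mult_distrib)
      qed
    qed (use f2 in auto)
    then show "(\<lambda>n. \<integral>x. (f x - F n x)\<^sup>2 \<partial>\<mu>) \<longlonglongrightarrow> 0" by simp
  qed
  then show ?thesis using e by (auto simp: poly_approx_def)
qed

end

section \<open>Parseval identity for the weighted expansion\<close>

locale Gegenbauer_expansion =
  fixes q :: real and G :: "nat \<Rightarrow> real poly" and \<phi> :: "real \<Rightarrow> real"
  assumes G: "normalized_Gegenbauer q G"
    and phi_measurable: "(\<lambda>x. indicator {-1<..<1} x * \<phi> x) \<in> borel_measurable borel"
    and phi_L2: "set_integrable lborel {-1<..<1} (\<lambda>x. (\<phi> x)\<^sup>2 / (1 - x\<^sup>2) powr q)"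
begin

definition w :: "real \<Rightarrow> real" where "w x = indicator {-1<..<1} x * (1 - x\<^sup>2) powr q"

definition \<mu> :: "real measure" where "\<mu> = density lborel (\<lambda>x. ennreal (w x))"

definition f :: "real \<Rightarrow> real" where "f x = indicator {-1<..<1} x * \<phi> x / (1 - x\<^sup>2) powr q"

lemma w_measurable[measurable]: "w \<in> borel_measurable borel"
  unfolding w_def by measurable

lemma w_nonneg: "0 \<le> w x" by (simp add: w_def)

lemma f_measurable[measurable]: "f \<in> borel_measurable borel"
  unfolding f_def by (rule borel_measurable_divide[OF phi_measurable]) measurable

lemma weight_pos: "x \<in> {-1<..<1} \<Longrightarrow> 0 < (1 - x\<^sup>2) powr q"
  using abs_square_less_1[of x] by (auto simp: abs_less_iff powr_gt_zero)

lemma mu_integral: "h \<in> borel_measurable borel \<Longrightarrow> (\<integral>x. h x \<partial>\<mu>) = (LBINT x:{-1<..<1}. h x * (1 - x\<^sup>2) powr q)"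
proof -
  assume h[measurable]: "h \<in> borel_measurable borel"
  have "(\<integral>x. h x \<partial>\<mu>) = (\<integral>x. w x * h x \<partial>lborel)"
    unfolding \<mu>_def by (rule integral_real_density) (auto simp: w_nonneg)
  also have "\<dots> = (LBINT x:{-1<..<1}. h x * (1 - x\<^sup>2) powr q)"
    unfolding set_lebesgue_integral_def by (intro Bochner_Integration.integral_cong refl) (simp add: w_def)
  finally show ?thesis .
qed

lemma mu_integrable: "h \<in> borel_measurable borel \<Longrightarrow>
    integrable \<mu> h \<longleftrightarrow> set_integrable lborel {-1<..<1} (\<lambda>x. h x * (1 - x\<^sup>2) powr q)"
proof -
  assume h[measurable]: "h \<in> borel_measurable borel"
  have "integrable \<mu> h \<longleftrightarrow> integrable lborel (\<lambda>x. w x * h x)"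
    unfolding \<mu>_def by (rule integrable_real_density) (auto simp: w_nonneg)
  also have "\<dots> \<longleftrightarrow> set_integrable lborel {-1<..<1} (\<lambda>x. h x * (1 - x\<^sup>2) powr q)"
    unfolding set_integrable_def by (intro Bochner_Integration.integrable_cong refl) (simp add: w_def)
  finally show ?thesis .
qed

lemma degree_G: "degree (G n) = n" and G_nonzero: "G n \<noteq> 0"
  using G by (auto simp: normalized_Gegenbauer_def)

lemma orthonormal: "(\<integral>x. poly (G j) x * poly (G k) x \<partial>\<mu>) = (if j = k then 1 else 0)"
  using G by (subst mu_integral) (auto simp: normalized_Gegenbauer_def)

text \<open>\<open>G 0\<close> is a nonzero constant. If its square were not integrable, the
  integral would be 0 by convention, against the normalization; hence the weight has finite
  mass.\<close>

lemma finite_mu: "finite_measure \<mu>"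
proof
  obtain a where a: "G 0 = [:a:]" using degree_G[of 0] by (auto elim: degree_eq_zeroE)
  have "integrable \<mu> (\<lambda>x. poly (G 0) x * poly (G 0) x)"
  proof (rule ccontr)
    assume "\<not> integrable \<mu> (\<lambda>x. poly (G 0) x * poly (G 0) x)"
    then have "(\<integral>x. poly (G 0) x * poly (G 0) x \<partial>\<mu>) = 0" by (rule not_integrable_integral_eq)
    then show False using orthonormal[of 0 0] by simp
  qed
  then have "integrable \<mu> (\<lambda>x. a * a)" unfolding a by simp
  moreover have "a \<noteq> 0" using G_nonzero[of 0] a by simp
  ultimately show "emeasure \<mu> (space \<mu>) \<noteq> \<infinity>"
    by (auto simp: integrable_iff_bounded ennreal_mult_less_top less_top)
qed

sublocale interval_measure_space \<mu>
proof -
  interpret finite_measure \<mu> by (rule finite_mu)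
  show "interval_measure_space \<mu>"
  proof
    show "sets \<mu> = sets borel" by (simp add: \<mu>_def)
    show "AE x in \<mu>. x \<in> {-1<..<1}"
      unfolding \<mu>_def by (subst AE_density) (auto simp: w_def indicator_def)
  qed
qed

lemma f_square: "integrable \<mu> (\<lambda>x. (f x)\<^sup>2)"
proof (subst mu_integrable)
  have "set_integrable lborel {-1<..<1} (\<lambda>x. (f x)\<^sup>2 * (1 - x\<^sup>2) powr q)
      \<longleftrightarrow> set_integrable lborel {-1<..<1} (\<lambda>x. (\<phi> x)\<^sup>2 / (1 - x\<^sup>2) powr q)"
  proof (rule set_integrable_cong[OF refl refl])
    fix x :: real assume x: "x \<in> {-1<..<1}"
    show "(f x)\<^sup>2 * (1 - x\<^sup>2) powr q = (\<phi> x)\<^sup>2 / (1 - x\<^sup>2) powr q"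
      using x weight_pos[OF x] by (simp add: f_def power2_eq_square)
  qed
  then show "set_integrable lborel {-1<..<1} (\<lambda>x. (f x)\<^sup>2 * (1 - x\<^sup>2) powr q)" using phi_L2 by simp
qed measurable

lemma integrable_product:
  assumes "g \<in> borel_measurable borel" "h \<in> borel_measurable borel"
    "integrable \<mu> (\<lambda>x. (g x)\<^sup>2)" "integrable \<mu> (\<lambda>x. (h x)\<^sup>2 :: real)"
  shows "integrable \<mu> (\<lambda>x. g x * h x)"
proof (rule Bochner_Integration.integrable_bound)
  show "integrable \<mu> (\<lambda>x. (g x)\<^sup>2 + (h x)\<^sup>2)" using assms by simp
  show "AE x in \<mu>. norm (g x * h x) \<le> norm ((g x)\<^sup>2 + (h x)\<^sup>2)"
  proof (rule AE_I2)
    fix x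
    have "2 * (\<bar>g x\<bar> * \<bar>h x\<bar>) \<le> (g x)\<^sup>2 + (h x)\<^sup>2" using sum_squares_bound[of "\<bar>g x\<bar>" "\<bar>h x\<bar>"] by simp
    moreover have "0 \<le> \<bar>g x\<bar> * \<bar>h x\<bar>" by simp
    ultimately have "\<bar>g x\<bar> * \<bar>h x\<bar> \<le> (g x)\<^sup>2 + (h x)\<^sup>2" by linarith
    then show "norm (g x * h x) \<le> norm ((g x)\<^sup>2 + (h x)\<^sup>2)" by (simp add: abs_mult)
  qed
qed (use assms in measurable)

definition \<zeta> :: "nat \<Rightarrow> real" where "\<zeta> k = (\<integral>x. f x * poly (G k) x \<partial>\<mu>)"

text \<open>By Parseval, the sum of \<open>(\<zeta> k)\<^sup>2\<close> over \<open>k > K\<close>,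
  written without an infinite series.\<close>

definition tail :: "nat \<Rightarrow> real" where "tail K = (\<integral>x. (f x)\<^sup>2 \<partial>\<mu>) - (\<Sum>k\<le>K. (\<zeta> k)\<^sup>2)"

lemma zeta_eq: "\<zeta> k = (LBINT x:{-1<..<1}. \<phi> x * poly (G k) x)"
proof -
  have "\<zeta> k = (LBINT x:{-1<..<1}. f x * poly (G k) x * (1 - x\<^sup>2) powr q)"
    unfolding \<zeta>_def by (intro mu_integral borel_measurable_times f_measurable poly_borel)
  also have "\<dots> = (LBINT x:{-1<..<1}. \<phi> x * poly (G k) x)"
  proof (rule set_lebesgue_integral_cong)
    show "\<forall>x. x \<in> {-1<..<1} \<longrightarrow> f x * poly (G k) x * (1 - x\<^sup>2) powr q = \<phi> x * poly (G k) x"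
      using weight_pos by (auto simp: f_def less_le)
  qed simp
  finally show ?thesis .
qed

definition proj :: "nat \<Rightarrow> (nat \<Rightarrow> real) \<Rightarrow> real poly" where
  "proj K c = (\<Sum>k\<le>K. smult (c k) (G k))"

text \<open>Pythagoras, for arbitrary coefficients: the estimators use it with random ones, the
  completeness proof with those of an approximating polynomial.\<close>

lemma error_eq: "(\<integral>x. (poly (proj K c) x - f x)\<^sup>2 \<partial>\<mu>) = (\<Sum>k\<le>K. (c k - \<zeta> k)\<^sup>2) + tail K"
proof -
  have ip: "integrable \<mu> (\<lambda>x. f x * poly p x)" "integrable \<mu> (\<lambda>x. poly p x * poly r x)" for p r
    using f_square square_integrable_poly by (auto intro!: integrable_product)
  have pp: "(\<integral>x. poly (proj K c) x * poly (proj K c) x \<partial>\<mu>) = (\<Sum>k\<le>K. (c k)\<^sup>2)"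
  proof -
    have "(\<integral>x. poly (proj K c) x * poly (proj K c) x \<partial>\<mu>)
        = (\<integral>x. (\<Sum>j\<le>K. \<Sum>k\<le>K. (c j * c k) * (poly (G j) x * poly (G k) x)) \<partial>\<mu>)"
      unfolding proj_def poly_sum poly_smult sum_product
      by (intro Bochner_Integration.integral_cong refl sum.cong) (simp add: mult_ac)
    also have "\<dots> = (\<Sum>j\<le>K. \<Sum>k\<le>K. (c j * c k) * (if j = k then 1 else 0))"
      using ip(2) by (simp add: orthonormal)
    also have "\<dots> = (\<Sum>j\<le>K. \<Sum>k\<le>K. if j = k then c j * c k else 0)" by (intro sum.cong refl) simp
    also have "\<dots> = (\<Sum>k\<le>K. (c k)\<^sup>2)" by (simp add: sum.delta power2_eq_square)
    finally show ?thesis .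
  qed
  have fp: "(\<integral>x. f x * poly (proj K c) x \<partial>\<mu>) = (\<Sum>k\<le>K. c k * \<zeta> k)"
  proof -
    have "(\<integral>x. f x * poly (proj K c) x \<partial>\<mu>) = (\<integral>x. (\<Sum>k\<le>K. c k * (f x * poly (G k) x)) \<partial>\<mu>)"
      unfolding proj_def poly_sum poly_smult sum_distrib_left
      by (intro Bochner_Integration.integral_cong refl sum.cong) (simp add: mult_ac)
    also have "\<dots> = (\<Sum>k\<le>K. c k * \<zeta> k)" using ip(1) by (simp add: \<zeta>_def)
    finally show ?thesis .
  qed
  have "(\<integral>x. (poly (proj K c) x - f x)\<^sup>2 \<partial>\<mu>)
      = (\<integral>x. poly (proj K c) x * poly (proj K c) x - 2 * (f x * poly (proj K c) x) + (f x)\<^sup>2 \<partial>\<mu>)"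
    by (intro Bochner_Integration.integral_cong refl) (simp add: power2_eq_square algebra_simps)
  also have "\<dots> = (\<Sum>k\<le>K. (c k)\<^sup>2) - 2 * (\<Sum>k\<le>K. c k * \<zeta> k) + (\<integral>x. (f x)\<^sup>2 \<partial>\<mu>)"
    using ip f_square by (simp add: pp fp)
  also have "\<dots> = (\<Sum>k\<le>K. (c k - \<zeta> k)\<^sup>2) + tail K"
    by (simp add: tail_def power2_diff sum.distrib sum_subtractf sum_distrib_left mult_ac)
  finally show ?thesis .
qed

lemma error_nonneg: "0 \<le> (\<Sum>k\<le>K. (c k - \<zeta> k)\<^sup>2) + tail K"
  unfolding error_eq[symmetric] by (rule Bochner_Integration.integral_nonneg) simp

lemma tail_nonneg: "0 \<le> tail K"
  using error_nonneg[where c=\<zeta> and K=K] by simp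

text \<open>\<open>tail K\<close> is the least squared distance from \<open>f\<close> to
  combinations of \<open>G 0\<close> up to \<open>G K\<close>. These exhaust the polynomials of
  degree at most \<open>K\<close>, so density of the polynomials makes it small.\<close>

lemma tail_tendsto_0: "tail \<longlonglongrightarrow> 0"
proof (rule LIMSEQ_I)
  fix e :: real assume e: "0 < e"
  obtain p where p: "(\<integral>x. (f x - poly p x)\<^sup>2 \<partial>\<mu>) < e"
    using polynomials_dense[OF f_measurable f_square e] by (elim exE) (rule that)
  have "norm (tail K - 0) < e" if K: "K \<ge> degree p" for K
  proof -
    obtain c where c: "p = proj K c"
      using graded_basis_expansion[of G p K] G_nonzero degree_G K by (auto simp: proj_def)
    have "tail K \<le> (\<Sum>k\<le>K. (c k - \<zeta> k)\<^sup>2) + tail K" by (simp add: sum_nonneg)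
    also have "\<dots> = (\<integral>x. (f x - poly p x)\<^sup>2 \<partial>\<mu>)"
      unfolding error_eq[symmetric] c[symmetric] by (simp add: power2_commute)
    finally show ?thesis using p tail_nonneg[of K] by simp
  qed
  then show "\<exists>N. \<forall>K\<ge>N. norm (tail K - 0) < e" by blast
qed

lemma estimator_error_pointwise:
  assumes x: "x \<in> {-1<..<1}"
  shows "((\<Sum>k=0..K. c k * poly (G k) x) * (1 - x\<^sup>2) powr q - \<phi> x)\<^sup>2 / (1 - x\<^sup>2) powr q
    = (poly (proj K c) x - f x)\<^sup>2 * (1 - x\<^sup>2) powr q"
proof -
  have w: "(1 - x\<^sup>2) powr q \<noteq> 0" using weight_pos[OF x] by simp
  have "(\<Sum>k=0..K. c k * poly (G k) x) * (1 - x\<^sup>2) powr q - \<phi> x = (poly (proj K c) x - f x) * (1 - x\<^sup>2) powr q"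
    using x w by (simp add: proj_def poly_sum f_def left_diff_distrib atLeast0AtMost)
  then show ?thesis using w by (simp add: power_mult_distrib power2_eq_square)
qed

lemma estimator_error_integral:
  "(LBINT x:{-1<..<1}. ((\<Sum>k=0..K. c k * poly (G k) x) * (1 - x\<^sup>2) powr q - \<phi> x)\<^sup>2 / (1 - x\<^sup>2) powr q)
    = (\<Sum>k\<le>K. (c k - \<zeta> k)\<^sup>2) + tail K"
proof -
  define h where "h x = (poly (proj K c) x - f x)\<^sup>2" for x
  have h: "h \<in> borel_measurable borel"
    unfolding h_def by (intro borel_measurable_power borel_measurable_diff poly_borel f_measurable)
  have "(LBINT x:{-1<..<1}. ((\<Sum>k=0..K. c k * poly (G k) x) * (1 - x\<^sup>2) powr q - \<phi> x)\<^sup>2 / (1 - x\<^sup>2) powr q)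
      = (LBINT x:{-1<..<1}. h x * (1 - x\<^sup>2) powr q)"
    unfolding set_lebesgue_integral_def
  proof (rule Bochner_Integration.integral_cong[OF refl])
    fix x :: real
    show "indicator {-1<..<1} x *\<^sub>R (((\<Sum>k=0..K. c k * poly (G k) x) * (1 - x\<^sup>2) powr q - \<phi> x)\<^sup>2 / (1 - x\<^sup>2) powr q)
      = indicator {-1<..<1} x *\<^sub>R (h x * (1 - x\<^sup>2) powr q)"
    proof (cases "x \<in> {-1<..<1}")
      case True
      show ?thesis unfolding estimator_error_pointwise[OF True] h_def ..
    next
      case False
      then have "indicator {-1<..<1} x = (0 :: real)" by (rule indicator_simps(2))
      then show ?thesis by (simp only: scaleR_zero_left)
    qed
  qed
  also have "\<dots> = (\<integral>x. h x \<partial>\<mu>)" by (rule mu_integral[OF h, symmetric])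
  also have "\<dots> = (\<Sum>k\<le>K. (c k - \<zeta> k)\<^sup>2) + tail K" unfolding h_def by (rule error_eq)
  finally show ?thesis .
qed

text \<open>The version for nonnegative integrals, to be combined with Tonelli's theorem.\<close>

lemma estimator_error_nn_integral:
  "(\<integral>\<^sup>+x. ennreal (((\<Sum>k=0..K. c k * poly (G k) x) * (1 - x\<^sup>2) powr q - \<phi> x)\<^sup>2) / ennreal ((1 - x\<^sup>2) powr q)
      * indicator {-1<..<1} x \<partial>lborel) = ennreal ((\<Sum>k\<le>K. (c k - \<zeta> k)\<^sup>2) + tail K)"
proof -
  have i: "integrable \<mu> (\<lambda>x. (poly (proj K c) x - f x)\<^sup>2)"
    by (rule square_integrable_diff(1)[OF _ _ square_integrable_poly f_square]; measurable)
  have "(\<integral>\<^sup>+x. ennreal (((\<Sum>k=0..K. c k * poly (G k) x) * (1 - x\<^sup>2) powr q - \<phi> x)\<^sup>2) / ennreal ((1 - x\<^sup>2) powr q)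
      * indicator {-1<..<1} x \<partial>lborel) = (\<integral>\<^sup>+x. ennreal (w x) * ennreal ((poly (proj K c) x - f x)\<^sup>2) \<partial>lborel)"
  proof (rule nn_integral_cong)
    fix x :: real
    show "ennreal (((\<Sum>k=0..K. c k * poly (G k) x) * (1 - x\<^sup>2) powr q - \<phi> x)\<^sup>2) / ennreal ((1 - x\<^sup>2) powr q)
      * indicator {-1<..<1} x = ennreal (w x) * ennreal ((poly (proj K c) x - f x)\<^sup>2)"
    proof (cases "x \<in> {-1<..<1}")
      case True
      have "ennreal (((\<Sum>k=0..K. c k * poly (G k) x) * (1 - x\<^sup>2) powr q - \<phi> x)\<^sup>2) / ennreal ((1 - x\<^sup>2) powr q)
          = ennreal ((poly (proj K c) x - f x)\<^sup>2 * (1 - x\<^sup>2) powr q)"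
        unfolding divide_ennreal[OF zero_le_power2 weight_pos[OF True]] estimator_error_pointwise[OF True] ..
      then show ?thesis using True by (simp add: w_def ennreal_mult mult.commute)
    qed (simp add: w_def)
  qed
  also have "\<dots> = (\<integral>\<^sup>+x. ennreal ((poly (proj K c) x - f x)\<^sup>2) \<partial>\<mu>)"
    unfolding \<mu>_def by (rule nn_integral_density[symmetric]) measurable
  also have "\<dots> = ennreal (\<integral>x. (poly (proj K c) x - f x)\<^sup>2 \<partial>\<mu>)"
    by (rule nn_integral_eq_integral[OF i]) simp
  finally show ?thesis by (simp add: error_eq)
qed

text \<open>Decompose \<open>r P - f = r (P - f) + (r - 1) f\<close>. The common factor
  \<open>r\<close> is the effect of a different normalization of the estimator.\<close>

lemma error_scale_le:
  "(\<Sum>k\<le>K. (r * c k - \<zeta> k)\<^sup>2) + tail K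
    \<le> 2 * r\<^sup>2 * ((\<Sum>k\<le>K. (c k - \<zeta> k)\<^sup>2) + tail K) + 2 * (r - 1)\<^sup>2 * (\<integral>x. (f x)\<^sup>2 \<partial>\<mu>)"
proof -
  have i: "integrable \<mu> (\<lambda>x. (poly (proj K c) x - f x)\<^sup>2)" for c
    by (rule square_integrable_diff(1)[OF _ _ square_integrable_poly f_square]; measurable)
  have p: "poly (proj K (\<lambda>k. r * c k)) x = r * poly (proj K c) x" for x
    by (simp add: proj_def poly_sum sum_distrib_left mult.assoc)
  have "(\<integral>x. (poly (proj K (\<lambda>k. r * c k)) x - f x)\<^sup>2 \<partial>\<mu>)
      \<le> (\<integral>x. 2 * r\<^sup>2 * (poly (proj K c) x - f x)\<^sup>2 + 2 * (r - 1)\<^sup>2 * (f x)\<^sup>2 \<partial>\<mu>)"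
  proof (rule integral_mono[OF i])
    show "integrable \<mu> (\<lambda>x. 2 * r\<^sup>2 * (poly (proj K c) x - f x)\<^sup>2 + 2 * (r - 1)\<^sup>2 * (f x)\<^sup>2)"
      using i f_square by auto
    fix x
    have s2: "(a + b)\<^sup>2 \<le> 2 * a\<^sup>2 + 2 * b\<^sup>2" for a b :: real
      using sum_squares_bound[of a b] by (simp add: power2_sum)
    have "poly (proj K (\<lambda>k. r * c k)) x - f x = r * (poly (proj K c) x - f x) + (r - 1) * f x"
      unfolding p by (simp add: algebra_simps)
    then show "(poly (proj K (\<lambda>k. r * c k)) x - f x)\<^sup>2 \<le> 2 * r\<^sup>2 * (poly (proj K c) x - f x)\<^sup>2 + 2 * (r - 1)\<^sup>2 * (f x)\<^sup>2"
      using s2[of "r * (poly (proj K c) x - f x)" "(r - 1) * f x"] by (simp add: power_mult_distrib)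
  qed
  also have "\<dots> = 2 * r\<^sup>2 * (\<integral>x. (poly (proj K c) x - f x)\<^sup>2 \<partial>\<mu>) + 2 * (r - 1)\<^sup>2 * (\<integral>x. (f x)\<^sup>2 \<partial>\<mu>)"
    using i f_square by simp
  finally show ?thesis unfolding error_eq .
qed

end

section \<open>Consistency of the estimators\<close>

text \<open>\<open>s^(2 K)\<close> is at most a power \<open>n^b\<close>. The bound on
  \<open>\<gamma>\<close> is what allows some \<open>s > 1 + sqrt 2\<close> with
  \<open>b < 1\<close>, and the power of the logarithm does no harm.\<close>

lemma logarithmic_truncation:
  fixes K :: "nat \<Rightarrow> nat"
  assumes gamma: "0 < \<gamma>" "\<gamma> < inverse (2 * ln (1 + sqrt 2))"
    and K: "\<And>n. n \<ge> 1 \<Longrightarrow> K n = nat \<lfloor>\<gamma> * ln (real n)\<rfloor>"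
  shows "\<exists>s>1 + sqrt 2. (\<lambda>n. (real (K n) + 2) ^ 3 * s ^ (2 * K n) / real n) \<longlonglongrightarrow> 0"
    and "filterlim K at_top sequentially"
    and "\<forall>\<^sub>F n in sequentially. K n + 2 \<le> n"
proof -
  have K_le: "real (K n) \<le> \<gamma> * ln (real n)" if "n \<ge> 1" for n
    using that gamma by (simp add: K of_nat_floor)
  have ev1: "\<forall>\<^sub>F n in sequentially. (1::nat) \<le> n" by (rule eventually_ge_at_top)
  show "\<exists>s>1 + sqrt 2. (\<lambda>n. (real (K n) + 2) ^ 3 * s ^ (2 * K n) / real n) \<longlonglongrightarrow> 0"
  proof -
    define L where "L = ln (1 + sqrt (2::real))"
    \<comment> \<open>\<open>ln s\<close> is the midpoint of \<open>L\<close> and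
      \<open>1 / (2 * \<gamma>)\<close>, whence \<open>b = \<gamma> * L + 1 / 2 < 1\<close>.\<close>
    define s where "s = exp ((L + 1 / (2 * \<gamma>)) / 2)"
    define b where "b = 2 * \<gamma> * ln s"
    have L: "0 < L" unfolding L_def by (intro ln_gt_zero) simp
    have gL: "2 * \<gamma> * L < 1"
    proof -
      have "\<gamma> * (2 * L) < inverse (2 * L) * (2 * L)" using gamma(2) L by (intro mult_strict_right_mono) (auto simp: L_def)
      then show ?thesis using L by (simp add: mult_ac)
    qed
    have "L < 1 / (2 * \<gamma>)" using gL gamma by (simp add: field_simps)
    then have Ls: "L < ln s" by (simp add: s_def)
    have s: "1 + sqrt 2 < s"
    proof -
      have "1 + sqrt 2 = exp L" unfolding L_def by (subst exp_ln) (auto simp: add_pos_nonneg)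
      also have "\<dots> < exp (ln s)" using Ls by simp
      also have "\<dots> = s" by (simp add: s_def)
      finally show ?thesis .
    qed
    have s1: "1 < s" "0 < s" using s real_sqrt_ge_zero[of 2] by linarith+
    have b: "b < 1" "0 < b"
    proof -
      have "b = \<gamma> * L + 1 / 2" using gamma by (simp add: b_def s_def field_simps)
      then show "b < 1" using gL by simp
      show "0 < b" using gamma s1 by (simp add: b_def)
    qed
    have lim: "(\<lambda>n. (\<gamma> * ln (real n) + 2) ^ 3 * (real n powr b) / real n) \<longlonglongrightarrow> 0"
      using gamma(1) b by real_asymp
    have "(\<lambda>n. (real (K n) + 2) ^ 3 * s ^ (2 * K n) / real n) \<longlonglongrightarrow> 0"
    proof (rule tendsto_sandwich[OF _ _ tendsto_const lim])
      show "\<forall>\<^sub>F n in sequentially. 0 \<le> (real (K n) + 2) ^ 3 * s ^ (2 * K n) / real n"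
        using s1 by (intro always_eventually allI divide_nonneg_nonneg mult_nonneg_nonneg zero_le_power) auto
      show "\<forall>\<^sub>F n in sequentially. (real (K n) + 2) ^ 3 * s ^ (2 * K n) / real n
          \<le> (\<gamma> * ln (real n) + 2) ^ 3 * (real n powr b) / real n"
        using ev1
      proof eventually_elim
        case (elim n)
        have "s ^ (2 * K n) = exp (real (2 * K n) * ln s)"
          by (subst exp_of_nat_mult) (use s1 in simp)
        also have "\<dots> \<le> exp (2 * (\<gamma> * ln (real n)) * ln s)"
          using K_le[OF elim] s1 by (simp add: mult_right_mono)
        also have "\<dots> = real n powr b" using elim by (simp add: b_def powr_def mult_ac)
        finally have 1: "s ^ (2 * K n) \<le> real n powr b" .
        have 2: "(real (K n) + 2) ^ 3 \<le> (\<gamma> * ln (real n) + 2) ^ 3"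
          using K_le[OF elim] by (intro power_mono) auto
        have 3: "0 \<le> (\<gamma> * ln (real n) + 2) ^ 3"
          by (rule order_trans[OF _ 2]) simp
        show ?case by (intro divide_right_mono mult_mono 1 2 3) (use s1 in auto)
      qed
    qed
    then show ?thesis using s by blast
  qed
  show "filterlim K at_top sequentially"
    unfolding filterlim_at_top
  proof
    fix Z :: nat
    have "\<forall>\<^sub>F n in sequentially. real Z \<le> \<gamma> * ln (real n)" using gamma(1) by real_asymp
    then show "\<forall>\<^sub>F n in sequentially. Z \<le> K n"
      using ev1 by eventually_elim (simp add: K le_nat_floor)
  qed
  have "\<forall>\<^sub>F n in sequentially. \<gamma> * ln (real n) + 2 \<le> real n" using gamma(1) by real_asymp
  then show "\<forall>\<^sub>F n in sequentially. K n + 2 \<le> n"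
    using ev1
  proof eventually_elim
    case (elim n)
    then have "real (K n + 2) \<le> real n" using K_le[of n] by simp
    then show ?case by linarith
  qed
qed

text \<open>The Cauchy-Schwarz inequality for the weights \<open>|g i|\<close>. With polynomial
  coefficients as weights only their absolute sum enters, and no covariances between errors at
  different lags have to be estimated.\<close>

lemma weighted_sum_square_le:
  fixes g e :: "'i \<Rightarrow> real"
  shows "(\<Sum>i\<in>I. g i * e i)\<^sup>2 \<le> (\<Sum>i\<in>I. \<bar>g i\<bar>) * (\<Sum>i\<in>I. \<bar>g i\<bar> * (e i)\<^sup>2)"
proof -
  have "(\<Sum>i\<in>I. g i * e i)\<^sup>2 = (\<Sum>i\<in>I. sqrt \<bar>g i\<bar> * (sgn (g i) * sqrt \<bar>g i\<bar> * e i))\<^sup>2"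
  proof -
    have "g i * e i = sqrt \<bar>g i\<bar> * (sgn (g i) * sqrt \<bar>g i\<bar> * e i)" for i
    proof -
      have "sqrt \<bar>g i\<bar> * (sgn (g i) * sqrt \<bar>g i\<bar> * e i) = sgn (g i) * (sqrt \<bar>g i\<bar> * sqrt \<bar>g i\<bar>) * e i" by (simp only: mult_ac)
      also have "\<dots> = g i * e i" by (simp add: mult_sgn_abs)
      finally show ?thesis ..
    qed
    then show ?thesis by (intro arg_cong[where f="\<lambda>x. x\<^sup>2"] sum.cong refl)
  qed
  also have "\<dots> \<le> (\<Sum>i\<in>I. (sqrt \<bar>g i\<bar>)\<^sup>2) * (\<Sum>i\<in>I. (sgn (g i) * sqrt \<bar>g i\<bar> * e i)\<^sup>2)"
    by (rule Cauchy_Schwarz_ineq_sum)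
  also have "\<dots> \<le> (\<Sum>i\<in>I. \<bar>g i\<bar>) * (\<Sum>i\<in>I. \<bar>g i\<bar> * (e i)\<^sup>2)"
    by (intro mult_mono sum_mono) (auto simp: power_mult_distrib sgn_real_def intro!: sum_nonneg)
  finally show ?thesis .
qed

locale mixing_density_estimation =
  aggregated_field P \<Phi> V M X + Geg: Gegenbauer_expansion q G \<phi>
  for P :: "'a measure" and \<Phi> V M X q G \<phi> +
  assumes Phi_integral: "\<And>p. (\<integral>x. poly p x \<partial>\<Phi>) = (LBINT x:{-1<..<1}. \<phi> x * poly p x)"
    and vari_pos: "0 < vari"
begin

definition err :: "nat \<Rightarrow> nat \<Rightarrow> 'a \<Rightarrow> real" where
  "err n j \<omega> = sample_cov n (\<lambda>t. X t \<omega>) j - sample_cov n (\<lambda>t. X t \<omega>) (j + 2) - rho j"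

definition risk :: "nat \<Rightarrow> nat \<Rightarrow> 'a \<Rightarrow> real" where
  "risk n K \<omega> = (\<Sum>k\<le>K. (zeta_coeff G vari n (\<lambda>t. X t \<omega>) k - Geg.\<zeta> k)\<^sup>2) + Geg.tail K"

lemma sample_cov_measurable[measurable]: "(\<lambda>\<omega>. sample_cov n (\<lambda>t. X t \<omega>) j) \<in> borel_measurable P"
  unfolding sample_cov_def sample_mean_def by measurable

lemma err_measurable[measurable]: "err n j \<in> borel_measurable P"
  unfolding err_def[abs_def] by measurable

lemma zeta_coeff_measurable[measurable]:
  "v \<in> borel_measurable P \<Longrightarrow> (\<lambda>\<omega>. zeta_coeff G (v \<omega>) n (\<lambda>t. X t \<omega>) k) \<in> borel_measurable P"
  unfolding zeta_coeff_def
  by (intro borel_measurable_times borel_measurable_divide borel_measurable_sum borel_measurable_diff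
      borel_measurable_const sample_cov_measurable)

lemma err_square:
  assumes "j + 2 \<le> n"
  shows "integrable P (\<lambda>\<omega>. (err n j \<omega>)\<^sup>2)" "expectation (\<lambda>\<omega>. (err n j \<omega>)\<^sup>2) \<le> Ce * (real (j + 2))\<^sup>2 / real n"
  unfolding err_def using sample_cov_error[OF assms] by auto

lemma rho_0: "rho 0 = vari"
proof -
  interpret Phi: prob_space \<Phi> by (rule prob_Phi)
  show ?thesis by (simp add: rho_def Phi.prob_space)
qed

text \<open>The weight cancels against that in \<open>\<phi> / w\<close>, so
  \<open>\<zeta> k\<close> is the integral of \<open>G k\<close> against \<open>\<Phi>\<close>, a
  combination of moments.\<close>

lemma vari_zeta: "vari * Geg.\<zeta> k = (\<Sum>j=0..k. coeff (G k) j * rho j)"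
proof -
  interpret Phi: prob_space \<Phi> by (rule prob_Phi)
  have i: "integrable \<Phi> (\<lambda>x. x ^ j)" for j
  proof (rule Phi.integrable_const_bound[where B=1])
    show "AE x in \<Phi>. norm (x ^ j) \<le> 1"
      by (rule AE_I2) (auto simp: space_Phi power_abs power_le_one)
  qed measurable
  have "Geg.\<zeta> k = (\<integral>x. poly (G k) x \<partial>\<Phi>)" unfolding Geg.zeta_eq Phi_integral ..
  also have "\<dots> = (\<integral>x. (\<Sum>j=0..k. coeff (G k) j * x ^ j) \<partial>\<Phi>)"
    by (simp add: poly_altdef Geg.degree_G atLeast0AtMost)
  also have "\<dots> = (\<Sum>j=0..k. coeff (G k) j * (\<integral>x. x ^ j \<partial>\<Phi>))" using i by simp
  finally show ?thesis by (simp add: rho_def sum_distrib_left mult_ac)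
qed

lemma zeta_coeff_error:
  "zeta_coeff G vari n (\<lambda>t. X t \<omega>) k - Geg.\<zeta> k = (1 / vari) * (\<Sum>j=0..k. coeff (G k) j * err n j \<omega>)"
proof -
  have "Geg.\<zeta> k = (1 / vari) * (\<Sum>j=0..k. coeff (G k) j * rho j)"
    using vari_zeta[of k] vari_pos by (simp add: field_simps)
  then show ?thesis
    by (simp add: zeta_coeff_def err_def right_diff_distrib sum_subtractf)
qed

lemma zeta_coeff_error_square:
  assumes kn: "k + 2 \<le> n"
  shows "integrable P (\<lambda>\<omega>. (zeta_coeff G vari n (\<lambda>t. X t \<omega>) k - Geg.\<zeta> k)\<^sup>2)"
    and "expectation (\<lambda>\<omega>. (zeta_coeff G vari n (\<lambda>t. X t \<omega>) k - Geg.\<zeta> k)\<^sup>2)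
      \<le> Ce / vari\<^sup>2 * (coeff_norm (G k))\<^sup>2 * (real (k + 2))\<^sup>2 / real n"
proof -
  define B where "B \<omega> = 1 / vari\<^sup>2 * (coeff_norm (G k) * (\<Sum>j=0..k. \<bar>coeff (G k) j\<bar> * (err n j \<omega>)\<^sup>2))" for \<omega>
  have cn: "coeff_norm (G k) = (\<Sum>j=0..k. \<bar>coeff (G k) j\<bar>)"
    by (simp add: coeff_norm_def Geg.degree_G atLeast0AtMost)
  have le: "(zeta_coeff G vari n (\<lambda>t. X t \<omega>) k - Geg.\<zeta> k)\<^sup>2 \<le> B \<omega>" for \<omega>
    unfolding zeta_coeff_error B_def cn power_mult_distrib power_one_over
    by (intro mult_left_mono weighted_sum_square_le) simp
  have i: "integrable P (\<lambda>\<omega>. (err n j \<omega>)\<^sup>2)" if "j \<in> {0..k}" for j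
    using that kn by (intro err_square(1)) auto
  have iB: "integrable P B" unfolding B_def[abs_def] using i by (intro integrable_mult_right integrable_sum) auto
  have meas: "(\<lambda>\<omega>. (zeta_coeff G vari n (\<lambda>t. X t \<omega>) k - Geg.\<zeta> k)\<^sup>2) \<in> borel_measurable P" by measurable
  show int: "integrable P (\<lambda>\<omega>. (zeta_coeff G vari n (\<lambda>t. X t \<omega>) k - Geg.\<zeta> k)\<^sup>2)"
    by (rule Bochner_Integration.integrable_bound[OF iB meas], rule AE_I2)
       (use le in \<open>auto intro: order_trans[OF _ abs_ge_self]\<close>)
  have "expectation (\<lambda>\<omega>. (zeta_coeff G vari n (\<lambda>t. X t \<omega>) k - Geg.\<zeta> k)\<^sup>2) \<le> expectation B"
    by (rule integral_mono[OF int iB le])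
  also have "\<dots> = 1 / vari\<^sup>2 * (coeff_norm (G k) * (\<Sum>j=0..k. \<bar>coeff (G k) j\<bar> * expectation (\<lambda>\<omega>. (err n j \<omega>)\<^sup>2)))"
    unfolding B_def using i by (simp add: integrable_mult_right)
  also have "\<dots> \<le> 1 / vari\<^sup>2 * (coeff_norm (G k) * (\<Sum>j=0..k. \<bar>coeff (G k) j\<bar> * (Ce * (real (k + 2))\<^sup>2 / real n)))"
  proof (intro mult_left_mono sum_mono)
    fix j assume j: "j \<in> {0..k}"
    then have "expectation (\<lambda>\<omega>. (err n j \<omega>)\<^sup>2) \<le> Ce * (real (j + 2))\<^sup>2 / real n"
      using kn by (intro err_square(2)) auto
    also have "\<dots> \<le> Ce * (real (k + 2))\<^sup>2 / real n"
      using j by (intro divide_right_mono mult_left_mono power_mono Ce_nonneg) auto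
    finally show "expectation (\<lambda>\<omega>. (err n j \<omega>)\<^sup>2) \<le> Ce * (real (k + 2))\<^sup>2 / real n" .
  qed (auto simp: cn sum_nonneg)
  also have "\<dots> = Ce / vari\<^sup>2 * (coeff_norm (G k))\<^sup>2 * (real (k + 2))\<^sup>2 / real n"
    unfolding sum_distrib_right[symmetric] cn[symmetric] by (simp add: power2_eq_square)
  finally show "expectation (\<lambda>\<omega>. (zeta_coeff G vari n (\<lambda>t. X t \<omega>) k - Geg.\<zeta> k)\<^sup>2)
      \<le> Ce / vari\<^sup>2 * (coeff_norm (G k))\<^sup>2 * (real (k + 2))\<^sup>2 / real n" .
qed

lemma risk_nonneg: "0 \<le> risk n K \<omega>"
  unfolding risk_def by (intro add_nonneg_nonneg sum_nonneg Geg.tail_nonneg) simp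

lemma risk_expectation:
  assumes Kn: "K + 2 \<le> n" and C: "\<And>k. coeff_norm (G k) \<le> C * s ^ k" "0 \<le> C" and s: "1 \<le> s"
  shows "integrable P (risk n K)"
    and "expectation (risk n K) \<le> Ce / vari\<^sup>2 * C\<^sup>2 * ((real K + 2) ^ 3 * s ^ (2 * K) / real n) + Geg.tail K"
proof -
  have i: "integrable P (\<lambda>\<omega>. (zeta_coeff G vari n (\<lambda>t. X t \<omega>) k - Geg.\<zeta> k)\<^sup>2)" if "k \<in> {..K}" for k
    using that Kn by (intro zeta_coeff_error_square(1)) auto
  show "integrable P (risk n K)"
    unfolding risk_def[abs_def] using i by (intro Bochner_Integration.integrable_add integrable_sum) auto
  define A where "A = Ce / vari\<^sup>2 * (C * s ^ K)\<^sup>2 * (real (K + 2))\<^sup>2 / real n"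
  have A: "0 \<le> A" unfolding A_def using Ce_nonneg by simp
  have "expectation (risk n K) = (\<Sum>k\<le>K. expectation (\<lambda>\<omega>. (zeta_coeff G vari n (\<lambda>t. X t \<omega>) k - Geg.\<zeta> k)\<^sup>2)) + Geg.tail K"
    unfolding risk_def
    by (subst Bochner_Integration.integral_add) (use i in \<open>auto simp: prob_space intro!: Bochner_Integration.integral_sum\<close>)
  also have "(\<Sum>k\<le>K. expectation (\<lambda>\<omega>. (zeta_coeff G vari n (\<lambda>t. X t \<omega>) k - Geg.\<zeta> k)\<^sup>2)) \<le> (\<Sum>k\<le>K. A)"
  proof (rule sum_mono)
    fix k assume k: "k \<in> {..K}"
    have "coeff_norm (G k) \<le> C * s ^ K"
      by (rule order_trans[OF C(1)]) (use k s C in \<open>auto intro!: mult_left_mono power_increasing\<close>)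
    moreover have "0 \<le> coeff_norm (G k)" by (simp add: coeff_norm_def sum_nonneg)
    moreover have "0 \<le> C * s ^ K" using C(2) s by simp
    ultimately have "Ce / vari\<^sup>2 * (coeff_norm (G k))\<^sup>2 * (real (k + 2))\<^sup>2 / real n \<le> A"
      unfolding A_def using k Ce_nonneg
      by (intro divide_right_mono mult_mono power_mono) auto
    then show "expectation (\<lambda>\<omega>. (zeta_coeff G vari n (\<lambda>t. X t \<omega>) k - Geg.\<zeta> k)\<^sup>2) \<le> A"
      using zeta_coeff_error_square(2)[of k n] k Kn by auto
  qed
  \<comment> \<open>The \<open>K + 1\<close> equal bounds, each containing \<open>(K + 2)^2\<close>,
    produce the third power.\<close>
  also have "(\<Sum>k\<le>K. A) \<le> (real K + 2) * A" using A by (simp add: mult_right_mono)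
  also have "\<dots> = Ce / vari\<^sup>2 * C\<^sup>2 * ((real K + 2) ^ 3 * s ^ (2 * K) / real n)"
  proof -
    have "s ^ (2 * K) = s ^ K * s ^ K" "real (K + 2) = real K + 2" by (simp_all add: mult_2 power_add)
    then show ?thesis unfolding A_def by (simp only: power_mult_distrib power3_eq_cube power2_eq_square) (simp add: mult_ac)
  qed
  finally show "expectation (risk n K) \<le> Ce / vari\<^sup>2 * C\<^sup>2 * ((real K + 2) ^ 3 * s ^ (2 * K) / real n) + Geg.tail K"
    by simp
qed

lemma risk_tendsto_0:
  fixes K :: "nat \<Rightarrow> nat"
  assumes s: "1 + sqrt 2 < s" and lim: "(\<lambda>n. (real (K n) + 2) ^ 3 * s ^ (2 * K n) / real n) \<longlonglongrightarrow> 0"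
    and K: "filterlim K at_top sequentially" and Kn: "\<forall>\<^sub>F n in sequentially. K n + 2 \<le> n"
  shows "\<forall>\<^sub>F n in sequentially. integrable P (risk n (K n))"
    and "(\<lambda>n. expectation (risk n (K n))) \<longlonglongrightarrow> 0"
proof -
  have s1: "1 \<le> s" using s real_sqrt_ge_zero[of 2] by linarith
  have "\<exists>C\<ge>0. \<forall>n. coeff_norm (G n) \<le> C * s ^ n"
    using Geg.G by (intro coeff_norm_growth[where q=q, OF Geg.degree_G _ s]) (auto simp: normalized_Gegenbauer_def)
  then obtain C where C: "0 \<le> C" "\<And>n. coeff_norm (G n) \<le> C * s ^ n" by auto
  show "\<forall>\<^sub>F n in sequentially. integrable P (risk n (K n))"
    using Kn by eventually_elim (rule risk_expectation(1)[OF _ C(2,1) s1])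
  show "(\<lambda>n. expectation (risk n (K n))) \<longlonglongrightarrow> 0"
  proof (rule tendsto_sandwich[OF _ _ tendsto_const])
    show "\<forall>\<^sub>F n in sequentially. 0 \<le> expectation (risk n (K n))"
      by (intro always_eventually allI Bochner_Integration.integral_nonneg risk_nonneg)
    show "\<forall>\<^sub>F n in sequentially. expectation (risk n (K n))
        \<le> Ce / vari\<^sup>2 * C\<^sup>2 * ((real (K n) + 2) ^ 3 * s ^ (2 * K n) / real n) + Geg.tail (K n)"
      using Kn by eventually_elim (rule risk_expectation(2)[OF _ C(2,1) s1])
    have "(\<lambda>n. Ce / vari\<^sup>2 * C\<^sup>2 * ((real (K n) + 2) ^ 3 * s ^ (2 * K n) / real n) + Geg.tail (K n))
        \<longlonglongrightarrow> Ce / vari\<^sup>2 * C\<^sup>2 * 0 + 0"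
      by (intro tendsto_add tendsto_mult tendsto_const lim filterlim_compose[OF Geg.tail_tendsto_0 K])
    then show "(\<lambda>n. Ce / vari\<^sup>2 * C\<^sup>2 * ((real (K n) + 2) ^ 3 * s ^ (2 * K n) / real n) + Geg.tail (K n)) \<longlonglongrightarrow> 0"
      by simp
  qed
qed

text \<open>Tonelli's theorem exchanges the expectation with the integral over \<open>x\<close>; for
  a fixed path the inner integral is the Parseval expression.\<close>

lemma phi_tilde_risk:
  "(\<integral>\<^sup>+x\<in>{-1<..<1}. (\<integral>\<^sup>+\<omega>. ennreal ((phi_tilde q G vari K n (\<lambda>t. X t \<omega>) x - \<phi> x)\<^sup>2) \<partial>P)
      / ennreal ((1 - x\<^sup>2) powr q) \<partial>lborel) = (\<integral>\<^sup>+\<omega>. ennreal (risk n K \<omega>) \<partial>P)"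
proof -
  \<comment> \<open>Measurability of \<open>\<phi>\<close> is available on the interval only, so it
    is cut off before joint measurability is claimed.\<close>
  define \<phi>' where "\<phi>' x = indicator {-1<..<1} x * \<phi> x" for x :: real
  define z where "z k \<omega> = zeta_coeff G vari n (\<lambda>t. X t \<omega>) k" for k \<omega>
  define h where "h \<omega> x = ennreal (((\<Sum>k=0..K. z k \<omega> * poly (G k) x) * (1 - x\<^sup>2) powr q - \<phi>' x)\<^sup>2)
      / ennreal ((1 - x\<^sup>2) powr q) * indicator {-1<..<1} x" for \<omega> x
  have phi'[measurable]: "\<phi>' \<in> borel_measurable borel" unfolding \<phi>'_def[abs_def] by (rule Geg.phi_measurable)
  have [measurable]: "z k \<in> borel_measurable P" for k unfolding z_def[abs_def] by measurable
  have [measurable]: "poly p \<in> borel_measurable (borel :: real measure)" for p :: "real poly" by (rule poly_borel)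
  have hm: "case_prod h \<in> borel_measurable (P \<Otimes>\<^sub>M lborel)"
    unfolding h_def by measurable
  interpret PL: pair_sigma_finite P lborel by unfold_locales
  have "(\<integral>\<^sup>+x\<in>{-1<..<1}. (\<integral>\<^sup>+\<omega>. ennreal ((phi_tilde q G vari K n (\<lambda>t. X t \<omega>) x - \<phi> x)\<^sup>2) \<partial>P)
      / ennreal ((1 - x\<^sup>2) powr q) \<partial>lborel) = (\<integral>\<^sup>+x. (\<integral>\<^sup>+\<omega>. h \<omega> x \<partial>P) \<partial>lborel)"
  proof (rule nn_integral_cong)
    fix x :: real
    show "(\<integral>\<^sup>+\<omega>. ennreal ((phi_tilde q G vari K n (\<lambda>t. X t \<omega>) x - \<phi> x)\<^sup>2) \<partial>P)
      / ennreal ((1 - x\<^sup>2) powr q) * indicator {-1<..<1} x = (\<integral>\<^sup>+\<omega>. h \<omega> x \<partial>P)"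
    proof (cases "x \<in> {-1<..<1}")
      case True
      have "(\<integral>\<^sup>+\<omega>. h \<omega> x \<partial>P) = (\<integral>\<^sup>+\<omega>. ennreal (((\<Sum>k=0..K. z k \<omega> * poly (G k) x) * (1 - x\<^sup>2) powr q - \<phi> x)\<^sup>2)
          / ennreal ((1 - x\<^sup>2) powr q) \<partial>P)"
        using True by (intro nn_integral_cong) (simp add: h_def \<phi>'_def)
      also have "\<dots> = (\<integral>\<^sup>+\<omega>. ennreal (((\<Sum>k=0..K. z k \<omega> * poly (G k) x) * (1 - x\<^sup>2) powr q - \<phi> x)\<^sup>2) \<partial>P)
          / ennreal ((1 - x\<^sup>2) powr q)" by (rule nn_integral_divide) measurable
      finally show ?thesis using True by (simp add: phi_tilde_def phi_estimator_def z_def)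
    next
      case False
      then have "indicator {-1<..<1} x = (0 :: ennreal)" by (rule indicator_simps(2))
      then show ?thesis by (simp add: h_def)
    qed
  qed
  also have "\<dots> = (\<integral>\<^sup>+\<omega>. (\<integral>\<^sup>+x. h \<omega> x \<partial>lborel) \<partial>P)" by (rule PL.Fubini'[OF hm])
  also have "\<dots> = (\<integral>\<^sup>+\<omega>. ennreal (risk n K \<omega>) \<partial>P)"
  proof (rule nn_integral_cong)
    fix \<omega>
    have "(\<integral>\<^sup>+x. h \<omega> x \<partial>lborel) = (\<integral>\<^sup>+x. ennreal (((\<Sum>k=0..K. z k \<omega> * poly (G k) x) * (1 - x\<^sup>2) powr q - \<phi> x)\<^sup>2)
        / ennreal ((1 - x\<^sup>2) powr q) * indicator {-1<..<1} x \<partial>lborel)"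
      by (rule nn_integral_cong) (simp add: h_def \<phi>'_def indicator_def)
    also have "\<dots> = ennreal (risk n K \<omega>)"
      unfolding risk_def z_def by (rule Geg.estimator_error_nn_integral)
    finally show "(\<integral>\<^sup>+x. h \<omega> x \<partial>lborel) = ennreal (risk n K \<omega>)" .
  qed
  finally show ?thesis .
qed

lemma sigma2_hat_eq: "sigma2_hat n (\<lambda>t. X t \<omega>) = vari + err n 0 \<omega>"
  by (simp add: sigma2_hat_def err_def rho_0 numeral_2_eq_2)

lemma sigma2_hat_measurable[measurable]: "(\<lambda>\<omega>. sigma2_hat n (\<lambda>t. X t \<omega>)) \<in> borel_measurable P"
  unfolding sigma2_hat_eq by measurable

lemma phi_hat_error_eq:
  "(LBINT x:{-1<..<1}. (phi_hat q G K n (\<lambda>t. X t \<omega>) x - \<phi> x)\<^sup>2 / (1 - x\<^sup>2) powr q)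
    = (\<Sum>k\<le>K. (zeta_coeff G (sigma2_hat n (\<lambda>t. X t \<omega>)) n (\<lambda>t. X t \<omega>) k - Geg.\<zeta> k)\<^sup>2) + Geg.tail K"
  unfolding phi_hat_def phi_estimator_def by (rule Geg.estimator_error_integral)

text \<open>On this event the estimated variance is at least half the true one, and using it in
  place of the true one multiplies all coefficients by the same ratio \<open>r\<close> in
  [0, 2].\<close>

lemma phi_hat_error_le:
  assumes e: "\<bar>err n 0 \<omega>\<bar> \<le> vari / 2"
  shows "(\<Sum>k\<le>K. (zeta_coeff G (sigma2_hat n (\<lambda>t. X t \<omega>)) n (\<lambda>t. X t \<omega>) k - Geg.\<zeta> k)\<^sup>2) + Geg.tail K
    \<le> 8 * risk n K \<omega> + 8 * (\<integral>x. (Geg.f x)\<^sup>2 \<partial>Geg.\<mu>) / vari\<^sup>2 * (err n 0 \<omega>)\<^sup>2"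
proof -
  define v where "v = sigma2_hat n (\<lambda>t. X t \<omega>)"
  define r where "r = vari / v"
  have v: "vari / 2 \<le> v" "0 < v" using e vari_pos by (auto simp: v_def sigma2_hat_eq abs_le_iff)
  have r: "0 \<le> r" "r \<le> 2" using v vari_pos by (auto simp: r_def divide_le_eq)
  have r2: "r\<^sup>2 \<le> 4" using power_mono[OF r(2,1), of 2] by simp
  have "r - 1 = - (err n 0 \<omega> / v)" using v by (simp add: r_def v_def sigma2_hat_eq field_simps)
  then have "(r - 1)\<^sup>2 = (err n 0 \<omega>)\<^sup>2 / v\<^sup>2" by (simp add: power_divide)
  also have "\<dots> \<le> (err n 0 \<omega>)\<^sup>2 / (vari / 2)\<^sup>2"
    using v vari_pos by (intro divide_left_mono power_mono mult_pos_pos) auto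
  also have "\<dots> = 4 / vari\<^sup>2 * (err n 0 \<omega>)\<^sup>2" by (simp add: power_divide)
  finally have r1: "(r - 1)\<^sup>2 \<le> 4 / vari\<^sup>2 * (err n 0 \<omega>)\<^sup>2" .
  have F: "0 \<le> (\<integral>x. (Geg.f x)\<^sup>2 \<partial>Geg.\<mu>)" by (rule Bochner_Integration.integral_nonneg) simp
  have "zeta_coeff G v n (\<lambda>t. X t \<omega>) k = r * zeta_coeff G vari n (\<lambda>t. X t \<omega>) k" for k
    using vari_pos by (simp add: zeta_coeff_def r_def)
  then have "(\<Sum>k\<le>K. (zeta_coeff G v n (\<lambda>t. X t \<omega>) k - Geg.\<zeta> k)\<^sup>2) + Geg.tail K
      \<le> 2 * r\<^sup>2 * risk n K \<omega> + 2 * (r - 1)\<^sup>2 * (\<integral>x. (Geg.f x)\<^sup>2 \<partial>Geg.\<mu>)"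
    using Geg.error_scale_le[of r "zeta_coeff G vari n (\<lambda>t. X t \<omega>)" K] by (simp add: risk_def)
  also have "\<dots> \<le> 2 * 4 * risk n K \<omega> + 2 * (4 / vari\<^sup>2 * (err n 0 \<omega>)\<^sup>2) * (\<integral>x. (Geg.f x)\<^sup>2 \<partial>Geg.\<mu>)"
    by (intro add_mono mult_right_mono mult_left_mono r2 r1 risk_nonneg F) auto
  finally show ?thesis by (simp add: v_def mult_ac)
qed

lemma phi_hat_conv_in_prob:
  fixes K :: "nat \<Rightarrow> nat"
  assumes ri: "\<forall>\<^sub>F n in sequentially. integrable P (risk n (K n))"
    and rl: "(\<lambda>n. expectation (risk n (K n))) \<longlonglongrightarrow> 0"
  shows "conv_in_prob P (\<lambda>n \<omega>. LBINT x:{-1<..<1}.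
      (phi_hat q G (K n) n (\<lambda>t. X t \<omega>) x - \<phi> x)\<^sup>2 / (1 - x\<^sup>2) powr q) (\<lambda>_. 0)"
proof -
  define Z where "Z n \<omega> = (\<Sum>k\<le>K n. (zeta_coeff G (sigma2_hat n (\<lambda>t. X t \<omega>)) n (\<lambda>t. X t \<omega>) k - Geg.\<zeta> k)\<^sup>2)
      + Geg.tail (K n)" for n \<omega>
  define F where "F = (\<integral>x. (Geg.f x)\<^sup>2 \<partial>Geg.\<mu>)"
  define D where "D = 8 * F / vari\<^sup>2 + 4 / vari\<^sup>2"
  have F: "0 \<le> F" unfolding F_def by (rule Bochner_Integration.integral_nonneg) simp
  have Zm[measurable]: "Z n \<in> borel_measurable P" for n unfolding Z_def[abs_def] by measurable
  have Z0: "0 \<le> Z n \<omega>" for n \<omega> unfolding Z_def by (intro add_nonneg_nonneg sum_nonneg Geg.tail_nonneg) simp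
  \<comment> \<open>Off the good event the left-hand side is at most 1 by truncation, while
    \<open>4 / vari^2 * err^2\<close> is at least 1. So one bound holds for all paths, including
    those where the estimated variance is 0 and the quotient has its default value.\<close>
  have Zle: "min 1 \<bar>Z n \<omega>\<bar> \<le> 8 * risk n (K n) \<omega> + D * (err n 0 \<omega>)\<^sup>2" for n \<omega>
  proof -
    have D: "D * (err n 0 \<omega>)\<^sup>2 = 8 * F / vari\<^sup>2 * (err n 0 \<omega>)\<^sup>2 + 4 / vari\<^sup>2 * (err n 0 \<omega>)\<^sup>2"
      by (simp add: D_def distrib_right)
    have n1: "0 \<le> 8 * F / vari\<^sup>2 * (err n 0 \<omega>)\<^sup>2" "0 \<le> 4 / vari\<^sup>2 * (err n 0 \<omega>)\<^sup>2" using F by simp_all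
    show ?thesis
    proof (cases "\<bar>err n 0 \<omega>\<bar> \<le> vari / 2")
      case True
      have "Z n \<omega> \<le> 8 * risk n (K n) \<omega> + 8 * F / vari\<^sup>2 * (err n 0 \<omega>)\<^sup>2"
        unfolding Z_def F_def by (rule phi_hat_error_le[OF True])
      then show ?thesis using D n1 Z0[of n \<omega>] by linarith
    next
      case False
      have "(vari / 2)\<^sup>2 \<le> \<bar>err n 0 \<omega>\<bar>\<^sup>2" using False vari_pos by (intro power_mono) auto
      then have "1 \<le> 4 / vari\<^sup>2 * (err n 0 \<omega>)\<^sup>2" using vari_pos by (simp add: power_divide field_simps)
      then show ?thesis using D n1 risk_nonneg[of n "K n" \<omega>] by linarith
    qed
  qed
  have el: "(\<lambda>n. expectation (\<lambda>\<omega>. (err n 0 \<omega>)\<^sup>2)) \<longlonglongrightarrow> 0"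
  proof (rule tendsto_sandwich[OF _ _ tendsto_const])
    show "\<forall>\<^sub>F n in sequentially. 0 \<le> expectation (\<lambda>\<omega>. (err n 0 \<omega>)\<^sup>2)"
      by (intro always_eventually allI Bochner_Integration.integral_nonneg) simp
    show "\<forall>\<^sub>F n in sequentially. expectation (\<lambda>\<omega>. (err n 0 \<omega>)\<^sup>2) \<le> Ce * 4 / real n"
      using eventually_ge_at_top[of 2]
    proof eventually_elim
      case (elim n)
      then show ?case using err_square(2)[of 0 n] by simp
    qed
    show "(\<lambda>n. Ce * 4 / real n) \<longlonglongrightarrow> 0" by (rule lim_const_over_n)
  qed
  have "(\<lambda>n. prob_size P (\<lambda>\<omega>. Z n \<omega> - 0)) \<longlonglongrightarrow> 0"
  proof (rule tendsto_sandwich[OF _ _ tendsto_const])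
    show "\<forall>\<^sub>F n in sequentially. 0 \<le> prob_size P (\<lambda>\<omega>. Z n \<omega> - 0)"
      by (intro always_eventually allI prob_size_nonneg)
    show "\<forall>\<^sub>F n in sequentially. prob_size P (\<lambda>\<omega>. Z n \<omega> - 0)
        \<le> 8 * expectation (risk n (K n)) + D * expectation (\<lambda>\<omega>. (err n 0 \<omega>)\<^sup>2)"
      using ri eventually_ge_at_top[of 2]
    proof eventually_elim
      case (elim n)
      have ie: "integrable P (\<lambda>\<omega>. (err n 0 \<omega>)\<^sup>2)" using elim err_square(1)[of 0 n] by simp
      have iB: "integrable P (\<lambda>\<omega>. 8 * risk n (K n) \<omega> + D * (err n 0 \<omega>)\<^sup>2)" using elim ie by simp
      have iZ: "integrable P (\<lambda>\<omega>. min 1 \<bar>Z n \<omega>\<bar>)"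
        by (rule integrable_const_bound[where B=1]) auto
      have "prob_size P (\<lambda>\<omega>. Z n \<omega> - 0) = expectation (\<lambda>\<omega>. min 1 \<bar>Z n \<omega>\<bar>)" by (simp add: prob_size_def)
      also have "\<dots> \<le> expectation (\<lambda>\<omega>. 8 * risk n (K n) \<omega> + D * (err n 0 \<omega>)\<^sup>2)"
        by (rule integral_mono[OF iZ iB Zle])
      also have "\<dots> = 8 * expectation (risk n (K n)) + D * expectation (\<lambda>\<omega>. (err n 0 \<omega>)\<^sup>2)"
        using elim ie by simp
      finally show ?case .
    qed
    have "(\<lambda>n. 8 * expectation (risk n (K n)) + D * expectation (\<lambda>\<omega>. (err n 0 \<omega>)\<^sup>2)) \<longlonglongrightarrow> 8 * 0 + D * 0"
      by (intro tendsto_add tendsto_mult tendsto_const rl el)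
    then show "(\<lambda>n. 8 * expectation (risk n (K n)) + D * expectation (\<lambda>\<omega>. (err n 0 \<omega>)\<^sup>2)) \<longlonglongrightarrow> 0" by simp
  qed
  then have "conv_in_prob P Z (\<lambda>_. 0)" by (subst conv_in_prob_iff) auto
  then show ?thesis unfolding phi_hat_error_eq Z_def[abs_def] .
qed

lemma phi_tilde_tendsto_0:
  fixes K :: "nat \<Rightarrow> nat"
  assumes ri: "\<forall>\<^sub>F n in sequentially. integrable P (risk n (K n))"
    and rl: "(\<lambda>n. expectation (risk n (K n))) \<longlonglongrightarrow> 0"
  shows "(\<lambda>n. \<integral>\<^sup>+x\<in>{-1<..<1}. (\<integral>\<^sup>+\<omega>. ennreal ((phi_tilde q G vari (K n) n (\<lambda>t. X t \<omega>) x - \<phi> x)\<^sup>2) \<partial>P)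
      / ennreal ((1 - x\<^sup>2) powr q) \<partial>lborel) \<longlonglongrightarrow> 0"
proof -
  have "(\<lambda>n. ennreal (expectation (risk n (K n)))) \<longlonglongrightarrow> ennreal 0" by (rule tendsto_ennrealI[OF rl])
  moreover have "\<forall>\<^sub>F n in sequentially. ennreal (expectation (risk n (K n))) = (\<integral>\<^sup>+\<omega>. ennreal (risk n (K n) \<omega>) \<partial>P)"
    using ri by eventually_elim (rule nn_integral_eq_integral[symmetric], auto simp: risk_nonneg)
  ultimately have "(\<lambda>n. \<integral>\<^sup>+\<omega>. ennreal (risk n (K n) \<omega>) \<partial>P) \<longlonglongrightarrow> ennreal 0"
    by (rule Lim_transform_eventually)
  then show ?thesis unfolding phi_tilde_risk by simp
qed

end

section \<open>The control measure as the law of the mixing variable\<close>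

lemma control_measure_distr:
  assumes phi_nonneg: "\<And>x. x \<in> {-1<..<1} \<Longrightarrow> 0 \<le> \<phi> x"
    and a_density: "distributed R (restrict_space lborel {-1<..<1}) a (\<lambda>x. ennreal (\<phi> x))"
  shows control_measure_eq_distr: "control_measure \<phi> = distr R (restrict_space lborel {-1<..<1}) a"
    and density_measurable: "(\<lambda>x. indicator {-1<..<1} x * \<phi> x) \<in> borel_measurable borel"
proof -
  show "control_measure \<phi> = distr R (restrict_space lborel {-1<..<1}) a"
    using a_density by (simp add: distributed_def control_measure_def)
  have "\<phi> \<in> borel_measurable (restrict_space lborel {-1<..<1})"
    by (rule distributed_real_measurable[OF _ a_density]) (use phi_nonneg in \<open>simp add: space_restrict_space\<close>)
  then show "(\<lambda>x. indicator {-1<..<1} x * \<phi> x) \<in> borel_measurable borel"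
    by (subst (asm) borel_measurable_restrict_space_iff) (auto simp: mult.commute)
qed

lemma control_measure_density:
  assumes phi_nonneg: "\<And>x. x \<in> {-1<..<1} \<Longrightarrow> 0 \<le> \<phi> x"
    and phi: "(\<lambda>x. indicator {-1<..<1} x * \<phi> x) \<in> borel_measurable borel"
  shows control_measure_integral: "f \<in> borel_measurable borel \<Longrightarrow>
      (\<integral>x. f x \<partial>control_measure \<phi>) = (LBINT x:{-1<..<1}. \<phi> x * (f x :: real))"
    and control_measure_singleton: "measure (control_measure \<phi>) {x} = 0"
    and space_control_measure: "space (control_measure \<phi>) = {-1<..<1}"
    and sets_control_measure: "sets (control_measure \<phi>) = sets (restrict_space borel {-1<..<1})"
proof -
  have m: "\<phi> \<in> borel_measurable (restrict_space lborel {-1<..<1})"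
    using phi by (subst borel_measurable_restrict_space_iff) (auto simp: mult.commute)
  show sp: "space (control_measure \<phi>) = {-1<..<1}" by (simp add: control_measure_def space_restrict_space)
  show se: "sets (control_measure \<phi>) = sets (restrict_space borel {-1<..<1})"
    by (simp add: control_measure_def sets_restrict_space)
  show "(\<integral>x. f x \<partial>control_measure \<phi>) = (LBINT x:{-1<..<1}. \<phi> x * (f x :: real))"
    if f: "f \<in> borel_measurable borel"
  proof -
    have f': "f \<in> borel_measurable (restrict_space lborel {-1<..<1})"
      using f by (intro measurable_restrict_space1) simp
    have "(\<integral>x. f x \<partial>control_measure \<phi>) = (\<integral>x. \<phi> x * f x \<partial>restrict_space lborel {-1<..<1})"
      unfolding control_measure_def
      by (rule integral_real_density[OF m _ f'], rule AE_I2) (use phi_nonneg in \<open>simp add: space_restrict_space\<close>)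
    also have "\<dots> = (LBINT x:{-1<..<1}. \<phi> x * f x)"
      by (subst integral_restrict_space) (auto simp: set_lebesgue_integral_def)
    finally show ?thesis .
  qed
  show "measure (control_measure \<phi>) {x} = 0"
  proof (cases "x \<in> {-1<..<1}")
    case True
    have s: "{x} \<in> sets (restrict_space lborel {-1<..<1})" using True by (auto simp: sets_restrict_space_iff)
    have "emeasure (restrict_space lborel {-1<..<1}) {x} = 0"
      using True by (subst emeasure_restrict_space) auto
    then have "{x} \<in> null_sets (restrict_space lborel {-1<..<1})" using s by blast
    then have "{x} \<in> null_sets (control_measure \<phi>)"
      using absolutely_continuousI_density[OF measurable_compose[OF m measurable_ennreal]]
      by (auto simp: control_measure_def absolutely_continuous_def)
    then show ?thesis by (rule measure_eq_0_null_sets)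
  next
    case False
    then have "{x} \<notin> sets (control_measure \<phi>)" using sets.sets_into_space[of "{x}" "control_measure \<phi>"] sp by auto
    then show ?thesis by (rule measure_notin_sets)
  qed
qed

text \<open>The first integrand is integrable for every path, because polynomials and
  \<open>\<phi> / w\<close> are square integrable for the weight \<open>w\<close>, so its integral
  is never a default value. The second limit uses nonnegative integrals, so that convergence to 0
  includes eventual finiteness. \<open>K\<close> is prescribed from \<open>n = 1\<close> on, where
  the logarithm makes sense.\<close>

theorem theorem4p1:
  fixes q \<gamma> \<mu> \<sigma> :: real and \<pi> :: "real measure" and \<phi> :: "real \<Rightarrow> real"
    and R :: "'c measure" and a :: "'c \<Rightarrow> real"
    and Q :: "'b measure" and W :: "'b \<Rightarrow> real"
    and P :: "'a measure" and M :: "int \<Rightarrow> real set \<Rightarrow> 'a \<Rightarrow> real" and X :: "int \<Rightarrow> 'a \<Rightarrow> real"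
    and G :: "nat \<Rightarrow> real poly" and K :: "nat \<Rightarrow> nat"
  assumes q: "q > -1"
    and R: "prob_space R"
    and phi_nonneg: "\<And>x. x \<in> {-1<..<1} \<Longrightarrow> 0 \<le> \<phi> x"
    and a_density: "distributed R (restrict_space lborel {-1<..<1}) a (\<lambda>x. ennreal (\<phi> x))"
    and a_moment: "integrable R (\<lambda>\<omega>. 1 / (1 - \<bar>a \<omega>\<bar>))"
    and phi_L2: "set_integrable lborel {-1<..<1} (\<lambda>x. (\<phi> x)\<^sup>2 / (1 - x\<^sup>2) powr q)"
    and W: "inf_divisible Q W \<mu> \<sigma> \<pi>"
    and W_var: "integrable Q (\<lambda>\<omega>. (W \<omega>)\<^sup>2)" "prob_space.variance Q W > 0"
    and P: "prob_space P"
    and M: "iid_id_random_measures P (control_measure \<phi>) (Levy_exponent \<mu> \<sigma> \<pi>) M"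
    and X: "aggregated_AR1 P (control_measure \<phi>) M X"
    and X_moment: "integrable P (\<lambda>\<omega>. (X 0 \<omega>) ^ 4)"
    and G: "normalized_Gegenbauer q G"
    and gamma: "0 < \<gamma>" "\<gamma> < inverse (2 * ln (1 + sqrt 2))"
    and K: "\<And>n. n \<ge> 1 \<Longrightarrow> K n = nat \<lfloor>\<gamma> * ln (real n)\<rfloor>"
  shows "conv_in_prob P
           (\<lambda>n \<omega>. LBINT x:{-1<..<1}.
              (phi_hat q G (K n) n (\<lambda>t. X t \<omega>) x - \<phi> x)\<^sup>2 / (1 - x\<^sup>2) powr q)
           (\<lambda>_. 0)
       \<and> (\<lambda>n. \<integral>\<^sup>+x\<in>{-1<..<1}.
              (\<integral>\<^sup>+\<omega>. ennreal ((phi_tilde q G (prob_space.variance Q W) (K n) n (\<lambda>t. X t \<omega>) x - \<phi> x)\<^sup>2) \<partial>P)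
              / ennreal ((1 - x\<^sup>2) powr q) \<partial>lborel) \<longlonglongrightarrow> 0"
proof -
  define \<Phi> where "\<Phi> = control_measure \<phi>"
  have phi_m: "(\<lambda>x. indicator {-1<..<1} x * \<phi> x) \<in> borel_measurable borel"
    using phi_nonneg a_density by (rule density_measurable)
  have Phi_distr: "\<Phi> = distr R (restrict_space lborel {-1<..<1}) a"
    unfolding \<Phi>_def using phi_nonneg a_density by (rule control_measure_eq_distr)
  have space_Phi: "space \<Phi> = {-1<..<1}"
    unfolding \<Phi>_def using phi_nonneg phi_m by (rule space_control_measure)
  have sets_Phi: "sets \<Phi> = sets (restrict_space borel {-1<..<1})"
    unfolding \<Phi>_def using phi_nonneg phi_m by (rule sets_control_measure)
  have a: "a \<in> measurable R (restrict_space lborel {-1<..<1})" using a_density by (simp add: distributed_def)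
  have prob_Phi: "prob_space \<Phi>" unfolding Phi_distr by (rule prob_space.prob_space_distr[OF R a])
  interpret Phi: prob_space \<Phi> by (rule prob_Phi)
  interpret Q: prob_space Q using W by (simp add: inf_divisible_def)
  have Wm: "W \<in> borel_measurable Q" and Levy: "Levy_measure \<pi>"
    and W_char: "\<And>\<theta>. char (distr Q borel W) \<theta> = exp (Levy_exponent \<mu> \<sigma> \<pi> \<theta>)"
    using W by (auto simp: inf_divisible_def)
  interpret random_field P \<Phi> "Levy_exponent \<mu> \<sigma> \<pi>" M
    by (rule random_field.intro[OF P random_field_axioms.intro[OF prob_Phi M[folded \<Phi>_def]]])
  have M0: "M 0 (space \<Phi>) \<in> borel_measurable P" by (rule field_measurable) simp
  \<comment> \<open>\<open>\<Phi>\<close> has mass 1, so \<open>M 0 (space \<Phi>)\<close> is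
    distributed like \<open>W\<close>; this carries the second moment and the variance over to
    \<open>P\<close>.\<close>
  have law: "distr P borel (M 0 (space \<Phi>)) = distr Q borel W"
  proof (rule Levy_uniqueness)
    show "real_distribution (distr P borel (M 0 (space \<Phi>)))" using M0 by (rule real_distribution_distr)
    show "real_distribution (distr Q borel W)" using Wm by (rule Q.real_distribution_distr)
    show "char (distr P borel (M 0 (space \<Phi>))) = char (distr Q borel W)"
      by (rule ext) (simp add: field_char W_char Phi.prob_space)
  qed
  have law_int: "integrable P (\<lambda>\<omega>. h (M 0 (space \<Phi>) \<omega>)) \<longleftrightarrow> integrable Q (\<lambda>\<omega>. h (W \<omega>))"
    and law_exp: "(\<integral>\<omega>. h (M 0 (space \<Phi>) \<omega>) \<partial>P) = (\<integral>\<omega>. h (W \<omega>) \<partial>Q)"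
    if h: "h \<in> borel_measurable borel" for h :: "real \<Rightarrow> real"
    using integrable_distr_eq[OF M0 h] integrable_distr_eq[OF Wm h] integral_distr[OF M0 h] integral_distr[OF Wm h]
    by (simp_all add: law)
  interpret square_integrable_field P \<Phi> "Levy_exponent \<mu> \<sigma> \<pi>" M
  proof
    show "(\<lambda>n. Levy_exponent \<mu> \<sigma> \<pi> (1 / real (Suc n))) \<longlonglongrightarrow> 0"
      by (rule Levy_exponent_tendsto_0[OF Levy]) (rule LIMSEQ_Suc[OF lim_1_over_n], simp)
    show "integrable P (\<lambda>\<omega>. (M 0 (space \<Phi>) \<omega>)\<^sup>2)"
      by (subst law_int) (use W_var(1) in auto)
  qed
  have vari_W: "vari = Q.variance W"
  proof -
    have "(\<integral>\<omega>. M 0 (space \<Phi>) \<omega> \<partial>P) = (\<integral>\<omega>. W \<omega> \<partial>Q)" by (rule law_exp) simp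
    then show ?thesis unfolding vari_def by (simp only:) (rule law_exp, measurable)
  qed
  have moment: "integrable \<Phi> (\<lambda>x. 1 / (1 - \<bar>x\<bar>))"
  proof -
    have m: "(\<lambda>x. 1 / (1 - \<bar>x\<bar>)) \<in> borel_measurable (restrict_space lborel {-1<..<1::real})"
      by (rule measurable_restrict_space1) measurable
    show ?thesis unfolding Phi_distr integrable_distr_eq[OF a m] by (rule a_moment)
  qed
  interpret mixing_density_estimation P \<Phi> "Levy_exponent \<mu> \<sigma> \<pi>" M X q G \<phi>
  proof
    show "aggregated_AR1 P \<Phi> M X" using X by (simp add: \<Phi>_def)
    show "measure \<Phi> {x} = 0" for x unfolding \<Phi>_def using phi_nonneg phi_m by (rule control_measure_singleton)
    show "(\<integral>x. poly p x \<partial>\<Phi>) = (LBINT x:{-1<..<1}. \<phi> x * poly p x)" for p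
      unfolding \<Phi>_def using phi_nonneg phi_m
      by (rule control_measure_integral) (assumption, intro borel_measurable_continuous_onI continuous_intros)
    show "0 < vari" using W_var(2) by (simp add: vari_W)
  qed (fact space_Phi sets_Phi moment X_moment G phi_m phi_L2)+
  obtain s where s: "1 + sqrt 2 < s" "(\<lambda>n. (real (K n) + 2) ^ 3 * s ^ (2 * K n) / real n) \<longlonglongrightarrow> 0"
    using logarithmic_truncation(1)[OF gamma K] by auto
  note risk = risk_tendsto_0[OF s logarithmic_truncation(2,3)[OF gamma K]]
  show ?thesis
    using phi_hat_conv_in_prob[OF risk] phi_tilde_tendsto_0[OF risk] by (simp add: vari_W)
qed

end
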